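(* Let $d\ge3$ and let $V\in C^2(\mathbb{R})$ be symmetric with $C_-\le V''(t)\le C_+$ for all $t\in\mathbb{R}$, for some constants $0<C_-\le C_+<\infty$. The weak limit $$\mu^0:=\lim_{m\to0}\lim_{n\to\infty}\mu^0_{\Gamma^d_n,m}$$ exists, and $\mu^0$ is the unique $\phi$-Gibbs measure on $\mathbb{Z}^d$ which is invariant and ergodic with respect to lattice shifts, and under which $\phi_0$ is square integrable and has zero mean.
   Context: For finite $\Lambda\subset\mathbb{Z}^d$, $\bar\Lambda$ is the union of $\Lambda$ and the vertices having a neighbour in $\Lambda$, and $\Lambda_*$ is the set of (directed) edges between vertices of $\bar\Lambda$. $\Gamma^d_n=(\mathbb{Z}/n\mathbb{Z})^d$ is the discrete torus; for $\Lambda=\Gamma^d_n$, $\bar\Lambda=\Lambda$ and $\Lambda_*$ is the set of (directed) edges of the torus. For $m\ge0$ and $\xi\in\mathbb{R}^{\mathbb{Z}^d}$ the Hamiltonian is $$H^\xi_{\Lambda,m}(\phi)=\frac12\sum_{x,y\in\bar\Lambda:(x,y)\in\Lambda_*}V(\phi_x-\phi_y)+\frac{m^2}2\sum_{x\in\Lambda}\phi_x^2,\qquad \phi\in\mathbb{R}^{\bar\Lambda},\ \phi=\xi\text{ on }\bar\Lambda\setminus\Lambda$$ (no dependence on $\xi$ when $\Lambda=\Gamma_n^d$), and $\mu^\xi_{\Lambda,m}(d\phi)=\frac1Z\exp(-H^\xi_{\Lambda,m}(\phi))\prod_{x\in\Lambda}d\phi_x$ is the corresponding probability measure on $\mathbb{R}^\Lambda$,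 defined if $\Lambda\subset\mathbb{Z}^d$ is finite and $m\ge0$, or if $\Lambda=\Gamma^d_n$ and $m>0$. The superscript in $\mu^0_{\Gamma^d_n,m}$ means $\xi=0$. Weak limits are on $\mathbb{R}^{\mathbb{Z}^d}$ with the product topology, the torus $\Gamma_n^d$ being identified with a box of side $n$ centred around the origin of $\mathbb{Z}^d$. A $\phi$-Gibbs measure on $\mathbb{Z}^d$ is a probability measure $\mu$ on $\mathbb{R}^{\mathbb{Z}^d}$ satisfying the DLR equations: for every finite $\Lambda\subset\mathbb{Z}^d$, the conditional law under $\mu$ of $(\phi_x)_{x\in\Lambda}$ given $(\phi_x)_{x\notin\Lambda}=\xi$ is $\mu^\xi_{\Lambda,0}$, for $\mu$-a.e. $\xi$. With shifts $(\tau_z\phi)_x=\phi_{x+z}$, $\mu$ is invariant and ergodic with respect to lattice shifts if $\mu\circ\tau_x^{-1}=\mu$ for all $x\in\mathbb{Z}^d$ and, for each $x\in\mathbb{Z}^d\setminus\{0\}$, $\mu(A)\in\{0,1\}$ for every measurable $A$ with $\tau_x(A)=A$. *)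

theory Defs
  imports "HOL-Probability.Probability" "HOL-Number_Theory.Cong"
begin

text \<open>
  The lattice of dimension \<open>d\<close> is the type \<^typ>\<open>int ^ 'd\<close> with \<^term>\<open>CARD('d) = d\<close>.
  A field configuration is a function on lattice sites. The product of the Borel
  \<open>\<sigma>\<close>-algebras below is the Borel \<open>\<sigma>\<close>-algebra of the product topology
  (\<open>sets_PiM_equal_borel\<close>), as the lattice is countable.
\<close>

abbreviation field_algebra :: "(int ^ 'd \<Rightarrow> real) measure" where
  "field_algebra \<equiv> (\<Pi>\<^sub>M x\<in>UNIV. borel)"

definition nearest_neighbour :: "int ^ 'd \<Rightarrow> int ^ 'd \<Rightarrow> bool" where
  "nearest_neighbour x y \<longleftrightarrow> (\<Sum>i\<in>UNIV. \<bar>x $ i - y $ i\<bar>) = 1"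

definition lattice_closure :: "(int ^ 'd) set \<Rightarrow> (int ^ 'd) set" where
  "lattice_closure \<Lambda> = \<Lambda> \<union> {x. \<exists>y\<in>\<Lambda>. nearest_neighbour x y}"

definition lattice_edges :: "(int ^ 'd) set \<Rightarrow> ((int ^ 'd) \<times> (int ^ 'd)) set" where
  "lattice_edges \<Lambda> =
     {(x, y). x \<in> lattice_closure \<Lambda> \<and> y \<in> lattice_closure \<Lambda> \<and> nearest_neighbour x y}"

text \<open>
  The torus of side \<open>n\<close> is represented by the box of side \<open>n\<close> centred around the origin, which
  contains exactly one representative of each class of sites modulo \<open>n\<close>. Its edges are the images
  of the lattice edges under reduction modulo \<open>n\<close>.
\<close>

definition torus_sites :: "nat \<Rightarrow> (int ^ 'd) set" where
  "torus_sites n = {x. \<forall>i. - int n < 2 * x $ i \<and> 2 * x $ i \<le> int n}"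

definition torus_edges :: "nat \<Rightarrow> ((int ^ 'd) \<times> (int ^ 'd)) set" where
  "torus_edges n = {(x, y). x \<in> torus_sites n \<and> y \<in> torus_sites n \<and>
     (\<exists>z. nearest_neighbour x z \<and> (\<forall>i. [z $ i = y $ i] (mod int n)))}"

definition hamiltonian ::
  "(real \<Rightarrow> real) \<Rightarrow> ('v \<times> 'v) set \<Rightarrow> 'v set \<Rightarrow> real \<Rightarrow> ('v \<Rightarrow> real) \<Rightarrow> real" where
  "hamiltonian V E \<Lambda> m \<phi> =
     1 / 2 * (\<Sum>(x, y)\<in>E. V (\<phi> x - \<phi> y)) + m\<^sup>2 / 2 * (\<Sum>x\<in>\<Lambda>. (\<phi> x)\<^sup>2)"

definition boltzmann_weight ::
  "(real \<Rightarrow> real) \<Rightarrow> ('v \<times> 'v) set \<Rightarrow> 'v set \<Rightarrow> real \<Rightarrow> ('v \<Rightarrow> real) \<Rightarrow> ('v \<Rightarrow> real) \<Rightarrow> ennreal" where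
  "boltzmann_weight V E \<Lambda> m \<xi> \<phi> = ennreal (exp (- hamiltonian V E \<Lambda> m (override_on \<xi> \<phi> \<Lambda>)))"

definition partition_function ::
  "(real \<Rightarrow> real) \<Rightarrow> ('v \<times> 'v) set \<Rightarrow> 'v set \<Rightarrow> real \<Rightarrow> ('v \<Rightarrow> real) \<Rightarrow> ennreal" where
  "partition_function V E \<Lambda> m \<xi> =
     (\<integral>\<^sup>+ \<phi>. boltzmann_weight V E \<Lambda> m \<xi> \<phi> \<partial>(\<Pi>\<^sub>M x\<in>\<Lambda>. lborel))"

definition finite_gibbs ::
  "(real \<Rightarrow> real) \<Rightarrow> ('v \<times> 'v) set \<Rightarrow> 'v set \<Rightarrow> real \<Rightarrow> ('v \<Rightarrow> real) \<Rightarrow> ('v \<Rightarrow> real) measure" where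
  "finite_gibbs V E \<Lambda> m \<xi> = density (\<Pi>\<^sub>M x\<in>\<Lambda>. lborel)
     (\<lambda>\<phi>. boltzmann_weight V E \<Lambda> m \<xi> \<phi> / partition_function V E \<Lambda> m \<xi>)"

text \<open>
  The torus measure as a law on the full configuration space: the field is extended by \<open>0\<close> outside
  the box. Weak limits in the product topology as the boxes grow do not depend on this extension.
\<close>

definition torus_gibbs :: "(real \<Rightarrow> real) \<Rightarrow> nat \<Rightarrow> real \<Rightarrow> (int ^ 'd \<Rightarrow> real) measure" where
  "torus_gibbs V n m =
     distr (finite_gibbs V (torus_edges n) (torus_sites n) m (\<lambda>_. 0)) field_algebra
       (\<lambda>\<phi>. override_on (\<lambda>_. 0) \<phi> (torus_sites n))"

definition weakly_converges ::
  "('i \<Rightarrow> (int ^ 'd \<Rightarrow> real) measure) \<Rightarrow> (int ^ 'd \<Rightarrow> real) measure \<Rightarrow> 'i filter \<Rightarrow> bool" where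
  "weakly_converges M L F \<longleftrightarrow>
     (\<forall>\<^sub>F i in F. M i \<in> space (prob_algebra field_algebra)) \<and>
     L \<in> space (prob_algebra field_algebra) \<and>
     (\<forall>f :: (int ^ 'd \<Rightarrow> real) \<Rightarrow> real. continuous_on UNIV f \<and> bounded (range f) \<longrightarrow>
        ((\<lambda>i. \<integral>\<phi>. f \<phi> \<partial>M i) \<longlongrightarrow> (\<integral>\<phi>. f \<phi> \<partial>L)) F)"

definition exterior_algebra :: "(int ^ 'd) set \<Rightarrow> (int ^ 'd \<Rightarrow> real) measure" where
  "exterior_algebra \<Lambda> =
     vimage_algebra UNIV (\<lambda>\<phi>. restrict \<phi> (- \<Lambda>)) (\<Pi>\<^sub>M x\<in>- \<Lambda>. borel)"

definition phi_gibbs :: "(real \<Rightarrow> real) \<Rightarrow> (int ^ 'd \<Rightarrow> real) measure \<Rightarrow> bool" where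
  "phi_gibbs V \<mu> \<longleftrightarrow>
     \<mu> \<in> space (prob_algebra field_algebra) \<and>
     (\<forall>\<Lambda>. finite \<Lambda> \<longrightarrow> (\<forall>A\<in>sets (\<Pi>\<^sub>M x\<in>\<Lambda>. borel). AE \<xi> in \<mu>.
        real_cond_exp \<mu> (exterior_algebra \<Lambda>) (indicator {\<phi>. restrict \<phi> \<Lambda> \<in> A}) \<xi> =
        measure (finite_gibbs V (lattice_edges \<Lambda>) \<Lambda> 0 \<xi>) A))"

definition shift :: "int ^ 'd \<Rightarrow> (int ^ 'd \<Rightarrow> real) \<Rightarrow> (int ^ 'd \<Rightarrow> real)" where
  "shift z \<phi> = (\<lambda>x. \<phi> (x + z))"

definition shift_invariant :: "(int ^ 'd \<Rightarrow> real) measure \<Rightarrow> bool" where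
  "shift_invariant \<mu> \<longleftrightarrow> (\<forall>z. distr \<mu> field_algebra (shift z) = \<mu>)"

definition shift_ergodic :: "(int ^ 'd \<Rightarrow> real) measure \<Rightarrow> bool" where
  "shift_ergodic \<mu> \<longleftrightarrow>
     (\<forall>z. z \<noteq> 0 \<longrightarrow> (\<forall>A\<in>sets field_algebra. shift z ` A = A \<longrightarrow> measure \<mu> A \<in> {0, 1}))"

definition ergodic_centred_gibbs :: "(real \<Rightarrow> real) \<Rightarrow> (int ^ 'd \<Rightarrow> real) measure \<Rightarrow> bool" where
  "ergodic_centred_gibbs V \<mu> \<longleftrightarrow>
     phi_gibbs V \<mu> \<and> shift_invariant \<mu> \<and> shift_ergodic \<mu> \<and>
     integrable \<mu> (\<lambda>\<phi>. (\<phi> 0)\<^sup>2) \<and> (\<integral>\<phi>. \<phi> 0 \<partial>\<mu>) = 0"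

end

theory Submission
  imports Defs "HOL-Real_Asymp.Real_Asymp"
begin

text \<open>
  Uniform convexity of the Hamiltonian and the Prekopa-Leindler inequality give, for finite-volume
  Gibbs measures, a variance bound for functions that are Lipschitz in the Dirichlet norm, and a
  comparison of the means of such functions under two boundary conditions. In dimension \<open>d \<ge> 3\<close> the
  value of the field at a site is of this kind up to an arbitrarily small square-summable error,
  since dyadic block averages change by a summable amount from scale to scale. Hence the torus
  measures have variances bounded uniformly in the volume and the mass, their limit points as
  \<open>n \<rightarrow> \<infinity>\<close> and then \<open>m \<rightarrow> 0\<close> exist by compactness, and these inherit shift invariance, reflection
  symmetry, the variance bound and the DLR equations.

  Two shift-invariant Gibbs measures with bounded second moments give the same mean to every local
  Lipschitz function of the gradients: average the function over a cube, compare boundary conditions,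
  and use that the boundary of a large cube is small compared with its volume. If moreover the block
  averages of the field tend to \<open>0\<close> in mean square, the two measures coincide, which makes the limits
  unique. Applied to ergodic averages, the variance bound shows that the limit is ergodic. Conversely,
  under an ergodic centred Gibbs measure the block averages converge by the comparison of gradients;
  the limit is shift invariant, hence constant, hence \<open>0\<close>, and uniqueness applies.
\<close>

text \<open>The torus supplies exact shift invariance, which a box with fixed boundary values lacks;
  but constants cost no gradient energy on it, so exp (- H) is integrable only with a mass, which is
  kept until the volume is infinite. The obstacle is to bound variances uniformly in volume and mass
  for non-quadratic \<open>V\<close>. Comparing exp (s f - H) with exp (- s f - H') at midpoints
  uses only convexity of the Hamiltonians and Lipschitz continuity of f in the energy norm: H = H'
  gives variances, two Hamiltonians give the comparison of boundary conditions. Dimension three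
  enters in one computation: moving a block of side 2^k by 2^k costs 2^k / 2^(3k/2) = 2^(-k/2),
  which is summable in k. Gradients alone do not determine the field, as adding a random constant
  changes none of them; decay of block averages in mean square removes this freedom, and this is
  what ergodicity and mean zero have to provide. Both limits follow one scheme: tightness gives
  limit points, the stable properties hold for each of them, and uniqueness identifies them.\<close>

type_synonym 'd config = "int ^ 'd \<Rightarrow> real"

abbreviation flat :: "'i set \<Rightarrow> ('i \<Rightarrow> real) measure" where
  "flat I \<equiv> PiM I (\<lambda>_. lborel)"

abbreviation field_law :: "'d::finite config measure \<Rightarrow> bool" where
  "field_law \<mu> \<equiv> \<mu> \<in> space (prob_algebra field_algebra)"

section \<open>The Prekopa-Leindler inequality\<close>

text \<open>The copy of \<open>A\<close> halved and moved by half the minimum of \<open>B\<close>,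
  and the copy of \<open>B\<close> halved and moved by half the maximum of \<open>A\<close>, both
  consist of midpoints and meet in at most one point, so their measures add up inside
  \<open>C\<close>.\<close>

lemma brunn_minkowski_compact:
  fixes A B C :: "real set"
  assumes "compact A" "compact B" "A \<noteq> {}" "B \<noteq> {}" and C: "C \<in> sets borel"
    and mid: "\<And>a b. a \<in> A \<Longrightarrow> b \<in> B \<Longrightarrow> (a + b) / 2 \<in> C"
  shows "emeasure lborel A + emeasure lborel B \<le> 2 * emeasure lborel C"
proof -
  obtain a where a: "a \<in> A" "\<And>x. x \<in> A \<Longrightarrow> x \<le> a"
    using compact_attains_sup[OF assms(1,3)] by blast
  obtain b where b: "b \<in> B" "\<And>x. x \<in> B \<Longrightarrow> b \<le> x"
    using compact_attains_inf[OF assms(2,4)] by blast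
  define A' where "A' = (\<lambda>x. (1/2) *\<^sub>R x + b/2) ` A"
  define B' where "B' = (\<lambda>x. (1/2) *\<^sub>R x + a/2) ` B"
  have cA: "compact A'" and cB: "compact B'"
    unfolding A'_def B'_def using assms(1,2)
    by (auto intro!: compact_continuous_image continuous_intros)
  have eq: "emeasure lborel ((\<lambda>x. (1/2) *\<^sub>R x + c) ` S) = ennreal (1/2) * emeasure lborel S"
    if "compact S" for S :: "real set" and c :: real
  proof -
    have i: "compact ((\<lambda>x. (1/2) *\<^sub>R x + c) ` S)"
      using that by (auto intro!: compact_continuous_image continuous_intros)
    have "emeasure lebesgue ((\<lambda>x. (1/2) *\<^sub>R x + c) ` S) = ennreal (1/2) * emeasure lebesgue S"
      using emeasure_lebesgue_affine[of "1/2::real" c S] by simp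
    then show ?thesis
      using i that by (simp add: borel_compact)
  qed
  have AB: "A' \<inter> B' \<subseteq> {(a + b)/2}"
  proof
    fix t assume "t \<in> A' \<inter> B'"
    then obtain x y where "x \<in> A" "y \<in> B" "t = (x + b)/2" "t = (y + a)/2"
      by (auto simp: A'_def B'_def field_simps)
    then show "t \<in> {(a+b)/2}" using a(2)[of x] b(2)[of y] by simp
  qed
  have null: "emeasure lborel (A' \<inter> B') = 0"
  proof -
    have "finite (A' \<inter> B')" using AB finite_subset by blast
    then show ?thesis by (simp add: emeasure_lborel_countable countable_finite)
  qed
  have sub: "A' \<union> B' \<subseteq> C"
    unfolding A'_def B'_def using mid a(1) b(1)
    by (auto simp: field_simps add_divide_distrib[symmetric]) (metis add.commute)+
  have "emeasure lborel A' + emeasure lborel B' = emeasure lborel (A' \<union> B')"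
    using emeasure_Un_Int[of A' lborel B'] null cA cB by (simp add: borel_compact)
  also have "\<dots> \<le> emeasure lborel C"
    by (intro emeasure_mono sub) (use C in simp)
  finally have "emeasure lborel A' + emeasure lborel B' \<le> emeasure lborel C" .
  then have *: "ennreal (1/2) * (emeasure lborel A + emeasure lborel B) \<le> emeasure lborel C"
    unfolding A'_def B'_def eq[OF assms(1)] eq[OF assms(2)] by (simp only: distrib_left)
  have "emeasure lborel A + emeasure lborel B = 2 * (ennreal (1/2) * (emeasure lborel A + emeasure lborel B))"
    by (simp only: mult.assoc[symmetric] ennreal_mult'[symmetric] flip: ennreal_numeral) simp
  also have "\<dots> \<le> 2 * emeasure lborel C"
    by (intro mult_left_mono *) auto
  finally show ?thesis .
qed

text \<open>Inner regularity reduces the claim to compact sets after truncation to a bounded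
  interval; continuity from below removes the truncation.\<close>

lemma brunn_minkowski:
  fixes A B C :: "real set"
  assumes A: "A \<in> sets borel" and B: "B \<in> sets borel" and ne: "A \<noteq> {}" "B \<noteq> {}" and C: "C \<in> sets borel"
    and mid: "\<And>a b. a \<in> A \<Longrightarrow> b \<in> B \<Longrightarrow> (a + b) / 2 \<in> C"
  shows "emeasure lborel A + emeasure lborel B \<le> 2 * emeasure lborel C"
proof -
  have inner: "\<exists>K. compact K \<and> K \<noteq> {} \<and> K \<subseteq> S \<and> emeasure lborel (S \<inter> {-real n..real n}) \<le> emeasure lborel K + ennreal e"
    if S: "S \<in> sets borel" "S \<noteq> {}" and e: "e > 0" for S :: "real set" and n e
  proof -
    obtain T where T: "closed T" "T \<subseteq> S" "S - T \<in> lmeasurable" "emeasure lebesgue (S - T) < ennreal e"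
      using sets_lebesgue_inner_closed[of S e] S e by auto
    obtain s where s: "s \<in> S" using S by auto
    \<comment> \<open>The point s is added because the compact case asks for nonempty sets, and the
      truncated closed set may be empty.\<close>
    define K where "K = insert s (T \<inter> {-real n..real n})"
    have K: "compact K" "K \<noteq> {}" "K \<subseteq> S"
      using T s unfolding K_def by (auto intro!: compact_insert closed_Int_compact)
    have [measurable]: "K \<in> sets borel" "T \<in> sets borel" "S \<in> sets borel"
      using K T S by (auto intro: borel_compact borel_closed)
    have "S \<inter> {-real n..real n} \<subseteq> K \<union> (S - T)"
      by (auto simp: K_def)
    then have "emeasure lborel (S \<inter> {-real n..real n}) \<le> emeasure lborel (K \<union> (S - T))"
      by (intro emeasure_mono) auto
    also have "\<dots> \<le> emeasure lborel K + emeasure lborel (S - T)"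
      by (intro emeasure_subadditive) auto
    also have "emeasure lborel (S - T) = emeasure lebesgue (S - T)"
      by simp
    also have "emeasure lborel K + \<dots> \<le> emeasure lborel K + ennreal e"
      using T by (intro add_left_mono) auto
    finally show ?thesis using K by blast
  qed
  have bound: "emeasure lborel (A \<inter> {-real n..real n}) + emeasure lborel (B \<inter> {-real n..real n})
      \<le> 2 * emeasure lborel C" for n
  proof (rule ennreal_le_epsilon)
    fix e :: real assume e: "0 < e"
    obtain K where K: "compact K" "K \<noteq> {}" "K \<subseteq> A"
      "emeasure lborel (A \<inter> {-real n..real n}) \<le> emeasure lborel K + ennreal (e/2)"
      using inner[OF A ne(1), of "e/2" n] e by auto
    obtain L where L: "compact L" "L \<noteq> {}" "L \<subseteq> B"
      "emeasure lborel (B \<inter> {-real n..real n}) \<le> emeasure lborel L + ennreal (e/2)"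
      using inner[OF B ne(2), of "e/2" n] e by auto
    have "emeasure lborel (A \<inter> {-real n..real n}) + emeasure lborel (B \<inter> {-real n..real n})
      \<le> (emeasure lborel K + ennreal (e/2)) + (emeasure lborel L + ennreal (e/2))"
      using K L by (intro add_mono) auto
    also have "\<dots> = (emeasure lborel K + emeasure lborel L) + (ennreal (e/2) + ennreal (e/2))"
      by (simp add: algebra_simps)
    also have "ennreal (e/2) + ennreal (e/2) = ennreal e"
      using e by (simp flip: ennreal_plus)
    also have "emeasure lborel K + emeasure lborel L \<le> 2 * emeasure lborel C"
      using K L mid C by (intro brunn_minkowski_compact) blast+
    finally show "emeasure lborel (A \<inter> {-real n..real n}) + emeasure lborel (B \<inter> {-real n..real n})
       \<le> 2 * emeasure lborel C + ennreal e"
      by (simp add: add_right_mono)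
  qed
  have lim: "(\<lambda>n. emeasure lborel (S \<inter> {-real n..real n})) \<longlonglongrightarrow> emeasure lborel S"
    if "S \<in> sets borel" for S :: "real set"
  proof -
    have "(\<Union>n. S \<inter> {-real n..real n}) = S"
    proof safe
      fix x assume "x \<in> S"
      moreover obtain n where "\<bar>x\<bar> \<le> real n" using real_arch_simple by blast
      ultimately show "x \<in> (\<Union>n. S \<inter> {-real n..real n})" by (auto intro!: exI[of _ n])
    qed
    moreover have "incseq (\<lambda>n. S \<inter> {-real n..real n})"
      by (auto simp: incseq_def)
    moreover have "range (\<lambda>n. S \<inter> {-real n..real n}) \<subseteq> sets lborel"
      using that by auto
    ultimately show ?thesis
      using Lim_emeasure_incseq[of "\<lambda>n. S \<inter> {-real n..real n}" lborel] by metis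
  qed
  show ?thesis
    by (rule LIMSEQ_le_const2[OF tendsto_add[OF lim[OF A] lim[OF B]]]) (use bound in auto)
qed

lemma nn_integral_layer_cake:
  fixes u :: "real \<Rightarrow> real"
  assumes [measurable]: "u \<in> borel_measurable borel" and "\<And>x. 0 \<le> u x"
  shows "(\<integral>\<^sup>+x. ennreal (u x) \<partial>lborel) = (\<integral>\<^sup>+t. indicator {0..} t * emeasure lborel {x. t < u x} \<partial>lborel)"
proof -
  have "(\<integral>\<^sup>+x. ennreal (u x) \<partial>lborel) = (\<integral>\<^sup>+x. (\<integral>\<^sup>+t. indicator {0..} t * indicator {x. t < u x} x \<partial>lborel) \<partial>lborel)"
  proof (intro nn_integral_cong)
    fix x
    have "(\<integral>\<^sup>+t. indicator {0..} t * indicator {x. t < u x} x \<partial>lborel) = (\<integral>\<^sup>+t. indicator {0..<u x} t \<partial>lborel)"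
      by (intro nn_integral_cong) (auto simp: indicator_def)
    then show "ennreal (u x) = (\<integral>\<^sup>+t. indicator {0..} t * indicator {x. t < u x} x \<partial>lborel)"
      using assms(2) by simp
  qed
  also have "\<dots> = (\<integral>\<^sup>+t. (\<integral>\<^sup>+x. indicator {0..} t * indicator {x. t < u x} x \<partial>lborel) \<partial>lborel)"
    by (intro lborel_pair.Fubini') measurable
  also have "\<dots> = (\<integral>\<^sup>+t. indicator {0..} t * emeasure lborel {x. t < u x} \<partial>lborel)"
    by (intro nn_integral_cong) (simp add: nn_integral_cmult)
  finally show ?thesis .
qed

lemma ennreal_mult_le_square:
  fixes p q r :: ennreal
  assumes "p + q \<le> 2 * r" shows "p * q \<le> r\<^sup>2"
proof (cases "r = \<top>")
  case False
  then have "2 * r < \<top>" by (simp add: ennreal_mult_less_top less_top)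
  then have "p < \<top>" "q < \<top>" using assms by (auto simp: less_top[symmetric] top_unique)
  then obtain p' q' r' where "p = ennreal p'" "q = ennreal q'" "r = ennreal r'" "0 \<le> p'" "0 \<le> q'" "0 \<le> r'"
    using False by (metis ennreal_cases less_irrefl)
  note e = this
  have "p' + q' \<le> 2 * r'"
    using assms e by (simp add: ennreal_mult''[symmetric] ennreal_le_iff flip: ennreal_plus ennreal_numeral)
  then have "(p' + q')\<^sup>2 \<le> (2 * r')\<^sup>2" using e by (intro power_mono) auto
  moreover have "0 \<le> (p' - q')\<^sup>2" by simp
  ultimately have "p' * q' \<le> r'\<^sup>2" by (simp add: power2_eq_square algebra_simps)
  then show ?thesis using e by (simp add: ennreal_mult''[symmetric] ennreal_power ennreal_le_iff)
qed (simp add: power2_eq_square)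

text \<open>With both suprema equal to 1, the superlevel sets of \<open>u\<close> and
  \<open>v\<close> are nonempty for the same levels t < 1. Their midpoints lie in the superlevel set
  of \<open>w\<close>, so Brunn-Minkowski applies level by level and the levels are
  integrated.\<close>

lemma prekopa_leindler_normalised:
  fixes u v w :: "real \<Rightarrow> real"
  assumes [measurable]: "u \<in> borel_measurable borel" "v \<in> borel_measurable borel" "w \<in> borel_measurable borel"
    and nn: "\<And>x. 0 \<le> u x" "\<And>x. 0 \<le> v x" "\<And>x. 0 \<le> w x"
    and le1: "\<And>x. u x \<le> 1" "\<And>x. v x \<le> 1"
    and sup: "\<And>t. t < 1 \<Longrightarrow> \<exists>x. t < u x" "\<And>t. t < 1 \<Longrightarrow> \<exists>x. t < v x"
    and uvw: "\<And>x y. u x * v y \<le> (w ((x + y) / 2))\<^sup>2"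
  shows "(\<integral>\<^sup>+x. u x \<partial>lborel) + (\<integral>\<^sup>+x. v x \<partial>lborel) \<le> 2 * (\<integral>\<^sup>+x. w x \<partial>lborel)"
proof -
  have lev: "emeasure lborel {x. t < u x} + emeasure lborel {x. t < v x} \<le> 2 * emeasure lborel {x. t < w x}"
    if t: "0 \<le> t" for t
  proof (cases "t < 1")
    case True
    show ?thesis
    proof (rule brunn_minkowski)
      fix a b assume "a \<in> {x. t < u x}" "b \<in> {x. t < v x}"
      then have "t * t < u a * v b" using t by (auto intro!: mult_strict_mono')
      then have "t\<^sup>2 < (w ((a+b)/2))\<^sup>2" using uvw[of a b] by (simp add: power2_eq_square)
      then show "(a + b) / 2 \<in> {x. t < w x}"
        using nn(3) power2_less_imp_less by auto
    qed (use sup[OF True] in \<open>auto\<close>)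
  next
    case False
    then have "{x. t < u x} = {}" "{x. t < v x} = {}" using le1 by (auto simp: not_less intro: order_trans)
    then show ?thesis by simp
  qed
  have "(\<integral>\<^sup>+x. u x \<partial>lborel) + (\<integral>\<^sup>+x. v x \<partial>lborel)
      = (\<integral>\<^sup>+t. indicator {0..} t * emeasure lborel {x. t < u x} + indicator {0..} t * emeasure lborel {x. t < v x} \<partial>lborel)"
    using nn by (simp add: nn_integral_layer_cake nn_integral_add)
  also have "\<dots> \<le> (\<integral>\<^sup>+t. 2 * (indicator {0..} t * emeasure lborel {x. t < w x}) \<partial>lborel)"
    using lev by (intro nn_integral_mono) (auto simp: indicator_def)
  also have "\<dots> = 2 * (\<integral>\<^sup>+x. w x \<partial>lborel)"
    using nn by (simp add: nn_integral_layer_cake nn_integral_cmult)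
  finally show ?thesis .
qed

text \<open>Dividing \<open>u\<close> and \<open>v\<close> by their suprema a and b, and
  \<open>w\<close> by sqrt (a b), leads to the additive inequality p + q \<le> 2 r. It implies p q
  \<le> r^2, and this form is homogeneous, so the scaling can be undone.\<close>

lemma prekopa_leindler_bounded:
  fixes u v w :: "real \<Rightarrow> real"
  assumes m[measurable]: "u \<in> borel_measurable borel" "v \<in> borel_measurable borel" "w \<in> borel_measurable borel"
    and nn: "\<And>x. 0 \<le> u x" "\<And>x. 0 \<le> v x" "\<And>x. 0 \<le> w x"
    and bd: "\<And>x. u x \<le> k" "\<And>x. v x \<le> k"
    and uvw: "\<And>x y. u x * v y \<le> (w ((x + y) / 2))\<^sup>2"
  shows "(\<integral>\<^sup>+x. u x \<partial>lborel) * (\<integral>\<^sup>+x. v x \<partial>lborel) \<le> (\<integral>\<^sup>+x. w x \<partial>lborel)\<^sup>2"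
proof -
  define a where "a = (SUP x. u x)"
  define b where "b = (SUP x. v x)"
  have bdd: "bdd_above (range u)" "bdd_above (range v)" using bd by (auto intro!: bdd_aboveI)
  have ua: "u x \<le> a" and vb: "v x \<le> b" for x
    using bdd by (auto simp: a_def b_def intro!: cSUP_upper)
  show ?thesis
  proof (cases "a \<le> 0 \<or> b \<le> 0")
    case True
    then have "(\<forall>x. u x = 0) \<or> (\<forall>x. v x = 0)" using nn ua vb by (meson order_antisym order_trans)
    then show ?thesis by auto
  next
    case False
    then have ab: "a > 0" "b > 0" by auto
    have "(\<integral>\<^sup>+x. u x / a \<partial>lborel) + (\<integral>\<^sup>+x. v x / b \<partial>lborel) \<le> 2 * (\<integral>\<^sup>+x. w x / sqrt (a * b) \<partial>lborel)"
    proof (rule prekopa_leindler_normalised)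
      show "\<exists>x. t < u x / a" if "t < 1" for t
      proof -
        have "t * a < a" using that ab by simp
        then obtain x where "t * a < u x"
          using bdd less_cSUP_iff[of UNIV u "t * a"] by (auto simp: a_def)
        then show ?thesis using ab by (auto simp: field_simps)
      qed
      show "\<exists>x. t < v x / b" if "t < 1" for t
      proof -
        have "t * b < b" using that ab by simp
        then obtain x where "t * b < v x"
          using bdd less_cSUP_iff[of UNIV v "t * b"] by (auto simp: b_def)
        then show ?thesis using ab by (auto simp: field_simps)
      qed
      show "u x / a * (v y / b) \<le> (w ((x + y) / 2) / sqrt (a * b))\<^sup>2" for x y
        using uvw[of x y] ab by (simp add: power_divide divide_right_mono)
    qed (use ua vb ab nn in \<open>auto simp: field_simps\<close>)
    from ennreal_mult_le_square[OF this]
    have *: "(\<integral>\<^sup>+x. u x / a \<partial>lborel) * (\<integral>\<^sup>+x. v x / b \<partial>lborel) \<le> (\<integral>\<^sup>+x. w x / sqrt (a * b) \<partial>lborel)\<^sup>2" .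
    have sc: "(\<integral>\<^sup>+x. ennreal (f x) \<partial>lborel) = ennreal c * (\<integral>\<^sup>+x. f x / c \<partial>lborel)"
      if "c > 0" "f \<in> borel_measurable borel" "\<And>x. 0 \<le> f x" for c :: real and f :: "real \<Rightarrow> real"
      using that by (subst nn_integral_cmult[symmetric]) (auto simp: ennreal_mult''[symmetric])
    have "(\<integral>\<^sup>+x. u x \<partial>lborel) * (\<integral>\<^sup>+x. v x \<partial>lborel)
        = ennreal (a * b) * ((\<integral>\<^sup>+x. u x / a \<partial>lborel) * (\<integral>\<^sup>+x. v x / b \<partial>lborel))"
      using sc[of a u] sc[of b v] ab nn by (simp add: ennreal_mult'' mult_ac)
    also have "\<dots> \<le> ennreal (a * b) * (\<integral>\<^sup>+x. w x / sqrt (a * b) \<partial>lborel)\<^sup>2"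
      by (intro mult_left_mono *) auto
    also have "\<dots> = (ennreal (sqrt (a * b)) * (\<integral>\<^sup>+x. w x / sqrt (a * b) \<partial>lborel))\<^sup>2"
      using ab by (simp add: power_mult_distrib ennreal_power)
    also have "\<dots> = (\<integral>\<^sup>+x. w x \<partial>lborel)\<^sup>2"
      using sc[of "sqrt (a * b)" w] ab nn by simp
    finally show ?thesis .
  qed
qed

lemma SUP_nn_integral_min:
  assumes [measurable]: "f \<in> borel_measurable M"
  shows "(SUP k::nat. \<integral>\<^sup>+x. min (f x) (of_nat k) \<partial>M) = (\<integral>\<^sup>+x. f x \<partial>M)"
proof -
  have sup: "(SUP k::nat. min (f x) (of_nat k)) = f x" for x
  proof -
    have "(SUP k::nat. min (f x) (of_nat k :: ennreal)) = inf (f x) (SUP k::nat. of_nat k)"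
      unfolding inf_min[symmetric] by (rule inf_SUP[symmetric])
    then show ?thesis by (simp add: ennreal_SUP_of_nat_eq_top inf_min)
  qed
  have "(\<integral>\<^sup>+x. (SUP k::nat. min (f x) (of_nat k)) \<partial>M) = (SUP k::nat. \<integral>\<^sup>+x. min (f x) (of_nat k) \<partial>M)"
    by (intro nn_integral_monotone_convergence_SUP)
       (auto simp: incseq_def le_fun_def intro!: min.mono simp del: min.bounded_iff)
  then show ?thesis by (simp add: sup)
qed

text \<open>Truncating \<open>u\<close> at k, \<open>v\<close> at l and \<open>w\<close> at max k l
  preserves the midpoint hypothesis and yields bounded real functions. Monotone convergence in k and
  in l separately restores \<open>u\<close> and \<open>v\<close>.\<close>

lemma prekopa_leindler_real:
  fixes u v w :: "real \<Rightarrow> ennreal"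
  assumes m[measurable]: "u \<in> borel_measurable borel" "v \<in> borel_measurable borel" "w \<in> borel_measurable borel"
    and uvw: "\<And>x y. u x * v y \<le> (w ((x + y) / 2))\<^sup>2"
  shows "(\<integral>\<^sup>+x. u x \<partial>lborel) * (\<integral>\<^sup>+x. v x \<partial>lborel) \<le> (\<integral>\<^sup>+x. w x \<partial>lborel)\<^sup>2"
proof -
  define tr :: "nat \<Rightarrow> ennreal \<Rightarrow> real" where "tr k a = enn2real (min a (of_nat k))" for k a
  have tr: "ennreal (tr k a) = min a (of_nat k)" for k a
    unfolding tr_def by (intro ennreal_enn2real) (auto simp: min_less_iff_disj of_nat_less_top)
  have tr0: "0 \<le> tr k a" for k a by (simp add: tr_def)
  have trk: "tr k a \<le> real k" for k a
    using tr[of k a] by (metis ennreal_le_iff ennreal_of_nat_eq_real_of_nat min.cobounded2 of_nat_0_le_iff)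
  have b: "(\<integral>\<^sup>+x. min (u x) (of_nat k) \<partial>lborel) * (\<integral>\<^sup>+x. min (v x) (of_nat l) \<partial>lborel) \<le> (\<integral>\<^sup>+x. w x \<partial>lborel)\<^sup>2" for k l
  proof -
    define n where "n = max k l"
    have "(\<integral>\<^sup>+x. ennreal (tr k (u x)) \<partial>lborel) * (\<integral>\<^sup>+x. ennreal (tr l (v x)) \<partial>lborel) \<le> (\<integral>\<^sup>+x. ennreal (tr n (w x)) \<partial>lborel)\<^sup>2"
    proof (rule prekopa_leindler_bounded)
      show "tr k (u x) \<le> real n" "tr l (v x) \<le> real n" for x
        using trk[of k "u x"] trk[of l "v x"] by (auto simp: n_def)
      fix x y :: real
      let ?z = "(x + y)/2"
      have "ennreal (tr k (u x) * tr l (v y)) = min (u x) (of_nat k) * min (v y) (of_nat l)"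
        by (simp add: ennreal_mult tr tr0)
      also have "\<dots> \<le> (min (w ?z) (of_nat n))\<^sup>2"
      proof (cases "w ?z \<le> of_nat n")
        case True
        have "min (u x) (of_nat k) * min (v y) (of_nat l) \<le> u x * v y"
          by (intro mult_mono) auto
        with uvw[of x y] True show ?thesis by (simp add: min_absorb1)
      next
        case False
        have "min (u x) (of_nat k) * min (v y) (of_nat l) \<le> of_nat n * (of_nat n :: ennreal)"
          unfolding n_def by (intro mult_mono) (auto simp: min_le_iff_disj)
        with False show ?thesis by (simp add: min_absorb2 power2_eq_square)
      qed
      also have "\<dots> = ennreal ((tr n (w ?z))\<^sup>2)"
        by (simp add: tr tr0 flip: ennreal_power)
      finally show "tr k (u x) * tr l (v y) \<le> (tr n (w ?z))\<^sup>2"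
        by (simp add: ennreal_le_iff)
    qed (auto simp: tr0 tr_def)
    also have "\<dots> \<le> (\<integral>\<^sup>+x. w x \<partial>lborel)\<^sup>2"
      by (intro power_mono nn_integral_mono) (auto simp: tr)
    finally show ?thesis by (simp add: tr)
  qed
  have "(\<integral>\<^sup>+x. u x \<partial>lborel) * (\<integral>\<^sup>+x. v x \<partial>lborel) =
     (SUP k::nat. \<integral>\<^sup>+x. min (u x) (of_nat k) \<partial>lborel) * (SUP l::nat. \<integral>\<^sup>+x. min (v x) (of_nat l) \<partial>lborel)"
    by (simp add: SUP_nn_integral_min)
  also have "\<dots> = (SUP k::nat. SUP l::nat. (\<integral>\<^sup>+x. min (u x) (of_nat k) \<partial>lborel) * (\<integral>\<^sup>+x. min (v x) (of_nat l) \<partial>lborel))"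
    unfolding SUP_mult_right_ennreal unfolding SUP_mult_left_ennreal ..
  also have "\<dots> \<le> (\<integral>\<^sup>+x. w x \<partial>lborel)\<^sup>2"
    by (intro SUP_least b)
  finally show ?thesis .
qed

text \<open>Integrating out one coordinate preserves the midpoint hypothesis, by the one-dimensional
  inequality applied on the fibres; this is what carries the induction over the index set.\<close>

lemma prekopa_leindler:
  fixes u v w :: "('i \<Rightarrow> real) \<Rightarrow> ennreal"
  assumes "finite I"
    and "u \<in> borel_measurable (flat I)" "v \<in> borel_measurable (flat I)"
      "w \<in> borel_measurable (flat I)"
    and "\<And>x y. x \<in> extensional I \<Longrightarrow> y \<in> extensional I \<Longrightarrow> u x * v y \<le> (w (\<lambda>i\<in>I. (x i + y i) / 2))\<^sup>2"
  shows "(\<integral>\<^sup>+x. u x \<partial>flat I) * (\<integral>\<^sup>+x. v x \<partial>flat I) \<le> (\<integral>\<^sup>+x. w x \<partial>flat I)\<^sup>2"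
  using assms
proof (induction I arbitrary: u v w rule: finite_induct)
  case empty
  have "(\<lambda>i\<in>{}. (undefined i + undefined i) / 2) = (\<lambda>i::'i. undefined::real)" by auto
  moreover have "(\<lambda>i::'i. undefined::real) \<in> extensional {}" by auto
  ultimately have "u (\<lambda>_. undefined) * v (\<lambda>_. undefined) \<le> (w (\<lambda>_. undefined))\<^sup>2"
    using empty(4)[of "\<lambda>_. undefined" "\<lambda>_. undefined"] by (simp add: restrict_def)
  then show ?case
    by (simp add: PiM_empty nn_integral_count_space_finite)
next
  case (insert i I)
  interpret product_sigma_finite "\<lambda>_::'i. lborel :: real measure" by standard
  note [measurable] = insert(4,5,6)
  have I: "(\<integral>\<^sup>+x. f x \<partial>flat (insert i I)) = (\<integral>\<^sup>+x. (\<integral>\<^sup>+y. f (x(i := y)) \<partial>lborel) \<partial>flat I)"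
    if "f \<in> borel_measurable (flat (insert i I))" for f :: "('i \<Rightarrow> real) \<Rightarrow> ennreal"
    using product_nn_integral_insert[OF insert(1,2) that] .
  have sl: "(\<lambda>t. f (x(i := t))) \<in> borel_measurable borel"
    if "f \<in> borel_measurable (flat (insert i I))" "x \<in> extensional I" for f :: "('i \<Rightarrow> real) \<Rightarrow> ennreal" and x
  proof -
    have "x \<in> space (flat I)" using that by (simp add: space_PiM PiE_def)
    from measurable_comp[OF measurable_component_update[OF this insert(2)] that(1)]
    show ?thesis by (simp add: comp_def)
  qed
  have ms: "(\<lambda>x. \<integral>\<^sup>+y. f (x(i := y)) \<partial>lborel) \<in> borel_measurable (flat I)"
    if [measurable]: "f \<in> borel_measurable (flat (insert i I))" for f :: "('i \<Rightarrow> real) \<Rightarrow> ennreal"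
    by measurable
  show ?case
    unfolding I[OF insert(4)] I[OF insert(5)] I[OF insert(6)]
  proof (rule insert.IH[OF ms ms ms])
    fix x y :: "'i \<Rightarrow> real" assume x: "x \<in> extensional I" and y: "y \<in> extensional I"
    show "(\<integral>\<^sup>+t. u (x(i := t)) \<partial>lborel) * (\<integral>\<^sup>+t. v (y(i := t)) \<partial>lborel)
       \<le> (\<integral>\<^sup>+t. w ((\<lambda>j\<in>I. (x j + y j) / 2)(i := t)) \<partial>lborel)\<^sup>2"
    proof (rule prekopa_leindler_real)
      fix s t :: real
      have "x(i := s) \<in> extensional (insert i I)" "y(i := t) \<in> extensional (insert i I)"
        using x y by (auto simp: extensional_def)
      from insert(7)[OF this]
      have "u (x(i := s)) * v (y(i := t)) \<le> (w (\<lambda>j\<in>insert i I. ((x(i := s)) j + (y(i := t)) j) / 2))\<^sup>2" .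
      also have "(\<lambda>j\<in>insert i I. ((x(i := s)) j + (y(i := t)) j) / 2) = (\<lambda>j\<in>I. (x j + y j) / 2)(i := (s + t)/2)"
        using insert(2) by (auto simp: fun_eq_iff restrict_def)
      finally show "u (x(i := s)) * v (y(i := t)) \<le> (w ((\<lambda>j\<in>I. (x j + y j) / 2)(i := (s + t)/2)))\<^sup>2" .
    qed (rule sl[OF insert(4) x] sl[OF insert(5) y] sl[OF insert(6) restrict_extensional])+
  qed (use insert in auto)
qed

section \<open>Variances and means under uniformly log-concave densities\<close>

definition gibbs_density :: "'a measure \<Rightarrow> ('a \<Rightarrow> real) \<Rightarrow> 'a measure" where
  "gibbs_density P H = density P (\<lambda>x. ennreal (exp (- H x)) / (\<integral>\<^sup>+x. ennreal (exp (- H x)) \<partial>P))"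

definition normalisable :: "'a measure \<Rightarrow> ('a \<Rightarrow> real) \<Rightarrow> bool" where
  "normalisable P H \<longleftrightarrow> H \<in> borel_measurable P \<and>
     (\<integral>\<^sup>+x. ennreal (exp (- H x)) \<partial>P) \<noteq> 0 \<and> (\<integral>\<^sup>+x. ennreal (exp (- H x)) \<partial>P) \<noteq> \<top>"

lemma normalisableD:
  assumes "normalisable P H"
  shows "H \<in> borel_measurable P" "(\<integral>\<^sup>+x. ennreal (exp (- H x)) \<partial>P) \<noteq> 0" "(\<integral>\<^sup>+x. ennreal (exp (- H x)) \<partial>P) \<noteq> \<top>"
  using assms by (auto simp: normalisable_def)

lemma sets_gibbs_density[simp, measurable_cong]: "sets (gibbs_density P H) = sets P"
  and space_gibbs_density[simp]: "space (gibbs_density P H) = space P"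
  by (simp_all add: gibbs_density_def)

lemma nn_integral_gibbs_density:
  assumes [measurable]: "H \<in> borel_measurable P" "g \<in> borel_measurable P"
  shows "(\<integral>\<^sup>+x. g x \<partial>gibbs_density P H) =
    (\<integral>\<^sup>+x. g x * ennreal (exp (- H x)) \<partial>P) / (\<integral>\<^sup>+x. ennreal (exp (- H x)) \<partial>P)"
  unfolding gibbs_density_def
  by (simp add: nn_integral_density nn_integral_divide[symmetric] ennreal_divide_times mult.commute ennreal_times_divide)

lemma prob_space_gibbs_density:
  assumes "normalisable P H"
  shows "prob_space (gibbs_density P H)"
proof (rule prob_spaceI)
  note n = normalisableD[OF assms]
  note [measurable] = n(1)
  have "emeasure (gibbs_density P H) (space (gibbs_density P H)) = (\<integral>\<^sup>+x. 1 \<partial>gibbs_density P H)"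
    by simp
  also have "\<dots> = 1"
    using n by (subst nn_integral_gibbs_density) (auto simp: ennreal_divide_self less_top)
  finally show "emeasure (gibbs_density P H) (space (gibbs_density P H)) = 1" .
qed

text \<open>Jensen's inequality, from the tangent to exp at the mean.\<close>

lemma (in prob_space) exp_expectation_le:
  fixes f :: "'a \<Rightarrow> real"
  assumes [measurable]: "f \<in> borel_measurable M" and bd: "\<And>x. x \<in> space M \<Longrightarrow> \<bar>f x\<bar> \<le> K"
  shows "ennreal (exp (expectation f)) \<le> (\<integral>\<^sup>+x. exp (f x) \<partial>M)"
proof -
  have i: "integrable M f" by (rule integrable_const_bound[of _ K]) (use bd in auto)
  have ie: "integrable M (\<lambda>x. exp (f x))"
    by (rule integrable_const_bound[of _ "exp K"]) (use bd in \<open>auto simp: abs_le_iff\<close>)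
  let ?a = "expectation f"
  have "exp ?a = expectation (\<lambda>x. exp ?a * (1 + (f x - ?a)))"
    using i by (simp add: prob_space)
  also have "\<dots> \<le> expectation (\<lambda>x. exp (f x))"
  proof (intro integral_mono ie)
    show "integrable M (\<lambda>x. exp ?a * (1 + (f x - ?a)))" using i by simp
    fix x
    have "exp ?a * (1 + (f x - ?a)) \<le> exp ?a * exp (f x - ?a)"
      using exp_ge_add_one_self[of "f x - ?a"] by (intro mult_left_mono) auto
    then show "exp ?a * (1 + (f x - ?a)) \<le> exp (f x)" by (simp flip: exp_add)
  qed
  finally have "ennreal (exp ?a) \<le> ennreal (expectation (\<lambda>x. exp (f x)))" by (rule ennreal_leI)
  also have "\<dots> = (\<integral>\<^sup>+x. exp (f x) \<partial>M)"
    using ie by (intro nn_integral_eq_integral[symmetric]) auto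
  finally show ?thesis .
qed

text \<open>Cauchy-Schwarz, obtained from Young's inequality with the weight r = sqrt (b / a), which
  makes the two terms equal.\<close>

lemma nn_integral_exp_half_le:
  fixes H1 H2 :: "'a \<Rightarrow> real"
  assumes n: "normalisable P H1" "normalisable P H2"
  shows "(\<integral>\<^sup>+x. ennreal (exp (- H1 x / 2)) * ennreal (exp (- H2 x / 2)) \<partial>P)\<^sup>2
    \<le> (\<integral>\<^sup>+x. ennreal (exp (- H1 x)) \<partial>P) * (\<integral>\<^sup>+x. ennreal (exp (- H2 x)) \<partial>P)"
proof -
  note [measurable] = n[THEN normalisableD(1)]
  obtain a b where ab: "(\<integral>\<^sup>+x. ennreal (exp (- H1 x)) \<partial>P) = ennreal a" "(\<integral>\<^sup>+x. ennreal (exp (- H2 x)) \<partial>P) = ennreal b" "a > 0" "b > 0"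
    using n[THEN normalisableD(2)] n[THEN normalisableD(3)] by (metis ennreal_cases ennreal_0 less_eq_real_def)
  define r where "r = sqrt (b / a)"
  have r: "r > 0" "r * a = sqrt (a * b)" "b / r = sqrt (a * b)"
    using ab by (auto simp: r_def real_sqrt_divide real_sqrt_mult field_simps)
  have "(\<integral>\<^sup>+x. ennreal (exp (- H1 x / 2)) * ennreal (exp (- H2 x / 2)) \<partial>P)
     \<le> (\<integral>\<^sup>+x. ennreal (r / 2) * ennreal (exp (- H1 x)) + ennreal (1 / (2 * r)) * ennreal (exp (- H2 x)) \<partial>P)"
  proof (intro nn_integral_mono)
    fix x
    let ?u = "exp (- H1 x / 2)" and ?v = "exp (- H2 x / 2)"
    have "0 \<le> (r * ?u - ?v)\<^sup>2" by simp
    then have "?u * ?v \<le> r / 2 * ?u\<^sup>2 + 1 / (2 * r) * ?v\<^sup>2"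
      using r(1) by (simp add: power2_eq_square field_simps)
    then show "ennreal ?u * ennreal ?v \<le> ennreal (r / 2) * ennreal (exp (- H1 x)) + ennreal (1 / (2 * r)) * ennreal (exp (- H2 x))"
      using r(1) by (simp add: exp_double[symmetric] ennreal_le_iff flip: ennreal_mult ennreal_plus)
  qed
  also have "\<dots> = ennreal (r / 2) * ennreal a + ennreal (1 / (2 * r)) * ennreal b"
    by (simp add: nn_integral_add nn_integral_cmult ab)
  also have "\<dots> = ennreal ((r * a) / 2 + (b / r) / 2)"
    using r(1) ab(3,4) by (simp flip: ennreal_mult ennreal_plus)
  also have "\<dots> = ennreal (sqrt (a * b))" unfolding r by simp
  finally have "(\<integral>\<^sup>+x. ennreal (exp (- H1 x / 2)) * ennreal (exp (- H2 x / 2)) \<partial>P)\<^sup>2 \<le> (ennreal (sqrt (a * b)))\<^sup>2"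
    by (intro power_mono) auto
  also have "\<dots> = ennreal a * ennreal b"
    using ab by (simp add: ennreal_power flip: ennreal_mult)
  finally show ?thesis unfolding ab .
qed

text \<open>Prekopa-Leindler is applied to exp (s f - H1) and exp (- s f - H2). The sum of the
  exponents at x and y exceeds minus the sum of the Hamiltonians at the midpoint by at most (s B +
  M) q - q^2 / 4, whose maximum over q is (s B + M)^2. The remaining integral at the midpoint is
  bounded by Cauchy-Schwarz. Here \<open>q\<close> stands for an energy distance and
  \<open>M\<close> measures the mismatch of \<open>H1\<close> and \<open>H2\<close>.\<close>

lemma gibbs_exponential_comparison:
  fixes H1 H2 f :: "('i \<Rightarrow> real) \<Rightarrow> real" and q :: "('i \<Rightarrow> real) \<Rightarrow> ('i \<Rightarrow> real) \<Rightarrow> real"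
  assumes I: "finite I" and n1: "normalisable (flat I) H1" and n2: "normalisable (flat I) H2"
    and f[measurable]: "f \<in> borel_measurable (flat I)"
    and conv: "\<And>x y. x \<in> extensional I \<Longrightarrow> y \<in> extensional I \<Longrightarrow>
        H1 (\<lambda>i\<in>I. (x i + y i) / 2) + H2 (\<lambda>i\<in>I. (x i + y i) / 2) \<le> H1 x + H2 y + M * q x y - (q x y)\<^sup>2 / 4"
    and lip: "\<And>x y. x \<in> extensional I \<Longrightarrow> y \<in> extensional I \<Longrightarrow> f x - f y \<le> B * q x y"
    and s: "0 \<le> s"
  shows "(\<integral>\<^sup>+x. exp (s * f x) \<partial>gibbs_density (flat I) H1) * (\<integral>\<^sup>+x. exp (- s * f x) \<partial>gibbs_density (flat I) H2)
    \<le> exp ((s * B + M)\<^sup>2)"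
proof -
  let ?P = "flat I" and ?c = "(s * B + M)\<^sup>2"
  note [measurable] = n1[THEN normalisableD(1)] n2[THEN normalisableD(1)]
  note Z = n1[THEN normalisableD(2)] n1[THEN normalisableD(3)] n2[THEN normalisableD(2)] n2[THEN normalisableD(3)]
  let ?Z1 = "\<integral>\<^sup>+x. ennreal (exp (- H1 x)) \<partial>?P" and ?Z2 = "\<integral>\<^sup>+x. ennreal (exp (- H2 x)) \<partial>?P"
  let ?A = "\<integral>\<^sup>+x. ennreal (exp (s * f x) * exp (- H1 x)) \<partial>?P" and ?B = "\<integral>\<^sup>+x. ennreal (exp (- s * f x) * exp (- H2 x)) \<partial>?P"
  have "?A * ?B \<le> (\<integral>\<^sup>+x. exp (?c / 2 - (H1 x + H2 x) / 2) \<partial>?P)\<^sup>2"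
  proof (rule prekopa_leindler[OF I])
    fix x y :: "'i \<Rightarrow> real" assume xy: "x \<in> extensional I" "y \<in> extensional I"
    let ?z = "\<lambda>i\<in>I. (x i + y i) / 2"
    have "s * (f x - f y) \<le> s * (B * q x y)"
      using lip[OF xy] s by (intro mult_left_mono) auto
    moreover have "0 \<le> (s * B + M - q x y / 2)\<^sup>2" by simp
    ultimately have "s * f x - H1 x + (- s * f y - H2 y) \<le> ?c - (H1 ?z + H2 ?z)"
      using conv[OF xy] by (simp add: power2_eq_square algebra_simps)
    then have "exp (s * f x - H1 x + (- s * f y - H2 y)) \<le> exp (?c - (H1 ?z + H2 ?z))" by simp
    also have "\<dots> = (exp (?c / 2 - (H1 ?z + H2 ?z) / 2))\<^sup>2"
      by (simp add: exp_double[symmetric] power2_eq_square flip: exp_add)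
    finally show "ennreal (exp (s * f x) * exp (- H1 x)) * ennreal (exp (- s * f y) * exp (- H2 y))
        \<le> (ennreal (exp (?c / 2 - (H1 ?z + H2 ?z) / 2)))\<^sup>2"
      by (simp add: ennreal_power ennreal_le_iff flip: ennreal_mult exp_add)
  qed measurable
  also have "\<dots> = (\<integral>\<^sup>+x. ennreal (exp (?c / 2)) * (ennreal (exp (- H1 x / 2)) * ennreal (exp (- H2 x / 2))) \<partial>?P)\<^sup>2"
    by (simp flip: ennreal_mult exp_add add: diff_divide_distrib add_divide_distrib algebra_simps)
  also have "\<dots> = ennreal (exp ?c) * (\<integral>\<^sup>+x. ennreal (exp (- H1 x / 2)) * ennreal (exp (- H2 x / 2)) \<partial>?P)\<^sup>2"
    by (simp add: nn_integral_cmult power_mult_distrib ennreal_power exp_double[symmetric])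
  also have "\<dots> \<le> ennreal (exp ?c) * (?Z1 * ?Z2)"
    using nn_integral_exp_half_le[OF n1 n2] by (intro mult_left_mono) auto
  finally have *: "?A * ?B \<le> exp ?c * (?Z1 * ?Z2)" .
  have ZZ: "?Z1 * ?Z2 \<noteq> 0" "?Z1 * ?Z2 \<noteq> \<top>"
    using Z by (auto simp: ennreal_mult_eq_top_iff)
  have "(\<integral>\<^sup>+x. exp (s * f x) \<partial>gibbs_density ?P H1) * (\<integral>\<^sup>+x. exp (- s * f x) \<partial>gibbs_density ?P H2)
     = (?A / ?Z1) * (?B / ?Z2)"
    by (simp add: nn_integral_gibbs_density ennreal_mult)
  also have "\<dots> = (?A * ?B) / (?Z1 * ?Z2)"
    using Z by (simp add: divide_ennreal_def ennreal_inverse_mult less_top mult_ac)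
  also have "\<dots> \<le> (exp ?c * (?Z1 * ?Z2)) / (?Z1 * ?Z2)"
    by (intro divide_right_mono_ennreal *)
  also have "\<dots> = exp ?c"
    using ZZ by (simp add: ennreal_mult_divide_eq)
  finally show ?thesis .
qed

text \<open>Jensen's inequality replaces the exponential moments by exponentials of the means. The
  parameter \<open>s\<close> stays free: one application optimises it, another takes it proportional
  to a volume.\<close>

lemma gibbs_mean_comparison:
  fixes H1 H2 f :: "('i \<Rightarrow> real) \<Rightarrow> real" and q :: "('i \<Rightarrow> real) \<Rightarrow> ('i \<Rightarrow> real) \<Rightarrow> real"
  assumes I: "finite I" and n1: "normalisable (flat I) H1" and n2: "normalisable (flat I) H2"
    and f[measurable]: "f \<in> borel_measurable (flat I)"
    and conv: "\<And>x y. x \<in> extensional I \<Longrightarrow> y \<in> extensional I \<Longrightarrow>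
        H1 (\<lambda>i\<in>I. (x i + y i) / 2) + H2 (\<lambda>i\<in>I. (x i + y i) / 2) \<le> H1 x + H2 y + M * q x y - (q x y)\<^sup>2 / 4"
    and lip: "\<And>x y. x \<in> extensional I \<Longrightarrow> y \<in> extensional I \<Longrightarrow> f x - f y \<le> B * q x y"
    and bd: "\<And>x. \<bar>f x\<bar> \<le> K"
    and s: "0 < s"
  shows "(\<integral>x. f x \<partial>gibbs_density (flat I) H1) - (\<integral>x. f x \<partial>gibbs_density (flat I) H2) \<le> (s * B + M)\<^sup>2 / s"
proof -
  interpret M1: prob_space "gibbs_density (flat I) H1" by (rule prob_space_gibbs_density[OF n1])
  interpret M2: prob_space "gibbs_density (flat I) H2" by (rule prob_space_gibbs_density[OF n2])
  have bd': "\<bar>s * f x\<bar> \<le> s * K" "\<bar>- s * f x\<bar> \<le> s * K" for x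
    using bd[of x] s by (auto simp: abs_mult)
  have "ennreal (exp (s * M1.expectation f - s * M2.expectation f))
     = ennreal (exp (M1.expectation (\<lambda>x. s * f x))) * ennreal (exp (M2.expectation (\<lambda>x. - s * f x)))"
    by (simp flip: ennreal_mult exp_add)
  also have "\<dots> \<le> (\<integral>\<^sup>+x. exp (s * f x) \<partial>gibbs_density (flat I) H1) * (\<integral>\<^sup>+x. exp (- s * f x) \<partial>gibbs_density (flat I) H2)"
    by (intro mult_mono M1.exp_expectation_le[where K = "s * K"] M2.exp_expectation_le[where K = "s * K"] bd') auto
  also have "\<dots> \<le> exp ((s * B + M)\<^sup>2)"
    by (rule gibbs_exponential_comparison[OF I n1 n2 f, where q = q]) (use conv lip s in auto)
  finally have "s * M1.expectation f - s * M2.expectation f \<le> (s * B + M)\<^sup>2"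
    by (simp add: ennreal_le_iff)
  then show ?thesis using s by (simp add: field_simps)
qed

text \<open>Since exp t + exp (- t) - 2 is the square of exp (t / 2) - exp (- t / 2), the claim
  reduces to the first-order bound for sinh.\<close>

lemma exp_add_exp_minus_ge: "2 + t\<^sup>2 \<le> exp t + exp (- t)" for t :: real
proof -
  have sq: "exp (2 * s) + exp (- (2 * s)) - 2 = (exp s - exp (- s))\<^sup>2" for s :: real
    unfolding exp_double mult_minus_right[symmetric] by (simp add: power2_diff flip: exp_add)
  have sinh: "2 * s \<le> exp s - exp (- s)" if "0 \<le> s" for s :: real
  proof -
    have "(\<lambda>s. exp s - exp (- s) - 2 * s) 0 \<le> (\<lambda>s. exp s - exp (- s) - 2 * s) s"
    proof (rule DERIV_nonneg_imp_nondecreasing[OF that])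
      fix y :: real
      have "((\<lambda>s. exp s - exp (- s) - 2 * s) has_real_derivative exp y + exp (- y) - 2) (at y)"
        by (auto intro!: derivative_eq_intros)
      moreover have "0 \<le> exp y + exp (- y) - 2" using sq[of "y / 2"] zero_le_power2[of "exp (y / 2) - exp (- (y / 2))"] by simp
      ultimately show "\<exists>z. ((\<lambda>s. exp s - exp (- s) - 2 * s) has_real_derivative z) (at y) \<and> 0 \<le> z" by blast
    qed
    then show ?thesis by simp
  qed
  have "\<bar>2 * s\<bar> \<le> \<bar>exp s - exp (- s)\<bar>" for s :: real
    using sinh[of s] sinh[of "- s"] by (cases "0 \<le> s") auto
  then have "(2 * s)\<^sup>2 \<le> (exp s - exp (- s))\<^sup>2" for s :: real by (rule abs_le_square_iff[THEN iffD1])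
  from this[of "t / 2"] sq[of "t / 2"] show ?thesis by simp
qed

text \<open>For the centred variable g scaled by s = 1 / B, the exponential moments of g and - g
  have product at most e. Each is at least 1 by Jensen's inequality, hence each is at most e, and 2
  + g^2 \<le> exp g + exp (- g) bounds the variance of g by 2 (e - 1) \<le> 4.\<close>

lemma gibbs_variance_bound:
  fixes H f :: "('i \<Rightarrow> real) \<Rightarrow> real" and q :: "('i \<Rightarrow> real) \<Rightarrow> ('i \<Rightarrow> real) \<Rightarrow> real" and I :: "'i set"
  defines "M \<equiv> gibbs_density (flat I) H"
  assumes I: "finite I" and n: "normalisable (flat I) H" and f[measurable]: "f \<in> borel_measurable (flat I)"
    and conv: "\<And>x y. x \<in> extensional I \<Longrightarrow> y \<in> extensional I \<Longrightarrow>
        2 * H (\<lambda>i\<in>I. (x i + y i) / 2) \<le> H x + H y - (q x y)\<^sup>2 / 4"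
    and lip: "\<And>x y. x \<in> extensional I \<Longrightarrow> y \<in> extensional I \<Longrightarrow> f x - f y \<le> B * q x y"
    and bd: "\<And>x. \<bar>f x\<bar> \<le> K"
    and B: "0 < B"
  shows "(\<integral>x. (f x)\<^sup>2 \<partial>M) - (\<integral>x. f x \<partial>M)\<^sup>2 \<le> 4 * B\<^sup>2"
proof -
  have [measurable_cong]: "sets M = sets (flat I)" by (simp add: M_def)
  interpret prob_space M unfolding M_def by (rule prob_space_gibbs_density[OF n])
  define s where "s = 1 / B"
  have s: "s > 0" "s * B = 1" using B by (auto simp: s_def)
  define a where "a = expectation f"
  define g where "g x = s * (f x - a)" for x
  have gm[measurable]: "g \<in> borel_measurable (flat I)" unfolding g_def by measurable
  have gb: "\<bar>g x\<bar> \<le> s * (K + \<bar>a\<bar>)" for x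
    using bd[of x] s by (auto simp: g_def abs_mult intro!: mult_left_mono)
  have int_f: "integrable M f"
    by (rule integrable_const_bound[of _ K]) (use bd in auto)
  have int_f2: "integrable M (\<lambda>x. (f x)\<^sup>2)"
    by (rule integrable_const_bound[of _ "K\<^sup>2"]) (use bd in \<open>auto simp: abs_le_square_iff[symmetric] intro!: AE_I2 order_trans[OF _ abs_ge_self]\<close>)
  have g0: "expectation g = 0"
    unfolding g_def using int_f by (simp add: prob_space a_def[symmetric])
  have ge1: "1 \<le> (\<integral>\<^sup>+x. exp (c * g x) \<partial>M)" for c
  proof -
    have "ennreal (exp (expectation (\<lambda>x. c * g x))) \<le> (\<integral>\<^sup>+x. exp (c * g x) \<partial>M)"
    proof (rule exp_expectation_le)
      show "\<bar>c * g x\<bar> \<le> \<bar>c\<bar> * (s * (K + \<bar>a\<bar>))" for x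
        using gb[of x] by (simp add: abs_mult mult_left_mono)
    qed measurable
    then show ?thesis by (simp add: g0)
  qed
  let ?X = "\<integral>\<^sup>+x. exp (g x) \<partial>M" and ?Y = "\<integral>\<^sup>+x. exp (- g x) \<partial>M"
  have prod: "?X * ?Y \<le> exp 1"
  proof -
    have "(\<integral>\<^sup>+x. exp (1 * g x) \<partial>M) * (\<integral>\<^sup>+x. exp (- 1 * g x) \<partial>M) \<le> exp ((1 * 1 + 0)\<^sup>2)"
      unfolding M_def
    proof (rule gibbs_exponential_comparison[OF I n n gm, where q = q])
      fix x y :: "'i \<Rightarrow> real" assume xy: "x \<in> extensional I" "y \<in> extensional I"
      have "s * (f x - f y) \<le> s * (B * q x y)"
        using lip[OF xy] s by (intro mult_left_mono) auto
      then show "g x - g y \<le> 1 * q x y"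
        using s by (simp add: g_def right_diff_distrib flip: mult.assoc)
      show "H (\<lambda>i\<in>I. (x i + y i) / 2) + H (\<lambda>i\<in>I. (x i + y i) / 2) \<le> H x + H y + 0 * q x y - (q x y)\<^sup>2 / 4"
        using conv[OF xy] by simp
    qed simp
    then show ?thesis by simp
  qed
  have "1 \<le> ?X" "1 \<le> ?Y" using ge1[of 1] ge1[of "-1"] by auto
  then have "?X * 1 \<le> ?X * ?Y" "1 * ?Y \<le> ?X * ?Y"
    by - (rule mult_left_mono mult_right_mono, assumption, simp)+
  then have XY: "?X \<le> exp 1" "?Y \<le> exp 1"
    using prod by (auto intro: order_trans)
  have "(\<integral>\<^sup>+x. ennreal (2 + (g x)\<^sup>2) \<partial>M) \<le> (\<integral>\<^sup>+x. ennreal (exp (g x)) + ennreal (exp (- g x)) \<partial>M)"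
    using exp_add_exp_minus_ge by (intro nn_integral_mono) (simp add: ennreal_le_iff flip: ennreal_plus)
  also have "\<dots> = ?X + ?Y" by (intro nn_integral_add) auto
  also have "\<dots> \<le> ennreal (exp 1) + ennreal (exp 1)" by (intro add_mono XY)
  also have "\<dots> = ennreal (2 * exp 1)" by (simp flip: ennreal_plus)
  finally have *: "(\<integral>\<^sup>+x. ennreal (2 + (g x)\<^sup>2) \<partial>M) \<le> ennreal (2 * exp 1)" .
  have g2: "2 + (g x)\<^sup>2 = (2 + s\<^sup>2 * a\<^sup>2) + s\<^sup>2 * (f x)\<^sup>2 - (2 * s\<^sup>2 * a) * f x" for x
    by (simp add: g_def power2_eq_square algebra_simps)
  have int_g2: "integrable M (\<lambda>x. 2 + (g x)\<^sup>2)"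
    unfolding g2 using int_f int_f2 by (intro Bochner_Integration.integrable_add Bochner_Integration.integrable_diff integrable_mult_right) auto
  have "expectation (\<lambda>x. 2 + (g x)\<^sup>2) \<le> 2 * exp 1"
    using * int_g2 by (subst (asm) nn_integral_eq_integral) (auto simp: ennreal_le_iff)
  moreover have "expectation (\<lambda>x. 2 + (g x)\<^sup>2) = 2 + s\<^sup>2 * a\<^sup>2 + s\<^sup>2 * expectation (\<lambda>x. (f x)\<^sup>2) - (2 * s\<^sup>2 * a) * a"
    unfolding g2 using int_f int_f2 by (simp add: prob_space a_def[symmetric])
  then have "expectation (\<lambda>x. 2 + (g x)\<^sup>2) = 2 + s\<^sup>2 * (expectation (\<lambda>x. (f x)\<^sup>2) - a\<^sup>2)"
    by (simp add: power2_eq_square right_diff_distrib)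
  ultimately have "s\<^sup>2 * (expectation (\<lambda>x. (f x)\<^sup>2) - a\<^sup>2) \<le> 2 * (exp 1 - 1)" by simp
  also have "\<dots> \<le> 4" using exp_le by simp
  finally have "expectation (\<lambda>x. (f x)\<^sup>2) - a\<^sup>2 \<le> 4 * B\<^sup>2"
    using B by (simp add: s_def power_divide field_simps)
  then show ?thesis by (simp add: a_def)
qed

section \<open>Compactness of laws on configurations\<close>

definition binary_digit :: "nat \<Rightarrow> real \<Rightarrow> real" where
  "binary_digit j y = real_of_int (\<lfloor>2 ^ Suc j * y\<rfloor> mod 2)"

lemma binary_digit_01: "binary_digit j y \<in> {0, 1}"
  by (auto simp: binary_digit_def)

lemma binary_digit_measurable[measurable]: "binary_digit j \<in> borel_measurable borel"
  unfolding binary_digit_def by measurable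

lemma binary_digit_sums:
  assumes "0 \<le> y" "y < 1"
  shows "(\<lambda>j. binary_digit j y / 2 ^ Suc j) sums y"
proof -
  have partial: "(\<Sum>j<n. binary_digit j y / 2 ^ Suc j) = real_of_int \<lfloor>2 ^ n * y\<rfloor> / 2 ^ n" for n
  proof (induction n)
    case 0
    have "\<lfloor>y\<rfloor> = 0" using assms by (simp add: floor_eq_iff)
    then show ?case by simp
  next
    case (Suc n)
    define t where "t = 2 ^ n * y"
    have half: "\<lfloor>2 * t\<rfloor> div 2 = \<lfloor>t\<rfloor>"
    proof -
      have "real_of_int \<lfloor>t\<rfloor> \<le> t" "t < real_of_int \<lfloor>t\<rfloor> + 1" by linarith+
      then have "2 * \<lfloor>t\<rfloor> \<le> \<lfloor>2 * t\<rfloor>" "\<lfloor>2 * t\<rfloor> < 2 * \<lfloor>t\<rfloor> + 2"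
        by linarith+
      then show ?thesis by presburger
    qed
    have "\<lfloor>2 * t\<rfloor> = 2 * \<lfloor>t\<rfloor> + \<lfloor>2 * t\<rfloor> mod 2"
      using half by presburger
    then have e: "real_of_int \<lfloor>2 * t\<rfloor> = 2 * real_of_int \<lfloor>t\<rfloor> + real_of_int (\<lfloor>2 * t\<rfloor> mod 2)"
      by (metis of_int_add of_int_mult of_int_numeral)
    have "(\<Sum>j<Suc n. binary_digit j y / 2 ^ Suc j) = real_of_int \<lfloor>t\<rfloor> / 2 ^ n + real_of_int (\<lfloor>2 * t\<rfloor> mod 2) / 2 ^ Suc n"
      using Suc by (simp add: binary_digit_def t_def mult.assoc)
    also have "\<dots> = real_of_int \<lfloor>2 * t\<rfloor> / 2 ^ Suc n"
      unfolding e by (simp add: field_simps)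
    finally show ?case by (simp add: t_def mult.assoc)
  qed
  have "(\<lambda>n. real_of_int \<lfloor>2 ^ n * y\<rfloor> / 2 ^ n) \<longlonglongrightarrow> y"
  proof (rule tendsto_sandwich)
    show "\<forall>\<^sub>F n in sequentially. y - (1/2) ^ n \<le> real_of_int \<lfloor>2 ^ n * y\<rfloor> / 2 ^ n"
    proof (intro always_eventually allI)
      fix n
      have "2 ^ n * y - 1 \<le> real_of_int \<lfloor>2 ^ n * y\<rfloor>" by linarith
      then have "(2 ^ n * y - 1) / 2 ^ n \<le> real_of_int \<lfloor>2 ^ n * y\<rfloor> / 2 ^ n"
        by (intro divide_right_mono) auto
      then show "y - (1/2) ^ n \<le> real_of_int \<lfloor>2 ^ n * y\<rfloor> / 2 ^ n"
        by (simp add: diff_divide_distrib power_divide)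
    qed
    show "\<forall>\<^sub>F n in sequentially. real_of_int \<lfloor>2 ^ n * y\<rfloor> / 2 ^ n \<le> y"
      by (intro always_eventually allI) (simp add: divide_le_eq mult.commute)
    have "(\<lambda>n. y - (1/2) ^ n) \<longlonglongrightarrow> y - 0"
      by (intro tendsto_intros LIMSEQ_power_zero) auto
    then show "(\<lambda>n. y - (1/2) ^ n) \<longlonglongrightarrow> y" by simp
  qed auto
  then show ?thesis unfolding sums_def partial .
qed

text \<open>
  Configurations are coded into the Cantor set because its ternary digits, unlike binary digits, are
  continuous functions: on the Cantor set \<open>cantor_head\<close> is half the first digit and
  \<open>cantor_tail\<close> deletes it. Compactness of laws on the line then carries over to configurations.
\<close>

definition cantor :: "(nat \<Rightarrow> real) \<Rightarrow> real" where
  "cantor b = (\<Sum>m. 2 * b m / 3 ^ Suc m)"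

definition cantor_head :: "real \<Rightarrow> real" where "cantor_head x = max 0 (min 1 (3 * x - 1))"

definition cantor_tail :: "real \<Rightarrow> real" where "cantor_tail x = 3 * x - 2 * cantor_head x"

lemma cantor_summable:
  assumes "\<And>m. b m \<in> {0, 1::real}"
  shows "summable (\<lambda>m. 2 * b m / 3 ^ Suc m)"
proof (rule summable_comparison_test')
  show "summable (\<lambda>m. (1/3::real) ^ m)" by (simp add: summable_geometric)
  show "norm (2 * b m / 3 ^ Suc m) \<le> (1/3) ^ m" for m
    using assms[of m] by (auto simp: power_divide field_simps)
qed

lemma cantor_unfold:
  assumes "\<And>m. b m \<in> {0, 1::real}"
  shows "cantor b = (2 * b 0 + cantor (\<lambda>m. b (Suc m))) / 3"
proof -
  have s: "summable (\<lambda>m. 2 * b (Suc m) / 3 ^ Suc m)"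
    using assms by (intro cantor_summable)
  have "cantor b = 2 * b 0 / 3 + (\<Sum>m. 2 * b (Suc m) / 3 ^ Suc (Suc m))"
    unfolding cantor_def using suminf_split_head[OF cantor_summable, of b] assms by simp
  also have "(\<Sum>m. 2 * b (Suc m) / 3 ^ Suc (Suc m)) = (\<Sum>m. (2 * b (Suc m) / 3 ^ Suc m) / 3)"
    by (simp add: field_simps)
  also have "\<dots> = cantor (\<lambda>m. b (Suc m)) / 3"
    unfolding cantor_def using suminf_divide[OF s, of 3] by simp
  finally show ?thesis by (simp add: field_simps)
qed

lemma cantor_bounds:
  assumes "\<And>m. b m \<in> {0, 1::real}"
  shows "0 \<le> cantor b" "cantor b \<le> 1"
proof -
  have b: "0 \<le> b m" "b m \<le> 1" for m using assms[of m] by auto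
  show "0 \<le> cantor b"
    unfolding cantor_def using b by (intro suminf_nonneg cantor_summable assms) auto
  have "(\<lambda>m. (1/3::real) ^ m) sums (1 / (1 - 1/3))" by (intro geometric_sums) auto
  then have "(\<lambda>m. 2 / 3 * (1/3::real) ^ m) sums (2 / 3 * (1 / (1 - 1/3)))" by (rule sums_mult)
  then have s: "(\<lambda>m. 2 / 3 * (1/3::real) ^ m) sums 1" by simp
  have "cantor b \<le> (\<Sum>m. 2 / 3 * (1/3::real) ^ m)"
    unfolding cantor_def
  proof (rule suminf_le)
    show "2 * b m / 3 ^ Suc m \<le> 2 / 3 * (1 / 3) ^ m" for m
      using b[of m] by (simp add: power_divide field_simps)
  qed (rule cantor_summable[OF assms] sums_summable[OF s])+
  then show "cantor b \<le> 1" using s by (simp add: sums_iff)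
qed

lemma cantor_head_tail:
  assumes "\<And>m. b m \<in> {0, 1::real}"
  shows "cantor_head (cantor b) = b 0" "cantor_tail (cantor b) = cantor (\<lambda>m. b (Suc m))"
proof -
  have "0 \<le> cantor (\<lambda>m. b (Suc m))" "cantor (\<lambda>m. b (Suc m)) \<le> 1"
    using assms by (auto intro: cantor_bounds)
  then show 1: "cantor_head (cantor b) = b 0"
    using assms[of 0] cantor_unfold[of b, OF assms] by (auto simp: cantor_head_def)
  show "cantor_tail (cantor b) = cantor (\<lambda>m. b (Suc m))"
    using cantor_unfold[of b, OF assms] by (simp add: cantor_tail_def 1)
qed

lemma cantor_digit:
  assumes "\<And>m. b m \<in> {0, 1::real}"
  shows "cantor_head ((cantor_tail ^^ m) (cantor b)) = b m"
proof -
  have "(cantor_tail ^^ m) (cantor b) = cantor (\<lambda>k. b (k + m))"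
  proof (induction m)
    case (Suc m)
    then show ?case using cantor_head_tail(2)[of "\<lambda>k. b (k + m)"] assms by simp
  qed simp
  then show ?thesis using cantor_head_tail(1)[of "\<lambda>k. b (k + m)"] assms by simp
qed

lemma continuous_on_cantor_digit: "continuous_on UNIV (\<lambda>x. cantor_head ((cantor_tail ^^ m) x))"
proof -
  have h: "continuous_on UNIV cantor_head"
    unfolding cantor_head_def by (intro continuous_intros)
  have t: "continuous_on UNIV cantor_tail"
    unfolding cantor_tail_def by (intro continuous_intros h)
  have "continuous_on UNIV (cantor_tail ^^ m)"
  proof (induction m)
    case 0 then show ?case by (simp add: continuous_on_id id_def)
  next
    case (Suc m)
    then show ?case using continuous_on_compose[OF Suc continuous_on_subset[OF t]] by (simp add: comp_def)
  qed
  from continuous_on_compose[OF this continuous_on_subset[OF h]]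
  show ?thesis by (simp add: comp_def)
qed

text \<open>The pairing \<open>prod_encode\<close> interleaves the binary digits of countably many
  coordinates in one ternary sequence. The map is defined and continuous on the whole line, so a
  limit of codes can be decoded even when it is not itself a code, as happens for binary expansions
  ending in ones.\<close>

definition cantor_coord :: "nat \<Rightarrow> real \<Rightarrow> real" where
  "cantor_coord i x = (\<Sum>j. cantor_head ((cantor_tail ^^ prod_encode (i, j)) x) / 2 ^ Suc j)"

lemma continuous_on_cantor_coord: "continuous_on UNIV (cantor_coord i)"
proof -
  have "uniform_limit UNIV (\<lambda>n x. \<Sum>j<n. cantor_head ((cantor_tail ^^ prod_encode (i, j)) x) / 2 ^ Suc j)
      (\<lambda>x. \<Sum>j. cantor_head ((cantor_tail ^^ prod_encode (i, j)) x) / 2 ^ Suc j) sequentially"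
  proof (rule Weierstrass_m_test)
    show "summable (\<lambda>j. (1/2::real) ^ j)" by (simp add: summable_geometric)
    show "norm (cantor_head ((cantor_tail ^^ prod_encode (i, j)) x) / 2 ^ Suc j) \<le> (1/2) ^ j" for j x
      by (auto simp: cantor_head_def power_divide divide_simps)
  qed
  then show ?thesis
    unfolding cantor_coord_def[abs_def]
    by (rule uniform_limit_theorem[rotated]) (auto intro!: always_eventually continuous_intros continuous_on_cantor_digit)
qed

lemma cantor_coord_measurable[measurable]: "cantor_coord i \<in> borel_measurable borel"
  by (intro borel_measurable_continuous_onI continuous_on_cantor_coord)

text \<open>
  Real values are first squashed into the open unit interval by \<open>t \<mapsto> (1 + t / (1 + \<bar>t\<bar>)) / 2\<close>.
  The decoding map has junk value \<open>0\<close> (division by zero) at the end points, which correspond to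
  infinite field values; tightness rules them out in the limit.
\<close>

definition field_code :: "('a::countable \<Rightarrow> real) \<Rightarrow> real" where
  "field_code \<phi> = cantor (\<lambda>m. binary_digit (snd (prod_decode m))
     ((1 + \<phi> (from_nat (fst (prod_decode m))) / (1 + \<bar>\<phi> (from_nat (fst (prod_decode m)))\<bar>)) / 2))"

definition field_decode :: "real \<Rightarrow> ('a::countable \<Rightarrow> real)" where
  "field_decode t = (\<lambda>x. (2 * cantor_coord (to_nat x) t - 1) / (1 - \<bar>2 * cantor_coord (to_nat x) t - 1\<bar>))"

lemma squash_bounds: "\<bar>t / (1 + \<bar>t\<bar>)\<bar> < (1::real)"
  by (simp add: abs_divide)

lemma cantor_coord_field_code:
  "cantor_coord (to_nat x) (field_code \<phi>) = (1 + \<phi> x / (1 + \<bar>\<phi> x\<bar>)) / 2"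
proof -
  let ?y = "(1 + \<phi> x / (1 + \<bar>\<phi> x\<bar>)) / 2"
  have "cantor_coord (to_nat x) (field_code \<phi>) = (\<Sum>j. binary_digit j ?y / 2 ^ Suc j)"
    unfolding cantor_coord_def field_code_def
    by (subst cantor_digit) (use binary_digit_01 in auto)
  also have "\<dots> = ?y"
  proof (intro sums_unique[symmetric] binary_digit_sums)
    have "\<bar>t\<bar> < 1 \<Longrightarrow> 0 \<le> (1 + t) / 2 \<and> (1 + t) / 2 < 1" for t :: real by auto
    from this[OF squash_bounds] show "0 \<le> ?y" "?y < 1" by blast+
  qed
  finally show ?thesis .
qed

lemma cantor_coord_field_code':
  "2 * cantor_coord (to_nat x) (field_code \<phi>) - 1 = \<phi> x / (1 + \<bar>\<phi> x\<bar>)"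
proof -
  have "2 * ((1 + t) / 2) - 1 = t" for t :: real by (simp add: field_simps)
  then show ?thesis unfolding cantor_coord_field_code .
qed

lemma field_decode_code: "field_decode (field_code \<phi>) = \<phi>"
proof
  fix x
  have "1 - \<bar>\<phi> x / (1 + \<bar>\<phi> x\<bar>)\<bar> = 1 / (1 + \<bar>\<phi> x\<bar>)"
    by (simp add: abs_divide field_simps)
  moreover have "1 + \<bar>\<phi> x\<bar> \<noteq> 0" by linarith
  ultimately show "field_decode (field_code \<phi>) x = \<phi> x"
    unfolding field_decode_def cantor_coord_field_code' by simp
qed

lemma field_code_measurable[measurable]: "field_code \<in> borel_measurable (PiM UNIV (\<lambda>_. borel))"
  unfolding field_code_def cantor_def by measurable

lemma field_decode_measurable[measurable]: "field_decode \<in> measurable borel (PiM UNIV (\<lambda>_. borel))"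
  unfolding field_decode_def by (intro measurable_PiM_single') auto

lemma field_code_bounds: "0 \<le> field_code \<phi>" "field_code \<phi> \<le> 1"
  unfolding field_code_def using binary_digit_01 by (auto intro!: cantor_bounds)

section \<open>Sequential compactness of laws on configurations\<close>

lemma tendsto_coordinatewise:
  fixes f :: "'b \<Rightarrow> 'a \<Rightarrow> 'c::topological_space"
  assumes "\<And>x. ((\<lambda>i. f i x) \<longlongrightarrow> l x) F"
  shows "(f \<longlongrightarrow> l) F"
proof -
  have "limitin (product_topology (\<lambda>_. euclidean) UNIV) f l F"
    using assms by (auto simp: limitin_componentwise)
  then show ?thesis by (simp add: euclidean_product_topology)
qed

text \<open>Codes lie in [0, 1], so their laws are tight on the line, and Skorohod's theorem
  provides copies that converge pointwise. Decoding is continuous wherever every squashed coordinate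
  stays inside the open interval; tightness at each single site excludes the end points almost
  surely, and countably many sites share one null set.\<close>

lemma prohorov_fields:
  fixes M :: "nat \<Rightarrow> ('a::countable \<Rightarrow> real) measure"
  assumes M: "\<And>n. M n \<in> space (prob_algebra (PiM UNIV (\<lambda>_. borel)))"
    and tight: "\<And>x e. 0 < e \<Longrightarrow> \<exists>R\<ge>0. \<forall>\<^sub>F n in sequentially. measure (M n) {\<phi>. R < \<bar>\<phi> x\<bar>} \<le> e"
  obtains r L where "strict_mono (r :: nat \<Rightarrow> nat)" "L \<in> space (prob_algebra (PiM UNIV (\<lambda>_. borel)))"
    "\<And>f :: ('a \<Rightarrow> real) \<Rightarrow> real. continuous_on UNIV f \<Longrightarrow> bounded (range f) \<Longrightarrow>
      (\<lambda>n. \<integral>\<phi>. f \<phi> \<partial>M (r n)) \<longlonglongrightarrow> (\<integral>\<phi>. f \<phi> \<partial>L)"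
proof -
  let ?S = "PiM UNIV (\<lambda>_. borel) :: ('a \<Rightarrow> real) measure"
  have pM: "prob_space (M n)" and sM[measurable_cong]: "sets (M n) = sets ?S" for n
    using M[of n] by (auto simp: space_prob_algebra)
  define N where "N n = distr (M n) borel field_code" for n
  have rN: "real_distribution (N n)" for n
    unfolding N_def by (intro prob_space.real_distribution_distr pM) measurable
  have "tight N"
    unfolding tight_def
  proof (intro conjI allI impI rN)
    fix e :: real assume e: "0 < e"
    have "measure (N n) {-1<..1} = 1" for n
    proof -
      interpret prob_space "M n" by (rule pM)
      have "measure (N n) {-1<..1} = measure (M n) (space (M n))"
        unfolding N_def using field_code_bounds less_le_trans[OF _ field_code_bounds(1), of "-1"]
        by (subst measure_distr) (auto intro!: arg_cong[where f = "measure (M n)"])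
      then show ?thesis by (simp add: prob_space)
    qed
    then show "\<exists>a b. a < b \<and> (\<forall>n. 1 - e < measure (N n) {a<..b})"
      using e by (intro exI[of _ "-1"] exI[of _ 1]) auto
  qed
  then obtain r Q where r: "strict_mono r" and Q: "real_distribution Q" "weak_conv_m (N \<circ> id \<circ> r) Q"
    using tight_imp_convergent_subsubsequence[of N id] by (auto simp: strict_mono_def)
  have "\<exists>(\<Omega> :: real measure) (Yn :: nat \<Rightarrow> real \<Rightarrow> real) (Y :: real \<Rightarrow> real).
    prob_space \<Omega> \<and> (\<forall>n. Yn n \<in> measurable \<Omega> borel) \<and> (\<forall>n. distr \<Omega> borel (Yn n) = (N \<circ> id \<circ> r) n) \<and>
    Y \<in> measurable \<Omega> lborel \<and> distr \<Omega> borel Y = Q \<and> (\<forall>x \<in> space \<Omega>. (\<lambda>n. Yn n x) \<longlonglongrightarrow> Y x)"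
    by (rule Skorohod) (use rN Q in \<open>auto simp: comp_def\<close>)
  then obtain \<Omega> :: "real measure" and Yn :: "nat \<Rightarrow> real \<Rightarrow> real" and Y :: "real \<Rightarrow> real"
    where S: "prob_space \<Omega> \<and> (\<forall>n. Yn n \<in> measurable \<Omega> borel) \<and> (\<forall>n. distr \<Omega> borel (Yn n) = (N \<circ> id \<circ> r) n) \<and>
      Y \<in> measurable \<Omega> lborel \<and> distr \<Omega> borel Y = Q \<and> (\<forall>x \<in> space \<Omega>. (\<lambda>n. Yn n x) \<longlonglongrightarrow> Y x)"
    by blast
  then have \<Omega>: "prob_space \<Omega>"
    and Yn[measurable]: "\<And>n. Yn n \<in> borel_measurable \<Omega>" and dYn: "\<And>n. distr \<Omega> borel (Yn n) = N (r n)"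
    and Y[measurable]: "Y \<in> borel_measurable \<Omega>"
    and lim: "\<And>w. w \<in> space \<Omega> \<Longrightarrow> (\<lambda>n. Yn n w) \<longlonglongrightarrow> Y w"
    by auto
  interpret \<Omega>: prob_space \<Omega> by (rule \<Omega>)
  define Z where "Z n w = (field_decode (Yn n w) :: 'a \<Rightarrow> real)" for n w
  define Zl where "Zl w = (field_decode (Y w) :: 'a \<Rightarrow> real)" for w
  have Zm[measurable]: "Z n \<in> measurable \<Omega> ?S" for n unfolding Z_def by measurable
  have Zlm[measurable]: "Zl \<in> measurable \<Omega> ?S" unfolding Zl_def by measurable
  have dZ: "distr \<Omega> ?S (Z n) = M (r n)" for n
  proof -
    have "distr \<Omega> ?S (Z n) = distr (distr \<Omega> borel (Yn n)) ?S field_decode"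
      unfolding Z_def by (subst distr_distr) (auto simp: comp_def)
    also have "\<dots> = distr (M (r n)) ?S (\<lambda>\<phi>. field_decode (field_code \<phi>))"
      unfolding dYn N_def by (subst distr_distr) (auto simp: comp_def)
    also have "\<dots> = M (r n)"
      unfolding field_decode_code by (rule distr_id2) (simp add: sM)
    finally show ?thesis .
  qed
  define c where "c x t = 2 * cantor_coord (to_nat x) t - 1" for x :: 'a and t
  have cm[measurable]: "c x \<in> borel_measurable borel" for x unfolding c_def by measurable
  have clim: "(\<lambda>n. c x (Yn n w)) \<longlonglongrightarrow> c x (Y w)" if "w \<in> space \<Omega>" for x w
    unfolding c_def
    by (intro tendsto_intros continuous_on_tendsto_compose[OF continuous_on_cantor_coord lim[OF that]]) auto
  have AEn: "AE w in \<Omega>. c x (Yn n w) = Z n w x / (1 + \<bar>Z n w x\<bar>)" for x n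
  proof -
    have "AE \<phi> in M (r n). c x (field_code \<phi>) = field_decode (field_code \<phi>) x / (1 + \<bar>field_decode (field_code \<phi>) x\<bar>)"
      unfolding c_def cantor_coord_field_code' field_decode_code by simp
    then have "AE t in N (r n). c x t = field_decode t x / (1 + \<bar>field_decode t x\<bar>)"
      unfolding N_def by (subst AE_distr_iff) auto
    then have "AE t in distr \<Omega> borel (Yn n). c x t = field_decode t x / (1 + \<bar>field_decode t x\<bar>)"
      unfolding dYn .
    then show ?thesis by (subst (asm) AE_distr_iff) (auto simp: Z_def)
  qed
  have AEl: "AE w in \<Omega>. \<bar>c x (Y w)\<bar> < 1" for x
  proof -
    define E where "E = {w \<in> space \<Omega>. 1 \<le> \<bar>c x (Y w)\<bar>}"
    have E[measurable]: "E \<in> sets \<Omega>" unfolding E_def by measurable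
    have "\<Omega>.prob E \<le> 0 + e" if e: "0 < e" for e
    proof -
      obtain R where R: "0 \<le> R" "\<forall>\<^sub>F n in sequentially. measure (M n) {\<phi>. R < \<bar>\<phi> x\<bar>} \<le> e"
        using tight[OF e] by blast
      then obtain n0 where n0: "\<And>n. n0 \<le> n \<Longrightarrow> measure (M n) {\<phi>. R < \<bar>\<phi> x\<bar>} \<le> e"
        by (auto simp: eventually_sequentially)
      \<comment> \<open>d is the image of the radius \<open>R\<close> under the squashing map. A
        limit at an end point exceeds d in modulus, so the approximating field values exceed
        \<open>R\<close> from some index on, an event of probability at most e.\<close>
      define d where "d = R / (1 + R)"
      have d: "d < 1" using R by (simp add: d_def)
      define A where "A n = {w \<in> space \<Omega>. d < \<bar>c x (Yn n w)\<bar>}" for n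
      have A[measurable]: "A n \<in> sets \<Omega>" for n unfolding A_def by measurable
      have "{\<phi> \<in> space ?S. R < \<bar>\<phi> x\<bar>} \<in> sets ?S" by measurable
      then have [measurable]: "{\<phi>. R < \<bar>\<phi> x\<bar>} \<in> sets ?S" by (simp add: space_PiM)
      have mA: "\<Omega>.prob (A n) \<le> e" if "n0 \<le> n" for n
      proof -
        have "\<Omega>.prob (A n) \<le> \<Omega>.prob {w \<in> space \<Omega>. R < \<bar>Z n w x\<bar>}"
        proof (rule \<Omega>.finite_measure_mono_AE)
          show "AE w in \<Omega>. w \<in> A n \<longrightarrow> w \<in> {w \<in> space \<Omega>. R < \<bar>Z n w x\<bar>}"
            using AEn[of x n]
          proof eventually_elim
            case (elim w)
            show ?case
            proof
              assume w: "w \<in> A n"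
              then have "R / (1 + R) < \<bar>Z n w x\<bar> / (1 + \<bar>Z n w x\<bar>)"
                using elim by (simp add: A_def d_def abs_divide)
              then have "R < \<bar>Z n w x\<bar>" using R by (simp add: field_simps)
              then show "w \<in> {w \<in> space \<Omega>. R < \<bar>Z n w x\<bar>}" using w by (simp add: A_def)
            qed
          qed
        qed measurable
        also have "\<dots> = measure (distr \<Omega> ?S (Z n)) {\<phi>. R < \<bar>\<phi> x\<bar>}"
          by (subst measure_distr) (auto intro!: arg_cong[where f = "measure \<Omega>"])
        also have "\<dots> \<le> e"
          unfolding dZ using n0[of "r n"] that seq_suble[OF r, of n] by auto
        finally show ?thesis .
      qed
      define B where "B k = (\<Inter>n\<in>{k..}. A n)" for k
      have B[measurable]: "B k \<in> sets \<Omega>" for k unfolding B_def by (intro sets.countable_INT) auto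
      have "incseq B" by (auto simp: incseq_def B_def)
      then have "(\<lambda>k. \<Omega>.prob (B k)) \<longlonglongrightarrow> \<Omega>.prob (\<Union>k. B k)"
        by (intro \<Omega>.finite_Lim_measure_incseq) auto
      moreover have "\<Omega>.prob (B k) \<le> e" for k
      proof -
        have "\<Omega>.prob (B k) \<le> \<Omega>.prob (A (max k n0))"
          by (intro \<Omega>.finite_measure_mono) (auto simp: B_def)
        also have "\<dots> \<le> e" by (intro mA) auto
        finally show ?thesis .
      qed
      ultimately have "\<Omega>.prob (\<Union>k. B k) \<le> e"
        by (intro LIMSEQ_le_const2) auto
      moreover have "E \<subseteq> (\<Union>k. B k)"
      proof
        fix w assume w: "w \<in> E"
        then have "(\<lambda>n. \<bar>c x (Yn n w)\<bar>) \<longlonglongrightarrow> \<bar>c x (Y w)\<bar>" "d < \<bar>c x (Y w)\<bar>"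
          using d by (auto simp: E_def intro!: tendsto_rabs clim)
        then have "\<forall>\<^sub>F n in sequentially. d < \<bar>c x (Yn n w)\<bar>" by (rule order_tendstoD)
        then show "w \<in> (\<Union>k. B k)"
          using w by (auto simp: eventually_sequentially B_def A_def E_def)
      qed
      ultimately show ?thesis
        using \<Omega>.finite_measure_mono[of E "\<Union>k. B k"] by auto
    qed
    then have "\<Omega>.prob E \<le> 0" by (rule field_le_epsilon)
    then have "\<Omega>.prob E = 0" using measure_nonneg[of \<Omega> E] by linarith
    then show ?thesis
      by (intro AE_I[of _ _ E]) (auto simp: E_def \<Omega>.emeasure_eq_measure)
  qed
  have AElim: "AE w in \<Omega>. (\<lambda>n. Z n w) \<longlonglongrightarrow> Zl w"
  proof -
    have "AE w in \<Omega>. w \<in> space \<Omega> \<and> (\<forall>x. \<bar>c x (Y w)\<bar> < 1)"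
      using AEl by (simp add: AE_all_countable)
    then show ?thesis
    proof (eventually_elim)
      case (elim w)
      have e: "field_decode t x = c x t / (1 - \<bar>c x t\<bar>)" for t and x :: 'a
        by (simp add: field_decode_def c_def)
      show ?case
        unfolding Z_def Zl_def
      proof (rule tendsto_coordinatewise)
        fix x
        have *: "(\<lambda>n. c x (Yn n w)) \<longlonglongrightarrow> c x (Y w)" using elim by (intro clim) auto
        have "1 - \<bar>c x (Y w)\<bar> \<noteq> 0" using elim by (metis diff_self eq_iff_diff_eq_0 less_irrefl)
        then show "(\<lambda>n. field_decode (Yn n w) x) \<longlonglongrightarrow> field_decode (Y w) x"
          unfolding e by (rule tendsto_divide[OF * tendsto_diff[OF tendsto_const tendsto_rabs[OF *]]])
      qed
    qed
  qed
  define L where "L = distr \<Omega> ?S Zl"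
  show ?thesis
  proof
    show "strict_mono r" by (rule r)
    show "L \<in> space (prob_algebra ?S)"
      unfolding L_def by (auto simp: space_prob_algebra intro!: \<Omega>.prob_space_distr)
    fix f :: "('a \<Rightarrow> real) \<Rightarrow> real" assume f: "continuous_on UNIV f" and b: "bounded (range f)"
    have fm[measurable]: "f \<in> borel_measurable ?S"
      unfolding measurable_cong_sets[OF sets_PiM_equal_borel refl] by (rule borel_measurable_continuous_onI[OF f])
    obtain K where K: "\<And>\<phi>. \<bar>f \<phi>\<bar> \<le> K" using b by (auto simp: bounded_iff)
    have "(\<lambda>n. \<integral>w. f (Z n w) \<partial>\<Omega>) \<longlonglongrightarrow> (\<integral>w. f (Zl w) \<partial>\<Omega>)"
    proof (rule integral_dominated_convergence[where w = "\<lambda>_. K"])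
      show "AE w in \<Omega>. (\<lambda>n. f (Z n w)) \<longlonglongrightarrow> f (Zl w)"
        using AElim by eventually_elim (auto intro: continuous_on_tendsto_compose[OF f])
    qed (use K in auto)
    moreover have "(\<integral>w. f (Z n w) \<partial>\<Omega>) = (\<integral>\<phi>. f \<phi> \<partial>M (r n))" for n
      unfolding dZ[symmetric] by (subst integral_distr) auto
    moreover have "(\<integral>w. f (Zl w) \<partial>\<Omega>) = (\<integral>\<phi>. f \<phi> \<partial>L)"
      unfolding L_def by (subst integral_distr) auto
    ultimately show "(\<lambda>n. \<integral>\<phi>. f \<phi> \<partial>M (r n)) \<longlonglongrightarrow> (\<integral>\<phi>. f \<phi> \<partial>L)" by simp
  qed
qed

section \<open>Lipschitz cylinder functions\<close>

definition lipschitz_in :: "real \<Rightarrow> 'a set \<Rightarrow> (('a \<Rightarrow> real) \<Rightarrow> real) \<Rightarrow> bool" where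
  "lipschitz_in K X F \<longleftrightarrow> finite X \<and> 0 \<le> K \<and> (\<forall>\<phi> \<psi>. \<bar>F \<phi> - F \<psi>\<bar> \<le> K * (\<Sum>x\<in>X. \<bar>\<phi> x - \<psi> x\<bar>))"

text \<open>These are the test functions of the whole proof: they determine a law, are closed under
  products and shifts, and are mapped to themselves by the Gibbs kernels, which is not clear for
  smaller classes.\<close>

definition lip_cyl :: "(('a \<Rightarrow> real) \<Rightarrow> real) \<Rightarrow> bool" where
  "lip_cyl F \<longleftrightarrow> (\<exists>C. \<forall>\<phi>. \<bar>F \<phi>\<bar> \<le> C) \<and> (\<exists>K X. lipschitz_in K X F)"

lemma lipschitz_in_cong:
  assumes "lipschitz_in K X F" "\<And>x. x \<in> X \<Longrightarrow> \<phi> x = \<psi> x"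
  shows "F \<phi> = F \<psi>"
proof -
  have "\<bar>F \<phi> - F \<psi>\<bar> \<le> K * (\<Sum>x\<in>X. \<bar>\<phi> x - \<psi> x\<bar>)"
    using assms(1) by (simp add: lipschitz_in_def)
  also have "(\<Sum>x\<in>X. \<bar>\<phi> x - \<psi> x\<bar>) = 0" using assms(2) by simp
  finally show ?thesis by simp
qed

lemma lipschitz_in_mono:
  assumes "lipschitz_in K X F" "K \<le> K'" "X \<subseteq> X'" "finite X'"
  shows "lipschitz_in K' X' F"
  unfolding lipschitz_in_def
proof (intro conjI allI)
  fix \<phi> \<psi> :: "'a \<Rightarrow> real"
  have "\<bar>F \<phi> - F \<psi>\<bar> \<le> K * (\<Sum>x\<in>X. \<bar>\<phi> x - \<psi> x\<bar>)" using assms by (auto simp: lipschitz_in_def)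
  also have "\<dots> \<le> K' * (\<Sum>x\<in>X'. \<bar>\<phi> x - \<psi> x\<bar>)"
    using assms by (intro mult_mono sum_mono2) (auto simp: lipschitz_in_def intro: sum_nonneg)
  finally show "\<bar>F \<phi> - F \<psi>\<bar> \<le> K' * (\<Sum>x\<in>X'. \<bar>\<phi> x - \<psi> x\<bar>)" .
qed (use assms in \<open>auto simp: lipschitz_in_def\<close>)

lemma lipschitz_in_continuous:
  fixes F :: "('a \<Rightarrow> real) \<Rightarrow> real"
  assumes "lipschitz_in K X F"
  shows "continuous_on UNIV F"
  unfolding continuous_on_def
proof
  fix \<phi> :: "'a \<Rightarrow> real"
  have c: "((\<lambda>\<psi>. K * (\<Sum>x\<in>X. \<bar>\<psi> x - \<phi> x\<bar>)) \<longlongrightarrow> K * (\<Sum>x\<in>X. \<bar>\<phi> x - \<phi> x\<bar>)) (at \<phi> within UNIV)"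
  proof (intro tendsto_intros)
    fix x
    show "((\<lambda>\<psi>. \<psi> x) \<longlongrightarrow> \<phi> x) (at \<phi> within UNIV)"
      using continuous_on_product_coordinates[of x] unfolding continuous_on_def by blast
  qed
  have "((\<lambda>\<psi>. F \<psi> - F \<phi>) \<longlongrightarrow> 0) (at \<phi> within UNIV)"
    by (rule Lim_null_comparison[OF _ c[simplified]]) (use assms in \<open>auto simp: lipschitz_in_def\<close>)
  then show "(F \<longlongrightarrow> F \<phi>) (at \<phi> within UNIV)" by (simp add: LIM_zero_iff)
qed

lemma borel_measurable_fields:
  fixes f :: "('a::countable \<Rightarrow> real) \<Rightarrow> real"
  assumes "continuous_on UNIV f"
  shows "f \<in> borel_measurable (PiM UNIV (\<lambda>_. borel))"
  unfolding measurable_cong_sets[OF sets_PiM_equal_borel refl]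
  by (rule borel_measurable_continuous_onI[OF assms])

lemma lip_cyl_continuous: "lip_cyl F \<Longrightarrow> continuous_on UNIV F"
  by (auto simp: lip_cyl_def intro: lipschitz_in_continuous)

lemma lip_cyl_bounded: "lip_cyl F \<Longrightarrow> bounded (range F)"
  by (auto simp: lip_cyl_def bounded_iff)

lemma lip_cyl_measurable: "lip_cyl F \<Longrightarrow> F \<in> borel_measurable (PiM UNIV (\<lambda>_::'a::countable. borel))"
  by (intro borel_measurable_fields lip_cyl_continuous)

lemma lip_cylE:
  assumes "lip_cyl F"
  obtains C K X where "\<And>\<phi>. \<bar>F \<phi>\<bar> \<le> C" "0 \<le> C" "lipschitz_in K X F"
proof -
  obtain C K X where 1: "\<And>\<phi>. \<bar>F \<phi>\<bar> \<le> C" "lipschitz_in K X F" using assms by (auto simp: lip_cyl_def)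
  have "0 \<le> C" using 1(1)[of undefined] by linarith
  then show ?thesis using that 1 by blast
qed

lemma lip_cyl_const: "lip_cyl (\<lambda>_. c)"
  unfolding lip_cyl_def lipschitz_in_def by (intro conjI exI[of _ "\<bar>c\<bar>"] exI[of _ 0] exI[of _ "{}"]) auto

lemma lip_cyl_cmult:
  assumes "lip_cyl F" shows "lip_cyl (\<lambda>\<phi>. c * F \<phi>)"
proof -
  obtain C K X where 1: "\<And>\<phi>. \<bar>F \<phi>\<bar> \<le> C" "0 \<le> C" "lipschitz_in K X F" using lip_cylE[OF assms] by blast
  have "\<bar>c * F \<phi> - c * F \<psi>\<bar> \<le> \<bar>c\<bar> * K * (\<Sum>x\<in>X. \<bar>\<phi> x - \<psi> x\<bar>)" for \<phi> \<psi>
    using 1(3) unfolding lipschitz_in_def right_diff_distrib[symmetric] abs_mult mult.assoc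
    by (intro mult_left_mono) auto
  then have "lipschitz_in (\<bar>c\<bar> * K) X (\<lambda>\<phi>. c * F \<phi>)" using 1 by (simp add: lipschitz_in_def)
  moreover have "\<bar>c * F \<phi>\<bar> \<le> \<bar>c\<bar> * C" for \<phi> using 1 by (simp add: abs_mult mult_left_mono)
  ultimately show ?thesis by (auto simp: lip_cyl_def)
qed

lemma lip_cyl_add:
  fixes F G :: "('a \<Rightarrow> real) \<Rightarrow> real"
  assumes "lip_cyl F" "lip_cyl G" shows "lip_cyl (\<lambda>\<phi>. F \<phi> + G \<phi>)"
proof -
  obtain C K X where 1: "\<And>\<phi>. \<bar>F \<phi>\<bar> \<le> C" "0 \<le> C" "lipschitz_in K X F" using lip_cylE[OF assms(1)] by blast
  obtain D L Y where 2: "\<And>\<phi>. \<bar>G \<phi>\<bar> \<le> D" "0 \<le> D" "lipschitz_in L Y G" using lip_cylE[OF assms(2)] by blast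
  have f: "finite (X \<union> Y)" "0 \<le> K" "0 \<le> L" using 1 2 by (auto simp: lipschitz_in_def)
  have F: "lipschitz_in K (X \<union> Y) F" and G: "lipschitz_in L (X \<union> Y) G"
    using lipschitz_in_mono[OF 1(3) order_refl _ f(1)] lipschitz_in_mono[OF 2(3) order_refl _ f(1)] by auto
  have "lipschitz_in (K + L) (X \<union> Y) (\<lambda>\<phi>. F \<phi> + G \<phi>)"
    unfolding lipschitz_in_def
  proof (intro conjI allI f(1))
    fix \<phi> \<psi> :: "'a \<Rightarrow> real"
    have "\<bar>F \<phi> - F \<psi>\<bar> \<le> K * (\<Sum>x\<in>X\<union>Y. \<bar>\<phi> x - \<psi> x\<bar>)" "\<bar>G \<phi> - G \<psi>\<bar> \<le> L * (\<Sum>x\<in>X\<union>Y. \<bar>\<phi> x - \<psi> x\<bar>)"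
      using F G by (auto simp: lipschitz_in_def)
    then show "\<bar>F \<phi> + G \<phi> - (F \<psi> + G \<psi>)\<bar> \<le> (K + L) * (\<Sum>x\<in>X\<union>Y. \<bar>\<phi> x - \<psi> x\<bar>)"
      unfolding distrib_right by linarith
  qed (use f in auto)
  moreover have "\<bar>F \<phi> + G \<phi>\<bar> \<le> C + D" for \<phi> using 1(1)[of \<phi>] 2(1)[of \<phi>] by linarith
  ultimately show ?thesis by (auto simp: lip_cyl_def)
qed

lemma lip_cyl_sum:
  "finite I \<Longrightarrow> (\<And>i. i \<in> I \<Longrightarrow> lip_cyl (F i)) \<Longrightarrow> lip_cyl (\<lambda>\<phi>. \<Sum>i\<in>I. F i \<phi>)"
  by (induction I rule: finite_induct) (auto intro: lip_cyl_add lip_cyl_const)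

lemma lip_cyl_mult:
  fixes F G :: "('a \<Rightarrow> real) \<Rightarrow> real"
  assumes "lip_cyl F" "lip_cyl G" shows "lip_cyl (\<lambda>\<phi>. F \<phi> * G \<phi>)"
proof -
  obtain C K X where 1: "\<And>\<phi>. \<bar>F \<phi>\<bar> \<le> C" "0 \<le> C" "lipschitz_in K X F" using lip_cylE[OF assms(1)] by blast
  obtain D L Y where 2: "\<And>\<phi>. \<bar>G \<phi>\<bar> \<le> D" "0 \<le> D" "lipschitz_in L Y G" using lip_cylE[OF assms(2)] by blast
  have f: "finite (X \<union> Y)" "0 \<le> K" "0 \<le> L" using 1 2 by (auto simp: lipschitz_in_def)
  have F: "lipschitz_in K (X \<union> Y) F" and G: "lipschitz_in L (X \<union> Y) G"
    using lipschitz_in_mono[OF 1(3) order_refl _ f(1)] lipschitz_in_mono[OF 2(3) order_refl _ f(1)] by auto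
  have "lipschitz_in (C * L + D * K) (X \<union> Y) (\<lambda>\<phi>. F \<phi> * G \<phi>)"
    unfolding lipschitz_in_def
  proof (intro conjI allI f(1))
    fix \<phi> \<psi> :: "'a \<Rightarrow> real"
    let ?S = "\<Sum>x\<in>X\<union>Y. \<bar>\<phi> x - \<psi> x\<bar>"
    have "\<bar>F \<phi> - F \<psi>\<bar> \<le> K * ?S" "\<bar>G \<phi> - G \<psi>\<bar> \<le> L * ?S"
      using F G by (auto simp: lipschitz_in_def)
    then have "\<bar>F \<phi> * (G \<phi> - G \<psi>)\<bar> \<le> C * (L * ?S)" "\<bar>G \<psi> * (F \<phi> - F \<psi>)\<bar> \<le> D * (K * ?S)"
      unfolding abs_mult using 1 2 by (auto intro!: mult_mono)
    moreover have "F \<phi> * G \<phi> - F \<psi> * G \<psi> = F \<phi> * (G \<phi> - G \<psi>) + G \<psi> * (F \<phi> - F \<psi>)"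
      by (simp add: algebra_simps)
    ultimately show "\<bar>F \<phi> * G \<phi> - F \<psi> * G \<psi>\<bar> \<le> (C * L + D * K) * ?S"
      unfolding distrib_right mult.assoc by linarith
  qed (use f 1 2 in auto)
  moreover have "\<bar>F \<phi> * G \<phi>\<bar> \<le> C * D" for \<phi> using 1(1)[of \<phi>] 2(1)[of \<phi>] 1(2)
    unfolding abs_mult by (intro mult_mono) auto
  ultimately show ?thesis by (auto simp: lip_cyl_def)
qed

section \<open>Truncation of observables\<close>

definition clamp_real :: "real \<Rightarrow> real \<Rightarrow> real" where "clamp_real R t = max (- R) (min R t)"

lemma clamp_real_lipschitz: "\<bar>clamp_real R s - clamp_real R t\<bar> \<le> \<bar>s - t\<bar>"
  by (auto simp: clamp_real_def)

lemma clamp_real_bound: "0 \<le> R \<Longrightarrow> \<bar>clamp_real R t\<bar> \<le> R"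
  by (auto simp: clamp_real_def)

lemma clamp_real_abs_le: "0 \<le> R \<Longrightarrow> \<bar>clamp_real R t\<bar> \<le> \<bar>t\<bar>"
  by (auto simp: clamp_real_def)

lemma clamp_real_minus: "0 \<le> R \<Longrightarrow> clamp_real R (- t) = - clamp_real R t"
  by (auto simp: clamp_real_def)

lemma clamp_real_eq: "\<bar>t\<bar> \<le> R \<Longrightarrow> clamp_real R t = t"
  by (auto simp: clamp_real_def)

lemma lip_cyl_clamp:
  assumes "lipschitz_in K X F" "0 \<le> R" shows "lip_cyl (\<lambda>\<phi>. clamp_real R (F \<phi>))"
proof -
  have "lipschitz_in K X (\<lambda>\<phi>. clamp_real R (F \<phi>))"
    using assms order_trans[OF clamp_real_lipschitz] by (fastforce simp: lipschitz_in_def)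
  then show ?thesis using clamp_real_bound[OF assms(2)] by (auto simp: lip_cyl_def)
qed

section \<open>Laws and weak limits tested on Lipschitz cylinder functions\<close>

lemma prob_algebra_fieldsD:
  assumes "M \<in> space (prob_algebra (PiM UNIV (\<lambda>_. borel)))"
  shows "prob_space M" "sets M = sets (PiM UNIV (\<lambda>_. borel))" "space M = UNIV"
  using assms sets_eq_imp_space_eq[of M "PiM UNIV (\<lambda>_. borel)"] by (auto simp: space_prob_algebra space_PiM)

lemma measurable_field_law:
  assumes "M \<in> space (prob_algebra (PiM UNIV (\<lambda>_. borel)))" "f \<in> measurable (PiM UNIV (\<lambda>_. borel)) N"
  shows "f \<in> measurable M N"
  using assms(2) prob_algebra_fieldsD(2)[OF assms(1)] by (simp cong: measurable_cong_sets)

text \<open>Indicators of closed orthants in finitely many coordinates are decreasing limits of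
  Lipschitz cylinder functions, and these orthants form a generator stable under
  intersection.\<close>

lemma fields_eqI:
  fixes M N :: "('a::countable \<Rightarrow> real) measure"
  assumes M: "M \<in> space (prob_algebra (PiM UNIV (\<lambda>_. borel)))"
    and N: "N \<in> space (prob_algebra (PiM UNIV (\<lambda>_. borel)))"
    and eq: "\<And>F. lip_cyl F \<Longrightarrow> (\<integral>\<phi>. F \<phi> \<partial>M) = (\<integral>\<phi>. F \<phi> \<partial>N)"
  shows "M = N"
proof -
  interpret M: prob_space M using M by (rule prob_algebra_fieldsD)
  interpret N: prob_space N using N by (rule prob_algebra_fieldsD)
  note sM[measurable_cong] = prob_algebra_fieldsD(2)[OF M] and sN[measurable_cong] = prob_algebra_fieldsD(2)[OF N]
  let ?S = "PiM UNIV (\<lambda>_. borel) :: ('a \<Rightarrow> real) measure"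
  define orth where "orth X a = {\<phi> :: 'a \<Rightarrow> real. \<forall>x\<in>X. \<phi> x \<le> a x}" for X a
  define E where "E = {orth X a | X a. finite X}"
  have Om: "orth X a \<in> sets ?S" if "finite X" for X a
  proof -
    have "{\<phi> \<in> space ?S. \<forall>x\<in>X. \<phi> x \<le> a x} \<in> sets ?S" using that by measurable
    then show ?thesis by (simp add: orth_def space_PiM)
  qed
  have EP: "E \<subseteq> Pow UNIV" by auto
  have sig: "sets ?S = sigma_sets UNIV E"
  proof
    show "sigma_sets UNIV E \<subseteq> sets ?S"
      using Om sets.sigma_sets_subset[of E ?S] by (auto simp: E_def space_PiM)
    have "(\<lambda>\<phi>. \<phi>) \<in> measurable (sigma UNIV E) ?S"
    proof (rule measurable_PiM_single')
      fix x :: 'a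
      show "(\<lambda>\<phi>. \<phi> x) \<in> borel_measurable (sigma UNIV E)"
        unfolding borel_measurable_iff_le
      proof
        fix a
        have "{\<phi>. \<phi> x \<le> a} = orth {x} (\<lambda>_. a)" by (auto simp: orth_def)
        then show "{\<phi> \<in> space (sigma UNIV E). \<phi> x \<le> a} \<in> sets (sigma UNIV E)"
          by (auto simp: E_def intro!: exI[of _ "{x}"])
      qed
    qed auto
    then have "id -` A \<inter> space (sigma UNIV E) \<in> sets (sigma UNIV E)" if "A \<in> sets ?S" for A
      using that unfolding id_def by (rule measurable_sets)
    then show "sets ?S \<subseteq> sigma_sets UNIV E" by auto
  qed
  have eqO: "emeasure M (orth X a) = emeasure N (orth X a)" if X: "finite X" for X a
  proof -
    define h where "h n \<phi> = max 0 (1 - real n * (\<Sum>x\<in>X. max 0 (\<phi> x - a x)))" for n :: nat and \<phi> :: "'a \<Rightarrow> real"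
    have hb: "0 \<le> h n \<phi>" "h n \<phi> \<le> 1" for n \<phi>
      unfolding h_def by (auto intro!: mult_nonneg_nonneg sum_nonneg)
    have lip: "lip_cyl (h n)" for n
    proof -
      have "\<bar>h n \<phi> - h n \<psi>\<bar> \<le> real n * (\<Sum>x\<in>X. \<bar>\<phi> x - \<psi> x\<bar>)" for \<phi> \<psi>
      proof -
        have "\<bar>h n \<phi> - h n \<psi>\<bar> \<le> \<bar>real n * (\<Sum>x\<in>X. max 0 (\<psi> x - a x)) - real n * (\<Sum>x\<in>X. max 0 (\<phi> x - a x))\<bar>"
          unfolding h_def by linarith
        also have "\<dots> = real n * \<bar>\<Sum>x\<in>X. max 0 (\<psi> x - a x) - max 0 (\<phi> x - a x)\<bar>"
          by (simp add: sum_subtractf right_diff_distrib[symmetric] abs_mult)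
        also have "\<dots> \<le> real n * (\<Sum>x\<in>X. \<bar>max 0 (\<psi> x - a x) - max 0 (\<phi> x - a x)\<bar>)"
          by (intro mult_left_mono sum_abs) auto
        also have "\<dots> \<le> real n * (\<Sum>x\<in>X. \<bar>\<phi> x - \<psi> x\<bar>)"
          by (intro mult_left_mono sum_mono) auto
        finally show ?thesis .
      qed
      then have "lipschitz_in (real n) X (h n)" using X by (auto simp: lipschitz_in_def)
      moreover have "\<bar>h n \<phi>\<bar> \<le> 1" for \<phi> using hb[of n \<phi>] by auto
      ultimately show ?thesis by (auto simp: lip_cyl_def)
    qed
    have lim: "(\<lambda>n. h n \<phi>) \<longlonglongrightarrow> indicator (orth X a) \<phi>" for \<phi>
    proof (cases "\<phi> \<in> orth X a")
      case True
      then have "(\<Sum>x\<in>X. max 0 (\<phi> x - a x)) = 0" by (intro sum.neutral) (auto simp: orth_def)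
      then show ?thesis using True by (simp add: h_def)
    next
      case False
      then obtain x where x: "x \<in> X" "a x < \<phi> x" by (auto simp: orth_def)
      have "0 < max 0 (\<phi> x - a x)" using x by auto
      also have "\<dots> \<le> (\<Sum>x\<in>X. max 0 (\<phi> x - a x))"
        using X x by (intro member_le_sum) auto
      finally have s: "0 < (\<Sum>x\<in>X. max 0 (\<phi> x - a x))" .
      then obtain n0 :: nat where n0: "1 < real n0 * (\<Sum>x\<in>X. max 0 (\<phi> x - a x))"
        using ex_less_of_nat_mult by blast
      have "h n \<phi> = 0" if "n0 \<le> n" for n
      proof -
        have "real n0 * (\<Sum>x\<in>X. max 0 (\<phi> x - a x)) \<le> real n * (\<Sum>x\<in>X. max 0 (\<phi> x - a x))"
          using that s by (intro mult_right_mono) auto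
        then show ?thesis using n0 by (simp add: h_def)
      qed
      then have "\<forall>\<^sub>F n in sequentially. h n \<phi> = indicator (orth X a) \<phi>"
        using False by (auto simp: eventually_sequentially)
      then show ?thesis by (rule tendsto_eventually)
    qed
    have hm[measurable]: "h n \<in> borel_measurable ?S" for n by (intro lip_cyl_measurable lip)
    note [measurable] = Om[OF X, of a]
    have limint: "(\<lambda>n. \<integral>\<phi>. h n \<phi> \<partial>P) \<longlonglongrightarrow> measure P (orth X a)"
      if P: "prob_space P" and [measurable_cong]: "sets P = sets ?S" and sp: "space P = UNIV" for P
    proof -
      interpret P: prob_space P by (rule P)
      have "(\<lambda>n. \<integral>\<phi>. h n \<phi> \<partial>P) \<longlonglongrightarrow> (\<integral>\<phi>. indicator (orth X a) \<phi> \<partial>P)"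
        by (rule integral_dominated_convergence[where w = "\<lambda>_. 1"]) (use lim hb in \<open>auto simp: abs_le_iff intro: order_trans\<close>)
      then show ?thesis using sp by simp
    qed
    have "measure M (orth X a) = measure N (orth X a)"
      by (rule LIMSEQ_unique[OF limint[OF M.prob_space_axioms sM prob_algebra_fieldsD(3)[OF M]]])
         (use limint[OF N.prob_space_axioms sN prob_algebra_fieldsD(3)[OF N]] eq[OF lip] in simp)
    then show ?thesis by (simp add: M.emeasure_eq_measure N.emeasure_eq_measure)
  qed
  show ?thesis
  proof (rule measure_eqI_generator_eq[where E = E and \<Omega> = UNIV and A = "\<lambda>_. UNIV"])
    show "Int_stable E"
    proof (rule Int_stableI)
      fix A B assume "A \<in> E" "B \<in> E"
      then obtain X a Y b where AB: "A = orth X a" "B = orth Y b" "finite X" "finite Y" by (auto simp: E_def)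
      define c where "c x = (if x \<in> X then if x \<in> Y then min (a x) (b x) else a x else b x)" for x
      have "A \<inter> B = orth (X \<union> Y) c"
        using AB by (auto simp: orth_def c_def split: if_splits)
      then show "A \<inter> B \<in> E" using AB by (auto simp: E_def)
    qed
    show "emeasure M A = emeasure N A" if "A \<in> E" for A using that eqO by (auto simp: E_def)
    have "UNIV = orth {} undefined" by (auto simp: orth_def)
    then have "UNIV \<in> E" unfolding E_def by blast
    then show "range (\<lambda>_. UNIV) \<subseteq> E" by auto
  qed (use EP sig sM sN in \<open>auto simp: M.emeasure_eq_measure\<close>)
qed

lemma weakly_convergesD:
  assumes "weakly_converges M L F" "lip_cyl f"
  shows "((\<lambda>i. \<integral>\<phi>. f \<phi> \<partial>M i) \<longlongrightarrow> (\<integral>\<phi>. f \<phi> \<partial>L)) F"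
  using assms lip_cyl_continuous lip_cyl_bounded unfolding weakly_converges_def by blast

lemma weak_limit_exists:
  fixes M :: "nat \<Rightarrow> 'd::finite config measure"
  assumes M: "\<And>n. field_law (M n)"
    and tight: "\<And>x e. 0 < e \<Longrightarrow> \<exists>R\<ge>0. \<forall>\<^sub>F n in sequentially. measure (M n) {\<phi>. R < \<bar>\<phi> x\<bar>} \<le> e"
  obtains r L where "strict_mono r" "weakly_converges (\<lambda>n. M (r n)) L sequentially"
  using prohorov_fields[OF M tight] M unfolding weakly_converges_def
  by (smt (verit) always_eventually)

text \<open>If the integrals of some test function stayed away from the proposed limit along a
  subsequence, compactness would give a further subsequence that converges weakly, and uniqueness of
  limit points would contradict the choice of the first one.\<close>

lemma weakly_converges_by_subsequences:
  fixes M :: "nat \<Rightarrow> 'd::finite config measure"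
  assumes M: "\<And>n. field_law (M n)"
    and tight: "\<And>x e. 0 < e \<Longrightarrow> \<exists>R\<ge>0. \<forall>\<^sub>F n in sequentially. measure (M n) {\<phi>. R < \<bar>\<phi> x\<bar>} \<le> e"
    and L0: "field_law L0"
    and uniq: "\<And>r L. strict_mono r \<Longrightarrow> weakly_converges (\<lambda>n. M (r n)) L sequentially \<Longrightarrow> L = L0"
  shows "weakly_converges M L0 sequentially"
  unfolding weakly_converges_def
proof (intro conjI allI impI L0 always_eventually M)
  fix f :: "'d config \<Rightarrow> real" assume f: "continuous_on UNIV f \<and> bounded (range f)"
  show "(\<lambda>n. \<integral>\<phi>. f \<phi> \<partial>M n) \<longlonglongrightarrow> (\<integral>\<phi>. f \<phi> \<partial>L0)"
  proof (rule ccontr)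
    assume "\<not> ?thesis"
    then obtain e where e: "e > 0" "\<not> (\<forall>\<^sub>F n in sequentially. dist (\<integral>\<phi>. f \<phi> \<partial>M n) (\<integral>\<phi>. f \<phi> \<partial>L0) < e)"
      by (auto simp: tendsto_iff)
    define S where "S = {n. e \<le> dist (\<integral>\<phi>. f \<phi> \<partial>M n) (\<integral>\<phi>. f \<phi> \<partial>L0)}"
    have "infinite S"
      using e(2) unfolding eventually_sequentially S_def infinite_nat_iff_unbounded_le by (auto simp: not_less)
    then obtain r :: "nat \<Rightarrow> nat" where r: "strict_mono r" "\<And>n. r n \<in> S"
      using infinite_enumerate by blast
    have tight': "\<exists>R\<ge>0. \<forall>\<^sub>F n in sequentially. measure (M (r n)) {\<phi>. R < \<bar>\<phi> x\<bar>} \<le> e" if "0 < e" for x e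
      using tight[OF that, of x] eventually_compose_filterlim[OF _ filterlim_subseq[OF r(1)]] by blast
    obtain s L where s: "strict_mono s" "weakly_converges (\<lambda>n. M (r (s n))) L sequentially"
      using weak_limit_exists[of "\<lambda>n. M (r n)"] M tight' by blast
    have "L = L0" using uniq[of "r \<circ> s" L] s r strict_mono_o[of r s] by (simp add: comp_def)
    then have "(\<lambda>n. \<integral>\<phi>. f \<phi> \<partial>M (r (s n))) \<longlonglongrightarrow> (\<integral>\<phi>. f \<phi> \<partial>L0)"
      using s f by (auto simp: weakly_converges_def)
    then have "\<forall>\<^sub>F n in sequentially. dist (\<integral>\<phi>. f \<phi> \<partial>M (r (s n))) (\<integral>\<phi>. f \<phi> \<partial>L0) < e"
      using e(1) by (rule tendstoD)
    then obtain n where "dist (\<integral>\<phi>. f \<phi> \<partial>M (r (s n))) (\<integral>\<phi>. f \<phi> \<partial>L0) < e"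
      by (auto simp: eventually_sequentially)
    with r(2)[of "s n"] show False by (auto simp: S_def)
  qed
qed

lemma weakly_converges_at_right:
  fixes \<mu> :: "real \<Rightarrow> 'd::finite config measure"
  assumes "\<And>m. 0 < m \<Longrightarrow> field_law (\<mu> m)"
    and "field_law \<mu>0"
    and "\<And>X. (\<And>i. 0 < X i) \<Longrightarrow> X \<longlonglongrightarrow> 0 \<Longrightarrow> weakly_converges (\<lambda>i. \<mu> (X i)) \<mu>0 sequentially"
  shows "weakly_converges \<mu> \<mu>0 (at_right 0)"
  unfolding weakly_converges_def
proof (intro conjI allI impI)
  show "\<forall>\<^sub>F i in at_right 0. field_law (\<mu> i)"
    using assms(1) by (auto simp: eventually_at_right_field intro!: exI[of _ 1])
  fix f :: "'d config \<Rightarrow> real" assume f: "continuous_on UNIV f \<and> bounded (range f)"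
  show "((\<lambda>i. \<integral>\<phi>. f \<phi> \<partial>\<mu> i) \<longlongrightarrow> (\<integral>\<phi>. f \<phi> \<partial>\<mu>0)) (at_right 0)"
    unfolding tendsto_at_iff_sequentially
    using assms(3) f by (auto simp: weakly_converges_def comp_def)
qed (use assms in auto)

section \<open>Block averages\<close>

lemma nearest_neighbour_add: "nearest_neighbour (x + z) (y + z) \<longleftrightarrow> nearest_neighbour x y"
  by (simp add: nearest_neighbour_def)

lemma nearest_neighbour_sym: "nearest_neighbour x y \<longleftrightarrow> nearest_neighbour y x"
  by (simp add: nearest_neighbour_def abs_minus_commute)

lemma nearest_neighbour_axis: "nearest_neighbour x (x + axis i 1)" "nearest_neighbour x (x - axis i 1)"
proof -
  have "(\<Sum>j\<in>UNIV. \<bar>(axis i 1 :: int ^ 'a) $ j\<bar>) = (\<Sum>j\<in>UNIV. if j = i then 1 else 0)"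
    by (intro sum.cong) (auto simp: axis_def)
  then show "nearest_neighbour x (x + axis i 1)" "nearest_neighbour x (x - axis i 1)"
    by (simp_all add: nearest_neighbour_def)
qed

lemma nearest_neighbourE:
  assumes "nearest_neighbour x y"
  obtains i where "y = x + axis i 1 \<or> y = x - axis i 1"
proof -
  let ?f = "\<lambda>j. \<bar>x $ j - y $ j\<bar>"
  have s: "(\<Sum>j\<in>UNIV. ?f j) = 1" using assms by (simp add: nearest_neighbour_def)
  have "\<exists>i. ?f i \<noteq> 0"
  proof (rule ccontr)
    assume "\<not> ?thesis"
    then have "(\<Sum>j\<in>UNIV. ?f j) = 0" by (intro sum.neutral) auto
    with s show False by simp
  qed
  then obtain i where i: "?f i \<noteq> 0" ..
  have "(\<Sum>j\<in>UNIV. ?f j) = ?f i + (\<Sum>j\<in>UNIV - {i}. ?f j)" by (simp add: sum.remove)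
  moreover have "0 \<le> (\<Sum>j\<in>UNIV - {i}. ?f j)" by (intro sum_nonneg) auto
  ultimately have fi: "?f i = 1" "(\<Sum>j\<in>UNIV - {i}. ?f j) = 0" using s i by linarith+
  then have o: "x $ j = y $ j" if "j \<noteq> i" for j
    using that by (subst (asm) sum_nonneg_eq_0_iff) auto
  have "y $ i = x $ i + 1 \<or> y $ i = x $ i - 1" using fi(1) by linarith
  then have "y = x + axis i 1 \<or> y = x - axis i 1"
  proof
    assume "y $ i = x $ i + 1"
    then have "y = x + axis i 1" using o by (auto simp: vec_eq_iff axis_def)
    then show ?thesis ..
  next
    assume "y $ i = x $ i - 1"
    then have "y = x - axis i 1" using o by (auto simp: vec_eq_iff axis_def)
    then show ?thesis ..
  qed
  then show ?thesis using that by blast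
qed

definition bond_set :: "((int ^ 'd) \<times> (int ^ 'd)) set \<Rightarrow> bool" where
  "bond_set E \<longleftrightarrow> finite E \<and> (\<forall>(x, y)\<in>E. nearest_neighbour x y)"

text \<open>The square root of the Dirichlet form over a set of directed edges; a set with both
  orientations of a bond counts it twice.\<close>

definition edge_norm :: "('v \<times> 'v) set \<Rightarrow> ('v \<Rightarrow> real) \<Rightarrow> real" where
  "edge_norm E u = L2_set (\<lambda>(x, y). u x - u y) E"

lemma L2_set_subset: "finite B \<Longrightarrow> A \<subseteq> B \<Longrightarrow> L2_set f A \<le> L2_set f B"
  unfolding L2_set_def by (intro real_sqrt_le_mono sum_mono2) auto

lemma edge_norm_mono: "finite E' \<Longrightarrow> E \<subseteq> E' \<Longrightarrow> edge_norm E u \<le> edge_norm E' u"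
  unfolding edge_norm_def by (rule L2_set_subset)

lemma edge_norm_nonneg[simp]: "0 \<le> edge_norm E u"
  by (simp add: edge_norm_def L2_set_nonneg)

lemma bond_set_Un: "bond_set E \<Longrightarrow> bond_set E' \<Longrightarrow> bond_set (E \<union> E')"
  by (auto simp: bond_set_def)

lemma L2_set_image: "inj_on g A \<Longrightarrow> L2_set f (g ` A) = L2_set (\<lambda>x. f (g x)) A"
  by (simp add: L2_set_def sum.reindex)

lemma L2_set_uminus: "L2_set (\<lambda>x. - f x) A = L2_set f A"
  by (simp add: L2_set_def)

lemma L2_set_sum_le:
  "finite I \<Longrightarrow> L2_set (\<lambda>x. \<Sum>i\<in>I. f i x) A \<le> (\<Sum>i\<in>I. L2_set (f i) A)"
proof (induction I rule: finite_induct)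
  case (insert i I)
  have "L2_set (\<lambda>x. \<Sum>i\<in>insert i I. f i x) A = L2_set (\<lambda>x. f i x + (\<Sum>i\<in>I. f i x)) A"
    using insert by simp
  also have "\<dots> \<le> L2_set (f i) A + L2_set (\<lambda>x. \<Sum>i\<in>I. f i x) A" by (rule L2_set_triangle_ineq)
  finally show ?case using insert by simp
qed (simp add: L2_set_def)

lemma abs_sum_le_L2_set: "\<bar>\<Sum>x\<in>A. f x\<bar> \<le> sqrt (card A) * L2_set f A"
proof -
  have "\<bar>\<Sum>x\<in>A. f x\<bar> \<le> (\<Sum>x\<in>A. \<bar>1\<bar> * \<bar>f x\<bar>)" by simp
  also have "\<dots> \<le> L2_set (\<lambda>_. 1) A * L2_set f A" by (rule L2_set_mult_ineq)
  finally show ?thesis by (simp add: L2_set_def)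
qed

text \<open>The constant is common to all finite \<open>Y\<close>, and only the edge set depends on
  \<open>Y\<close>. This uniformity allows blocks of any size, for which the bound is then divided
  by the square root of the volume.\<close>

definition translation_bound :: "int ^ 'd \<Rightarrow> real \<Rightarrow> bool" where
  "translation_bound w C \<longleftrightarrow> (\<forall>Y. finite Y \<longrightarrow> (\<exists>E. bond_set E \<and>
     (\<forall>u. L2_set (\<lambda>y. u (y + w) - u y) Y \<le> C * edge_norm E u)))"

lemma translation_bound_0: "translation_bound 0 0"
  by (auto simp: translation_bound_def bond_set_def L2_set_def intro!: exI[of _ "{}"])

lemma translation_bound_axis: "translation_bound (axis i 1) 1"
  unfolding translation_bound_def
proof (intro allI impI)
  fix Y :: "(int ^ 'a) set" assume Y: "finite Y"
  let ?g = "\<lambda>y. (y + axis i 1, y) :: (int ^ 'a) \<times> (int ^ 'a)"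
  have "bond_set (?g ` Y)"
    using Y nearest_neighbour_axis(1)[THEN nearest_neighbour_sym[THEN iffD1]] by (auto simp: bond_set_def)
  moreover have "edge_norm (?g ` Y) u = L2_set (\<lambda>y. u (y + axis i 1) - u y) Y" for u :: "int ^ 'a \<Rightarrow> real"
    unfolding edge_norm_def by (subst L2_set_image) (auto simp: inj_on_def)
  ultimately show "\<exists>E. bond_set E \<and> (\<forall>u. L2_set (\<lambda>y. u (y + axis i 1) - u y) Y \<le> 1 * edge_norm E u)"
    by (intro exI[of _ "?g ` Y"]) auto
qed

lemma translation_bound_minus:
  fixes w :: "int ^ 'd"
  assumes "translation_bound w C" shows "translation_bound (- w) C"
  unfolding translation_bound_def
proof (intro allI impI)
  fix Y :: "(int ^ 'd) set" assume Y: "finite Y"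
  let ?g = "\<lambda>y. y - w"
  obtain E where E: "bond_set E" "\<And>u. L2_set (\<lambda>y. u (y + w) - u y) (?g ` Y) \<le> C * edge_norm E u"
    using assms Y unfolding translation_bound_def by (meson finite_imageI)
  have "L2_set (\<lambda>y. u (y + - w) - u y) Y = L2_set (\<lambda>y. u (y + w) - u y) (?g ` Y)" for u
    by (subst L2_set_image) (auto simp: inj_on_def L2_set_uminus[of "\<lambda>y. u (y - w) - u y", symmetric])
  with E show "\<exists>E. bond_set E \<and> (\<forall>u. L2_set (\<lambda>y. u (y + - w) - u y) Y \<le> C * edge_norm E u)" by auto
qed

lemma translation_bound_add:
  fixes w w' :: "int ^ 'd"
  assumes "translation_bound w C" "translation_bound w' C'" "0 \<le> C" "0 \<le> C'"
  shows "translation_bound (w + w') (C + C')"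
  unfolding translation_bound_def
proof (intro allI impI)
  fix Y :: "(int ^ 'd) set" assume Y: "finite Y"
  let ?g = "\<lambda>y. y + w"
  obtain E where E: "bond_set E" "\<And>u. L2_set (\<lambda>y. u (y + w) - u y) Y \<le> C * edge_norm E u"
    using assms(1) Y unfolding translation_bound_def by meson
  obtain E' where E': "bond_set E'" "\<And>u. L2_set (\<lambda>y. u (y + w') - u y) (?g ` Y) \<le> C' * edge_norm E' u"
    using assms(2) Y unfolding translation_bound_def by (meson finite_imageI)
  have "L2_set (\<lambda>y. u (y + (w + w')) - u y) Y \<le> (C + C') * edge_norm (E \<union> E') u" for u
  proof -
    have "L2_set (\<lambda>y. u (y + (w + w')) - u y) Y = L2_set (\<lambda>y. (u (y + w + w') - u (y + w)) + (u (y + w) - u y)) Y"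
      by (simp add: add.assoc)
    also have "\<dots> \<le> L2_set (\<lambda>y. u (y + w + w') - u (y + w)) Y + L2_set (\<lambda>y. u (y + w) - u y) Y"
      by (rule L2_set_triangle_ineq)
    also have "L2_set (\<lambda>y. u (y + w + w') - u (y + w)) Y = L2_set (\<lambda>y. u (y + w') - u y) (?g ` Y)"
      by (subst L2_set_image) (auto simp: inj_on_def)
    also have "\<dots> \<le> C' * edge_norm (E \<union> E') u"
      using E'(2)[of u] edge_norm_mono[of "E \<union> E'" E' u] E(1) E'(1) assms(4)
      by (meson Un_upper2 bond_set_Un bond_set_def mult_left_mono order_trans)
    also have "L2_set (\<lambda>y. u (y + w) - u y) Y \<le> C * edge_norm (E \<union> E') u"
      using E(2)[of u] edge_norm_mono[of "E \<union> E'" E u] E(1) E'(1) assms(3)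
      by (meson Un_upper1 bond_set_Un bond_set_def mult_left_mono order_trans)
    finally show ?thesis by (simp add: algebra_simps)
  qed
  then show "\<exists>E. bond_set E \<and> (\<forall>u. L2_set (\<lambda>y. u (y + (w + w')) - u y) Y \<le> (C + C') * edge_norm E u)"
    using bond_set_Un E(1) E'(1) by blast
qed

lemma translation_bound_axis_nat: "translation_bound (axis i (int k)) (real k)"
proof (induction k)
  case 0
  have "axis i (int 0) = 0" by (simp add: axis_def vec_eq_iff)
  then show ?case using translation_bound_0 by (simp only: of_nat_0)
next
  case (Suc k)
  have "axis i (int (Suc k)) = axis i (int k) + axis i 1" by (simp add: axis_def vec_eq_iff)
  then show ?case using translation_bound_add[OF Suc translation_bound_axis] by (simp add: add.commute)
qed

lemma translation_bound_exists:
  fixes w :: "int ^ 'd"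
  obtains C where "0 \<le> C" "translation_bound w C"
proof -
  have ax: "\<exists>C\<ge>0. translation_bound (axis i a) C" for i :: 'd and a
  proof (cases "0 \<le> a")
    case True
    then show ?thesis using translation_bound_axis_nat[of i "nat a"] by (intro exI[of _ "real (nat a)"]) auto
  next
    case False
    have "- axis i (int (nat (- a))) = axis i a" using False by (auto simp: axis_def vec_eq_iff)
    then show ?thesis
      using translation_bound_minus[OF translation_bound_axis_nat[of i "nat (- a)"]] False
      by (intro exI[of _ "real (nat (- a))"]) auto
  qed
  have "finite S \<Longrightarrow> \<exists>C\<ge>0. translation_bound (\<Sum>i\<in>S. axis i (w $ i)) C" for S :: "'d set"
  proof (induction S rule: finite_induct)
    case empty
    then show ?case using translation_bound_0 by auto
  next
    case (insert i S)
    then obtain C where C: "0 \<le> C" "translation_bound (\<Sum>i\<in>S. axis i (w $ i)) C" by blast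
    obtain D where D: "0 \<le> D" "translation_bound (axis i (w $ i)) D" using ax by blast
    have "translation_bound (\<Sum>i\<in>insert i S. axis i (w $ i)) (D + C)"
      using translation_bound_add[OF D(2) C(2) D(1) C(1)] insert(1,2) by simp
    then show ?case using C(1) D(1) by (intro exI[of _ "D + C"]) auto
  qed
  from this[of UNIV] have "\<exists>C\<ge>0. translation_bound (\<Sum>i\<in>UNIV. axis i (w $ i)) C" by simp
  moreover have "(\<Sum>i\<in>UNIV. axis i (w $ i)) = w"
    by (auto simp: vec_eq_iff axis_def if_distrib cong: if_cong)
  ultimately show ?thesis using that by auto
qed

section \<open>Averages over boxes\<close>

definition block :: "('d::finite \<Rightarrow> nat) \<Rightarrow> (int ^ 'd) set" where
  "block s = {w. \<forall>i. 0 \<le> w $ i \<and> w $ i < int (s i)}"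

lemma card_vec_box:
  fixes A :: "'d::finite \<Rightarrow> int set"
  assumes "\<And>i. finite (A i)"
  shows "finite {w :: int ^ 'd. \<forall>i. w $ i \<in> A i}" "card {w :: int ^ 'd. \<forall>i. w $ i \<in> A i} = (\<Prod>i\<in>UNIV. card (A i))"
proof -
  have e: "{w :: int ^ 'd. \<forall>i. w $ i \<in> A i} = vec_lambda ` (PiE UNIV A)"
  proof safe
    fix w :: "int ^ 'd" assume "\<forall>i. w $ i \<in> A i"
    then have "vec_nth w \<in> PiE UNIV A" by auto
    then show "w \<in> vec_lambda ` (PiE UNIV A)" by (metis image_eqI vec_nth_inverse)
  qed auto
  have "inj_on (vec_lambda :: ('d \<Rightarrow> int) \<Rightarrow> _) (PiE UNIV A)"
    by (rule inj_onI) (metis vec_lambda_inverse UNIV_I)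
  then show "card {w :: int ^ 'd. \<forall>i. w $ i \<in> A i} = (\<Prod>i\<in>UNIV. card (A i))"
    unfolding e by (simp add: card_image card_PiE)
  show "finite {w :: int ^ 'd. \<forall>i. w $ i \<in> A i}"
    unfolding e using assms by (intro finite_imageI finite_PiE) auto
qed

lemma finite_block[simp]: "finite (block s)" and card_block: "card (block s) = (\<Prod>i\<in>UNIV. s i)"
proof -
  have e: "block s = {w. \<forall>i. w $ i \<in> {0..<int (s i)}}" by (auto simp: block_def)
  show "finite (block s)" unfolding e by (rule card_vec_box) auto
  show "card (block s) = (\<Prod>i\<in>UNIV. s i)" unfolding e by (subst card_vec_box(2)) auto
qed

definition block_avg :: "('d::finite \<Rightarrow> nat) \<Rightarrow> 'd config \<Rightarrow> int ^ 'd \<Rightarrow> real" where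
  "block_avg s u x = (\<Sum>w\<in>block s. u (x + w)) / real (card (block s))"

lemma block_double:
  fixes s :: "'d::finite \<Rightarrow> nat"
  shows "block (s(i := 2 * s i)) = block s \<union> (\<lambda>w. w + axis i (int (s i))) ` block s"
    and "block s \<inter> (\<lambda>w. w + axis i (int (s i))) ` block s = {}"
proof -
  have mem: "w \<in> block t \<longleftrightarrow> (0 \<le> w $ i \<and> w $ i < int (t i)) \<and> (\<forall>j. j \<noteq> i \<longrightarrow> 0 \<le> w $ j \<and> w $ j < int (t j))" for w t
    by (simp add: block_def) metis
  have img: "w \<in> (\<lambda>w. w + axis i a) ` block s \<longleftrightarrow> w - axis i a \<in> block s" for w :: "int ^ 'd" and a
    by (auto intro!: image_eqI[of _ _ "w - axis i a"])
  show "block s \<inter> (\<lambda>w. w + axis i (int (s i))) ` block s = {}"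
    by (auto simp: img mem axis_def simp del: image_iff)
  show "block (s(i := 2 * s i)) = block s \<union> (\<lambda>w. w + axis i (int (s i))) ` block s"
    unfolding set_eq_iff Un_iff img mem by (auto simp: axis_def)
qed

lemma block_avg_double:
  "block_avg (s(i := 2 * s i)) u x = (block_avg s u x + block_avg s u (x + axis i (int (s i)))) / 2"
proof -
  let ?g = "\<lambda>w. w + axis i (int (s i))"
  have inj: "inj_on ?g (block s)" by (auto simp: inj_on_def)
  have c: "card (block (s(i := 2 * s i))) = 2 * card (block s)"
    unfolding block_double(1) by (subst card_Un_disjoint) (auto simp: block_double(2) card_image[OF inj])
  have "(\<Sum>w\<in>block (s(i := 2 * s i)). u (x + w)) = (\<Sum>w\<in>block s. u (x + w)) + (\<Sum>w\<in>?g ` block s. u (x + w))"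
    unfolding block_double(1) by (intro sum.union_disjoint) (auto simp: block_double(2))
  also have "(\<Sum>w\<in>?g ` block s. u (x + w)) = (\<Sum>w\<in>block s. u (x + axis i (int (s i)) + w))"
    by (subst sum.reindex[OF inj]) (simp add: algebra_simps)
  finally have *: "(\<Sum>w\<in>block (s(i := 2 * s i)). u (x + w))
    = (\<Sum>w\<in>block s. u (x + w)) + (\<Sum>w\<in>block s. u (x + axis i (int (s i)) + w))" .
  show ?thesis unfolding block_avg_def c * by (simp add: add_divide_distrib)
qed

text \<open>By Cauchy-Schwarz a sum of n differences is at most sqrt n times their l2 norm, and
  dividing by n leaves the gain 1 / sqrt n. The l2 norm itself is at most k times the Dirichlet
  norm, whatever the block.\<close>

lemma block_avg_shift:
  fixes x :: "int ^ 'd::finite"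
  obtains E where "bond_set E" "\<And>u. \<bar>block_avg s u (x + axis i (int k)) - block_avg s u x\<bar>
    \<le> real k / sqrt (card (block s)) * edge_norm E u"
proof -
  let ?Y = "(\<lambda>w. x + w) ` block s"
  obtain E where E: "bond_set E" "\<And>u. L2_set (\<lambda>y. u (y + axis i (int k)) - u y) ?Y \<le> real k * edge_norm E u"
    using translation_bound_axis_nat[of i k] unfolding translation_bound_def by (meson finite_block finite_imageI)
  show ?thesis
  proof (rule that[OF E(1)])
    fix u
    let ?n = "real (card (block s))"
    have "\<bar>block_avg s u (x + axis i (int k)) - block_avg s u x\<bar>
        = \<bar>\<Sum>w\<in>block s. u (x + w + axis i (int k)) - u (x + w)\<bar> / ?n"
      unfolding block_avg_def diff_divide_distrib[symmetric] sum_subtractf[symmetric] abs_divide by (simp add: algebra_simps)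
    also have "\<dots> \<le> sqrt ?n * L2_set (\<lambda>w. u (x + w + axis i (int k)) - u (x + w)) (block s) / ?n"
      by (intro divide_right_mono abs_sum_le_L2_set) auto
    also have "L2_set (\<lambda>w. u (x + w + axis i (int k)) - u (x + w)) (block s) = L2_set (\<lambda>y. u (y + axis i (int k)) - u y) ?Y"
      by (subst L2_set_image) auto
    also have "sqrt ?n * \<dots> / ?n \<le> sqrt ?n * (real k * edge_norm E u) / ?n"
      by (intro divide_right_mono mult_left_mono E(2)) auto
    also have "\<dots> = real k / sqrt ?n * edge_norm E u"
      by (cases "?n = 0") (auto simp: real_div_sqrt field_simps)
    finally show "\<bar>block_avg s u (x + axis i (int k)) - block_avg s u x\<bar> \<le> real k / sqrt ?n * edge_norm E u" .
  qed
qed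

abbreviation dyadic_avg :: "nat \<Rightarrow> 'd::finite config \<Rightarrow> int ^ 'd \<Rightarrow> real" where
  "dyadic_avg k \<equiv> block_avg (\<lambda>_. 2 ^ k)"

text \<open>This is 2 / sqrt (2^3): the ratio of the costs of doubling a cubical block at
  consecutive scales in dimension three.\<close>

definition decay_rate :: real where "decay_rate = sqrt (1 / 2)"

lemma decay_rate: "0 < decay_rate" "decay_rate < 1"
  by (auto simp: decay_rate_def)

text \<open>
  The block is doubled in one coordinate at a time. Each doubling compares two translates at distance
  \<open>2 ^ k\<close>, which costs \<open>2 ^ k\<close> over the square root of a volume of at least \<open>2 ^ (3 * k)\<close>.
\<close>

lemma dyadic_avg_step:
  fixes x :: "int ^ 'd::finite"
  assumes d: "CARD('d) \<ge> 3"
  obtains E where "bond_set E"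
    "\<And>u. \<bar>dyadic_avg (Suc k) u x - dyadic_avg k u x\<bar> \<le> real CARD('d) / 2 * decay_rate ^ k * edge_norm E u"
proof -
  define sc where "sc I = (\<lambda>i::'d. if i \<in> I then 2 * 2 ^ k else 2 ^ k :: nat)" for I
  have "finite I \<Longrightarrow> \<exists>E. bond_set E \<and> (\<forall>u. \<bar>block_avg (sc I) u x - dyadic_avg k u x\<bar> \<le> real (card I) / 2 * decay_rate ^ k * edge_norm E u)" for I
  proof (induction I rule: finite_induct)
    case empty
    have "sc {} = (\<lambda>_. 2 ^ k)" by (auto simp: sc_def)
    then show ?case by (intro exI[of _ "{}"]) (auto simp: bond_set_def)
  next
    case (insert i I)
    then obtain E where E: "bond_set E" "\<And>u. \<bar>block_avg (sc I) u x - dyadic_avg k u x\<bar> \<le> real (card I) / 2 * decay_rate ^ k * edge_norm E u"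
      by auto
    have sci: "sc I i = 2 ^ k" "sc (insert i I) = (sc I)(i := 2 * sc I i)"
      using insert by (auto simp: sc_def)
    obtain E' where E': "bond_set E'" "\<And>u. \<bar>block_avg (sc I) u (x + axis i (int (2 ^ k))) - block_avg (sc I) u x\<bar>
      \<le> real (2 ^ k) / sqrt (card (block (sc I))) * edge_norm E' u"
      using block_avg_shift[where s = "sc I" and i = i and k = "2 ^ k" and x = x] by auto
    have "(2 ^ k) ^ 3 \<le> ((2 ^ k) ^ CARD('d) :: nat)" using d by (intro power_increasing) auto
    also have "\<dots> = (\<Prod>i\<in>(UNIV :: 'd set). 2 ^ k)" by simp
    also have "\<dots> \<le> card (block (sc I))"
      unfolding card_block by (intro prod_mono) (auto simp: sc_def)
    finally have "real ((2 ^ k) ^ 3) \<le> real (card (block (sc I)))" by linarith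
    then have c3: "(2 ^ k) ^ 3 \<le> real (card (block (sc I)))" by simp
    have "real (2 ^ k) / sqrt (card (block (sc I))) \<le> 2 ^ k / sqrt ((2 ^ k) ^ 3)"
      using c3 by (intro frac_le) auto
    also have "\<dots> = decay_rate ^ k"
    proof -
      have "2 ^ k / sqrt ((2 ^ k) ^ 3) = sqrt ((2 ^ k)\<^sup>2 / (2 ^ k) ^ 3)" by (simp add: real_sqrt_divide)
      also have "(2 ^ k)\<^sup>2 / (2 ^ k) ^ 3 = (1 / 2 :: real) ^ k" by (simp add: power_divide power2_eq_square power3_eq_cube)
      finally show ?thesis by (simp add: decay_rate_def real_sqrt_power)
    qed
    finally have r: "real (2 ^ k) / sqrt (card (block (sc I))) \<le> decay_rate ^ k" .
    have "\<bar>block_avg (sc (insert i I)) u x - dyadic_avg k u x\<bar> \<le> real (card (insert i I)) / 2 * decay_rate ^ k * edge_norm (E \<union> E') u" for u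
    proof -
      have fin: "finite (E \<union> E')" using E(1) E'(1) by (auto simp: bond_set_def)
      have 1: "\<bar>block_avg (sc I) u (x + axis i (int (2 ^ k))) - block_avg (sc I) u x\<bar> \<le> decay_rate ^ k * edge_norm (E \<union> E') u"
        using E'(2)[of u] mult_mono[OF r edge_norm_mono[OF fin Un_upper2], of u] decay_rate by auto
      have 2: "\<bar>block_avg (sc I) u x - dyadic_avg k u x\<bar> \<le> real (card I) / 2 * decay_rate ^ k * edge_norm (E \<union> E') u"
        using E(2)[of u] mult_left_mono[OF edge_norm_mono[OF fin Un_upper1, of u], of "real (card I) / 2 * decay_rate ^ k"] decay_rate by auto
      \<comment> \<open>The average over the doubled block is the mean of the averages over two
        translates, so it moves by half their difference; d such moves give the constant d /
        2.\<close>
      have "block_avg (sc (insert i I)) u x - dyadic_avg k u x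
        = (block_avg (sc I) u x - dyadic_avg k u x) + (block_avg (sc I) u (x + axis i (int (2 ^ k))) - block_avg (sc I) u x) / 2"
        using block_avg_double[of "sc I" i u x] unfolding sci by (simp add: field_simps)
      moreover have tri: "x = y + z / 2 \<Longrightarrow> \<bar>z\<bar> \<le> b \<Longrightarrow> \<bar>y\<bar> \<le> a \<Longrightarrow> \<bar>x\<bar> \<le> a + b / 2" for x y z a b :: real
        by linarith
      ultimately have "\<bar>block_avg (sc (insert i I)) u x - dyadic_avg k u x\<bar>
        \<le> real (card I) / 2 * decay_rate ^ k * edge_norm (E \<union> E') u + (decay_rate ^ k * edge_norm (E \<union> E') u) / 2"
        using 1 2 tri by blast
      also have "\<dots> = real (card (insert i I)) / 2 * decay_rate ^ k * edge_norm (E \<union> E') u"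
        using insert by (simp add: field_simps)
      finally show ?thesis .
    qed
    then show ?case using bond_set_Un[OF E(1) E'(1)] by blast
  qed
  from this[of UNIV] obtain E where "bond_set E" "\<And>u. \<bar>block_avg (sc UNIV) u x - dyadic_avg k u x\<bar> \<le> real CARD('d) / 2 * decay_rate ^ k * edge_norm E u"
    by auto
  moreover have "sc UNIV = (\<lambda>_. 2 ^ Suc k)" by (auto simp: sc_def)
  ultimately show ?thesis using that by auto
qed

section \<open>Domination by the Dirichlet norm\<close>

text \<open>
  The square-summable error, with an arbitrarily small constant \<open>b\<close>, is controlled by the mass term
  of the torus measures and disappears from all bounds in the limit \<open>n \<rightarrow> \<infinity>\<close>.
\<close>

definition dominated :: "real \<Rightarrow> ('d::finite config \<Rightarrow> real) \<Rightarrow> bool" where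
  "dominated a l \<longleftrightarrow> (\<forall>b>0. \<exists>E X. bond_set E \<and> finite X \<and> (\<forall>u. l u \<le> a * edge_norm E u + b * L2_set u X))"

lemma dominated_mono:
  assumes "dominated a l" "\<And>u. l' u \<le> l u"
  shows "dominated a l'"
  using assms unfolding dominated_def by (meson order_trans)

lemma dominated_mono_const:
  assumes "dominated a l" "a \<le> a'"
  shows "dominated a' l"
  unfolding dominated_def
proof (intro allI impI)
  fix b :: real assume "0 < b"
  then obtain E X where "bond_set E" "finite X" and 1: "\<And>u. l u \<le> a * edge_norm E u + b * L2_set u X"
    using assms(1) unfolding dominated_def by meson
  moreover have "l u \<le> a' * edge_norm E u + b * L2_set u X" for u
    using 1[of u] mult_right_mono[OF assms(2) edge_norm_nonneg[of E u]] by linarith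
  ultimately show "\<exists>E X. bond_set E \<and> finite X \<and> (\<forall>u. l u \<le> a' * edge_norm E u + b * L2_set u X)" by blast
qed

lemma dominated_zero: "dominated 0 (\<lambda>_. 0)"
  by (auto simp: dominated_def bond_set_def intro!: exI[of _ "{}"])

lemma dominated_add:
  assumes "dominated a l" "dominated a' l'" "0 \<le> a" "0 \<le> a'"
  shows "dominated (a + a') (\<lambda>u. l u + l' u)"
  unfolding dominated_def
proof (intro allI impI)
  fix b :: real assume "0 < b"
  then have b: "0 < b / 2" by simp
  obtain E X where 1: "bond_set E" "finite X" "\<And>u. l u \<le> a * edge_norm E u + b / 2 * L2_set u X"
    using assms(1) b unfolding dominated_def by meson
  obtain E' X' where 2: "bond_set E'" "finite X'" "\<And>u. l' u \<le> a' * edge_norm E' u + b / 2 * L2_set u X'"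
    using assms(2) b unfolding dominated_def by meson
  have fin: "finite (E \<union> E')" "finite (X \<union> X')" using 1 2 by (auto simp: bond_set_def)
  have "l u + l' u \<le> (a + a') * edge_norm (E \<union> E') u + b * L2_set u (X \<union> X')" for u
  proof -
    have "a * edge_norm E u \<le> a * edge_norm (E \<union> E') u" "a' * edge_norm E' u \<le> a' * edge_norm (E \<union> E') u"
      using assms fin by (auto intro!: mult_left_mono edge_norm_mono)
    moreover have "b / 2 * L2_set u X \<le> b / 2 * L2_set u (X \<union> X')" "b / 2 * L2_set u X' \<le> b / 2 * L2_set u (X \<union> X')"
      using b fin by (auto intro!: mult_left_mono L2_set_subset simp del: times_divide_eq_left)
    ultimately show ?thesis using 1(3)[of u] 2(3)[of u] by (simp add: algebra_simps)
  qed
  then show "\<exists>E X. bond_set E \<and> finite X \<and> (\<forall>u. l u + l' u \<le> (a + a') * edge_norm E u + b * L2_set u X)"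
    using bond_set_Un[OF 1(1) 2(1)] fin(2) by blast
qed

lemma dominated_cmult:
  assumes "dominated a l" "0 \<le> c"
  shows "dominated (c * a) (\<lambda>u. c * l u)"
proof (cases "c = 0")
  case True
  then show ?thesis using dominated_zero by simp
next
  case False
  then have c: "0 < c" using assms by simp
  show ?thesis
    unfolding dominated_def
  proof (intro allI impI)
    fix b :: real assume "0 < b"
    then have b: "0 < b / c" using c by simp
    obtain E X where 1: "bond_set E" "finite X" "\<And>u. l u \<le> a * edge_norm E u + b / c * L2_set u X"
      using assms(1) b unfolding dominated_def by meson
    have "c * l u \<le> c * a * edge_norm E u + b * L2_set u X" for u
      using mult_left_mono[OF 1(3)[of u], of c] c by (simp add: algebra_simps)
    then show "\<exists>E X. bond_set E \<and> finite X \<and> (\<forall>u. c * l u \<le> c * a * edge_norm E u + b * L2_set u X)"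
      using 1 by blast
  qed
qed

lemma dominated_sum:
  assumes "finite I" "\<And>i. i \<in> I \<Longrightarrow> dominated a (l i)" "0 \<le> a"
  shows "dominated (real (card I) * a) (\<lambda>u. \<Sum>i\<in>I. l i u)"
  using assms
proof (induction I rule: finite_induct)
  case empty then show ?case using dominated_zero by simp
next
  case (insert i I)
  have "dominated (a + real (card I) * a) (\<lambda>u. l i u + (\<Sum>i\<in>I. l i u))"
    using insert by (intro dominated_add) auto
  then show ?case using insert by (simp add: algebra_simps)
qed

lemma dominated_edge_norm:
  assumes "bond_set E" "\<And>u. l u \<le> a * edge_norm E u"
  shows "dominated a l"
  unfolding dominated_def
  by (intro allI impI exI[of _ E] exI[of _ "{}"] conjI) (simp_all add: assms)

text \<open>The sum over all scales k of the doubling costs d / 2 times \<open>decay_rate\<close> ^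
  k. Its square bounds, up to normalisation, the lattice Green function at the origin.\<close>

definition green_const :: "'d::finite itself \<Rightarrow> real" where
  "green_const _ = real CARD('d) / (2 * (1 - decay_rate))"

lemma green_const_pos: "0 < green_const TYPE('d::finite)"
  unfolding green_const_def using decay_rate by (intro divide_pos_pos) (auto simp: card_gt_0_iff)

text \<open>Telescoping from scale k to a scale K costs at most the tail of a geometric series,
  independently of K. The average at scale K is at most the l2 norm over its block divided by the
  square root of the volume; a large K turns this into the error term with the prescribed constant
  b.\<close>

lemma dyadic_avg_dominated:
  fixes x :: "int ^ 'd::finite"
  assumes d: "CARD('d) \<ge> 3"
  shows "dominated (green_const TYPE('d) * decay_rate ^ k) (\<lambda>u. \<bar>dyadic_avg k u x\<bar>)"
  unfolding dominated_def
proof (intro allI impI)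
  fix b :: real assume b: "0 < b"
  let ?q = decay_rate
  have tele: "\<exists>E. bond_set E \<and> (\<forall>u. \<bar>dyadic_avg (k + j) u x - dyadic_avg k u x\<bar>
      \<le> real CARD('d) / 2 * ?q ^ k * (\<Sum>i<j. ?q ^ i) * edge_norm E u)" for j
  proof (induction j)
    case 0
    then show ?case by (auto simp: bond_set_def intro!: exI[of _ "{}"])
  next
    case (Suc j)
    then obtain E where E: "bond_set E" "\<And>u. \<bar>dyadic_avg (k + j) u x - dyadic_avg k u x\<bar>
      \<le> real CARD('d) / 2 * ?q ^ k * (\<Sum>i<j. ?q ^ i) * edge_norm E u" by blast
    obtain E' where E': "bond_set E'" "\<And>u. \<bar>dyadic_avg (Suc (k + j)) u x - dyadic_avg (k + j) u x\<bar>
      \<le> real CARD('d) / 2 * ?q ^ (k + j) * edge_norm E' u"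
      using dyadic_avg_step[OF d] by blast
    have fin: "finite (E \<union> E')" using E E' by (auto simp: bond_set_def)
    have "\<bar>dyadic_avg (k + Suc j) u x - dyadic_avg k u x\<bar>
      \<le> real CARD('d) / 2 * ?q ^ k * (\<Sum>i<Suc j. ?q ^ i) * edge_norm (E \<union> E') u" for u
    proof -
      have "real CARD('d) / 2 * ?q ^ k * (\<Sum>i<j. ?q ^ i) * edge_norm E u
          \<le> real CARD('d) / 2 * ?q ^ k * (\<Sum>i<j. ?q ^ i) * edge_norm (E \<union> E') u"
        using decay_rate fin by (intro mult_left_mono edge_norm_mono) (auto intro!: mult_nonneg_nonneg sum_nonneg)
      moreover have "real CARD('d) / 2 * ?q ^ (k + j) * edge_norm E' u \<le> real CARD('d) / 2 * ?q ^ (k + j) * edge_norm (E \<union> E') u"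
        using decay_rate fin by (intro mult_left_mono edge_norm_mono) auto
      moreover have "real CARD('d) / 2 * ?q ^ k * (\<Sum>i<Suc j. ?q ^ i) * edge_norm (E \<union> E') u
        = real CARD('d) / 2 * ?q ^ k * (\<Sum>i<j. ?q ^ i) * edge_norm (E \<union> E') u + real CARD('d) / 2 * ?q ^ (k + j) * edge_norm (E \<union> E') u"
        by (simp add: algebra_simps power_add)
      moreover have "\<bar>dyadic_avg (k + Suc j) u x - dyadic_avg k u x\<bar>
          \<le> \<bar>dyadic_avg (Suc (k + j)) u x - dyadic_avg (k + j) u x\<bar> + \<bar>dyadic_avg (k + j) u x - dyadic_avg k u x\<bar>"
        unfolding add_Suc_right by linarith
      ultimately show ?thesis using E(2)[of u] E'(2)[of u] by linarith
    qed
    then show ?case using bond_set_Un[OF E(1) E'(1)] by blast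
  qed
  \<comment> \<open>The volume at scale K is at least 2^K, so the factor in front of the l2 norm is
    at most \<open>decay_rate\<close> ^ K; hence the condition on j0.\<close>
  obtain j0 where j0: "?q ^ j0 < b" using real_arch_pow_inv[of b ?q] b decay_rate by auto
  define K where "K = k + j0"
  have "?q ^ K \<le> ?q ^ j0" unfolding K_def using decay_rate by (intro power_decreasing) auto
  then have qK: "?q ^ K \<le> b" using j0 by simp
  obtain E where E: "bond_set E" "\<And>u. \<bar>dyadic_avg K u x - dyadic_avg k u x\<bar>
      \<le> real CARD('d) / 2 * ?q ^ k * (\<Sum>i<j0. ?q ^ i) * edge_norm E u" unfolding K_def using tele by blast
  let ?B = "block (\<lambda>_::'d. 2 ^ K)" and ?n = "real (card (block (\<lambda>_::'d. 2 ^ K)))"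
  define X where "X = (\<lambda>w. x + w) ` ?B"
  have n1: "2 ^ K \<le> ?n"
  proof -
    have "(2 ^ K) ^ 1 \<le> ((2 ^ K) ^ CARD('d) :: nat)" using d by (intro power_increasing) auto
    then have "2 ^ K \<le> card ?B" by (simp add: card_block)
    then show ?thesis by (metis of_nat_le_iff of_nat_numeral of_nat_power)
  qed
  have geo: "(\<Sum>i<j0. ?q ^ i) \<le> 1 / (1 - ?q)"
    using decay_rate by (simp add: sum_gp_strict divide_right_mono)
  have "\<bar>dyadic_avg k u x\<bar> \<le> green_const TYPE('d) * ?q ^ k * edge_norm E u + b * L2_set u X" for u
  proof -
    have "\<bar>dyadic_avg K u x\<bar> \<le> sqrt ?n * L2_set (\<lambda>w. u (x + w)) ?B / ?n"
      unfolding block_avg_def abs_divide by (intro order_trans[OF divide_right_mono[OF abs_sum_le_L2_set]]) auto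
    also have "L2_set (\<lambda>w. u (x + w)) ?B = L2_set u X"
      unfolding X_def by (subst L2_set_image) auto
    also have "sqrt ?n * L2_set u X / ?n = 1 / sqrt ?n * L2_set u X"
      using n1 by (cases "?n = 0") (auto simp: real_div_sqrt field_simps)
    also have "\<dots> \<le> ?q ^ K * L2_set u X"
    proof (intro mult_right_mono)
      have "1 / sqrt ?n \<le> 1 / sqrt (2 ^ K)" using n1 by (intro frac_le) auto
      then show "1 / sqrt ?n \<le> ?q ^ K" by (simp add: decay_rate_def real_sqrt_divide real_sqrt_power power_divide)
    qed auto
    also have "\<dots> \<le> b * L2_set u X" using qK by (intro mult_right_mono) auto
    finally have 1: "\<bar>dyadic_avg K u x\<bar> \<le> b * L2_set u X" .
    have "real CARD('d) / 2 * ?q ^ k * (\<Sum>i<j0. ?q ^ i) \<le> real CARD('d) / 2 * ?q ^ k * (1 / (1 - ?q))"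
      using geo decay_rate by (intro mult_left_mono) auto
    also have "\<dots> = green_const TYPE('d) * ?q ^ k" by (simp add: green_const_def)
    finally have "real CARD('d) / 2 * ?q ^ k * (\<Sum>i<j0. ?q ^ i) * edge_norm E u \<le> green_const TYPE('d) * ?q ^ k * edge_norm E u"
      by (intro mult_right_mono) auto
    with 1 E(2)[of u] show ?thesis by linarith
  qed
  moreover have "finite X" by (simp add: X_def)
  ultimately show "\<exists>E X. bond_set E \<and> finite X \<and> (\<forall>u. \<bar>dyadic_avg k u x\<bar> \<le> green_const TYPE('d) * decay_rate ^ k * edge_norm E u + b * L2_set u X)"
    using E(1) by blast
qed

lemma block_one: "block (\<lambda>_::'d::finite. 1) = {0}"
proof (intro equalityI subsetI)
  fix y :: "int ^ 'd" assume "y \<in> block (\<lambda>_. 1)"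
  then have "0 \<le> y $ i \<and> y $ i < 1" for i by (simp add: block_def)
  then have "y $ i = 0" for i by (smt (verit))
  then show "y \<in> {0}" by (simp add: vec_eq_iff)
qed (simp add: block_def)

lemma dyadic_avg_0: "dyadic_avg 0 u x = u x"
  by (simp add: block_avg_def block_one[simplified])

lemma site_dominated:
  fixes x :: "int ^ 'd::finite"
  assumes "CARD('d) \<ge> 3"
  shows "dominated (green_const TYPE('d)) (\<lambda>u. \<bar>u x\<bar>)"
  using dyadic_avg_dominated[OF assms, of 0 x] by (simp add: dyadic_avg_0[simplified])

lemma block_avg_minus_site:
  fixes s :: "'d::finite \<Rightarrow> nat"
  assumes "block s \<noteq> {}"
  shows "u y - block_avg s u y = (\<Sum>w\<in>block s. (u y - u (y + w)) / real (card (block s)))"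
  using assms by (simp add: block_avg_def sum_divide_distrib[symmetric] sum_subtractf diff_divide_distrib)

lemma block_nonempty: "block (\<lambda>_::'d::finite. 2 ^ k) \<noteq> {}"
proof -
  have "0 \<in> block (\<lambda>_::'d. 2 ^ k)" by (simp add: block_def)
  then show ?thesis by blast
qed

text \<open>Each difference between a site and a fixed translate of it has a bound uniform in
  \<open>Y\<close>, and the block contains finitely many translates. The constant depends on the
  block but not on \<open>Y\<close>, so it does not grow with the number of sites.\<close>

lemma block_oscillation:
  fixes s :: "'d::finite \<Rightarrow> nat"
  assumes ne: "block s \<noteq> {}"
  obtains C where "0 \<le> C" "\<And>Y. finite Y \<Longrightarrow>
    \<exists>E. bond_set E \<and> (\<forall>u. L2_set (\<lambda>y. u y - block_avg s u y) Y \<le> C * edge_norm E u)"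
proof -
  obtain c where c: "\<And>w :: int ^ 'd. 0 \<le> c w" "\<And>w :: int ^ 'd. translation_bound w (c w)"
    using translation_bound_exists by metis
  let ?B = "block s"
  define C where "C = (\<Sum>w\<in>?B. c w)"
  show ?thesis
  proof (rule that[of C])
    show "0 \<le> C" unfolding C_def using c by (intro sum_nonneg) auto
    fix Y :: "(int ^ 'd) set" assume Y: "finite Y"
    have "\<exists>E. bond_set E \<and> (\<forall>u. L2_set (\<lambda>y. u (y + w) - u y) Y \<le> c w * edge_norm E u)" for w
      using c(2)[of w] Y unfolding translation_bound_def by blast
    then obtain E where E: "\<And>w. bond_set (E w)" "\<And>w u. L2_set (\<lambda>y. u (y + w) - u y) Y \<le> c w * edge_norm (E w) u"
      by metis
    define E' where "E' = (\<Union>w\<in>?B. E w)"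
    have E': "bond_set E'" using E(1) by (auto simp: bond_set_def E'_def)
    have "L2_set (\<lambda>y. u y - block_avg s u y) Y \<le> C * edge_norm E' u" for u
    proof -
      let ?n = "real (card ?B)"
      have n: "1 \<le> ?n" using ne by (simp add: Suc_le_eq card_gt_0_iff)
      have "L2_set (\<lambda>y. u y - block_avg s u y) Y \<le> (\<Sum>w\<in>?B. L2_set (\<lambda>y. (u y - u (y + w)) / ?n) Y)"
        unfolding block_avg_minus_site[OF ne] by (rule L2_set_sum_le) simp
      also have "\<dots> \<le> (\<Sum>w\<in>?B. c w * edge_norm E' u)"
      proof (intro sum_mono)
        fix w assume w: "w \<in> ?B"
        have "L2_set (\<lambda>y. (u y - u (y + w)) / ?n) Y = L2_set (\<lambda>y. (u (y + w) - u y) * (1 / ?n)) Y"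
          by (subst L2_set_uminus[symmetric]) (simp add: minus_divide_left)
        also have "\<dots> = L2_set (\<lambda>y. u (y + w) - u y) Y * (1 / ?n)"
          by (rule L2_set_left_distrib[symmetric]) simp
        also have "\<dots> \<le> L2_set (\<lambda>y. u (y + w) - u y) Y * 1"
          using n by (intro mult_left_mono) auto
        also have "\<dots> \<le> c w * edge_norm (E w) u" using E(2) by simp
        also have "\<dots> \<le> c w * edge_norm E' u"
          using E' w c by (intro mult_left_mono edge_norm_mono) (auto simp: bond_set_def E'_def)
        finally show "L2_set (\<lambda>y. (u y - u (y + w)) / ?n) Y \<le> c w * edge_norm E' u" .
      qed
      finally show ?thesis by (simp add: C_def sum_distrib_right)
    qed
    then show "\<exists>E. bond_set E \<and> (\<forall>u. L2_set (\<lambda>y. u y - block_avg s u y) Y \<le> C * edge_norm E u)"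
      using E' by blast
  qed
qed

text \<open>The field is split into its block average at a scale J, dominated with a small constant,
  and the oscillation around it, whose l2 norm over N sites is bounded uniformly in N and which
  therefore averages to order 1 / sqrt N. The scale J is fixed first because the oscillation
  constant depends on it.\<close>

lemma ergodic_avg_dominated:
  fixes x z :: "int ^ 'd::finite"
  assumes d: "CARD('d) \<ge> 3" and z: "z \<noteq> 0" and e: "0 < e"
  obtains N0 where "\<And>N. N0 \<le> N \<Longrightarrow> dominated e (\<lambda>u. (\<Sum>k<N. \<bar>u (x + int k *s z)\<bar>) / real N)"
proof -
  let ?G = "green_const TYPE('d)"
  have G: "0 < ?G" by (rule green_const_pos)
  obtain J where J: "decay_rate ^ J < e / (2 * ?G)"
    using real_arch_pow_inv[of "e / (2 * ?G)" decay_rate] decay_rate e G by auto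
  then have J': "?G * decay_rate ^ J \<le> e / 2" using G by (simp add: field_simps)
  obtain C where C: "0 \<le> C" "\<And>Y :: (int ^ 'd) set. finite Y \<Longrightarrow>
    \<exists>E. bond_set E \<and> (\<forall>u. L2_set (\<lambda>y. u y - dyadic_avg J u y) Y \<le> C * edge_norm E u)"
    by (rule block_oscillation[OF block_nonempty[where 'd = 'd, of J]]; rule that; assumption)
  obtain N0 :: nat where N0: "(2 * C / e)\<^sup>2 < real N0" using reals_Archimedean2 by blast
  show ?thesis
  proof (rule that[of "max 1 N0"])
    fix N assume "max 1 N0 \<le> N"
    then have N: "1 \<le> N" "(2 * C / e)\<^sup>2 \<le> real N" using N0 by linarith+
    define g where "g k = x + int k *s z" for k
    \<comment> \<open>Here z \<noteq> 0 enters: the N sites are distinct, so that a sum over k is a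
      sum over a set of N sites.\<close>
    have inj: "inj g"
    proof (rule injI)
      fix k l assume "g k = g l"
      then have "int k * z $ i = int l * z $ i" for i unfolding g_def by (metis add_left_cancel vector_smult_component)
      moreover obtain i where "z $ i \<noteq> 0" using z by (auto simp: vec_eq_iff)
      ultimately show "k = l" by (metis mult_right_cancel of_nat_eq_iff)
    qed
    obtain E where E: "bond_set E" "\<And>u. L2_set (\<lambda>y. u y - dyadic_avg J u y) (g ` {..<N}) \<le> C * edge_norm E u"
      using C(2)[of "g ` {..<N}"] by auto
    have "C / sqrt (real N) \<le> e / 2"
    proof -
      have "sqrt ((2 * C / e)\<^sup>2) \<le> sqrt (real N)" using N by (intro real_sqrt_le_mono)
      then have "2 * C / e \<le> sqrt (real N)" using C e by simp
      then show ?thesis using N e by (simp add: field_simps)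
    qed
    have "dominated (e / 2) (\<lambda>u. (\<Sum>k<N. \<bar>u (g k) - dyadic_avg J u (g k)\<bar>) / real N)"
    proof (rule dominated_edge_norm[OF E(1)])
      fix u
      have "(\<Sum>k<N. \<bar>u (g k) - dyadic_avg J u (g k)\<bar>) \<le> sqrt (card {..<N}) * L2_set (\<lambda>k. \<bar>u (g k) - dyadic_avg J u (g k)\<bar>) {..<N}"
        using abs_sum_le_L2_set[of "\<lambda>k. \<bar>u (g k) - dyadic_avg J u (g k)\<bar>" "{..<N}"] by simp
      also have "L2_set (\<lambda>k. \<bar>u (g k) - dyadic_avg J u (g k)\<bar>) {..<N} = L2_set (\<lambda>y. u y - dyadic_avg J u y) (g ` {..<N})"
        by (subst L2_set_image[OF inj_on_subset[OF inj subset_UNIV]]) (simp add: L2_set_def)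
      also have "sqrt (card {..<N}) * \<dots> \<le> sqrt (real N) * (C * edge_norm E u)"
        using E(2)[of u] by (intro mult_mono) auto
      finally have "(\<Sum>k<N. \<bar>u (g k) - dyadic_avg J u (g k)\<bar>) / real N \<le> sqrt (real N) * (C * edge_norm E u) / real N"
        by (intro divide_right_mono) auto
      also have "\<dots> = C / sqrt (real N) * edge_norm E u" using N by (simp add: real_div_sqrt field_simps)
      also have "\<dots> \<le> e / 2 * edge_norm E u" using \<open>C / sqrt (real N) \<le> e / 2\<close> by (intro mult_right_mono) auto
      finally show "(\<Sum>k<N. \<bar>u (g k) - dyadic_avg J u (g k)\<bar>) / real N \<le> e / 2 * edge_norm E u" .
    qed
    moreover have "dominated (1 / real N * (real (card {..<N}) * (?G * decay_rate ^ J))) (\<lambda>u. 1 / real N * (\<Sum>k<N. \<bar>dyadic_avg J u (g k)\<bar>))"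
      using G decay_rate by (intro dominated_cmult dominated_sum dyadic_avg_dominated[OF d]) auto
    then have "dominated (e / 2) (\<lambda>u. 1 / real N * (\<Sum>k<N. \<bar>dyadic_avg J u (g k)\<bar>))"
      by (rule dominated_mono_const) (use N J' in simp)
    ultimately have "dominated (e / 2 + e / 2) (\<lambda>u. (\<Sum>k<N. \<bar>u (g k) - dyadic_avg J u (g k)\<bar>) / real N + 1 / real N * (\<Sum>k<N. \<bar>dyadic_avg J u (g k)\<bar>))"
      using e by (intro dominated_add) auto
    then have "dominated e (\<lambda>u. (\<Sum>k<N. \<bar>u (g k) - dyadic_avg J u (g k)\<bar>) / real N + 1 / real N * (\<Sum>k<N. \<bar>dyadic_avg J u (g k)\<bar>))"
      by simp
    then show "dominated e (\<lambda>u. (\<Sum>k<N. \<bar>u (x + int k *s z)\<bar>) / real N)"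
    proof (rule dominated_mono)
      fix u
      have "(\<Sum>k<N. \<bar>u (g k)\<bar>) \<le> (\<Sum>k<N. \<bar>u (g k) - dyadic_avg J u (g k)\<bar> + \<bar>dyadic_avg J u (g k)\<bar>)"
        by (intro sum_mono) auto
      then have "(\<Sum>k<N. \<bar>u (g k)\<bar>) / real N \<le> ((\<Sum>k<N. \<bar>u (g k) - dyadic_avg J u (g k)\<bar>) + (\<Sum>k<N. \<bar>dyadic_avg J u (g k)\<bar>)) / real N"
        unfolding sum.distrib by (intro divide_right_mono) auto
      then show "(\<Sum>k<N. \<bar>u (x + int k *s z)\<bar>) / real N
        \<le> (\<Sum>k<N. \<bar>u (g k) - dyadic_avg J u (g k)\<bar>) / real N + 1 / real N * (\<Sum>k<N. \<bar>dyadic_avg J u (g k)\<bar>)"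
        by (simp add: g_def add_divide_distrib)
    qed
  qed
qed

section \<open>Cubes, boundaries and fields of finite support\<close>

definition cube :: "nat \<Rightarrow> (int ^ 'd::finite) set" where
  "cube L = {x. \<forall>i. \<bar>x $ i\<bar> \<le> int L}"

lemma finite_cube[simp]: "finite (cube L :: (int ^ 'd::finite) set)" and card_cube: "card (cube L :: (int ^ 'd::finite) set) = (2 * L + 1) ^ CARD('d)"
proof -
  have e: "(cube L :: (int ^ 'd) set) = {w. \<forall>i. w $ i \<in> {- int L..int L}}" by (simp add: cube_def abs_le_iff minus_le_iff conj_commute)
  show "finite (cube L :: (int ^ 'd) set)" unfolding e by (rule card_vec_box) auto
  have "nat (int L + 1 + int L) = 2 * L + 1" by simp
  then show "card (cube L :: (int ^ 'd) set) = (2 * L + 1) ^ CARD('d)" unfolding e by (subst card_vec_box(2)) auto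
qed

definition boundary_bonds :: "(int ^ 'd::finite) set \<Rightarrow> ((int ^ 'd) \<times> (int ^ 'd)) set" where
  "boundary_bonds \<Lambda> = {(x, y). x \<in> \<Lambda> \<and> y \<notin> \<Lambda> \<and> nearest_neighbour x y}"

lemma finite_boundary_bonds: "finite \<Lambda> \<Longrightarrow> finite (boundary_bonds \<Lambda>)"
proof -
  assume f: "finite \<Lambda>"
  have "boundary_bonds \<Lambda> \<subseteq> (\<lambda>(x, i). (x, x + axis i 1)) ` (\<Lambda> \<times> UNIV) \<union> (\<lambda>(x, i). (x, x - axis i 1)) ` (\<Lambda> \<times> UNIV)"
    by (auto simp: boundary_bonds_def elim!: nearest_neighbourE)
  then show ?thesis by (rule finite_subset) (use f in simp)
qed

text \<open>A bond that leaves the cube starts in its outermost layer and is determined by its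
  starting point, a coordinate and a sign. The successor makes this layer a difference of two
  cubes.\<close>

lemma card_boundary_bonds_cube:
  "card (boundary_bonds (cube (Suc L) :: (int ^ 'd::finite) set)) \<le> 2 * CARD('d) * ((2 * Suc L + 1) ^ CARD('d) - (2 * L + 1) ^ CARD('d))"
proof -
  let ?D = "cube (Suc L) - cube L :: (int ^ 'd) set"
  have sub: "cube L \<subseteq> (cube (Suc L) :: (int ^ 'd) set)" by (auto simp: cube_def intro: order_trans)
  have in1: "x \<in> ?D" if "x \<in> cube (Suc L)" "y \<notin> cube (Suc L)" "nearest_neighbour x y" for x y :: "int ^ 'd"
  proof -
    have "y \<in> cube (Suc L)" if "x \<in> cube L"
    proof -
      obtain i where i: "y = x + axis i 1 \<or> y = x - axis i 1" using \<open>nearest_neighbour x y\<close> by (rule nearest_neighbourE)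
      show ?thesis unfolding cube_def
      proof (intro CollectI allI)
        fix j
        have "\<bar>x $ j\<bar> \<le> int L" using that by (simp add: cube_def)
        moreover have "\<bar>y $ j - x $ j\<bar> \<le> 1" using i by (auto simp: axis_def)
        ultimately show "\<bar>y $ j\<bar> \<le> int (Suc L)" by linarith
      qed
    qed
    then show ?thesis using that by auto
  qed
  let ?f = "\<lambda>(x :: int ^ 'd, i :: 'd, b). (x, if b then x + axis i 1 else x - axis i 1)"
  have "boundary_bonds (cube (Suc L)) \<subseteq> ?f ` (?D \<times> UNIV \<times> (UNIV :: bool set))"
  proof
    fix p :: "(int ^ 'd) \<times> (int ^ 'd)" assume "p \<in> boundary_bonds (cube (Suc L))"
    then obtain x y where p: "p = (x, y)" "x \<in> cube (Suc L)" "y \<notin> cube (Suc L)" "nearest_neighbour x y"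
      by (auto simp: boundary_bonds_def)
    obtain i where i: "y = x + axis i 1 \<or> y = x - axis i 1" using p(4) by (rule nearest_neighbourE)
    then obtain b where "y = (if b then x + axis i 1 else x - axis i 1)" by (metis (full_types))
    then have "p = ?f (x, i, b)" using p by simp
    then show "p \<in> ?f ` (?D \<times> UNIV \<times> (UNIV :: bool set))" using in1[OF p(2-4)] by blast
  qed
  then have "card (boundary_bonds (cube (Suc L) :: (int ^ 'd) set)) \<le> card (?D \<times> (UNIV :: 'd set) \<times> (UNIV :: bool set))"
    by (rule surj_card_le[rotated]) simp
  also have "\<dots> = 2 * CARD('d) * card ?D" by (simp add: card_cartesian_product UNIV_bool)
  also have "card ?D = (2 * Suc L + 1) ^ CARD('d) - (2 * L + 1) ^ CARD('d)"
    using card_Diff_subset[OF _ sub] by (simp add: card_cube)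
  finally show ?thesis .
qed

text \<open>The numerator belongs to a cube larger by a fixed width, which will contain the support
  of a local observable translated over the smaller cube. After division both volumes in the
  estimate of the layer tend to 1, so their difference vanishes.\<close>

lemma cube_boundary_ratio:
  "(\<lambda>L. real (card (boundary_bonds (cube (L + Suc r) :: (int ^ 'd::finite) set))) / real (card (cube L :: (int ^ 'd) set))) \<longlonglongrightarrow> 0"
proof (rule tendsto_sandwich[where f = "\<lambda>_. 0"])
  let ?g = "\<lambda>L::nat. 2 * real CARD('d) * ((real (2 * (L + Suc r) + 1) / real (2 * L + 1)) ^ CARD('d) - (real (2 * (L + r) + 1) / real (2 * L + 1)) ^ CARD('d))"
  show "\<forall>\<^sub>F L in sequentially. real (card (boundary_bonds (cube (L + Suc r) :: (int ^ 'd) set))) / real (card (cube L :: (int ^ 'd) set)) \<le> ?g L"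
  proof (intro always_eventually allI)
    fix L
    have mono: "(2 * (L + r) + 1) ^ CARD('d) \<le> (2 * (L + Suc r) + 1) ^ CARD('d)" by (intro power_mono) auto
    have "real (card (boundary_bonds (cube (L + Suc r) :: (int ^ 'd) set)))
        \<le> real (2 * CARD('d) * ((2 * (L + Suc r) + 1) ^ CARD('d) - (2 * (L + r) + 1) ^ CARD('d)))"
      using card_boundary_bonds_cube[where 'd = 'd, of "L + r"] unfolding add_Suc_right of_nat_le_iff .
    also have "\<dots> = 2 * real CARD('d) * (real (2 * (L + Suc r) + 1) ^ CARD('d) - real (2 * (L + r) + 1) ^ CARD('d))"
      by (simp add: of_nat_diff[OF mono] del: of_nat_add)
    finally have "real (card (boundary_bonds (cube (L + Suc r) :: (int ^ 'd) set))) / real (card (cube L :: (int ^ 'd) set))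
        \<le> 2 * real CARD('d) * (real (2 * (L + Suc r) + 1) ^ CARD('d) - real (2 * (L + r) + 1) ^ CARD('d)) / real (card (cube L :: (int ^ 'd) set))"
      by (intro divide_right_mono) auto
    also have "\<dots> = ?g L" unfolding card_cube of_nat_power power_divide diff_divide_distrib[symmetric] by simp
    finally show "real (card (boundary_bonds (cube (L + Suc r) :: (int ^ 'd) set))) / real (card (cube L :: (int ^ 'd) set)) \<le> ?g L" .
  qed
  have r1: "(\<lambda>L::nat. real (2 * (L + k) + 1) / real (2 * L + 1)) \<longlonglongrightarrow> 1" for k :: nat
    by real_asymp
  have "?g \<longlonglongrightarrow> 2 * real CARD('d) * (1 ^ CARD('d) - 1 ^ CARD('d))"
    by (intro tendsto_intros r1)
  then show "?g \<longlonglongrightarrow> 0" by simp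
qed auto

lemma finite_lattice_closure: "finite \<Lambda> \<Longrightarrow> finite (lattice_closure \<Lambda> :: (int ^ 'd::finite) set)"
proof -
  assume f: "finite \<Lambda>"
  have "lattice_closure \<Lambda> \<subseteq> \<Lambda> \<union> (\<lambda>(x, i). x + axis i 1) ` (\<Lambda> \<times> UNIV) \<union> (\<lambda>(x, i). x - axis i 1) ` (\<Lambda> \<times> UNIV)"
  proof
    fix x assume "x \<in> lattice_closure \<Lambda>"
    then consider "x \<in> \<Lambda>" | y where "y \<in> \<Lambda>" "nearest_neighbour y x"
      by (auto simp: lattice_closure_def nearest_neighbour_sym)
    then show "x \<in> \<Lambda> \<union> (\<lambda>(x, i). x + axis i 1) ` (\<Lambda> \<times> UNIV) \<union> (\<lambda>(x, i). x - axis i 1) ` (\<Lambda> \<times> UNIV)"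
    proof cases
      case 2
      obtain i where "x = y + axis i 1 \<or> x = y - axis i 1" using 2(2) by (rule nearest_neighbourE)
      then show ?thesis using 2(1) by auto
    qed auto
  qed
  then show ?thesis by (rule finite_subset) (use f in simp)
qed

lemma bond_set_lattice_edges: "finite \<Lambda> \<Longrightarrow> bond_set (lattice_edges \<Lambda>)"
proof -
  assume f: "finite \<Lambda>"
  have "lattice_edges \<Lambda> \<subseteq> lattice_closure \<Lambda> \<times> lattice_closure \<Lambda>" by (auto simp: lattice_edges_def)
  then have "finite (lattice_edges \<Lambda>)" by (rule finite_subset) (use finite_lattice_closure[OF f] in simp)
  then show ?thesis by (auto simp: bond_set_def lattice_edges_def)
qed

lemma lattice_edges_touching:
  "nearest_neighbour x y \<Longrightarrow> x \<in> \<Lambda> \<or> y \<in> \<Lambda> \<Longrightarrow> (x, y) \<in> lattice_edges \<Lambda>"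
  using nearest_neighbour_sym[of x y] by (auto simp: lattice_edges_def lattice_closure_def)

text \<open>Edges that do not touch the support contribute 0. Hence the unspecified edge sets of the
  general estimates can be replaced by the edges in the Hamiltonian of \<Lambda>.\<close>

lemma edge_norm_supported:
  assumes "bond_set E" "finite \<Lambda>" "\<And>x. x \<notin> \<Lambda> \<Longrightarrow> u x = 0"
  shows "edge_norm E u \<le> edge_norm (lattice_edges \<Lambda>) u"
proof -
  let ?E = "E \<inter> lattice_edges \<Lambda>"
  have fin: "finite E" "finite (lattice_edges \<Lambda>)" using assms bond_set_lattice_edges by (auto simp: bond_set_def)
  have "u x - u y = 0" if "(x, y) \<in> E - ?E" for x y
  proof -
    have "nearest_neighbour x y" using that assms(1) by (auto simp: bond_set_def)
    then have "x \<notin> \<Lambda>" "y \<notin> \<Lambda>" using that lattice_edges_touching by blast+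
    then show ?thesis using assms(3) by simp
  qed
  then have "\<forall>p\<in>E - ?E. (case p of (x, y) \<Rightarrow> u x - u y)\<^sup>2 = 0" by fastforce
  then have "edge_norm E u = edge_norm ?E u"
    unfolding edge_norm_def L2_set_def using fin by (intro arg_cong[where f = sqrt] sum.mono_neutral_right) blast+
  also have "\<dots> \<le> edge_norm (lattice_edges \<Lambda>) u" using fin by (intro edge_norm_mono) auto
  finally show ?thesis .
qed

text \<open>A translation takes x to a site outside \<Lambda>, where the field vanishes, so the
  value at x is itself a difference. The constant depends on \<Lambda>, in contrast to the bounds
  from block averages; it serves integrability and the continuity of kernels.\<close>

lemma dirichlet_bound:
  fixes \<Lambda> :: "(int ^ 'd::finite) set"
  assumes "finite \<Lambda>"
  obtains C where "0 \<le> C" "\<And>u x. (\<And>x. x \<notin> \<Lambda> \<Longrightarrow> u x = 0) \<Longrightarrow> \<bar>u x\<bar> \<le> C * edge_norm (lattice_edges \<Lambda>) u"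
proof -
  have ex: "\<exists>C\<ge>0. \<forall>u. (\<forall>x. x \<notin> \<Lambda> \<longrightarrow> u x = 0) \<longrightarrow> \<bar>u x\<bar> \<le> C * edge_norm (lattice_edges \<Lambda>) u" for x :: "int ^ 'd"
  proof -
    have "infinite (UNIV :: (int ^ 'd) set)"
    proof
      assume "finite (UNIV :: (int ^ 'd) set)"
      then have "finite (range (\<lambda>a::int. axis (undefined :: 'd) a))" using finite_subset[OF subset_UNIV] by blast
      moreover have "inj (\<lambda>a::int. axis (undefined :: 'd) a)" by (auto simp: inj_def axis_eq_axis)
      ultimately show False using finite_imageD infinite_UNIV_int by blast
    qed
    then obtain y where y: "y \<notin> \<Lambda>" using assms ex_new_if_finite by blast
    obtain C where C: "0 \<le> C" "translation_bound (y - x) C" by (rule translation_bound_exists)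
    then obtain E where E: "bond_set E" "\<And>u. L2_set (\<lambda>z. u (z + (y - x)) - u z) {x} \<le> C * edge_norm E u"
      unfolding translation_bound_def by (meson finite.emptyI finite.insertI)
    show ?thesis
    proof (intro exI[of _ C] conjI C allI impI)
      fix u :: "'d config" assume u: "\<forall>x. x \<notin> \<Lambda> \<longrightarrow> u x = 0"
      have "\<bar>u x\<bar> = L2_set (\<lambda>z. u (z + (y - x)) - u z) {x}"
        using u y by simp
      also have "\<dots> \<le> C * edge_norm E u" by (rule E)
      also have "\<dots> \<le> C * edge_norm (lattice_edges \<Lambda>) u"
        using C E(1) assms u by (intro mult_left_mono edge_norm_supported) auto
      finally show "\<bar>u x\<bar> \<le> C * edge_norm (lattice_edges \<Lambda>) u" .
    qed
  qed
  obtain c where c: "\<And>x. 0 \<le> c x" "\<And>x u. (\<And>x. x \<notin> \<Lambda> \<Longrightarrow> u x = 0) \<Longrightarrow> \<bar>u x\<bar> \<le> c x * edge_norm (lattice_edges \<Lambda>) u"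
    using ex by metis
  show ?thesis
  proof (rule that[of "\<Sum>x\<in>\<Lambda>. c x"])
    show "0 \<le> (\<Sum>x\<in>\<Lambda>. c x)" using c by (intro sum_nonneg) auto
    fix u x assume u: "\<And>x. x \<notin> \<Lambda> \<Longrightarrow> u x = (0::real)"
    show "\<bar>u x\<bar> \<le> (\<Sum>x\<in>\<Lambda>. c x) * edge_norm (lattice_edges \<Lambda>) u"
    proof (cases "x \<in> \<Lambda>")
      case True
      have "\<bar>u x\<bar> \<le> c x * edge_norm (lattice_edges \<Lambda>) u" using c(2) u by blast
      also have "\<dots> \<le> (\<Sum>x\<in>\<Lambda>. c x) * edge_norm (lattice_edges \<Lambda>) u"
        using True assms c(1) by (intro mult_right_mono member_le_sum) auto
      finally show ?thesis .
    next
      case False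
      then show ?thesis using u c(1) by (auto intro!: mult_nonneg_nonneg sum_nonneg)
    qed
  qed
qed

section \<open>Finite-volume Gibbs measures\<close>

text \<open>
  The two inequalities at the end are all that is used of \<open>c \<le> V'' \<le> C\<close>: uniform convexity in
  midpoint form and, for changes of the boundary condition, Lipschitz continuity of \<open>V'\<close>.
\<close>

locale convex_potential =
  fixes V :: "real \<Rightarrow> real" and c C :: real
  assumes c_pos: "0 < c" and C_nonneg: "0 \<le> C"
    and V_even: "V (- t) = V t"
    and V_continuous: "continuous_on UNIV V"
    and V_midpoint: "2 * V ((a + b) / 2) + c / 4 * (a - b)\<^sup>2 \<le> V a + V b"
    and V_mixed: "\<bar>(V (b + h) - V b) - (V (b' + h) - V b')\<bar> \<le> C * (\<bar>h\<bar> * \<bar>b - b'\<bar>)"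
begin

abbreviation lattice_gibbs :: "(int ^ 'd) set \<Rightarrow> real \<Rightarrow> 'd config \<Rightarrow> 'd config measure" where
  "lattice_gibbs \<Lambda> \<equiv> finite_gibbs V (lattice_edges \<Lambda>) \<Lambda>"

lemma V_measurable[measurable]: "V \<in> borel_measurable borel"
  by (intro borel_measurable_continuous_onI V_continuous)

lemma V_lower: "V 0 + c / 2 * t\<^sup>2 \<le> V t"
  using V_midpoint[of t "- t"] V_even[of t] by (simp add: power2_eq_square)

text \<open>Normalised so that the Hamiltonian satisfies the midpoint inequality with defect
  \<open>energy_form\<close> / 4, the form q^2 / 4 required by the abstract comparison.\<close>

definition energy_form :: "('v \<times> 'v) set \<Rightarrow> 'v set \<Rightarrow> real \<Rightarrow> ('v \<Rightarrow> real) \<Rightarrow> real" where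
  "energy_form E \<Lambda> m u = c / 2 * (edge_norm E u)\<^sup>2 + m\<^sup>2 * (L2_set u \<Lambda>)\<^sup>2"

lemma energy_form_nonneg: "0 \<le> energy_form E \<Lambda> m u"
  using c_pos by (simp add: energy_form_def)

lemma edge_norm_le_energy: "edge_norm E u \<le> sqrt (2 / c) * sqrt (energy_form E \<Lambda> m u)"
proof -
  have "(edge_norm E u)\<^sup>2 \<le> 2 / c * energy_form E \<Lambda> m u"
    using c_pos by (simp add: energy_form_def field_simps)
  then have "sqrt ((edge_norm E u)\<^sup>2) \<le> sqrt (2 / c * energy_form E \<Lambda> m u)" by (rule real_sqrt_le_mono)
  then show ?thesis unfolding real_sqrt_mult by simp
qed

lemma L2_set_le_energy: "0 < m \<Longrightarrow> L2_set u \<Lambda> \<le> 1 / m * sqrt (energy_form E \<Lambda> m u)"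
proof -
  assume m: "0 < m"
  have "(m * L2_set u \<Lambda>)\<^sup>2 \<le> energy_form E \<Lambda> m u"
    using c_pos by (simp add: energy_form_def power_mult_distrib)
  then have "m * L2_set u \<Lambda> \<le> sqrt (energy_form E \<Lambda> m u)" by (rule real_le_rsqrt)
  then show ?thesis using m by (simp add: field_simps)
qed

lemma sum_edge_norm: "(\<Sum>(x, y)\<in>E. (u x - u y)\<^sup>2) = (edge_norm E u)\<^sup>2"
  by (simp add: edge_norm_def L2_set_def sum_nonneg case_prod_unfold)

lemma hamiltonian_midpoint:
  "2 * hamiltonian V E \<Lambda> m (\<lambda>i. (a i + b i) / 2)
    \<le> hamiltonian V E \<Lambda> m a + hamiltonian V E \<Lambda> m b - energy_form E \<Lambda> m (\<lambda>i. a i - b i) / 4"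
proof -
  have 1: "(\<Sum>(x, y)\<in>E. 2 * V ((a x + b x) / 2 - (a y + b y) / 2) + c / 4 * ((a x - b x) - (a y - b y))\<^sup>2)
    \<le> (\<Sum>(x, y)\<in>E. V (a x - a y) + V (b x - b y))"
  proof (intro sum_mono, clarify)
    fix x y
    have "(a x - a y + (b x - b y)) / 2 = (a x + b x) / 2 - (a y + b y) / 2"
      "(a x - a y) - (b x - b y) = (a x - b x) - (a y - b y)" by (auto simp: field_simps)
    with V_midpoint[of "a x - a y" "b x - b y"]
    show "2 * V ((a x + b x) / 2 - (a y + b y) / 2) + c / 4 * ((a x - b x) - (a y - b y))\<^sup>2 \<le> V (a x - a y) + V (b x - b y)"
      by simp
  qed
  have 2: "2 * (\<Sum>x\<in>\<Lambda>. ((a x + b x) / 2)\<^sup>2) + (\<Sum>x\<in>\<Lambda>. (a x - b x)\<^sup>2) / 2 = (\<Sum>x\<in>\<Lambda>. (a x)\<^sup>2) + (\<Sum>x\<in>\<Lambda>. (b x)\<^sup>2)"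
    unfolding sum_distrib_left sum_divide_distrib sum.distrib[symmetric]
    by (intro sum.cong) (auto simp: power2_eq_square field_simps)
  let ?M1 = "\<Sum>(x, y)\<in>E. V ((a x + b x) / 2 - (a y + b y) / 2)" and ?N1 = "\<Sum>(x, y)\<in>E. ((a x - b x) - (a y - b y))\<^sup>2"
  have N: "?N1 = (edge_norm E (\<lambda>i. a i - b i))\<^sup>2" by (simp flip: sum_edge_norm)
  have L: "(\<Sum>x\<in>\<Lambda>. (a x - b x)\<^sup>2) = (L2_set (\<lambda>i. a i - b i) \<Lambda>)\<^sup>2" by (simp add: L2_set_def sum_nonneg)
  have 3: "2 * ?M1 + c / 4 * (edge_norm E (\<lambda>i. a i - b i))\<^sup>2 \<le> (\<Sum>(x, y)\<in>E. V (a x - a y)) + (\<Sum>(x, y)\<in>E. V (b x - b y))"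
    unfolding N[symmetric] using 1 by (simp add: case_prod_unfold sum.distrib sum_distrib_left)
  have 4: "m\<^sup>2 * (2 * (\<Sum>x\<in>\<Lambda>. ((a x + b x) / 2)\<^sup>2) + (L2_set (\<lambda>i. a i - b i) \<Lambda>)\<^sup>2 / 2) = m\<^sup>2 * ((\<Sum>x\<in>\<Lambda>. (a x)\<^sup>2) + (\<Sum>x\<in>\<Lambda>. (b x)\<^sup>2))"
    using 2 unfolding L by simp
  have "2 * M + c / 4 * N \<le> A + B \<Longrightarrow> m\<^sup>2 * (2 * Q + L / 2) = m\<^sup>2 * (P + R) \<Longrightarrow>
      2 * (1 / 2 * M + m\<^sup>2 / 2 * Q) \<le> (1 / 2 * A + m\<^sup>2 / 2 * P) + (1 / 2 * B + m\<^sup>2 / 2 * R) - (c / 2 * N + m\<^sup>2 * L) / 4"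
    for M N A B L P Q R :: real by (simp add: field_simps)
  from this[OF 3 4] show ?thesis
    unfolding hamiltonian_def energy_form_def .
qed

text \<open>The sum runs over bonds, so an outer site is weighted by the number of its neighbours in
  \<Lambda>.\<close>

definition boundary_dist :: "(int ^ 'd::finite) set \<Rightarrow> 'd config \<Rightarrow> 'd config \<Rightarrow> real" where
  "boundary_dist \<Lambda> \<xi> \<eta> = sqrt (\<Sum>(x, y)\<in>boundary_bonds \<Lambda>. (\<xi> y - \<eta> y)\<^sup>2)"

text \<open>Changing the inner field from x to y and the boundary condition from \<xi> to \<eta>
  produces on each edge a mixed second difference of \<open>V\<close>, bounded by the product of the
  two increments. Cauchy-Schwarz over the boundary edges separates the increments; the inner one is
  then enlarged to the full Dirichlet norm.\<close>

lemma hamiltonian_boundary_difference: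
  fixes \<Lambda> :: "(int ^ 'd::finite) set" and m :: real
  assumes \<Lambda>: "finite \<Lambda>"
  defines "H \<equiv> \<lambda>\<xi> x. hamiltonian V (lattice_edges \<Lambda>) \<Lambda> m (override_on \<xi> x \<Lambda>)"
  shows "\<bar>(H \<xi> x - H \<xi> y) - (H \<eta> x - H \<eta> y)\<bar>
    \<le> C * boundary_dist \<Lambda> \<xi> \<eta> * edge_norm (lattice_edges \<Lambda>) (\<lambda>i. override_on \<xi> x \<Lambda> i - override_on \<xi> y \<Lambda> i)"
proof -
  let ?E = "lattice_edges \<Lambda>" and ?B = "boundary_bonds \<Lambda>"
  let ?o = "\<lambda>\<xi> x. override_on \<xi> x \<Lambda>"
  have finE: "finite ?E" and finB: "finite ?B"
    using bond_set_lattice_edges[OF \<Lambda>] finite_boundary_bonds[OF \<Lambda>] by (auto simp: bond_set_def)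
  define u where "u i = ?o \<xi> x i - ?o \<xi> y i" for i
  define t where "t i = ?o \<xi> x i - ?o \<eta> x i" for i
  define du where "du = (\<lambda>(a, b). u a - u b)"
  define dt where "dt = (\<lambda>(a, b). t a - t b)"
  \<comment> \<open>The Hamiltonian contains both orientations of each bond, so the boundary edges
    are taken in both directions.\<close>
  define X where "X = ?B \<union> prod.swap ` ?B"
  have XE: "X \<subseteq> ?E"
  proof -
    have "e \<in> ?E \<and> prod.swap e \<in> ?E" if "e \<in> ?B" for e
    proof -
      obtain a b where e: "e = (a, b)" by (cases e)
      have "a \<in> \<Lambda>" "nearest_neighbour a b" "nearest_neighbour b a"
        using that nearest_neighbour_sym[of a b] by (auto simp: e boundary_bonds_def)
      then show ?thesis by (simp add: e lattice_edges_touching)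
    qed
    then show ?thesis by (auto simp: X_def)
  qed
  \<comment> \<open>An edge inside \<Lambda> does not see the change of the boundary condition, and
    an edge outside \<Lambda> does not see the change of the inner field.\<close>
  have zero: "du e = 0 \<or> dt e = 0" if "e \<in> ?E - X" for e
  proof -
    obtain a b where e: "e = (a, b)" by (cases e)
    have nn: "nearest_neighbour a b" using that e by (auto simp: lattice_edges_def)
    have "(a, b) \<notin> ?B" "(b, a) \<notin> ?B" using that e by (auto simp: X_def image_iff)
    then have "a \<in> \<Lambda> \<longleftrightarrow> b \<in> \<Lambda>" using nn nearest_neighbour_sym[of a b] by (auto simp: boundary_bonds_def)
    then show ?thesis by (auto simp: e du_def dt_def u_def t_def override_on_def)
  qed
  define S where "S \<zeta> = (\<Sum>(a, b)\<in>?E. V (?o \<zeta> x a - ?o \<zeta> x b) - V (?o \<zeta> y a - ?o \<zeta> y b))" for \<zeta>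
  have dH: "H \<zeta> x - H \<zeta> y = 1 / 2 * S \<zeta> + m\<^sup>2 / 2 * (\<Sum>a\<in>\<Lambda>. (x a)\<^sup>2 - (y a)\<^sup>2)" for \<zeta>
    by (simp add: S_def H_def hamiltonian_def case_prod_unfold sum_subtractf algebra_simps)
  have "(H \<xi> x - H \<xi> y) - (H \<eta> x - H \<eta> y) = 1 / 2 * (S \<xi> - S \<eta>)"
    unfolding dH by (simp add: right_diff_distrib)
  then have "\<bar>(H \<xi> x - H \<xi> y) - (H \<eta> x - H \<eta> y)\<bar> = 1 / 2 * \<bar>S \<xi> - S \<eta>\<bar>"
    by (simp only: abs_mult)
  also have "S \<xi> - S \<eta> = (\<Sum>(a, b)\<in>?E. (V (?o \<xi> x a - ?o \<xi> x b) - V (?o \<xi> y a - ?o \<xi> y b)) - (V (?o \<eta> x a - ?o \<eta> x b) - V (?o \<eta> y a - ?o \<eta> y b)))"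
    unfolding S_def sum_subtractf[symmetric] by (intro sum.cong) auto
  also have "1 / 2 * \<bar>\<dots>\<bar> \<le> 1 / 2 * (\<Sum>e\<in>?E. C * (\<bar>du e\<bar> * \<bar>dt e\<bar>))"
  proof (intro mult_left_mono order_trans[OF sum_abs] sum_mono)
    fix e assume "e \<in> ?E"
    obtain a b where e: "e = (a, b)" by (cases e)
    have d1: "?o \<xi> x a - ?o \<xi> x b = (?o \<xi> y a - ?o \<xi> y b) + du e" by (simp add: e du_def u_def)
    have d2: "?o \<eta> x a - ?o \<eta> x b = (?o \<eta> y a - ?o \<eta> y b) + du e"
      by (simp add: e du_def u_def override_on_def)
    have d3: "(?o \<xi> y a - ?o \<xi> y b) - (?o \<eta> y a - ?o \<eta> y b) = dt e"
      by (simp add: e dt_def t_def override_on_def)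
    show "\<bar>case e of (a, b) \<Rightarrow> V (?o \<xi> x a - ?o \<xi> x b) - V (?o \<xi> y a - ?o \<xi> y b) - (V (?o \<eta> x a - ?o \<eta> x b) - V (?o \<eta> y a - ?o \<eta> y b))\<bar>
      \<le> C * (\<bar>du e\<bar> * \<bar>dt e\<bar>)"
      using V_mixed[of "?o \<xi> y a - ?o \<xi> y b" "du e" "?o \<eta> y a - ?o \<eta> y b"]
      unfolding d1[symmetric] d2[symmetric] d3 by (simp add: e)
  qed auto
  also have "(\<Sum>e\<in>?E. C * (\<bar>du e\<bar> * \<bar>dt e\<bar>)) = (\<Sum>e\<in>X. C * (\<bar>du e\<bar> * \<bar>dt e\<bar>))"
    using zero by (intro sum.mono_neutral_right[OF finE XE]) auto
  also have "\<dots> = C * (\<Sum>e\<in>X. \<bar>du e\<bar> * \<bar>dt e\<bar>)" by (simp add: sum_distrib_left)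
  also have "\<dots> \<le> C * (L2_set du X * L2_set dt X)"
    by (intro mult_left_mono L2_set_mult_ineq C_nonneg)
  also have "\<dots> \<le> C * (edge_norm ?E u * (2 * boundary_dist \<Lambda> \<xi> \<eta>))"
  proof (intro mult_left_mono mult_mono C_nonneg)
    show "L2_set du X \<le> edge_norm ?E u"
      unfolding edge_norm_def du_def by (rule L2_set_subset[OF finE XE])
    have sq: "(dt e)\<^sup>2 = (\<xi> (snd e) - \<eta> (snd e))\<^sup>2" if "e \<in> ?B" for e
      using that by (auto simp: boundary_bonds_def dt_def t_def override_on_def power2_commute)
    have sw: "(dt (prod.swap e))\<^sup>2 = (dt e)\<^sup>2" for e
      by (cases e) (simp add: dt_def power2_commute)
    have "(\<Sum>e\<in>X. (dt e)\<^sup>2) \<le> (\<Sum>e\<in>?B. (dt e)\<^sup>2) + (\<Sum>e\<in>prod.swap ` ?B. (dt e)\<^sup>2)"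
      unfolding X_def using finB by (subst sum.union_inter[symmetric]) (auto intro!: sum_nonneg)
    also have "(\<Sum>e\<in>prod.swap ` ?B. (dt e)\<^sup>2) = (\<Sum>e\<in>?B. (dt e)\<^sup>2)"
      by (subst sum.reindex) (auto simp: sw comp_def inj_on_def)
    also have "(\<Sum>e\<in>?B. (dt e)\<^sup>2) = (\<Sum>(x, y)\<in>?B. (\<xi> y - \<eta> y)\<^sup>2)"
      by (intro sum.cong) (auto simp: sq)
    finally have "L2_set dt X \<le> sqrt (2 * (\<Sum>(x, y)\<in>?B. (\<xi> y - \<eta> y)\<^sup>2))"
      unfolding L2_set_def by (intro real_sqrt_le_mono) simp
    \<comment> \<open>The two orientations give a factor sqrt 2; it is enlarged to 2, which cancels
      the factor 1 / 2 in the Hamiltonian.\<close>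
    also have "\<dots> \<le> 2 * boundary_dist \<Lambda> \<xi> \<eta>"
      unfolding boundary_dist_def real_sqrt_mult
      by (intro mult_right_mono real_le_lsqrt) (auto intro!: sum_nonneg real_sqrt_ge_zero)
    finally show "L2_set dt X \<le> 2 * boundary_dist \<Lambda> \<xi> \<eta>" .
  qed auto
  finally have "\<bar>(H \<xi> x - H \<xi> y) - (H \<eta> x - H \<eta> y)\<bar> \<le> C * boundary_dist \<Lambda> \<xi> \<eta> * edge_norm ?E u"
    by (simp add: mult_ac)
  moreover have "(\<lambda>i. ?o \<xi> x i - ?o \<xi> y i) = u" by (simp add: u_def fun_eq_iff)
  ultimately show ?thesis by metis
qed

end

section \<open>Integrability of the Boltzmann weights\<close>

lemma finite_gibbs_eq: "finite_gibbs V E \<Lambda> m \<xi> =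
  gibbs_density (flat \<Lambda>) (\<lambda>\<phi>. hamiltonian V E \<Lambda> m (override_on \<xi> \<phi> \<Lambda>))"
  by (simp add: finite_gibbs_def gibbs_density_def partition_function_def boltzmann_weight_def)

lemma nn_integral_gaussian_finite:
  fixes a :: real
  assumes "0 < a"
  shows "(\<integral>\<^sup>+t. ennreal (exp (- a * t\<^sup>2)) \<partial>lborel) < \<top>"
proof -
  define s where "s = sqrt (1 / (2 * a))"
  have s: "0 < s" "2 * s\<^sup>2 = 1 / a" using assms by (auto simp: s_def)
  have "exp (- a * t\<^sup>2) = sqrt (2 * pi * s\<^sup>2) * normal_density 0 s t" for t
    using assms s by (simp add: normal_density_def field_simps)
  then have "integrable lborel (\<lambda>t. exp (- a * t\<^sup>2))"
    using s by simp
  then show ?thesis by (simp add: integrable_iff_bounded)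
qed

lemma normalisable_coercive:
  fixes H :: "('i \<Rightarrow> real) \<Rightarrow> real"
  assumes I: "finite I" and m[measurable]: "H \<in> borel_measurable (flat I)"
    and a: "0 < a" and H: "\<And>x. x \<in> extensional I \<Longrightarrow> a * (\<Sum>i\<in>I. (x i)\<^sup>2) - b \<le> H x"
  shows "normalisable (flat I) H"
  unfolding normalisable_def
proof (intro conjI m notI)
  interpret product_sigma_finite "\<lambda>_::'i. lborel :: real measure" by standard
  let ?P = "flat I"
  {
    assume "(\<integral>\<^sup>+x. ennreal (exp (- H x)) \<partial>?P) = 0"
    then have "AE x in ?P. ennreal (exp (- H x)) = 0" by (subst (asm) nn_integral_0_iff_AE) auto
    then have "AE x in ?P. False" by (simp add: ennreal_eq_0_iff not_le[symmetric])
    then have "emeasure ?P (space ?P) = 0" by (simp add: AE_iff_measurable[OF sets.top])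
    moreover have "emeasure ?P (PiE I (\<lambda>_. UNIV)) = (\<Prod>i\<in>I. emeasure lborel (UNIV :: real set))"
      using I by (intro emeasure_PiM) auto
    ultimately show False using I by (simp add: space_PiM)
  }
  have "(\<integral>\<^sup>+x. ennreal (exp (- H x)) \<partial>?P)
    \<le> (\<integral>\<^sup>+x. ennreal (exp b) * (\<Prod>i\<in>I. ennreal (exp (- a * (x i)\<^sup>2))) \<partial>?P)"
  proof (intro nn_integral_mono)
    fix x assume "x \<in> space ?P"
    then have "x \<in> extensional I" by (simp add: space_PiM PiE_def)
    then have "- H x \<le> b + (\<Sum>i\<in>I. - a * (x i)\<^sup>2)" using H[of x] by (simp add: sum_distrib_left sum_negf)
    then have "exp (- H x) \<le> exp b * (\<Prod>i\<in>I. exp (- a * (x i)\<^sup>2))"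
      using I by (simp flip: exp_sum exp_add)
    then show "ennreal (exp (- H x)) \<le> ennreal (exp b) * (\<Prod>i\<in>I. ennreal (exp (- a * (x i)\<^sup>2)))"
      by (simp add: prod_ennreal ennreal_le_iff prod_nonneg flip: ennreal_mult)
  qed
  also have "\<dots> = ennreal (exp b) * (\<Prod>i\<in>I. \<integral>\<^sup>+t. ennreal (exp (- a * t\<^sup>2)) \<partial>lborel)"
    using product_nn_integral_prod[OF I, of "\<lambda>i t. ennreal (exp (- a * t\<^sup>2))"]
    by (subst nn_integral_cmult) simp_all
  also have "\<dots> < \<top>"
  proof -
    obtain r where "0 \<le> r" "(\<integral>\<^sup>+t. ennreal (exp (- a * t\<^sup>2)) \<partial>lborel) = ennreal r"
      using nn_integral_gaussian_finite[OF a] by (metis ennreal_cases less_irrefl)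
    then show ?thesis by (simp add: ennreal_power ennreal_less_top flip: ennreal_mult)
  qed
  finally show False if "(\<integral>\<^sup>+x. ennreal (exp (- H x)) \<partial>?P) = \<top>" using that by simp
qed

context convex_potential
begin

lemma hamiltonian_measurable[measurable]:
  assumes "finite E"
  shows "(\<lambda>\<phi>. hamiltonian V E \<Lambda> m (override_on \<xi> \<phi> \<Lambda>)) \<in> borel_measurable (flat \<Lambda>)"
proof -
  have o: "(\<lambda>\<phi>. override_on \<xi> \<phi> \<Lambda> x) \<in> borel_measurable (flat \<Lambda>)" for x
    by (cases "x \<in> \<Lambda>") (simp_all add: override_on_def)
  show ?thesis
    unfolding hamiltonian_def case_prod_unfold
    by (intro borel_measurable_add borel_measurable_times borel_measurable_sum borel_measurable_const
        borel_measurable_power measurable_compose[OF _ V_measurable] borel_measurable_diff o)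
qed

lemma override_midpoint:
  fixes \<xi> x y :: "'a \<Rightarrow> real"
  shows "override_on \<xi> (\<lambda>i\<in>\<Lambda>. (x i + y i) / 2) \<Lambda> = (\<lambda>i. (override_on \<xi> x \<Lambda> i + override_on \<xi> y \<Lambda> i) / 2)"
  by (auto simp: override_on_def)

text \<open>At mass 0 the coercivity comes from the boundary. The configuration is split into a
  field u supported in \<Lambda> and the boundary values v; the Dirichlet bound controls the squares
  of u by its Dirichlet norm, and v contributes a constant.\<close>

lemma lattice_normalisable:
  fixes \<Lambda> :: "(int ^ 'd::finite) set"
  assumes \<Lambda>: "finite \<Lambda>"
  shows "normalisable (flat \<Lambda>) (\<lambda>x. hamiltonian V (lattice_edges \<Lambda>) \<Lambda> m (override_on \<xi> x \<Lambda>))"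
proof -
  let ?E = "lattice_edges \<Lambda>"
  have finE: "finite ?E" using bond_set_lattice_edges[OF \<Lambda>] by (simp add: bond_set_def)
  obtain K where K: "0 \<le> K" "\<And>u x. (\<And>x. x \<notin> \<Lambda> \<Longrightarrow> u x = 0) \<Longrightarrow> \<bar>u x\<bar> \<le> K * edge_norm ?E u"
    using dirichlet_bound[OF \<Lambda>] by metis
  define k where "k = real (card \<Lambda>) * K\<^sup>2 + 1"
  have k: "0 < k" using K by (simp add: k_def add_nonneg_pos)
  define b where "b = c / 4 * (edge_norm ?E (override_on \<xi> (\<lambda>_. 0) \<Lambda>))\<^sup>2 - real (card ?E) / 2 * V 0"
  show ?thesis
  proof (rule normalisable_coercive[OF \<Lambda> hamiltonian_measurable[OF finE]])
    \<comment> \<open>The quadratic growth c / 2 of \<open>V\<close> becomes c / 4 through the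
      factor 1 / 2 of the Hamiltonian and c / 8 through the separation of u from v by p^2 / 2 - q^2
      \<le> (p + q)^2; k converts the Dirichlet norm into the sum of squares.\<close>
    show "0 < c / (8 * k)" using c_pos k by simp
    fix x :: "'d config"
    define u where "u = override_on (\<lambda>_. 0) x \<Lambda>"
    define v where "v = override_on \<xi> (\<lambda>_. 0) \<Lambda>"
    have uv: "override_on \<xi> x \<Lambda> i = u i + v i" for i by (auto simp: u_def v_def override_on_def)
    have u0: "u i = 0" if "i \<notin> \<Lambda>" for i using that by (simp add: u_def)
    have "(\<Sum>i\<in>\<Lambda>. (x i)\<^sup>2) = (\<Sum>i\<in>\<Lambda>. \<bar>u i\<bar>\<^sup>2)" by (intro sum.cong) (auto simp: u_def)
    also have "\<dots> \<le> (\<Sum>i\<in>\<Lambda>. (K * edge_norm ?E u)\<^sup>2)"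
      using K(2)[OF u0] by (intro sum_mono power_mono) auto
    also have "\<dots> = (real (card \<Lambda>) * K\<^sup>2) * (edge_norm ?E u)\<^sup>2" by (simp add: power_mult_distrib)
    also have "\<dots> \<le> k * (edge_norm ?E u)\<^sup>2" unfolding k_def by (intro mult_right_mono) auto
    finally have 1: "c / (8 * k) * (\<Sum>i\<in>\<Lambda>. (x i)\<^sup>2) \<le> c / 8 * (edge_norm ?E u)\<^sup>2"
      using mult_left_mono[of _ "k * (edge_norm ?E u)\<^sup>2" "c / (8 * k)"] c_pos k by fastforce
    have "(\<Sum>(i, j)\<in>?E. V 0 + c / 2 * ((u i - u j)\<^sup>2 / 2 - (v i - v j)\<^sup>2)) \<le> (\<Sum>(i, j)\<in>?E. V ((u i + v i) - (u j + v j)))"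
    proof (intro sum_mono, clarify)
      fix i j
      have "(p + q)\<^sup>2 - (p\<^sup>2 / 2 - q\<^sup>2) = (p + 2 * q)\<^sup>2 / 2" for p q :: real
        by (simp add: power2_eq_square field_simps)
      then have "p\<^sup>2 / 2 - q\<^sup>2 \<le> (p + q)\<^sup>2" for p q :: real
        by (metis diff_ge_0_iff_ge zero_le_divide_iff zero_le_numeral zero_le_power2)
      from this[of "u i - u j" "v i - v j"]
      have "(u i - u j)\<^sup>2 / 2 - (v i - v j)\<^sup>2 \<le> ((u i + v i) - (u j + v j))\<^sup>2" by (simp add: algebra_simps)
      then have "c / 2 * ((u i - u j)\<^sup>2 / 2 - (v i - v j)\<^sup>2) \<le> c / 2 * ((u i + v i) - (u j + v j))\<^sup>2"
        using c_pos by (intro mult_left_mono) auto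
      then show "V 0 + c / 2 * ((u i - u j)\<^sup>2 / 2 - (v i - v j)\<^sup>2) \<le> V ((u i + v i) - (u j + v j))"
        using V_lower[of "(u i + v i) - (u j + v j)"] by linarith
    qed
    moreover have "(\<Sum>(i, j)\<in>?E. V 0 + c / 2 * ((u i - u j)\<^sup>2 / 2 - (v i - v j)\<^sup>2))
      = real (card ?E) * V 0 + c / 4 * (edge_norm ?E u)\<^sup>2 - c / 2 * (edge_norm ?E v)\<^sup>2"
      unfolding sum_edge_norm[symmetric] case_prod_unfold
      by (simp add: sum.distrib sum_subtractf sum_distrib_left right_diff_distrib)
    moreover have "hamiltonian V ?E \<Lambda> m (override_on \<xi> x \<Lambda>) \<ge> 1 / 2 * (\<Sum>(i, j)\<in>?E. V ((u i + v i) - (u j + v j)))"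
      unfolding hamiltonian_def uv by (simp add: sum_nonneg)
    ultimately have "real (card ?E) / 2 * V 0 + c / 8 * (edge_norm ?E u)\<^sup>2 - c / 4 * (edge_norm ?E v)\<^sup>2
      \<le> hamiltonian V ?E \<Lambda> m (override_on \<xi> x \<Lambda>)" by (simp add: field_simps)
    with 1 show "c / (8 * k) * (\<Sum>i\<in>\<Lambda>. (x i)\<^sup>2) - b \<le> hamiltonian V ?E \<Lambda> m (override_on \<xi> x \<Lambda>)"
      unfolding b_def v_def[symmetric] by linarith
  qed
qed

lemma massive_normalisable:
  assumes \<Lambda>: "finite \<Lambda>" and E: "finite E" and m: "0 < m"
  shows "normalisable (flat \<Lambda>) (\<lambda>x. hamiltonian V E \<Lambda> m (override_on \<xi> x \<Lambda>))"
proof (rule normalisable_coercive[OF \<Lambda> hamiltonian_measurable[OF E]])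
  show "0 < m\<^sup>2 / 2" using m by simp
  fix x :: "'a \<Rightarrow> real"
  have "(\<Sum>e\<in>E. V 0) \<le> (\<Sum>(i, j)\<in>E. V (override_on \<xi> x \<Lambda> i - override_on \<xi> x \<Lambda> j))"
  proof (intro sum_mono, clarify)
    fix i j
    have "0 \<le> c / 2 * t\<^sup>2" for t using c_pos by simp
    then show "V 0 \<le> V (override_on \<xi> x \<Lambda> i - override_on \<xi> x \<Lambda> j)"
      using V_lower[of "override_on \<xi> x \<Lambda> i - override_on \<xi> x \<Lambda> j"] by (smt (verit))
  qed
  moreover have "(\<Sum>i\<in>\<Lambda>. (override_on \<xi> x \<Lambda> i)\<^sup>2) = (\<Sum>i\<in>\<Lambda>. (x i)\<^sup>2)" by (intro sum.cong) auto
  ultimately show "m\<^sup>2 / 2 * (\<Sum>i\<in>\<Lambda>. (x i)\<^sup>2) - (- real (card E) / 2 * V 0) \<le> hamiltonian V E \<Lambda> m (override_on \<xi> x \<Lambda>)"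
    unfolding hamiltonian_def by simp
qed

section \<open>Means and variances in finite volume\<close>

lemma prob_space_lattice_gibbs:
  fixes \<Lambda> :: "(int ^ 'd::finite) set"
  assumes \<Lambda>: "finite \<Lambda>"
  shows "prob_space (lattice_gibbs \<Lambda> m \<xi>)"
  unfolding finite_gibbs_eq by (rule prob_space_gibbs_density[OF lattice_normalisable[OF \<Lambda>]])

lemma prob_space_massive_gibbs:
  assumes \<Lambda>: "finite \<Lambda>" and E: "finite E" and m: "0 < m"
  shows "prob_space (finite_gibbs V E \<Lambda> m \<xi>)"
  unfolding finite_gibbs_eq by (rule prob_space_gibbs_density[OF massive_normalisable[OF assms]])

text \<open>The mean of the midpoint inequalities for \<xi> and \<eta> has on its right side half of
  all four energies. It differs from the energy of x under \<xi> plus that of y under \<eta> by half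
  a mixed difference, which is linear in the energy distance. So the mismatch M of the abstract
  comparison is C / 2 times sqrt (2 / c) times the boundary distance.\<close>

lemma boundary_comparison:
  fixes \<Lambda> :: "(int ^ 'd::finite) set"
  assumes \<Lambda>: "finite \<Lambda>" and f: "f \<in> borel_measurable (flat \<Lambda>)" and bd: "\<And>x. \<bar>f x\<bar> \<le> K"
    and lip: "\<And>x y. f x - f y \<le> B * edge_norm (lattice_edges \<Lambda>) (\<lambda>i. override_on (\<lambda>_. 0) x \<Lambda> i - override_on (\<lambda>_. 0) y \<Lambda> i)"
    and B: "0 \<le> B" and s: "0 < s"
  shows "(\<integral>x. f x \<partial>lattice_gibbs \<Lambda> m \<xi>) - (\<integral>x. f x \<partial>lattice_gibbs \<Lambda> m \<eta>)
    \<le> (s * (B * sqrt (2 / c)) + C / 2 * sqrt (2 / c) * boundary_dist \<Lambda> \<xi> \<eta>)\<^sup>2 / s"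
proof -
  let ?E = "lattice_edges \<Lambda>"
  define H where "H \<zeta> x = hamiltonian V ?E \<Lambda> m (override_on \<zeta> x \<Lambda>)" for \<zeta> x
  define d where "d x y = (\<lambda>i. override_on (\<lambda>_. 0) x \<Lambda> i - override_on (\<lambda>_. 0) y \<Lambda> i :: real)" for x y
  define q where "q x y = sqrt (energy_form ?E \<Lambda> m (d x y))" for x y
  have d: "(\<lambda>i. override_on \<zeta> x \<Lambda> i - override_on \<zeta> y \<Lambda> i) = d x y" for \<zeta> x y
    by (auto simp: d_def override_on_def)
  have q: "(q x y)\<^sup>2 = energy_form ?E \<Lambda> m (d x y)" for x y
    by (simp add: q_def energy_form_nonneg)
  have en: "edge_norm ?E (d x y) \<le> sqrt (2 / c) * q x y" for x y
    unfolding q_def by (rule edge_norm_le_energy)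
  have bdn: "0 \<le> boundary_dist \<Lambda> \<xi> \<eta>"
    by (auto simp: boundary_dist_def intro!: sum_nonneg)
  have mid: "2 * H \<zeta> (\<lambda>i\<in>\<Lambda>. (x i + y i) / 2) \<le> H \<zeta> x + H \<zeta> y - (q x y)\<^sup>2 / 4" for \<zeta> x y
    using hamiltonian_midpoint[of ?E \<Lambda> m "override_on \<zeta> x \<Lambda>" "override_on \<zeta> y \<Lambda>"]
    unfolding H_def override_midpoint q d .
  show ?thesis
    unfolding finite_gibbs_eq
  proof (rule gibbs_mean_comparison[OF \<Lambda> lattice_normalisable[OF \<Lambda>] lattice_normalisable[OF \<Lambda>] f _ _ bd s, where q = q])
    fix x y :: "'d config"
    have "f x - f y \<le> B * edge_norm ?E (d x y)" unfolding d_def by (rule lip)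
    also have "\<dots> \<le> B * (sqrt (2 / c) * q x y)" by (intro mult_left_mono en B)
    finally show "f x - f y \<le> B * sqrt (2 / c) * q x y" by (simp add: mult.assoc)
    let ?z = "\<lambda>i\<in>\<Lambda>. (x i + y i) / 2"
    have "\<bar>(H \<xi> x - H \<xi> y) - (H \<eta> x - H \<eta> y)\<bar> \<le> C * boundary_dist \<Lambda> \<xi> \<eta> * edge_norm ?E (d x y)"
      using hamiltonian_boundary_difference[OF \<Lambda>, of m \<xi> x y \<eta>] unfolding H_def d .
    also have "\<dots> \<le> C * boundary_dist \<Lambda> \<xi> \<eta> * (sqrt (2 / c) * q x y)"
      by (intro mult_left_mono en mult_nonneg_nonneg C_nonneg bdn)
    finally have 1: "\<bar>(H \<xi> x - H \<xi> y) - (H \<eta> x - H \<eta> y)\<bar> \<le> C * boundary_dist \<Lambda> \<xi> \<eta> * (sqrt (2 / c) * q x y)" .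
    have "\<bar>t\<bar> \<le> r \<Longrightarrow> - r / 2 \<le> t / 2" for t r :: real by linarith
    from this[OF 1] have "- (C * boundary_dist \<Lambda> \<xi> \<eta> * (sqrt (2 / c) * q x y)) / 2 \<le> ((H \<xi> x - H \<xi> y) - (H \<eta> x - H \<eta> y)) / 2" .
    moreover have "C / 2 * sqrt (2 / c) * boundary_dist \<Lambda> \<xi> \<eta> * q x y = C * boundary_dist \<Lambda> \<xi> \<eta> * (sqrt (2 / c) * q x y) / 2" by simp
    moreover have comb: "- T / 2 \<le> (h - h' - (k - k')) / 2 \<Longrightarrow> N = T / 2 \<Longrightarrow> 2 * z \<le> h + h' - Q / 4 \<Longrightarrow> 2 * z' \<le> k + k' - Q / 4 \<Longrightarrow> z + z' \<le> h + k' + N - Q / 4"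
      for T h h' k k' N z z' Q :: real by (simp add: field_simps)
    ultimately have "H \<xi> ?z + H \<eta> ?z \<le> H \<xi> x + H \<eta> y + C / 2 * sqrt (2 / c) * boundary_dist \<Lambda> \<xi> \<eta> * q x y - (q x y)\<^sup>2 / 4"
      using comb mid[of \<xi> x y] mid[of \<eta> x y] by blast
    then show "hamiltonian V ?E \<Lambda> m (override_on \<xi> ?z \<Lambda>) + hamiltonian V ?E \<Lambda> m (override_on \<eta> ?z \<Lambda>)
      \<le> hamiltonian V ?E \<Lambda> m (override_on \<xi> x \<Lambda>) + hamiltonian V ?E \<Lambda> m (override_on \<eta> y \<Lambda>)
        + C / 2 * sqrt (2 / c) * boundary_dist \<Lambda> \<xi> \<eta> * q x y - (q x y)\<^sup>2 / 4"
      unfolding H_def .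
  qed
qed

text \<open>The mass part of the energy absorbs the l2 term at the price 1 / m. At fixed m this
  contribution disappears as b tends to 0, so no trace of the mass remains in the limiting
  bound.\<close>

lemma massive_variance_bound:
  fixes \<Lambda> :: "'v set"
  assumes \<Lambda>: "finite \<Lambda>" and E: "finite E" and m: "0 < m"
    and f: "f \<in> borel_measurable (flat \<Lambda>)" and bd: "\<And>x. \<bar>f x\<bar> \<le> K"
    and lip: "\<And>x y. f x - f y \<le> a * edge_norm E (\<lambda>i. override_on (\<lambda>_. 0) x \<Lambda> i - override_on (\<lambda>_. 0) y \<Lambda> i)
      + b * L2_set (\<lambda>i. override_on (\<lambda>_. 0) x \<Lambda> i - override_on (\<lambda>_. 0) y \<Lambda> i) \<Lambda>"
    and ab: "0 \<le> a" "0 < b"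
  shows "(\<integral>x. (f x)\<^sup>2 \<partial>finite_gibbs V E \<Lambda> m (\<lambda>_. 0)) - (\<integral>x. f x \<partial>finite_gibbs V E \<Lambda> m (\<lambda>_. 0))\<^sup>2
    \<le> 4 * (a * sqrt (2 / c) + b / m)\<^sup>2"
proof -
  define H where "H x = hamiltonian V E \<Lambda> m (override_on (\<lambda>_. 0) x \<Lambda>)" for x
  define d where "d x y = (\<lambda>i. override_on (\<lambda>_. 0) x \<Lambda> i - override_on (\<lambda>_. 0) y \<Lambda> i :: real)" for x y
  define q where "q x y = sqrt (energy_form E \<Lambda> m (d x y))" for x y
  have q: "(q x y)\<^sup>2 = energy_form E \<Lambda> m (d x y)" for x y
    by (simp add: q_def energy_form_nonneg)
  have mid: "2 * H (\<lambda>i\<in>\<Lambda>. (x i + y i) / 2) \<le> H x + H y - (q x y)\<^sup>2 / 4" for x y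
    using hamiltonian_midpoint[of E \<Lambda> m "override_on (\<lambda>_. 0) x \<Lambda>" "override_on (\<lambda>_. 0) y \<Lambda>"]
    unfolding H_def override_midpoint q d_def .
  show ?thesis
    unfolding finite_gibbs_eq
  proof (rule gibbs_variance_bound[OF \<Lambda> massive_normalisable[OF \<Lambda> E m] f _ _ bd, where q = q])
    fix x y :: "'v \<Rightarrow> real"
    show "2 * hamiltonian V E \<Lambda> m (override_on (\<lambda>_. 0) (\<lambda>i\<in>\<Lambda>. (x i + y i) / 2) \<Lambda>)
       \<le> hamiltonian V E \<Lambda> m (override_on (\<lambda>_. 0) x \<Lambda>) + hamiltonian V E \<Lambda> m (override_on (\<lambda>_. 0) y \<Lambda>) - (q x y)\<^sup>2 / 4"
      using mid unfolding H_def .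
    have "f x - f y \<le> a * edge_norm E (d x y) + b * L2_set (d x y) \<Lambda>" unfolding d_def by (rule lip)
    also have "\<dots> \<le> a * (sqrt (2 / c) * q x y) + b * (1 / m * q x y)"
      unfolding q_def using ab by (intro add_mono mult_left_mono edge_norm_le_energy L2_set_le_energy m) auto
    finally show "f x - f y \<le> (a * sqrt (2 / c) + b / m) * q x y" by (simp add: algebra_simps)
    show "0 < a * sqrt (2 / c) + b / m" using ab m c_pos by (intro add_nonneg_pos) auto
  qed
qed

end

section \<open>Gibbs kernels and resampling\<close>

lemma integral_gibbs_density:
  fixes G H :: "'a \<Rightarrow> real"
  assumes n: "normalisable P H" and [measurable]: "G \<in> borel_measurable P"
  shows "(\<integral>x. G x \<partial>gibbs_density P H) = (\<integral>x. G x * exp (- H x) \<partial>P) / (\<integral>x. exp (- H x) \<partial>P)"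
    and "0 < (\<integral>x. exp (- H x) \<partial>P)"
proof -
  note Z = normalisableD(2,3)[OF n]
  note [measurable] = normalisableD(1)[OF n]
  have i: "integrable P (\<lambda>x. exp (- H x))"
    using Z by (simp add: integrable_iff_bounded less_top)
  then have z: "(\<integral>\<^sup>+x. ennreal (exp (- H x)) \<partial>P) = ennreal (\<integral>x. exp (- H x) \<partial>P)"
    by (intro nn_integral_eq_integral) auto
  show pos: "0 < (\<integral>x. exp (- H x) \<partial>P)"
    using Z(1) unfolding z by (simp add: ennreal_eq_0_iff not_le)
  have "gibbs_density P H = density P (\<lambda>x. ennreal (exp (- H x) / (\<integral>x. exp (- H x) \<partial>P)))"
    unfolding gibbs_density_def z using pos by (simp add: divide_ennreal)
  then have "(\<integral>x. G x \<partial>gibbs_density P H) = (\<integral>x. exp (- H x) / (\<integral>x. exp (- H x) \<partial>P) * G x \<partial>P)"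
    using pos by (simp add: integral_density)
  also have "\<dots> = (\<integral>x. (G x * exp (- H x)) / (\<integral>x. exp (- H x) \<partial>P) \<partial>P)"
    by (simp add: mult.commute)
  finally show "(\<integral>x. G x \<partial>gibbs_density P H) = (\<integral>x. G x * exp (- H x) \<partial>P) / (\<integral>x. exp (- H x) \<partial>P)"
    by simp
qed

text \<open>The optimal value is s = M / B. When B or M vanishes there is no minimiser, and s is
  sent to 0 or to infinity instead; hence the margin e.\<close>

lemma quadratic_over_linear_bound:
  fixes t B M :: real
  assumes "0 \<le> B" "0 \<le> M" and le: "\<And>s. 0 < s \<Longrightarrow> t \<le> (s * B + M)\<^sup>2 / s"
  shows "t \<le> 4 * B * M"
proof -
  have eps: "t \<le> 4 * B * M + e" if e: "0 < e" for e
  proof (cases "0 < B \<and> 0 < M")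
    case True
    then have "t \<le> (M / B * B + M)\<^sup>2 / (M / B)" by (intro le) auto
    also have "\<dots> = 4 * B * M" using True by (simp add: power2_eq_square field_simps)
    finally show ?thesis using e by simp
  next
    case False
    then consider "M = 0" | "B = 0" using assms by linarith
    then show ?thesis
    proof cases
      case 1
      define s where "s = e / (B\<^sup>2 + 1)"
      have s: "0 < s" using e by (auto simp: s_def intro!: divide_pos_pos add_nonneg_pos)
      have "t \<le> s * B\<^sup>2" using le[OF s] 1 s by (simp add: power2_eq_square mult_ac)
      also have "\<dots> = e * (B\<^sup>2 / (B\<^sup>2 + 1))" by (simp add: s_def)
      also have "\<dots> \<le> e * 1" using e by (intro mult_left_mono) (auto simp: divide_le_eq_1 add_nonneg_pos)
      finally show ?thesis using 1 by simp
    next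
      case 2
      define s where "s = (M\<^sup>2 + 1) / e"
      have s: "0 < s" using e by (auto simp: s_def intro!: divide_pos_pos add_nonneg_pos)
      have "t \<le> M\<^sup>2 / s" using le[OF s] 2 by simp
      also have "\<dots> = e * (M\<^sup>2 / (M\<^sup>2 + 1))" using e by (simp add: s_def)
      also have "\<dots> \<le> e * 1" using e by (intro mult_left_mono) (auto simp: divide_le_eq_1 add_nonneg_pos)
      finally show ?thesis using 2 by simp
    qed
  qed
  show ?thesis by (rule field_le_epsilon) (rule eps)
qed

context convex_potential
begin

section \<open>Redrawing the field in a finite set\<close>

definition gibbs_avg :: "(int ^ 'd::finite) set \<Rightarrow> real \<Rightarrow> 'd config \<Rightarrow> ('d config \<Rightarrow> real) \<Rightarrow> real" where
  "gibbs_avg \<Lambda> m \<xi> G = (\<integral>\<phi>. G (override_on \<xi> \<phi> \<Lambda>) \<partial>lattice_gibbs \<Lambda> m \<xi>)"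

text \<open>The law of a field whose values in \<Lambda> are redrawn from the Gibbs kernel given the
  outside. Writing it as a density on a product space reduces measurability to that of the weight
  jointly in both arguments. The DLR equation for \<Lambda> says that \<mu> is fixed by this
  operation.\<close>

definition resample :: "(int ^ 'd::finite) set \<Rightarrow> real \<Rightarrow> 'd config measure \<Rightarrow> 'd config measure" where
  "resample \<Lambda> m \<mu> = distr (density (\<mu> \<Otimes>\<^sub>M flat \<Lambda>)
     (\<lambda>(\<xi>, \<phi>). boltzmann_weight V (lattice_edges \<Lambda>) \<Lambda> m \<xi> \<phi> / partition_function V (lattice_edges \<Lambda>) \<Lambda> m \<xi>))
     field_algebra (\<lambda>(\<xi>, \<phi>). override_on \<xi> \<phi> \<Lambda>)"

lemma override_measurable[measurable]:
  "(\<lambda>(\<xi>, \<phi>). override_on \<xi> \<phi> \<Lambda>) \<in> measurable ((field_algebra :: 'd::finite config measure) \<Otimes>\<^sub>M flat \<Lambda>) field_algebra"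
  unfolding case_prod_unfold
proof (rule measurable_PiM_single')
  fix x :: "int ^ 'd"
  show "(\<lambda>p. override_on (fst p) (snd p) \<Lambda> x) \<in> borel_measurable (field_algebra \<Otimes>\<^sub>M flat \<Lambda>)"
    by (cases "x \<in> \<Lambda>") (simp_all add: override_on_def)
qed auto

lemma override_measurable_snd[measurable]:
  "(\<lambda>\<phi>. override_on \<xi> \<phi> \<Lambda>) \<in> measurable (flat \<Lambda>) (field_algebra :: 'd::finite config measure)"
proof (rule measurable_PiM_single')
  fix x :: "int ^ 'd"
  show "(\<lambda>\<phi>. override_on \<xi> \<phi> \<Lambda> x) \<in> borel_measurable (flat \<Lambda>)"
    by (cases "x \<in> \<Lambda>") (simp_all add: override_on_def)
qed auto

lemma hamiltonian_field_measurable[measurable]: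
  "(\<lambda>\<phi>. hamiltonian V E \<Lambda> m \<phi>) \<in> borel_measurable (field_algebra :: 'd::finite config measure)"
  unfolding hamiltonian_def case_prod_unfold
  by (intro borel_measurable_add borel_measurable_times borel_measurable_sum borel_measurable_const
      borel_measurable_power measurable_compose[OF _ V_measurable] borel_measurable_diff measurable_component_singleton UNIV_I)

lemma weight_measurable[measurable]:
  "(\<lambda>(\<xi>, \<phi>). boltzmann_weight V E \<Lambda> m \<xi> \<phi>) \<in> borel_measurable ((field_algebra :: 'd::finite config measure) \<Otimes>\<^sub>M flat \<Lambda>)"
proof -
  have "(\<lambda>p. hamiltonian V E \<Lambda> m (case p of (\<xi>, \<phi>) \<Rightarrow> override_on \<xi> \<phi> \<Lambda>)) \<in> borel_measurable (field_algebra \<Otimes>\<^sub>M flat \<Lambda>)"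
    by (rule measurable_compose[OF override_measurable hamiltonian_field_measurable])
  then show ?thesis
    unfolding boltzmann_weight_def by (simp add: case_prod_unfold)
qed

lemma sigma_finite_lborel_PiM: "finite \<Lambda> \<Longrightarrow> sigma_finite_measure (flat \<Lambda>)"
proof -
  assume "finite \<Lambda>"
  interpret product_sigma_finite "\<lambda>_. lborel :: real measure" by standard
  show ?thesis using \<open>finite \<Lambda>\<close> by (rule sigma_finite)
qed

lemma partition_measurable[measurable]:
  fixes \<Lambda> :: "(int ^ 'd::finite) set"
  assumes "finite \<Lambda>"
  shows "partition_function V E \<Lambda> m \<in> borel_measurable field_algebra"
proof -
  interpret sigma_finite_measure "flat \<Lambda>" by (rule sigma_finite_lborel_PiM[OF assms])
  show ?thesis
    unfolding partition_function_def[abs_def]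
    by (rule borel_measurable_nn_integral) (rule weight_measurable)
qed

lemma nn_integral_resample:
  fixes \<Lambda> :: "(int ^ 'd::finite) set"
  assumes \<Lambda>: "finite \<Lambda>" and \<mu>: "field_law \<mu>" and g[measurable]: "g \<in> borel_measurable field_algebra"
  shows "(\<integral>\<^sup>+\<psi>. g \<psi> \<partial>resample \<Lambda> m \<mu>) =
    (\<integral>\<^sup>+\<xi>. (\<integral>\<^sup>+\<phi>. g (override_on \<xi> \<phi> \<Lambda>) \<partial>lattice_gibbs \<Lambda> m \<xi>) \<partial>\<mu>)"
    and "(\<lambda>\<xi>. (\<integral>\<^sup>+\<phi>. g (override_on \<xi> \<phi> \<Lambda>) \<partial>lattice_gibbs \<Lambda> m \<xi>)) \<in> borel_measurable field_algebra"
proof -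
  let ?P = "flat \<Lambda>"
  interpret P: sigma_finite_measure ?P by (rule sigma_finite_lborel_PiM[OF \<Lambda>])
  note s[measurable_cong] = prob_algebra_fieldsD(2)[OF \<mu>]
  note [measurable] = partition_measurable[OF \<Lambda>, of "lattice_edges \<Lambda>" m]
  have gm[measurable]: "(\<lambda>(\<xi>, \<phi>). g (override_on \<xi> \<phi> \<Lambda>)) \<in> borel_measurable (field_algebra \<Otimes>\<^sub>M ?P)"
    using measurable_compose[OF override_measurable g] by (simp add: case_prod_unfold)
  have km: "(\<lambda>(\<xi>, \<phi>). boltzmann_weight V (lattice_edges \<Lambda>) \<Lambda> m \<xi> \<phi> / partition_function V (lattice_edges \<Lambda>) \<Lambda> m \<xi>)
    \<in> borel_measurable (field_algebra \<Otimes>\<^sub>M ?P)"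
    using weight_measurable unfolding case_prod_unfold by measurable
  have km': "(\<lambda>(\<xi>, \<phi>). boltzmann_weight V (lattice_edges \<Lambda>) \<Lambda> m \<xi> \<phi> / partition_function V (lattice_edges \<Lambda>) \<Lambda> m \<xi>)
    \<in> borel_measurable (\<mu> \<Otimes>\<^sub>M ?P)" using km by measurable
  let ?k = "\<lambda>\<xi> \<phi>. boltzmann_weight V (lattice_edges \<Lambda>) \<Lambda> m \<xi> \<phi> / partition_function V (lattice_edges \<Lambda>) \<Lambda> m \<xi>"
  have prodm: "(\<lambda>(\<xi>, \<phi>). ?k \<xi> \<phi> * g (override_on \<xi> \<phi> \<Lambda>)) \<in> borel_measurable (field_algebra \<Otimes>\<^sub>M ?P)"
    using borel_measurable_times_ennreal[OF km gm] by (simp add: case_prod_unfold)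
  have inner: "(\<integral>\<^sup>+\<phi>. g (override_on \<xi> \<phi> \<Lambda>) \<partial>lattice_gibbs \<Lambda> m \<xi>)
     = (\<integral>\<^sup>+\<phi>. ?k \<xi> \<phi> * g (override_on \<xi> \<phi> \<Lambda>) \<partial>?P)" for \<xi>
    unfolding finite_gibbs_def
  proof (rule nn_integral_density)
    show "?k \<xi> \<in> borel_measurable ?P"
      using lattice_normalisable[OF \<Lambda>, THEN normalisableD(1), of m \<xi>] unfolding boltzmann_weight_def by measurable
    show "(\<lambda>\<phi>. g (override_on \<xi> \<phi> \<Lambda>)) \<in> borel_measurable ?P"
      by (rule measurable_compose[OF override_measurable_snd g])
  qed
  show "(\<lambda>\<xi>. (\<integral>\<^sup>+\<phi>. g (override_on \<xi> \<phi> \<Lambda>) \<partial>lattice_gibbs \<Lambda> m \<xi>)) \<in> borel_measurable field_algebra"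
    unfolding inner by (rule P.borel_measurable_nn_integral) (rule prodm)
  have "(\<integral>\<^sup>+\<psi>. g \<psi> \<partial>resample \<Lambda> m \<mu>) =
    (\<integral>\<^sup>+p. g (case p of (\<xi>, \<phi>) \<Rightarrow> override_on \<xi> \<phi> \<Lambda>) \<partial>density (\<mu> \<Otimes>\<^sub>M ?P) (\<lambda>(\<xi>, \<phi>). ?k \<xi> \<phi>))"
    unfolding resample_def by (subst nn_integral_distr) auto
  also have "\<dots> = (\<integral>\<^sup>+p. (case p of (\<xi>, \<phi>) \<Rightarrow> ?k \<xi> \<phi>) * g (case p of (\<xi>, \<phi>) \<Rightarrow> override_on \<xi> \<phi> \<Lambda>) \<partial>(\<mu> \<Otimes>\<^sub>M ?P))"
    by (rule nn_integral_density[OF km']) (use gm in \<open>simp add: case_prod_unfold\<close>)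
  also have "\<dots> = (\<integral>\<^sup>+\<xi>. \<integral>\<^sup>+\<phi>. ?k \<xi> \<phi> * g (override_on \<xi> \<phi> \<Lambda>) \<partial>?P \<partial>\<mu>)"
    using P.nn_integral_fst[of "\<lambda>(\<xi>, \<phi>). ?k \<xi> \<phi> * g (override_on \<xi> \<phi> \<Lambda>)" \<mu>, symmetric] prodm
    by (simp add: case_prod_unfold cong: measurable_cong_sets)
  finally show "(\<integral>\<^sup>+\<psi>. g \<psi> \<partial>resample \<Lambda> m \<mu>) =
    (\<integral>\<^sup>+\<xi>. (\<integral>\<^sup>+\<phi>. g (override_on \<xi> \<phi> \<Lambda>) \<partial>lattice_gibbs \<Lambda> m \<xi>) \<partial>\<mu>)"
    unfolding inner .
qed

lemma resample_prob:
  fixes \<Lambda> :: "(int ^ 'd::finite) set"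
  assumes \<Lambda>: "finite \<Lambda>" and \<mu>: "field_law \<mu>"
  shows "field_law (resample \<Lambda> m \<mu>)"
proof -
  interpret \<mu>: prob_space \<mu> using \<mu> by (rule prob_algebra_fieldsD)
  have "emeasure (resample \<Lambda> m \<mu>) (space (resample \<Lambda> m \<mu>)) = (\<integral>\<^sup>+\<psi>. 1 \<partial>resample \<Lambda> m \<mu>)" by simp
  also have "\<dots> = (\<integral>\<^sup>+\<xi>. (\<integral>\<^sup>+\<phi>. 1 \<partial>lattice_gibbs \<Lambda> m \<xi>) \<partial>\<mu>)"
    by (subst nn_integral_resample[OF \<Lambda> \<mu>]) auto
  also have "\<dots> = 1"
    using prob_space.emeasure_space_1[OF prob_space_lattice_gibbs[OF \<Lambda>]] by (simp add: \<mu>.emeasure_space_1)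
  finally have "prob_space (resample \<Lambda> m \<mu>)" by (rule prob_spaceI)
  then show ?thesis by (simp add: space_prob_algebra resample_def)
qed

lemma sets_finite_gibbs[measurable_cong]: "sets (finite_gibbs V E \<Lambda> m \<xi>) = sets (flat \<Lambda>)"
  by (simp add: finite_gibbs_def)

lemma gibbs_avg_integrable:
  fixes \<Lambda> :: "(int ^ 'd::finite) set"
    and G :: "'d config \<Rightarrow> real"
  assumes \<Lambda>: "finite \<Lambda>" and g: "G \<in> borel_measurable field_algebra" and bd: "\<And>\<phi>. \<bar>G \<phi>\<bar> \<le> K"
  shows "integrable (lattice_gibbs \<Lambda> m \<xi>) (\<lambda>\<phi>. G (override_on \<xi> \<phi> \<Lambda>))"
proof -
  interpret prob_space "lattice_gibbs \<Lambda> m \<xi>" by (rule prob_space_lattice_gibbs[OF \<Lambda>])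
  have "(\<lambda>\<phi>. G (override_on \<xi> \<phi> \<Lambda>)) \<in> borel_measurable (lattice_gibbs \<Lambda> m \<xi>)"
    using measurable_compose[OF override_measurable_snd g] by measurable
  then show ?thesis by (intro integrable_const_bound[of _ K]) (use bd in auto)
qed

lemma gibbs_avg_bound:
  fixes \<Lambda> :: "(int ^ 'd::finite) set"
    and G :: "'d config \<Rightarrow> real"
  assumes \<Lambda>: "finite \<Lambda>" and g: "G \<in> borel_measurable field_algebra" and bd: "\<And>\<phi>. \<bar>G \<phi>\<bar> \<le> K"
  shows "\<bar>gibbs_avg \<Lambda> m \<xi> G\<bar> \<le> K"
proof -
  interpret prob_space "lattice_gibbs \<Lambda> m \<xi>" by (rule prob_space_lattice_gibbs[OF \<Lambda>])
  have "\<bar>gibbs_avg \<Lambda> m \<xi> G\<bar> \<le> (\<integral>\<phi>. K \<partial>lattice_gibbs \<Lambda> m \<xi>)"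
    unfolding gibbs_avg_def
    by (intro order_trans[OF integral_abs_bound] integral_mono integrable_abs gibbs_avg_integrable[OF \<Lambda> g bd]) (use bd in auto)
  then show ?thesis by (simp add: prob_space)
qed

lemma gibbs_avg_mono:
  fixes \<Lambda> :: "(int ^ 'd::finite) set"
    and G G' :: "'d config \<Rightarrow> real"
  assumes \<Lambda>: "finite \<Lambda>" and "G \<in> borel_measurable field_algebra" "\<And>\<phi>. \<bar>G \<phi>\<bar> \<le> K"
    and "G' \<in> borel_measurable field_algebra" "\<And>\<phi>. \<bar>G' \<phi>\<bar> \<le> K'"
    and "\<And>\<phi>. G \<phi> \<le> G' \<phi>"
  shows "gibbs_avg \<Lambda> m \<xi> G \<le> gibbs_avg \<Lambda> m \<xi> G'"
  unfolding gibbs_avg_def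
  by (rule integral_mono[OF gibbs_avg_integrable[OF \<Lambda> assms(2,3)] gibbs_avg_integrable[OF \<Lambda> assms(4,5)] assms(6)])

lemma gibbs_avg_resample:
  fixes \<Lambda> :: "(int ^ 'd::finite) set"
    and G :: "'d config \<Rightarrow> real"
  assumes \<Lambda>: "finite \<Lambda>" and \<mu>: "field_law \<mu>"
    and g[measurable]: "G \<in> borel_measurable field_algebra" and bd: "\<And>\<phi>. \<bar>G \<phi>\<bar> \<le> K"
  shows "(\<lambda>\<xi>. gibbs_avg \<Lambda> m \<xi> G) \<in> borel_measurable field_algebra"
    and "(\<integral>\<psi>. G \<psi> \<partial>resample \<Lambda> m \<mu>) = (\<integral>\<xi>. gibbs_avg \<Lambda> m \<xi> G \<partial>\<mu>)"
proof -
  let ?\<gamma> = "lattice_gibbs \<Lambda> m"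
  interpret \<mu>: prob_space \<mu> using \<mu> by (rule prob_algebra_fieldsD)
  interpret R: prob_space "resample \<Lambda> m \<mu>" using resample_prob[OF \<Lambda> \<mu>] by (rule prob_algebra_fieldsD)
  note s[measurable_cong] = prob_algebra_fieldsD(2)[OF \<mu>] prob_algebra_fieldsD(2)[OF resample_prob[OF \<Lambda> \<mu>], of m]
  \<comment> \<open>Adding the bound K makes the function nonnegative, so measurability and the
    exchange of integrals carry over from nonnegative integrals; the constant is subtracted at the
    end.\<close>
  define G' where "G' \<phi> = G \<phi> + K" for \<phi>
  have g'[measurable]: "G' \<in> borel_measurable field_algebra" unfolding G'_def by measurable
  have nn: "0 \<le> G' \<phi>" for \<phi> using bd[of \<phi>] by (simp add: G'_def)
  have bd': "\<bar>G' \<phi>\<bar> \<le> 2 * K" for \<phi> using bd[of \<phi>] by (simp add: G'_def)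
  have avg': "ennreal (gibbs_avg \<Lambda> m \<xi> G') = (\<integral>\<^sup>+\<phi>. G' (override_on \<xi> \<phi> \<Lambda>) \<partial>?\<gamma> \<xi>)" for \<xi>
    unfolding gibbs_avg_def using gibbs_avg_integrable[OF \<Lambda> g' bd', of m \<xi>] nn
    by (intro nn_integral_eq_integral[symmetric]) auto
  have nn': "0 \<le> gibbs_avg \<Lambda> m \<xi> G'" for \<xi> unfolding gibbs_avg_def using nn by (intro integral_nonneg_AE) auto
  have shift: "gibbs_avg \<Lambda> m \<xi> G' = gibbs_avg \<Lambda> m \<xi> G + K" for \<xi>
  proof -
    interpret prob_space "?\<gamma> \<xi>" by (rule prob_space_lattice_gibbs[OF \<Lambda>])
    show ?thesis
      unfolding gibbs_avg_def G'_def using gibbs_avg_integrable[OF \<Lambda> g bd, of m \<xi>] by (simp add: prob_space)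
  qed
  have "(\<lambda>\<xi>. enn2real (\<integral>\<^sup>+\<phi>. G' (override_on \<xi> \<phi> \<Lambda>) \<partial>?\<gamma> \<xi>)) \<in> borel_measurable field_algebra"
    using nn_integral_resample(2)[OF \<Lambda> \<mu>, of "\<lambda>\<phi>. ennreal (G' \<phi>)" m] by measurable
  then have m': "(\<lambda>\<xi>. gibbs_avg \<Lambda> m \<xi> G') \<in> borel_measurable field_algebra"
    unfolding avg'[symmetric] using nn' by simp
  then have "(\<lambda>\<xi>. gibbs_avg \<Lambda> m \<xi> G' - K) \<in> borel_measurable field_algebra" by measurable
  then show mG[measurable]: "(\<lambda>\<xi>. gibbs_avg \<Lambda> m \<xi> G) \<in> borel_measurable field_algebra"
    unfolding shift by simp
  have ia: "integrable \<mu> (\<lambda>\<xi>. gibbs_avg \<Lambda> m \<xi> G)"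
    by (rule \<mu>.integrable_const_bound[of _ K]) (use gibbs_avg_bound[OF \<Lambda> g bd] in auto)
  have iG: "integrable (resample \<Lambda> m \<mu>) G"
    by (rule R.integrable_const_bound[of _ K]) (use bd in auto)
  have "ennreal (\<integral>\<psi>. G' \<psi> \<partial>resample \<Lambda> m \<mu>) = (\<integral>\<^sup>+\<psi>. G' \<psi> \<partial>resample \<Lambda> m \<mu>)"
    using nn iG by (intro nn_integral_eq_integral[symmetric]) (auto simp: G'_def)
  also have "\<dots> = (\<integral>\<^sup>+\<xi>. ennreal (gibbs_avg \<Lambda> m \<xi> G') \<partial>\<mu>)"
    unfolding avg' by (rule nn_integral_resample[OF \<Lambda> \<mu>]) measurable
  also have "\<dots> = ennreal (\<integral>\<xi>. gibbs_avg \<Lambda> m \<xi> G' \<partial>\<mu>)"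
    using ia nn' unfolding shift by (intro nn_integral_eq_integral) (auto)
  finally have "(\<integral>\<psi>. G' \<psi> \<partial>resample \<Lambda> m \<mu>) = (\<integral>\<xi>. gibbs_avg \<Lambda> m \<xi> G' \<partial>\<mu>)"
    using nn nn' by (subst (asm) ennreal_inj) (auto intro!: integral_nonneg_AE)
  then show "(\<integral>\<psi>. G \<psi> \<partial>resample \<Lambda> m \<mu>) = (\<integral>\<xi>. gibbs_avg \<Lambda> m \<xi> G \<partial>\<mu>)"
    unfolding G'_def shift[unfolded G'_def] using iG ia by (simp add: R.prob_space \<mu>.prob_space)
qed

text \<open>A quantitative Feller property, which lets the DLR equations pass to weak limits. The
  change of the kernel is bounded by the comparison of boundary conditions, optimised over s, and
  the change of the observable at the outer sites by its own Lipschitz bound. The constants may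
  depend on \<Lambda>.\<close>

lemma gibbs_avg_lipschitz:
  fixes \<Lambda> :: "(int ^ 'd::finite) set"
  assumes \<Lambda>: "finite \<Lambda>" and G: "lip_cyl G"
  shows "lip_cyl (\<lambda>\<xi>. gibbs_avg \<Lambda> m \<xi> G)"
proof -
  let ?E = "lattice_edges \<Lambda>" and ?\<gamma> = "lattice_gibbs \<Lambda> m"
  obtain D K X where D: "\<And>\<phi>. \<bar>G \<phi>\<bar> \<le> D" "0 \<le> D" and L: "lipschitz_in K X G" using lip_cylE[OF G] by blast
  have K: "0 \<le> K" "finite X" and lip: "\<And>\<phi> \<psi>. \<bar>G \<phi> - G \<psi>\<bar> \<le> K * (\<Sum>x\<in>X. \<bar>\<phi> x - \<psi> x\<bar>)"
    using L by (auto simp: lipschitz_in_def)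
  note Gm = lip_cyl_measurable[OF G]
  obtain W where W: "0 \<le> W" "\<And>u x. (\<And>x. x \<notin> \<Lambda> \<Longrightarrow> u x = 0) \<Longrightarrow> \<bar>u x\<bar> \<le> W * edge_norm ?E u"
    using dirichlet_bound[OF \<Lambda>] by metis
  define B where "B = K * (real (card X) * W)"
  have B: "0 \<le> B" using K W by (simp add: B_def)
  define T where "T = 4 * (B * sqrt (2 / c)) * (C / 2 * sqrt (2 / c))"
  have T: "0 \<le> T" using B C_nonneg c_pos by (simp add: T_def)
  have bdn: "0 \<le> boundary_dist \<Lambda> \<xi> \<eta>" for \<xi> \<eta>
    by (auto simp: boundary_dist_def intro!: sum_nonneg)
  have one: "gibbs_avg \<Lambda> m \<xi> G - gibbs_avg \<Lambda> m \<eta> G \<le> T * boundary_dist \<Lambda> \<xi> \<eta> + K * (\<Sum>x\<in>X. \<bar>\<xi> x - \<eta> x\<bar>)" for \<xi> \<eta>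
  proof -
    interpret \<eta>: prob_space "?\<gamma> \<eta>" by (rule prob_space_lattice_gibbs[OF \<Lambda>])
    \<comment> \<open>The boundary values inside the observable are frozen at \<xi> while the kernel
      changes from \<xi> to \<eta>; the remaining change of the observable is treated afterwards
      under the kernel of \<eta>.\<close>
    define f where "f \<phi> = G (override_on \<xi> \<phi> \<Lambda>)" for \<phi>
    have fm[measurable]: "f \<in> borel_measurable (flat \<Lambda>)"
      unfolding f_def by (rule measurable_compose[OF override_measurable_snd Gm])
    have "(\<integral>x. f x \<partial>?\<gamma> \<xi>) - (\<integral>x. f x \<partial>?\<gamma> \<eta>) \<le> 4 * (B * sqrt (2 / c)) * (C / 2 * sqrt (2 / c) * boundary_dist \<Lambda> \<xi> \<eta>)"
    proof (rule quadratic_over_linear_bound)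
      show "0 \<le> B * sqrt (2 / c)" using B c_pos by simp
      show "0 \<le> C / 2 * sqrt (2 / c) * boundary_dist \<Lambda> \<xi> \<eta>" using bdn C_nonneg c_pos by simp
      fix s :: real assume s: "0 < s"
      show "(\<integral>x. f x \<partial>?\<gamma> \<xi>) - (\<integral>x. f x \<partial>?\<gamma> \<eta>) \<le> (s * (B * sqrt (2 / c)) + C / 2 * sqrt (2 / c) * boundary_dist \<Lambda> \<xi> \<eta>)\<^sup>2 / s"
      proof (rule boundary_comparison[OF \<Lambda> fm _ _ B s])
        show "\<bar>f x\<bar> \<le> D" for x unfolding f_def by (rule D)
        fix x y :: "'d config"
        define u where "u i = override_on (\<lambda>_. 0) x \<Lambda> i - override_on (\<lambda>_. 0) y \<Lambda> i" for i
        have "f x - f y \<le> K * (\<Sum>i\<in>X. \<bar>override_on \<xi> x \<Lambda> i - override_on \<xi> y \<Lambda> i\<bar>)"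
          unfolding f_def using lip by (meson abs_le_D1)
        also have "(\<Sum>i\<in>X. \<bar>override_on \<xi> x \<Lambda> i - override_on \<xi> y \<Lambda> i\<bar>) = (\<Sum>i\<in>X. \<bar>u i\<bar>)"
          by (intro sum.cong) (auto simp: u_def override_on_def)
        also have "\<dots> \<le> (\<Sum>i\<in>X. W * edge_norm ?E u)"
          by (intro sum_mono W(2)) (simp add: u_def)
        also have "\<dots> = real (card X) * W * edge_norm ?E u" by simp
        finally have "f x - f y \<le> B * edge_norm ?E u"
          using K by (simp add: B_def mult_left_mono mult.assoc)
        moreover have "u = (\<lambda>i. override_on (\<lambda>_. 0) x \<Lambda> i - override_on (\<lambda>_. 0) y \<Lambda> i)" by (simp add: u_def fun_eq_iff)
        ultimately show "f x - f y \<le> B * edge_norm ?E (\<lambda>i. override_on (\<lambda>_. 0) x \<Lambda> i - override_on (\<lambda>_. 0) y \<Lambda> i)" by simp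
      qed
    qed
    then have 1: "gibbs_avg \<Lambda> m \<xi> G - (\<integral>x. f x \<partial>?\<gamma> \<eta>) \<le> T * boundary_dist \<Lambda> \<xi> \<eta>"
      by (simp add: gibbs_avg_def f_def T_def)
    have "(\<integral>x. f x \<partial>?\<gamma> \<eta>) \<le> (\<integral>x. G (override_on \<eta> x \<Lambda>) + K * (\<Sum>x\<in>X. \<bar>\<xi> x - \<eta> x\<bar>) \<partial>?\<gamma> \<eta>)"
    proof (rule integral_mono)
      show "integrable (?\<gamma> \<eta>) f" by (rule \<eta>.integrable_const_bound[of _ D]) (use D in \<open>auto simp: f_def\<close>)
      show "integrable (?\<gamma> \<eta>) (\<lambda>x. G (override_on \<eta> x \<Lambda>) + K * (\<Sum>x\<in>X. \<bar>\<xi> x - \<eta> x\<bar>))"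
        using gibbs_avg_integrable[OF \<Lambda> Gm D(1), of m \<eta>] by simp
      fix x
      have "f x - G (override_on \<eta> x \<Lambda>) \<le> K * (\<Sum>i\<in>X. \<bar>override_on \<xi> x \<Lambda> i - override_on \<eta> x \<Lambda> i\<bar>)"
        unfolding f_def using lip by (meson abs_le_D1)
      also have "\<dots> \<le> K * (\<Sum>i\<in>X. \<bar>\<xi> i - \<eta> i\<bar>)"
        using K by (intro mult_left_mono sum_mono) (auto simp: override_on_def)
      finally show "f x \<le> G (override_on \<eta> x \<Lambda>) + K * (\<Sum>x\<in>X. \<bar>\<xi> x - \<eta> x\<bar>)" by simp
    qed
    also have "\<dots> = gibbs_avg \<Lambda> m \<eta> G + K * (\<Sum>x\<in>X. \<bar>\<xi> x - \<eta> x\<bar>)"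
      using gibbs_avg_integrable[OF \<Lambda> Gm D(1), of m \<eta>] by (simp add: gibbs_avg_def \<eta>.prob_space)
    finally show ?thesis using 1 by linarith
  qed
  let ?B = "boundary_bonds \<Lambda>"
  define Y where "Y = snd ` ?B"
  have finB: "finite ?B" by (rule finite_boundary_bonds[OF \<Lambda>])
  have bd: "boundary_dist \<Lambda> \<xi> \<eta> \<le> real (card ?B) * (\<Sum>y\<in>Y. \<bar>\<xi> y - \<eta> y\<bar>)" for \<xi> \<eta>
  proof -
    have "boundary_dist \<Lambda> \<xi> \<eta> = L2_set (\<lambda>e. \<xi> (snd e) - \<eta> (snd e)) ?B"
      by (simp add: boundary_dist_def L2_set_def case_prod_unfold)
    also have "\<dots> \<le> (\<Sum>e\<in>?B. \<bar>\<xi> (snd e) - \<eta> (snd e)\<bar>)" by (rule L2_set_le_sum_abs)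
    also have "\<dots> \<le> (\<Sum>e\<in>?B. \<Sum>y\<in>Y. \<bar>\<xi> y - \<eta> y\<bar>)"
      using finB by (intro sum_mono member_le_sum) (auto simp: Y_def)
    finally show ?thesis by simp
  qed
  have "lipschitz_in (T * real (card ?B) + K) (X \<union> Y) (\<lambda>\<xi>. gibbs_avg \<Lambda> m \<xi> G)"
    unfolding lipschitz_in_def
  proof (intro conjI allI)
    show fXY: "finite (X \<union> Y)" using K finB by (simp add: Y_def)
    show "0 \<le> T * real (card ?B) + K" using T K by simp
    fix \<xi> \<eta> :: "'d config"
    have one': "gibbs_avg \<Lambda> m \<xi> G - gibbs_avg \<Lambda> m \<eta> G \<le> (T * real (card ?B) + K) * (\<Sum>x\<in>X \<union> Y. \<bar>\<xi> x - \<eta> x\<bar>)" for \<xi> \<eta>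
    proof -
      have "T * boundary_dist \<Lambda> \<xi> \<eta> \<le> T * (real (card ?B) * (\<Sum>y\<in>X \<union> Y. \<bar>\<xi> y - \<eta> y\<bar>))"
        using fXY T by (intro mult_left_mono order_trans[OF bd] sum_mono2) auto
      moreover have "K * (\<Sum>x\<in>X. \<bar>\<xi> x - \<eta> x\<bar>) \<le> K * (\<Sum>y\<in>X \<union> Y. \<bar>\<xi> y - \<eta> y\<bar>)"
        using fXY K by (intro mult_left_mono sum_mono2) auto
      ultimately show ?thesis using one[of \<xi> \<eta>] by (simp add: distrib_right mult.assoc)
    qed
    show "\<bar>gibbs_avg \<Lambda> m \<xi> G - gibbs_avg \<Lambda> m \<eta> G\<bar> \<le> (T * real (card ?B) + K) * (\<Sum>x\<in>X \<union> Y. \<bar>\<xi> x - \<eta> x\<bar>)"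
      using one'[of \<xi> \<eta>] one'[of \<eta> \<xi>] by (simp add: abs_le_iff abs_minus_commute)
  qed
  moreover have "\<bar>gibbs_avg \<Lambda> m \<xi> G\<bar> \<le> D" for \<xi> by (rule gibbs_avg_bound[OF \<Lambda> Gm D(1)])
  ultimately show ?thesis unfolding lip_cyl_def by blast
qed

text \<open>
  A bounded Lipschitz majorant of \<open>1 - exp (- m\<^sup>2 / 2 * (\<Sum>x\<in>\<Lambda>. (\<phi> x)\<^sup>2))\<close>, the change of the
  density between mass \<open>0\<close> and mass \<open>m\<close>. It makes the kernels of small mass converge to the
  massless one in a form that passes to weak limits.
\<close>

definition mass_cutoff :: "(int ^ 'd::finite) set \<Rightarrow> real \<Rightarrow> 'd config \<Rightarrow> real" where
  "mass_cutoff \<Lambda> m \<phi> = (\<Sum>x\<in>\<Lambda>. clamp_real 1 (m * \<phi> x) * clamp_real 1 (m * \<phi> x))"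

lemma lip_cyl_mass_cutoff: "finite \<Lambda> \<Longrightarrow> lip_cyl (mass_cutoff \<Lambda> m)"
proof -
  assume \<Lambda>: "finite \<Lambda>"
  have "lip_cyl (\<lambda>\<phi>. clamp_real 1 (m * \<phi> x))" for x :: "int ^ 'a"
  proof (rule lip_cyl_clamp[where K = "\<bar>m\<bar>" and X = "{x}"])
    show "lipschitz_in \<bar>m\<bar> {x} (\<lambda>\<phi>. m * \<phi> x)"
      by (auto simp: lipschitz_in_def abs_mult[symmetric] right_diff_distrib)
  qed simp
  then show ?thesis unfolding mass_cutoff_def[abs_def] by (intro lip_cyl_sum \<Lambda> lip_cyl_mult)
qed

lemma mass_cutoff_bounds: "0 \<le> mass_cutoff \<Lambda> m \<phi>" "mass_cutoff \<Lambda> m \<phi> \<le> real (card \<Lambda>)"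
proof -
  show "0 \<le> mass_cutoff \<Lambda> m \<phi>" unfolding mass_cutoff_def by (intro sum_nonneg) auto
  have "clamp_real 1 (m * \<phi> x) * clamp_real 1 (m * \<phi> x) \<le> 1" for x
  proof -
    have "\<bar>clamp_real 1 (m * \<phi> x)\<bar> \<le> 1" by (rule clamp_real_bound) simp
    then have "(clamp_real 1 (m * \<phi> x))\<^sup>2 \<le> 1" by (simp add: abs_square_le_1)
    then show ?thesis by (simp add: power2_eq_square)
  qed
  then have "mass_cutoff \<Lambda> m \<phi> \<le> (\<Sum>x\<in>\<Lambda>. 1)" unfolding mass_cutoff_def by (intro sum_mono)
  then show "mass_cutoff \<Lambda> m \<phi> \<le> real (card \<Lambda>)" by simp
qed

lemma mass_cutoff_mono: "0 \<le> m \<Longrightarrow> m \<le> m' \<Longrightarrow> mass_cutoff \<Lambda> m \<phi> \<le> mass_cutoff \<Lambda> m' \<phi>"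
  unfolding mass_cutoff_def
proof (rule sum_mono)
  fix x assume m: "0 \<le> m" "m \<le> m'"
  have "\<bar>m * \<phi> x\<bar> \<le> \<bar>m' * \<phi> x\<bar>" using m by (simp add: abs_mult mult_right_mono)
  moreover have "\<bar>clamp_real 1 t\<bar> = min 1 \<bar>t\<bar>" for t by (auto simp: clamp_real_def)
  ultimately have "\<bar>clamp_real 1 (m * \<phi> x)\<bar> \<le> \<bar>clamp_real 1 (m' * \<phi> x)\<bar>" by auto
  then have "(clamp_real 1 (m * \<phi> x))\<^sup>2 \<le> (clamp_real 1 (m' * \<phi> x))\<^sup>2" by (rule abs_le_square_iff[THEN iffD1])
  then show "clamp_real 1 (m * \<phi> x) * clamp_real 1 (m * \<phi> x) \<le> clamp_real 1 (m' * \<phi> x) * clamp_real 1 (m' * \<phi> x)"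
    by (simp add: power2_eq_square)
qed

lemma exp_mass_le_cutoff:
  assumes "finite \<Lambda>"
  shows "1 - exp (- (m\<^sup>2 / 2 * (\<Sum>x\<in>\<Lambda>. (\<phi> x)\<^sup>2))) \<le> mass_cutoff \<Lambda> m \<phi>"
proof (cases "\<forall>x\<in>\<Lambda>. \<bar>m * \<phi> x\<bar> \<le> 1")
  case True
  then have "mass_cutoff \<Lambda> m \<phi> = (\<Sum>x\<in>\<Lambda>. m\<^sup>2 * (\<phi> x)\<^sup>2)"
    unfolding mass_cutoff_def by (intro sum.cong) (auto simp: clamp_real_eq power2_eq_square)
  then have e: "mass_cutoff \<Lambda> m \<phi> = m\<^sup>2 * (\<Sum>x\<in>\<Lambda>. (\<phi> x)\<^sup>2)" by (simp add: sum_distrib_left)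
  have "1 - exp (- (m\<^sup>2 / 2 * (\<Sum>x\<in>\<Lambda>. (\<phi> x)\<^sup>2))) \<le> m\<^sup>2 / 2 * (\<Sum>x\<in>\<Lambda>. (\<phi> x)\<^sup>2)"
    using exp_ge_add_one_self[of "- (m\<^sup>2 / 2 * (\<Sum>x\<in>\<Lambda>. (\<phi> x)\<^sup>2))"] by linarith
  also have "\<dots> \<le> m\<^sup>2 * (\<Sum>x\<in>\<Lambda>. (\<phi> x)\<^sup>2)" by (intro mult_right_mono sum_nonneg) auto
  finally show ?thesis unfolding e .
next
  case False
  then obtain x where x: "x \<in> \<Lambda>" "1 < \<bar>m * \<phi> x\<bar>" by (auto simp: not_le)
  then have "clamp_real 1 (m * \<phi> x) * clamp_real 1 (m * \<phi> x) = 1" by (auto simp: clamp_real_def abs_if split: if_splits)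
  moreover have "clamp_real 1 (m * \<phi> x) * clamp_real 1 (m * \<phi> x) \<le> mass_cutoff \<Lambda> m \<phi>"
    unfolding mass_cutoff_def using assms x by (intro member_le_sum) auto
  ultimately have "1 \<le> mass_cutoff \<Lambda> m \<phi>" by simp
  moreover have "0 \<le> exp (- (m\<^sup>2 / 2 * (\<Sum>x\<in>\<Lambda>. (\<phi> x)\<^sup>2)))" by simp
  ultimately show ?thesis by linarith
qed

text \<open>Let e be the ratio of the unnormalised densities, p its massless mean and g the massless
  mean of \<open>G\<close> times e. The massive mean is g / p. Passing from g / p to g, and from g
  to the massless mean of \<open>G\<close>, costs at most K (1 - p) each, and 1 - p is the massless
  mean of 1 - e, which the cutoff dominates.\<close>

lemma gibbs_avg_mass_comparison:
  fixes \<Lambda> :: "(int ^ 'd::finite) set"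
    and G :: "'d config \<Rightarrow> real"
  assumes \<Lambda>: "finite \<Lambda>" and Gm: "G \<in> borel_measurable field_algebra" and K: "\<And>\<phi>. \<bar>G \<phi>\<bar> \<le> K"
  shows "\<bar>gibbs_avg \<Lambda> m \<xi> G - gibbs_avg \<Lambda> 0 \<xi> G\<bar> \<le> 2 * K * gibbs_avg \<Lambda> 0 \<xi> (mass_cutoff \<Lambda> m)"
proof -
  let ?E = "lattice_edges \<Lambda>" and ?P = "flat \<Lambda>"
  let ?o = "\<lambda>x. override_on \<xi> x \<Lambda>"
  have K0: "0 \<le> K" using K[of undefined] by linarith
  define H where "H m x = hamiltonian V ?E \<Lambda> m (?o x)" for m x
  define e where "e \<phi> = exp (- (m\<^sup>2 / 2 * (\<Sum>x\<in>\<Lambda>. (\<phi> x)\<^sup>2)))" for \<phi> :: "'d config"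
  have em[measurable]: "e \<in> borel_measurable field_algebra" unfolding e_def by measurable
  have e01: "0 < e \<phi>" "e \<phi> \<le> 1" for \<phi> by (auto simp: e_def intro!: mult_nonneg_nonneg sum_nonneg)
  have eb: "\<bar>e \<phi>\<bar> \<le> 1" for \<phi> using e01[of \<phi>] by simp
  have He: "exp (- H m x) = e (?o x) * exp (- H 0 x)" for x
    by (simp add: H_def e_def hamiltonian_def exp_add[symmetric])
  note Gm[measurable]
  have om[measurable]: "(\<lambda>x. G' (?o x)) \<in> borel_measurable ?P" if "G' \<in> borel_measurable field_algebra" for G' :: "_ \<Rightarrow> real"
    by (rule measurable_compose[OF override_measurable_snd that])
  have avg: "gibbs_avg \<Lambda> m' \<xi> G' = (\<integral>x. G' (?o x) * exp (- H m' x) \<partial>?P) / (\<integral>x. exp (- H m' x) \<partial>?P)"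
    if "G' \<in> borel_measurable field_algebra" for G' m'
    unfolding gibbs_avg_def finite_gibbs_eq H_def
    by (rule integral_gibbs_density(1)[OF lattice_normalisable[OF \<Lambda>] om[OF that]])
  have pos: "0 < (\<integral>x. exp (- H m' x) \<partial>?P)" for m'
    unfolding H_def
    by (rule integral_gibbs_density(2)[OF lattice_normalisable[OF \<Lambda>] om[OF Gm]])
  define p where "p = gibbs_avg \<Lambda> 0 \<xi> e"
  define g where "g = gibbs_avg \<Lambda> 0 \<xi> (\<lambda>\<phi>. G \<phi> * e \<phi>)"
  have Gem[measurable]: "(\<lambda>\<phi>. G \<phi> * e \<phi>) \<in> borel_measurable field_algebra" by measurable
  have Geb: "\<bar>G \<phi> * e \<phi>\<bar> \<le> K" for \<phi>
    using K[of \<phi>] e01[of \<phi>] K0 mult_mono[of "\<bar>G \<phi>\<bar>" K "\<bar>e \<phi>\<bar>" 1] by (simp add: abs_mult)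
  have p: "p = (\<integral>x. exp (- H m x) \<partial>?P) / (\<integral>x. exp (- H 0 x) \<partial>?P)"
    unfolding p_def by (subst avg[OF em]) (simp add: He)
  have p0: "0 < p" unfolding p using pos by simp
  have gm: "gibbs_avg \<Lambda> m \<xi> G = g / p"
  proof -
    have "g = (\<integral>x. G (?o x) * exp (- H m x) \<partial>?P) / (\<integral>x. exp (- H 0 x) \<partial>?P)"
      unfolding g_def by (subst avg[OF Gem]) (simp add: He mult.assoc)
    then show ?thesis unfolding p avg[OF Gm] using pos[of 0] pos[of m] by simp
  qed
  have iG: "integrable (finite_gibbs V ?E \<Lambda> 0 \<xi>) (\<lambda>x. G (?o x))" and ie: "integrable (finite_gibbs V ?E \<Lambda> 0 \<xi>) (\<lambda>x. e (?o x))"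
    and iGe: "integrable (finite_gibbs V ?E \<Lambda> 0 \<xi>) (\<lambda>x. G (?o x) * e (?o x))"
    using gibbs_avg_integrable[OF \<Lambda> Gm K] gibbs_avg_integrable[OF \<Lambda> em eb] gibbs_avg_integrable[OF \<Lambda> Gem Geb] by auto
  interpret g0: prob_space "finite_gibbs V ?E \<Lambda> 0 \<xi>" by (rule prob_space_lattice_gibbs[OF \<Lambda>])
  have p1: "1 - p = (\<integral>x. 1 - e (?o x) \<partial>finite_gibbs V ?E \<Lambda> 0 \<xi>)"
    using ie by (simp add: p_def gibbs_avg_def g0.prob_space)
  have gabs: "\<bar>g\<bar> \<le> K * p"
  proof -
    have "\<bar>g\<bar> \<le> (\<integral>x. K * e (?o x) \<partial>finite_gibbs V ?E \<Lambda> 0 \<xi>)"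
      unfolding g_def gibbs_avg_def
    proof (intro order_trans[OF integral_abs_bound] integral_mono integrable_abs iGe)
      show "integrable (finite_gibbs V ?E \<Lambda> 0 \<xi>) (\<lambda>x. K * e (?o x))" using ie by simp
      show "\<bar>G (?o x) * e (?o x)\<bar> \<le> K * e (?o x)" for x
        using K e01[of "?o x"] by (simp add: abs_mult mult_right_mono)
    qed
    then show ?thesis by (simp add: p_def gibbs_avg_def)
  qed
  have gG: "\<bar>g - gibbs_avg \<Lambda> 0 \<xi> G\<bar> \<le> K * (1 - p)"
  proof -
    have "g - gibbs_avg \<Lambda> 0 \<xi> G = (\<integral>x. G (?o x) * e (?o x) - G (?o x) \<partial>finite_gibbs V ?E \<Lambda> 0 \<xi>)"
      unfolding g_def gibbs_avg_def using iG iGe by simp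
    also have "\<bar>\<dots>\<bar> \<le> (\<integral>x. K * (1 - e (?o x)) \<partial>finite_gibbs V ?E \<Lambda> 0 \<xi>)"
    proof (intro order_trans[OF integral_abs_bound] integral_mono integrable_abs)
      show "integrable (finite_gibbs V ?E \<Lambda> 0 \<xi>) (\<lambda>x. G (?o x) * e (?o x) - G (?o x))" using iG iGe by simp
      show "integrable (finite_gibbs V ?E \<Lambda> 0 \<xi>) (\<lambda>x. K * (1 - e (?o x)))" using ie by simp
      fix x
      have "\<bar>G (?o x) * e (?o x) - G (?o x)\<bar> = \<bar>G (?o x)\<bar> * (1 - e (?o x))"
        using e01[of "?o x"] abs_mult[of "G (?o x)" "e (?o x) - 1"] by (simp add: algebra_simps)
      also have "\<dots> \<le> K * (1 - e (?o x))" using K e01[of "?o x"] by (intro mult_right_mono) auto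
      finally show "\<bar>G (?o x) * e (?o x) - G (?o x)\<bar> \<le> K * (1 - e (?o x))" .
    qed
    finally show ?thesis unfolding p1 by simp
  qed
  have pc: "1 - p \<le> gibbs_avg \<Lambda> 0 \<xi> (mass_cutoff \<Lambda> m)"
    unfolding p1 gibbs_avg_def
  proof (intro integral_mono)
    show "integrable (finite_gibbs V ?E \<Lambda> 0 \<xi>) (\<lambda>x. 1 - e (?o x))" using ie by simp
    show "integrable (finite_gibbs V ?E \<Lambda> 0 \<xi>) (\<lambda>x. mass_cutoff \<Lambda> m (?o x))"
      using mass_cutoff_bounds[of \<Lambda> m] lip_cyl_measurable[OF lip_cyl_mass_cutoff[OF \<Lambda>]]
      by (intro gibbs_avg_integrable[OF \<Lambda>, where K = "real (card \<Lambda>)"]) (auto simp: abs_le_iff intro: order_trans[OF _ of_nat_0_le_iff])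
    show "1 - e (?o x) \<le> mass_cutoff \<Lambda> m (?o x)" for x
      unfolding e_def by (rule exp_mass_le_cutoff[OF \<Lambda>])
  qed
  have ple: "p \<le> 1"
  proof -
    have "0 \<le> 1 - p" unfolding p1 using e01 by (intro integral_nonneg_AE) auto
    then show ?thesis by simp
  qed
  have "\<bar>g / p - g\<bar> = \<bar>g\<bar> * (1 / p - 1)"
  proof -
    have "g / p - g = g * (1 / p - 1)" by (simp add: algebra_simps)
    moreover have "0 \<le> 1 / p - 1" using p0 ple by simp
    ultimately show ?thesis by (simp add: abs_mult)
  qed
  also have "\<dots> \<le> K * p * (1 / p - 1)" using gabs p0 ple by (intro mult_right_mono) auto
  also have "\<dots> = K * (1 - p)" using p0 by (simp add: algebra_simps)
  finally have "\<bar>g / p - gibbs_avg \<Lambda> 0 \<xi> G\<bar> \<le> 2 * K * (1 - p)" using gG by linarith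
  also have "\<dots> \<le> 2 * K * gibbs_avg \<Lambda> 0 \<xi> (mass_cutoff \<Lambda> m)" using pc K0 by (intro mult_left_mono) auto
  finally show ?thesis unfolding gm .
qed

lemma gibbs_avg_mass_cutoff_lim:
  fixes \<Lambda> :: "(int ^ 'd::finite) set"
  assumes \<Lambda>: "finite \<Lambda>"
  shows "(\<lambda>n. gibbs_avg \<Lambda> 0 \<xi> (mass_cutoff \<Lambda> (1 / real (Suc n)))) \<longlonglongrightarrow> 0"
proof -
  let ?g = "lattice_gibbs \<Lambda> 0 \<xi>"
  interpret g0: prob_space ?g by (rule prob_space_lattice_gibbs[OF \<Lambda>])
  have m: "mass_cutoff \<Lambda> m \<in> borel_measurable field_algebra" for m
    by (rule lip_cyl_measurable[OF lip_cyl_mass_cutoff[OF \<Lambda>]])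
  have "(\<lambda>n. \<integral>x. mass_cutoff \<Lambda> (1 / real (Suc n)) (override_on \<xi> x \<Lambda>) \<partial>?g) \<longlonglongrightarrow> (\<integral>x. 0 \<partial>?g)"
  proof (rule integral_dominated_convergence[where w = "\<lambda>_. real (card \<Lambda>)"])
    show "(\<lambda>x. mass_cutoff \<Lambda> (1 / real (Suc n)) (override_on \<xi> x \<Lambda>)) \<in> borel_measurable ?g" for n
      using measurable_compose[OF override_measurable_snd m] by measurable
    show "AE x in ?g. norm (mass_cutoff \<Lambda> (1 / real (Suc n)) (override_on \<xi> x \<Lambda>)) \<le> real (card \<Lambda>)" for n
      using mass_cutoff_bounds[of \<Lambda> "1 / real (Suc n)"] by (intro AE_I2) (simp only: real_norm_def abs_of_nonneg)
    have "(\<lambda>n. mass_cutoff \<Lambda> (1 / real (Suc n)) \<phi>) \<longlonglongrightarrow> (\<Sum>x\<in>\<Lambda>. clamp_real 1 (0 * \<phi> x) * clamp_real 1 (0 * \<phi> x))" for \<phi>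
      unfolding mass_cutoff_def clamp_real_def
      by (intro tendsto_intros LIMSEQ_Suc[OF lim_1_over_n])
    then show "AE x in ?g. (\<lambda>n. mass_cutoff \<Lambda> (1 / real (Suc n)) (override_on \<xi> x \<Lambda>)) \<longlonglongrightarrow> 0"
      by (simp add: clamp_real_def)
  qed auto
  then show ?thesis by (simp add: gibbs_avg_def)
qed

end

section \<open>Properties stable under weak limits\<close>

lemma measurable_shift[measurable]: "shift z \<in> measurable (field_algebra :: 'd::finite config measure) field_algebra"
  unfolding shift_def[abs_def] by (rule measurable_PiM_single') auto

lemma measurable_reflect[measurable]: "(\<lambda>\<phi> x. - \<phi> x) \<in> measurable (field_algebra :: 'd::finite config measure) field_algebra"
  by (rule measurable_PiM_single') auto

lemma lipschitz_inD: "lipschitz_in K X G \<Longrightarrow> \<bar>G \<phi> - G \<psi>\<bar> \<le> K * (\<Sum>x\<in>X. \<bar>\<phi> x - \<psi> x\<bar>)"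
  by (simp add: lipschitz_in_def)

lemma lip_cyl_shift:
  fixes G :: "'d::finite config \<Rightarrow> real"
  assumes "lip_cyl G" shows "lip_cyl (\<lambda>\<phi>. G (shift z \<phi>))"
proof -
  obtain C K X where 1: "\<And>\<phi>. \<bar>G \<phi>\<bar> \<le> C" "0 \<le> C" "lipschitz_in K X G" using lip_cylE[OF assms] by blast
  have "lipschitz_in K ((\<lambda>x. x + z) ` X) (\<lambda>\<phi>. G (shift z \<phi>))"
    unfolding lipschitz_in_def
  proof (intro conjI allI)
    fix \<phi> \<psi> :: "'d config"
    have "\<bar>G (shift z \<phi>) - G (shift z \<psi>)\<bar> \<le> K * (\<Sum>x\<in>X. \<bar>shift z \<phi> x - shift z \<psi> x\<bar>)"
      using lipschitz_inD[OF 1(3)] .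
    also have "(\<Sum>x\<in>X. \<bar>shift z \<phi> x - shift z \<psi> x\<bar>) = (\<Sum>x\<in>(\<lambda>x. x + z) ` X. \<bar>\<phi> x - \<psi> x\<bar>)"
      by (subst sum.reindex) (auto simp: shift_def inj_on_def)
    finally show "\<bar>G (shift z \<phi>) - G (shift z \<psi>)\<bar> \<le> K * (\<Sum>x\<in>(\<lambda>x. x + z) ` X. \<bar>\<phi> x - \<psi> x\<bar>)" .
  qed (use 1(3) in \<open>simp_all add: lipschitz_in_def\<close>)
  with 1(1) show ?thesis unfolding lip_cyl_def by blast
qed

lemma lip_cyl_reflect:
  assumes "lip_cyl G" shows "lip_cyl (\<lambda>\<phi>. G (\<lambda>x. - \<phi> x))"
proof -
  obtain C K X where 1: "\<And>\<phi>. \<bar>G \<phi>\<bar> \<le> C" "0 \<le> C" "lipschitz_in K X G" using lip_cylE[OF assms] by blast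
  have "lipschitz_in K X (\<lambda>\<phi>. G (\<lambda>x. - \<phi> x))"
    unfolding lipschitz_in_def
  proof (intro conjI allI)
    fix \<phi> \<psi> :: "'a \<Rightarrow> real"
    have "\<bar>G (\<lambda>x. - \<phi> x) - G (\<lambda>x. - \<psi> x)\<bar> \<le> K * (\<Sum>x\<in>X. \<bar>- \<phi> x - - \<psi> x\<bar>)"
      using lipschitz_inD[OF 1(3)] .
    also have "(\<Sum>x\<in>X. \<bar>- \<phi> x - - \<psi> x\<bar>) = (\<Sum>x\<in>X. \<bar>\<phi> x - \<psi> x\<bar>)" by (intro sum.cong) auto
    finally show "\<bar>G (\<lambda>x. - \<phi> x) - G (\<lambda>x. - \<psi> x)\<bar> \<le> K * (\<Sum>x\<in>X. \<bar>\<phi> x - \<psi> x\<bar>)" .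
  qed (use 1(3) in \<open>simp_all add: lipschitz_in_def\<close>)
  with 1(1) show ?thesis unfolding lip_cyl_def by blast
qed

lemma lip_cyl_integrable:
  fixes G :: "'d::finite config \<Rightarrow> real"
  assumes "lip_cyl G" "field_law \<mu>"
  shows "integrable \<mu> G"
proof -
  interpret prob_space \<mu> using assms(2) by (rule prob_algebra_fieldsD)
  obtain C where "\<And>\<phi>. \<bar>G \<phi>\<bar> \<le> C" using lip_cylE[OF assms(1)] by metis
  moreover have "G \<in> borel_measurable \<mu>"
    by (rule measurable_field_law[OF assms(2) lip_cyl_measurable[OF assms(1)]])
  ultimately show ?thesis by (intro integrable_const_bound[of _ C]) auto
qed

text \<open>The counterpart of \<open>dominated\<close> for nonlinear observables; the l2 term with
  small constant is again meant to be absorbed by the mass.\<close>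

definition grad_lipschitz :: "real \<Rightarrow> ('d::finite config \<Rightarrow> real) \<Rightarrow> bool" where
  "grad_lipschitz a G \<longleftrightarrow> (\<forall>b>0. \<exists>E X. bond_set E \<and> finite X \<and>
     (\<forall>\<phi> \<psi>. G \<phi> - G \<psi> \<le> a * edge_norm E (\<lambda>x. \<phi> x - \<psi> x) + b * L2_set (\<lambda>x. \<phi> x - \<psi> x) X))"

lemma grad_lipschitzI:
  assumes "dominated a l" "\<And>\<phi> \<psi>. G \<phi> - G \<psi> \<le> l (\<lambda>x. \<phi> x - \<psi> x)"
  shows "grad_lipschitz a G"
  using assms unfolding dominated_def grad_lipschitz_def by (meson order_trans)

context convex_potential
begin

definition dlr :: "(int ^ 'd::finite) set \<Rightarrow> real \<Rightarrow> 'd config measure \<Rightarrow> bool" where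
  "dlr \<Lambda> m \<mu> \<longleftrightarrow> (\<forall>G. lip_cyl G \<longrightarrow> (\<integral>\<phi>. G \<phi> \<partial>\<mu>) = (\<integral>\<xi>. gibbs_avg \<Lambda> m \<xi> G \<partial>\<mu>))"

definition reflection_invariant :: "'d::finite config measure \<Rightarrow> bool" where
  "reflection_invariant \<mu> \<longleftrightarrow> distr \<mu> field_algebra (\<lambda>\<phi> x. - \<phi> x) = \<mu>"

text \<open>The constant is 4 (a sqrt (2 / c))^2, the finite-volume variance bound after the l2 term
  has been removed.\<close>

definition grad_poincare :: "'d::finite config measure \<Rightarrow> bool" where
  "grad_poincare \<mu> \<longleftrightarrow> (\<forall>G a. lip_cyl G \<longrightarrow> 0 \<le> a \<longrightarrow> grad_lipschitz a G \<longrightarrow>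
     (\<integral>\<phi>. G \<phi> * G \<phi> \<partial>\<mu>) - (\<integral>\<phi>. G \<phi> \<partial>\<mu>)\<^sup>2 \<le> 8 * a\<^sup>2 / c)"

text \<open>
  These are the properties of the torus measures of mass \<open>m\<close> that survive the infinite-volume limit,
  and then the massless limit.
\<close>

definition good :: "real \<Rightarrow> 'd::finite config measure \<Rightarrow> bool" where
  "good m \<mu> \<longleftrightarrow> field_law \<mu> \<and> shift_invariant \<mu> \<and> reflection_invariant \<mu> \<and>
     grad_poincare \<mu> \<and> (\<forall>\<Lambda>. finite \<Lambda> \<longrightarrow> dlr \<Lambda> m \<mu>)"

section \<open>Closure under weak limits\<close>

lemma integral_distr_fields:
  fixes \<mu> :: "'d::finite config measure"
  assumes "field_law \<mu>" "T \<in> measurable field_algebra field_algebra" "lip_cyl G"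
  shows "(\<integral>\<phi>. G \<phi> \<partial>distr \<mu> field_algebra T) = (\<integral>\<phi>. G (T \<phi>) \<partial>\<mu>)"
    and "field_law (distr \<mu> field_algebra T)"
proof -
  note s = prob_algebra_fieldsD[OF assms(1)]
  note T = measurable_field_law[OF assms(1,2)]
  show "(\<integral>\<phi>. G \<phi> \<partial>distr \<mu> field_algebra T) = (\<integral>\<phi>. G (T \<phi>) \<partial>\<mu>)"
    by (rule integral_distr[OF T lip_cyl_measurable[OF assms(3)]])
  show "field_law (distr \<mu> field_algebra T)"
    by (auto simp: space_prob_algebra intro!: prob_space.prob_space_distr[OF s(1) T])
qed

lemma shift_invariant_integral:
  fixes \<mu> :: "'d::finite config measure"
  assumes "field_law \<mu>" "shift_invariant \<mu>" "G \<in> borel_measurable field_algebra"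
  shows "(\<integral>\<phi>. G (shift z \<phi>) \<partial>\<mu>) = (\<integral>\<phi>. G \<phi> \<partial>\<mu> :: real)"
proof -
  note T = measurable_field_law[OF assms(1) measurable_shift]
  have "(\<integral>\<phi>. G \<phi> \<partial>distr \<mu> field_algebra (shift z)) = (\<integral>\<phi>. G (shift z \<phi>) \<partial>\<mu>)"
    by (rule integral_distr[OF T assms(3)])
  then show ?thesis using assms(2) by (simp add: shift_invariant_def)
qed

lemma reflection_invariant_integral:
  fixes \<mu> :: "'d::finite config measure"
  assumes "field_law \<mu>" "reflection_invariant \<mu>" "G \<in> borel_measurable field_algebra"
  shows "(\<integral>\<phi>. G (\<lambda>x. - \<phi> x) \<partial>\<mu>) = (\<integral>\<phi>. G \<phi> \<partial>\<mu> :: real)"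
proof -
  note T = measurable_field_law[OF assms(1) measurable_reflect]
  have "(\<integral>\<phi>. G \<phi> \<partial>distr \<mu> field_algebra (\<lambda>\<phi> x. - \<phi> x)) = (\<integral>\<phi>. G (\<lambda>x. - \<phi> x) \<partial>\<mu>)"
    by (rule integral_distr[OF T assms(3)])
  then show ?thesis using assms(2) by (simp add: reflection_invariant_def)
qed

text \<open>The identity is required for each test function only from some index on: the torus
  measures, extended by 0, look shift invariant to a local function once the box contains the sites
  that it sees.\<close>

lemma shift_invariant_limit:
  fixes L :: "'d::finite config measure"
  assumes w: "weakly_converges M L sequentially"
    and ev: "\<And>G z. lip_cyl G \<Longrightarrow> \<forall>\<^sub>F i in sequentially. (\<integral>\<phi>. G (shift z \<phi>) \<partial>M i) = (\<integral>\<phi>. G \<phi> \<partial>M i)"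
  shows "shift_invariant L"
  unfolding shift_invariant_def
proof
  fix z
  have L: "field_law L" using w by (simp add: weakly_converges_def)
  show "distr L field_algebra (shift z) = L"
  proof (rule fields_eqI[OF _ L])
    show "field_law (distr L field_algebra (shift z))"
      by (rule integral_distr_fields(2)[OF L measurable_shift lip_cyl_const])
    fix F :: "'d config \<Rightarrow> real" assume F: "lip_cyl F"
    have "(\<lambda>i. \<integral>\<phi>. F \<phi> \<partial>M i) \<longlonglongrightarrow> (\<integral>\<phi>. F (shift z \<phi>) \<partial>L)"
      using weakly_convergesD[OF w lip_cyl_shift[OF F]] by (rule Lim_transform_eventually) (rule ev[OF F])
    then have "(\<integral>\<phi>. F (shift z \<phi>) \<partial>L) = (\<integral>\<phi>. F \<phi> \<partial>L)"
      using weakly_convergesD[OF w F] by (rule LIMSEQ_unique)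
    then show "(\<integral>\<phi>. F \<phi> \<partial>distr L field_algebra (shift z)) = (\<integral>\<phi>. F \<phi> \<partial>L)"
      by (simp add: integral_distr_fields(1)[OF L measurable_shift F])
  qed
qed

lemma reflection_invariant_limit:
  fixes L :: "'d::finite config measure"
  assumes w: "weakly_converges M L sequentially"
    and ev: "\<And>G. lip_cyl G \<Longrightarrow> \<forall>\<^sub>F i in sequentially. (\<integral>\<phi>. G (\<lambda>x. - \<phi> x) \<partial>M i) = (\<integral>\<phi>. G \<phi> \<partial>M i)"
  shows "reflection_invariant L"
  unfolding reflection_invariant_def
proof -
  have L: "field_law L" using w by (simp add: weakly_converges_def)
  show "distr L field_algebra (\<lambda>\<phi> x. - \<phi> x) = L"
  proof (rule fields_eqI[OF _ L])
    show "field_law (distr L field_algebra (\<lambda>\<phi> x. - \<phi> x))"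
      by (rule integral_distr_fields(2)[OF L measurable_reflect lip_cyl_const])
    fix F :: "'d config \<Rightarrow> real" assume F: "lip_cyl F"
    have "(\<lambda>i. \<integral>\<phi>. F \<phi> \<partial>M i) \<longlonglongrightarrow> (\<integral>\<phi>. F (\<lambda>x. - \<phi> x) \<partial>L)"
      using weakly_convergesD[OF w lip_cyl_reflect[OF F]] by (rule Lim_transform_eventually) (rule ev[OF F])
    then have "(\<integral>\<phi>. F (\<lambda>x. - \<phi> x) \<partial>L) = (\<integral>\<phi>. F \<phi> \<partial>L)"
      using weakly_convergesD[OF w F] by (rule LIMSEQ_unique)
    then show "(\<integral>\<phi>. F \<phi> \<partial>distr L field_algebra (\<lambda>\<phi> x. - \<phi> x)) = (\<integral>\<phi>. F \<phi> \<partial>L)"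
      by (simp add: integral_distr_fields(1)[OF L measurable_reflect F])
  qed
qed

lemma grad_poincare_limit:
  fixes L :: "'d::finite config measure"
  assumes w: "weakly_converges M L sequentially"
    and ev: "\<And>G a e. lip_cyl G \<Longrightarrow> 0 \<le> a \<Longrightarrow> grad_lipschitz a G \<Longrightarrow> 0 < e \<Longrightarrow>
      \<forall>\<^sub>F i in sequentially. (\<integral>\<phi>. G \<phi> * G \<phi> \<partial>M i) - (\<integral>\<phi>. G \<phi> \<partial>M i)\<^sup>2 \<le> 8 * a\<^sup>2 / c + e"
  shows "grad_poincare L"
  unfolding grad_poincare_def
proof (intro allI impI)
  fix G :: "'d config \<Rightarrow> real" and a :: real
  assume G: "lip_cyl G" "0 \<le> a" "grad_lipschitz a G"
  have lim: "(\<lambda>i. (\<integral>\<phi>. G \<phi> * G \<phi> \<partial>M i) - (\<integral>\<phi>. G \<phi> \<partial>M i)\<^sup>2) \<longlonglongrightarrow> (\<integral>\<phi>. G \<phi> * G \<phi> \<partial>L) - (\<integral>\<phi>. G \<phi> \<partial>L)\<^sup>2"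
    by (intro tendsto_intros weakly_convergesD[OF w] lip_cyl_mult G)
  show "(\<integral>\<phi>. G \<phi> * G \<phi> \<partial>L) - (\<integral>\<phi>. G \<phi> \<partial>L)\<^sup>2 \<le> 8 * a\<^sup>2 / c"
  proof (rule field_le_epsilon)
    fix e :: real assume "0 < e"
    from tendsto_upperbound[OF lim ev[OF G this]]
    show "(\<integral>\<phi>. G \<phi> * G \<phi> \<partial>L) - (\<integral>\<phi>. G \<phi> \<partial>L)\<^sup>2 \<le> 8 * a\<^sup>2 / c + e" by simp
  qed
qed

lemma dlr_limit:
  fixes L :: "'d::finite config measure"
  assumes w: "weakly_converges M L sequentially" and \<Lambda>: "finite \<Lambda>"
    and ev: "\<And>G. lip_cyl G \<Longrightarrow> \<forall>\<^sub>F i in sequentially. (\<integral>\<phi>. G \<phi> \<partial>M i) = (\<integral>\<xi>. gibbs_avg \<Lambda> m \<xi> G \<partial>M i)"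
  shows "dlr \<Lambda> m L"
  unfolding dlr_def
proof (intro allI impI)
  fix G :: "'d config \<Rightarrow> real" assume G: "lip_cyl G"
  have "(\<lambda>i. \<integral>\<xi>. gibbs_avg \<Lambda> m \<xi> G \<partial>M i) \<longlonglongrightarrow> (\<integral>\<phi>. G \<phi> \<partial>L)"
    using weakly_convergesD[OF w G] by (rule Lim_transform_eventually) (rule ev[OF G])
  then show "(\<integral>\<phi>. G \<phi> \<partial>L) = (\<integral>\<xi>. gibbs_avg \<Lambda> m \<xi> G \<partial>L)"
    using weakly_convergesD[OF w gibbs_avg_lipschitz[OF \<Lambda> G]] by (rule LIMSEQ_unique)
qed

text \<open>Measure and kernel both vary with the mass, so the two limits have to be separated. Once
  the mass is below a fixed m', the error is at most the mean of the cutoff of mass m' under the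
  massless kernel, which is a Lipschitz cylinder function of the boundary condition. The measures
  converge first, and then m' tends to 0.\<close>

lemma dlr_massless_limit:
  fixes L :: "'d::finite config measure"
  assumes w: "weakly_converges M L sequentially" and \<Lambda>: "finite \<Lambda>"
    and M: "\<And>i. field_law (M i)"
    and d: "\<And>i. dlr \<Lambda> (ms i) (M i)" and ms: "\<And>i. 0 < ms i" "ms \<longlonglongrightarrow> 0"
  shows "dlr \<Lambda> 0 L"
  unfolding dlr_def
proof (intro allI impI)
  fix G :: "'d config \<Rightarrow> real" assume G: "lip_cyl G"
  have L: "field_law L" using w by (simp add: weakly_converges_def)
  interpret L: prob_space L using L by (rule prob_algebra_fieldsD)
  obtain K where K: "\<And>\<phi>. \<bar>G \<phi>\<bar> \<le> K" "0 \<le> K" using lip_cylE[OF G] by metis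
  note Gm = lip_cyl_measurable[OF G]
  let ?g = "\<lambda>\<xi>. gibbs_avg \<Lambda> 0 \<xi> G" and ?h = "\<lambda>m' \<xi>. gibbs_avg \<Lambda> 0 \<xi> (mass_cutoff \<Lambda> m')"
  have lh: "lip_cyl (?h m')" for m' by (rule gibbs_avg_lipschitz[OF \<Lambda> lip_cyl_mass_cutoff[OF \<Lambda>]])
  have lg: "lip_cyl ?g" by (rule gibbs_avg_lipschitz[OF \<Lambda> G])
  have bound: "\<bar>(\<integral>\<phi>. G \<phi> \<partial>L) - (\<integral>\<xi>. ?g \<xi> \<partial>L)\<bar> \<le> 2 * K * (\<integral>\<xi>. ?h m' \<xi> \<partial>L)" if m': "0 < m'" for m'
  proof (rule tendsto_le[OF sequentially_bot])
    show "(\<lambda>i. 2 * K * (\<integral>\<xi>. ?h m' \<xi> \<partial>M i)) \<longlonglongrightarrow> 2 * K * (\<integral>\<xi>. ?h m' \<xi> \<partial>L)"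
      by (intro tendsto_intros weakly_convergesD[OF w lh])
    show "(\<lambda>i. \<bar>(\<integral>\<phi>. G \<phi> \<partial>M i) - (\<integral>\<xi>. ?g \<xi> \<partial>M i)\<bar>) \<longlonglongrightarrow> \<bar>(\<integral>\<phi>. G \<phi> \<partial>L) - (\<integral>\<xi>. ?g \<xi> \<partial>L)\<bar>"
      by (intro tendsto_intros weakly_convergesD[OF w] G lg)
    have "\<forall>\<^sub>F i in sequentially. ms i < m'" using ms(2) m' by (rule order_tendstoD)
    then show "\<forall>\<^sub>F i in sequentially. \<bar>(\<integral>\<phi>. G \<phi> \<partial>M i) - (\<integral>\<xi>. ?g \<xi> \<partial>M i)\<bar> \<le> 2 * K * (\<integral>\<xi>. ?h m' \<xi> \<partial>M i)"
    proof eventually_elim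
      case (elim i)
      let ?k = "\<lambda>\<xi>. gibbs_avg \<Lambda> (ms i) \<xi> G"
      have ik: "integrable (M i) ?k" and ig: "integrable (M i) ?g" and ih: "integrable (M i) (?h m')"
        by (intro lip_cyl_integrable[OF _ M] gibbs_avg_lipschitz[OF \<Lambda>] G lh)+
      have "(\<integral>\<phi>. G \<phi> \<partial>M i) - (\<integral>\<xi>. ?g \<xi> \<partial>M i) = (\<integral>\<xi>. ?k \<xi> - ?g \<xi> \<partial>M i)"
        using d[of i] G ik ig by (simp add: dlr_def)
      also have "\<bar>\<dots>\<bar> \<le> (\<integral>\<xi>. 2 * K * ?h m' \<xi> \<partial>M i)"
      proof (intro order_trans[OF integral_abs_bound] integral_mono)
        show "integrable (M i) (\<lambda>\<xi>. \<bar>?k \<xi> - ?g \<xi>\<bar>)" using ik ig by simp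
        show "integrable (M i) (\<lambda>\<xi>. 2 * K * ?h m' \<xi>)" using ih by simp
        fix \<xi>
        have "\<bar>?k \<xi> - ?g \<xi>\<bar> \<le> 2 * K * ?h (ms i) \<xi>" by (rule gibbs_avg_mass_comparison[OF \<Lambda> Gm K(1)])
        also have "\<dots> \<le> 2 * K * ?h m' \<xi>"
        proof (intro mult_left_mono gibbs_avg_mono[OF \<Lambda>])
          show "mass_cutoff \<Lambda> (ms i) \<phi> \<le> mass_cutoff \<Lambda> m' \<phi>" for \<phi>
            using ms(1)[of i] elim by (intro mass_cutoff_mono) auto
          show "\<bar>mass_cutoff \<Lambda> (ms i) \<phi>\<bar> \<le> real (card \<Lambda>)" for \<phi>
            using mass_cutoff_bounds[of \<Lambda> "ms i" \<phi>] by (simp only: abs_of_nonneg)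
          show "\<bar>mass_cutoff \<Lambda> m' \<phi>\<bar> \<le> real (card \<Lambda>)" for \<phi>
            using mass_cutoff_bounds[of \<Lambda> m' \<phi>] by (simp only: abs_of_nonneg)
        qed (use K lip_cyl_measurable[OF lip_cyl_mass_cutoff[OF \<Lambda>]] in auto)
        finally show "\<bar>?k \<xi> - ?g \<xi>\<bar> \<le> 2 * K * ?h m' \<xi>" .
      qed
      also have "\<dots> = 2 * K * (\<integral>\<xi>. ?h m' \<xi> \<partial>M i)" by simp
      finally show ?case .
    qed
  qed
  have "(\<lambda>n. \<integral>\<xi>. ?h (1 / real (Suc n)) \<xi> \<partial>L) \<longlonglongrightarrow> (\<integral>\<xi>. 0 \<partial>L)"
  proof (rule integral_dominated_convergence[where w = "\<lambda>_. real (card \<Lambda>)"])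
    show "?h (1 / real (Suc n)) \<in> borel_measurable L" for n
      by (rule measurable_field_law[OF L lip_cyl_measurable[OF lh]])
    show "AE \<xi> in L. (\<lambda>n. ?h (1 / real (Suc n)) \<xi>) \<longlonglongrightarrow> 0"
      using gibbs_avg_mass_cutoff_lim[OF \<Lambda>] by (intro AE_I2)
    show "AE \<xi> in L. norm (?h (1 / real (Suc n)) \<xi>) \<le> real (card \<Lambda>)" for n
    proof (intro AE_I2)
      fix \<xi>
      have "\<bar>mass_cutoff \<Lambda> (1 / real (Suc n)) \<phi>\<bar> \<le> real (card \<Lambda>)" for \<phi>
        using mass_cutoff_bounds[of \<Lambda> "1 / real (Suc n)" \<phi>] by (simp only: abs_of_nonneg)
      from gibbs_avg_bound[OF \<Lambda> lip_cyl_measurable[OF lip_cyl_mass_cutoff[OF \<Lambda>]] this]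
      show "norm (?h (1 / real (Suc n)) \<xi>) \<le> real (card \<Lambda>)" by simp
    qed
  qed auto
  then have "(\<lambda>n. 2 * K * (\<integral>\<xi>. ?h (1 / real (Suc n)) \<xi> \<partial>L)) \<longlonglongrightarrow> 2 * K * (\<integral>\<xi>. 0 \<partial>L)"
    by (intro tendsto_intros)
  then have "\<bar>(\<integral>\<phi>. G \<phi> \<partial>L) - (\<integral>\<xi>. ?g \<xi> \<partial>L)\<bar> \<le> 2 * K * (\<integral>\<xi>. 0 \<partial>L)"
    by (rule LIMSEQ_le_const) (intro exI allI impI bound, simp)
  then show "(\<integral>\<phi>. G \<phi> \<partial>L) = (\<integral>\<xi>. ?g \<xi> \<partial>L)" by simp
qed

lemma good_massless_limit:
  fixes L :: "'d::finite config measure"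
  assumes w: "weakly_converges M L sequentially" and g: "\<And>i. good (ms i) (M i)" and ms: "\<And>i. 0 < ms i" "ms \<longlonglongrightarrow> 0"
  shows "good 0 L"
proof -
  have M: "field_law (M i)" for i using g by (simp add: good_def)
  show ?thesis
    unfolding good_def
  proof (intro conjI allI impI)
    show "field_law L" using w by (simp add: weakly_converges_def)
    show "shift_invariant L"
      by (rule shift_invariant_limit[OF w])
         (use g lip_cyl_measurable in \<open>auto simp: good_def intro!: always_eventually shift_invariant_integral\<close>)
    show "reflection_invariant L"
      by (rule reflection_invariant_limit[OF w])
         (use g lip_cyl_measurable in \<open>auto simp: good_def intro!: always_eventually reflection_invariant_integral\<close>)
    show "grad_poincare L"
    proof (rule grad_poincare_limit[OF w], intro always_eventually allI)
      fix G :: "'d config \<Rightarrow> real" and a e :: real and i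
      assume "lip_cyl G" "0 \<le> a" "grad_lipschitz a G" "0 < e"
      moreover have "grad_poincare (M i)" using g by (simp add: good_def)
      ultimately have "(\<integral>\<phi>. G \<phi> * G \<phi> \<partial>M i) - (\<integral>\<phi>. G \<phi> \<partial>M i)\<^sup>2 \<le> 8 * a\<^sup>2 / c"
        unfolding grad_poincare_def by blast
      then show "(\<integral>\<phi>. G \<phi> * G \<phi> \<partial>M i) - (\<integral>\<phi>. G \<phi> \<partial>M i)\<^sup>2 \<le> 8 * a\<^sup>2 / c + e" using \<open>0 < e\<close> by linarith
    qed
    show "dlr \<Lambda> 0 L" if "finite \<Lambda>" for \<Lambda>
      by (rule dlr_massless_limit[OF w that M _ ms]) (use g that in \<open>auto simp: good_def\<close>)
  qed
qed

text \<open>Variance bounds are available for bounded observables only; Fatou's lemma removes the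
  clamp and yields integrability at the same time.\<close>

lemma second_moment_from_clamped:
  assumes \<mu>: "prob_space \<mu>" and [measurable]: "l \<in> borel_measurable \<mu>"
    and b: "\<And>R. 0 \<le> R \<Longrightarrow> (\<integral>\<phi>. clamp_real R (l \<phi>) * clamp_real R (l \<phi>) \<partial>\<mu>) \<le> K"
  shows "integrable \<mu> (\<lambda>\<phi>. (l \<phi>)\<^sup>2)" "(\<integral>\<phi>. (l \<phi>)\<^sup>2 \<partial>\<mu>) \<le> K"
proof -
  interpret prob_space \<mu> by (rule \<mu>)
  have [measurable]: "clamp_real R \<in> borel_measurable borel" for R
    unfolding clamp_real_def by measurable
  have K: "0 \<le> K" using b[of 0] by (simp add: clamp_real_def)
  let ?f = "\<lambda>n \<phi>. (clamp_real (real n) (l \<phi>))\<^sup>2"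
  have le: "(\<integral>\<^sup>+\<phi>. ennreal (?f n \<phi>) \<partial>\<mu>) \<le> ennreal K" for n
  proof -
    have "integrable \<mu> (?f n)"
    proof (rule integrable_const_bound[of _ "(real n)\<^sup>2"])
      have "\<bar>clamp_real (real n) t\<bar> \<le> \<bar>real n\<bar>" for t using clamp_real_bound[of "real n" t] by simp
      then show "AE \<phi> in \<mu>. norm (?f n \<phi>) \<le> (real n)\<^sup>2" by (simp add: abs_le_square_iff[symmetric])
    qed measurable
    then have "(\<integral>\<^sup>+\<phi>. ennreal (?f n \<phi>) \<partial>\<mu>) = ennreal (\<integral>\<phi>. ?f n \<phi> \<partial>\<mu>)" by (intro nn_integral_eq_integral) auto
    also have "\<dots> \<le> ennreal K" using b[of "real n"] by (intro ennreal_leI) (simp add: power2_eq_square)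
    finally show ?thesis .
  qed
  have lim: "(\<lambda>n. ennreal (?f n \<phi>)) \<longlonglongrightarrow> ennreal ((l \<phi>)\<^sup>2)" for \<phi>
  proof (rule tendsto_eventually)
    obtain N :: nat where "\<bar>l \<phi>\<bar> \<le> real N" using real_arch_simple by blast
    then show "\<forall>\<^sub>F n in sequentially. ennreal (?f n \<phi>) = ennreal ((l \<phi>)\<^sup>2)"
      unfolding eventually_sequentially by (intro exI[of _ N]) (auto simp: clamp_real_eq)
  qed
  have "(\<integral>\<^sup>+\<phi>. ennreal ((l \<phi>)\<^sup>2) \<partial>\<mu>) = (\<integral>\<^sup>+\<phi>. liminf (\<lambda>n. ennreal (?f n \<phi>)) \<partial>\<mu>)"
    by (intro nn_integral_cong) (simp add: lim_imp_Liminf[OF _ lim])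
  also have "\<dots> \<le> liminf (\<lambda>n. \<integral>\<^sup>+\<phi>. ennreal (?f n \<phi>) \<partial>\<mu>)" by (intro nn_integral_liminf) measurable
  also have "\<dots> \<le> ennreal K" using le by (intro Liminf_le) auto
  finally have *: "(\<integral>\<^sup>+\<phi>. ennreal ((l \<phi>)\<^sup>2) \<partial>\<mu>) \<le> ennreal K" .
  then show i: "integrable \<mu> (\<lambda>\<phi>. (l \<phi>)\<^sup>2)"
    by (intro integrableI_nonneg) (auto intro: le_less_trans)
  show "(\<integral>\<phi>. (l \<phi>)\<^sup>2 \<partial>\<mu>) \<le> K"
    using * K by (subst (asm) nn_integral_eq_integral[OF i]) (auto simp: ennreal_le_iff)
qed

text \<open>An odd observable has mean 0 by reflection symmetry, and so has its clamped version. The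
  variance bound is therefore a bound on second moments. Additivity lets domination of l by the
  Dirichlet norm serve as a two-point Lipschitz bound.\<close>

lemma good_second_moment:
  fixes \<mu> :: "'d::finite config measure"
  assumes g: "good m \<mu>" and l: "lipschitz_in K X l" and odd: "\<And>\<phi>. l (\<lambda>x. - \<phi> x) = - l \<phi>"
    and diff: "\<And>\<phi> \<psi>. l \<phi> - l \<psi> = l (\<lambda>x. \<phi> x - \<psi> x)" and dom: "dominated a (\<lambda>u. \<bar>l u\<bar>)" and a: "0 \<le> a"
  shows "integrable \<mu> (\<lambda>\<phi>. (l \<phi>)\<^sup>2)" "(\<integral>\<phi>. (l \<phi>)\<^sup>2 \<partial>\<mu>) \<le> 8 * a\<^sup>2 / c" "(\<integral>\<phi>. l \<phi> \<partial>\<mu>) = 0"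
proof -
  have \<mu>: "field_law \<mu>" and r: "reflection_invariant \<mu>" and gp: "grad_poincare \<mu>"
    using g by (auto simp: good_def)
  have lm: "l \<in> borel_measurable field_algebra"
    by (rule borel_measurable_fields[OF lipschitz_in_continuous[OF l]])
  note lm' = measurable_field_law[OF \<mu> lm]
  have b: "(\<integral>\<phi>. clamp_real R (l \<phi>) * clamp_real R (l \<phi>) \<partial>\<mu>) \<le> 8 * a\<^sup>2 / c" if R: "0 \<le> R" for R
  proof -
    let ?G = "\<lambda>\<phi>. clamp_real R (l \<phi>)"
    have lc: "lip_cyl ?G" by (rule lip_cyl_clamp[OF l R])
    have "grad_lipschitz a ?G"
    proof (rule grad_lipschitzI[OF dom])
      fix \<phi> \<psi> :: "'d config"
      show "clamp_real R (l \<phi>) - clamp_real R (l \<psi>) \<le> \<bar>l (\<lambda>x. \<phi> x - \<psi> x)\<bar>"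
        using clamp_real_lipschitz[of R "l \<phi>" "l \<psi>"] unfolding diff by linarith
    qed
    then have "(\<integral>\<phi>. ?G \<phi> * ?G \<phi> \<partial>\<mu>) - (\<integral>\<phi>. ?G \<phi> \<partial>\<mu>)\<^sup>2 \<le> 8 * a\<^sup>2 / c"
      using gp lc a unfolding grad_poincare_def by blast
    moreover have "(\<integral>\<phi>. ?G \<phi> \<partial>\<mu>) = 0"
      using reflection_invariant_integral[OF \<mu> r lip_cyl_measurable[OF lc]] by (simp add: odd clamp_real_minus[OF R])
    ultimately show ?thesis by simp
  qed
  show "integrable \<mu> (\<lambda>\<phi>. (l \<phi>)\<^sup>2)" "(\<integral>\<phi>. (l \<phi>)\<^sup>2 \<partial>\<mu>) \<le> 8 * a\<^sup>2 / c"
    using second_moment_from_clamped[OF prob_algebra_fieldsD(1)[OF \<mu>] lm' b] by auto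
  show "(\<integral>\<phi>. l \<phi> \<partial>\<mu>) = 0"
    using reflection_invariant_integral[OF \<mu> r lm] by (simp add: odd)
qed

section \<open>Moments of sites and block averages\<close>

lemma lipschitz_in_site: "lipschitz_in 1 {x} (\<lambda>\<phi>. \<phi> x)"
  by (simp add: lipschitz_in_def)

lemma lipschitz_in_block_avg:
  fixes x :: "int ^ 'd::finite"
  shows "lipschitz_in 1 ((\<lambda>w. x + w) ` block s) (\<lambda>\<phi>. block_avg s \<phi> x)"
  unfolding lipschitz_in_def
proof (intro conjI allI)
  fix \<phi> \<psi> :: "'d config"
  let ?n = "real (card (block s))"
  have "\<bar>block_avg s \<phi> x - block_avg s \<psi> x\<bar> = \<bar>\<Sum>w\<in>block s. \<phi> (x + w) - \<psi> (x + w)\<bar> / ?n"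
    by (simp add: block_avg_def diff_divide_distrib[symmetric] sum_subtractf abs_divide)
  also have "\<dots> \<le> (\<Sum>w\<in>block s. \<bar>\<phi> (x + w) - \<psi> (x + w)\<bar>) / ?n"
    by (intro divide_right_mono sum_abs) auto
  also have "\<dots> \<le> (\<Sum>w\<in>block s. \<bar>\<phi> (x + w) - \<psi> (x + w)\<bar>)"
  proof (cases "card (block s) = 0")
    case False
    then have "1 \<le> ?n" by linarith
    then have "(\<Sum>w\<in>block s. \<bar>\<phi> (x + w) - \<psi> (x + w)\<bar>) / ?n \<le> (\<Sum>w\<in>block s. \<bar>\<phi> (x + w) - \<psi> (x + w)\<bar>) / 1"
      by (intro divide_left_mono sum_nonneg) auto
    then show ?thesis by simp
  qed (auto intro: sum_nonneg)
  also have "\<dots> = (\<Sum>y\<in>(\<lambda>w. x + w) ` block s. \<bar>\<phi> y - \<psi> y\<bar>)"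
    by (subst sum.reindex) auto
  finally show "\<bar>block_avg s \<phi> x - block_avg s \<psi> x\<bar> \<le> 1 * (\<Sum>y\<in>(\<lambda>w. x + w) ` block s. \<bar>\<phi> y - \<psi> y\<bar>)" by simp
qed auto

lemma block_avg_diff: "block_avg s \<phi> x - block_avg s \<psi> x = block_avg s (\<lambda>y. \<phi> y - \<psi> y) x"
  by (simp add: block_avg_def diff_divide_distrib[symmetric] sum_subtractf)

lemma good_dyadic_avg:
  fixes \<mu> :: "'d::finite config measure"
  assumes g: "good m \<mu>" and d: "CARD('d) \<ge> 3"
  shows "integrable \<mu> (\<lambda>\<phi>. (dyadic_avg k \<phi> x)\<^sup>2)"
    "(\<integral>\<phi>. (dyadic_avg k \<phi> x)\<^sup>2 \<partial>\<mu>) \<le> 8 * (green_const TYPE('d))\<^sup>2 / c * (1/2) ^ k"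
proof -
  have e: "block_avg s (\<lambda>y. - \<phi> y) x = - block_avg s \<phi> x" for s and \<phi> :: "'d config"
    by (simp add: block_avg_def sum_negf)
  have a: "0 \<le> green_const TYPE('d) * decay_rate ^ k" using green_const_pos[where 'd = 'd] decay_rate by simp
  note r = good_second_moment[OF g lipschitz_in_block_avg e block_avg_diff dyadic_avg_dominated[OF d] a]
  show "integrable \<mu> (\<lambda>\<phi>. (dyadic_avg k \<phi> x)\<^sup>2)" by (rule r)
  have "(decay_rate ^ k)\<^sup>2 = (1/2) ^ k"
    by (simp add: decay_rate_def power_mult_distrib[symmetric] power2_eq_square flip: power_mult_distrib)
  then show "(\<integral>\<phi>. (dyadic_avg k \<phi> x)\<^sup>2 \<partial>\<mu>) \<le> 8 * (green_const TYPE('d))\<^sup>2 / c * (1/2) ^ k"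
    using r(2) by (simp add: power_mult_distrib)
qed

lemma good_site:
  fixes \<mu> :: "'d::finite config measure"
  assumes g: "good m \<mu>" and d: "CARD('d) \<ge> 3"
  shows "integrable \<mu> (\<lambda>\<phi>. (\<phi> x)\<^sup>2)" "(\<integral>\<phi>. (\<phi> x)\<^sup>2 \<partial>\<mu>) \<le> 8 * (green_const TYPE('d))\<^sup>2 / c" "(\<integral>\<phi>. \<phi> x \<partial>\<mu>) = 0"
proof -
  note r = good_second_moment[OF g lipschitz_in_site _ _ site_dominated[OF d] less_imp_le[OF green_const_pos]]
  show "integrable \<mu> (\<lambda>\<phi>. (\<phi> x)\<^sup>2)" "(\<integral>\<phi>. (\<phi> x)\<^sup>2 \<partial>\<mu>) \<le> 8 * (green_const TYPE('d))\<^sup>2 / c" "(\<integral>\<phi>. \<phi> x \<partial>\<mu>) = 0"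
    by (rule r; simp)+
qed

text \<open>Chebyshev's inequality for the clamped variable, which has modulus \<open>R\<close> on
  the tail event; no second moment of l itself is assumed.\<close>

lemma tail_bound:
  assumes \<mu>: "prob_space \<mu>" and [measurable]: "l \<in> borel_measurable \<mu>" and R: "0 < R"
    and b: "(\<integral>\<phi>. clamp_real R (l \<phi>) * clamp_real R (l \<phi>) \<partial>\<mu>) \<le> K"
  shows "measure \<mu> {\<phi> \<in> space \<mu>. R < \<bar>l \<phi>\<bar>} \<le> K / R\<^sup>2"
proof -
  interpret prob_space \<mu> by (rule \<mu>)
  have [measurable]: "clamp_real R \<in> borel_measurable borel"
    unfolding clamp_real_def by measurable
  have "R\<^sup>2 * measure \<mu> {\<phi> \<in> space \<mu>. R < \<bar>l \<phi>\<bar>} = (\<integral>\<phi>. R\<^sup>2 * indicator {\<phi> \<in> space \<mu>. R < \<bar>l \<phi>\<bar>} \<phi> \<partial>\<mu>)"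
    by simp
  also have "\<dots> \<le> (\<integral>\<phi>. clamp_real R (l \<phi>) * clamp_real R (l \<phi>) \<partial>\<mu>)"
  proof (rule integral_mono)
    show "integrable \<mu> (\<lambda>\<phi>. R\<^sup>2 * indicator {\<phi> \<in> space \<mu>. R < \<bar>l \<phi>\<bar>} \<phi>)"
      by (intro integrable_mult_right integrable_real_indicator) (auto simp: less_top[symmetric])
    show "integrable \<mu> (\<lambda>\<phi>. clamp_real R (l \<phi>) * clamp_real R (l \<phi>))"
    proof (rule integrable_const_bound[of _ "R * R"])
      have "\<bar>clamp_real R t\<bar> \<le> R" for t using clamp_real_bound[of R t] R by simp
      then have "\<bar>clamp_real R t\<bar> * \<bar>clamp_real R t\<bar> \<le> R * R" for t
        using R by (intro mult_mono) auto
      then show "AE \<phi> in \<mu>. norm (clamp_real R (l \<phi>) * clamp_real R (l \<phi>)) \<le> R * R"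
        by (intro AE_I2) (simp only: real_norm_def abs_mult)
    qed measurable
    show "R\<^sup>2 * indicator {\<phi> \<in> space \<mu>. R < \<bar>l \<phi>\<bar>} \<phi> \<le> clamp_real R (l \<phi>) * clamp_real R (l \<phi>)" for \<phi>
      using R by (auto simp: indicator_def clamp_real_def power2_eq_square)
  qed
  also note b
  finally show ?thesis using R by (simp add: field_simps)
qed

end

section \<open>Comparison of gradients\<close>

text \<open>Bounded local functions of gradients. The two sites of a pair may be far apart, so the
  difference of a site and a block average is covered directly.\<close>

definition pair_lipschitz :: "('d::finite config \<Rightarrow> real) \<Rightarrow> bool" where
  "pair_lipschitz F \<longleftrightarrow> (\<exists>D. \<forall>\<phi>. \<bar>F \<phi>\<bar> \<le> D) \<and> (\<exists>K P. finite P \<and> 0 \<le> K \<and>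
     (\<forall>\<phi> \<psi>. \<bar>F \<phi> - F \<psi>\<bar> \<le> K * (\<Sum>(x, y)\<in>P. \<bar>(\<phi> x - \<psi> x) - (\<phi> y - \<psi> y)\<bar>)))"

lemma pair_lipschitzE:
  fixes F :: "'d::finite config \<Rightarrow> real"
  assumes "pair_lipschitz F"
  obtains D K P where "\<And>\<phi>. \<bar>F \<phi>\<bar> \<le> D" "finite P" "0 \<le> K"
    "\<And>\<phi> \<psi>. \<bar>F \<phi> - F \<psi>\<bar> \<le> K * (\<Sum>(x, y)\<in>P. \<bar>(\<phi> x - \<psi> x) - (\<phi> y - \<psi> y)\<bar>)"
proof -
  obtain D where D: "\<forall>\<phi>. \<bar>F \<phi>\<bar> \<le> D" using assms unfolding pair_lipschitz_def by blast
  obtain K P where P: "finite P \<and> 0 \<le> K \<and>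
     (\<forall>\<phi> \<psi>. \<bar>F \<phi> - F \<psi>\<bar> \<le> K * (\<Sum>(x, y)\<in>P. \<bar>(\<phi> x - \<psi> x) - (\<phi> y - \<psi> y)\<bar>))"
    using assms unfolding pair_lipschitz_def by blast
  show ?thesis
    by (rule that[of D P K]) (use D P in \<open>simp_all\<close>)
qed

lemma pair_lipschitz_lip_cyl:
  fixes F :: "'d::finite config \<Rightarrow> real"
  assumes "pair_lipschitz F" shows "lip_cyl F"
proof -
  obtain D K P where D: "\<And>\<phi>. \<bar>F \<phi>\<bar> \<le> D" and P: "finite P" "0 \<le> K"
    "\<And>\<phi> \<psi>. \<bar>F \<phi> - F \<psi>\<bar> \<le> K * (\<Sum>(x, y)\<in>P. \<bar>(\<phi> x - \<psi> x) - (\<phi> y - \<psi> y)\<bar>)"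
    by (rule pair_lipschitzE[OF assms]; rule that; assumption)
  let ?X = "fst ` P \<union> snd ` P"
  have "lipschitz_in (K * (real (card P) * 2)) ?X F"
    unfolding lipschitz_in_def
  proof (intro conjI allI)
    fix \<phi> \<psi> :: "'d config"
    let ?S = "\<Sum>x\<in>?X. \<bar>\<phi> x - \<psi> x\<bar>"
    have "(\<Sum>(x, y)\<in>P. \<bar>(\<phi> x - \<psi> x) - (\<phi> y - \<psi> y)\<bar>) \<le> (\<Sum>p\<in>P. 2 * ?S)"
    proof (intro sum_mono)
      fix p assume p: "p \<in> P"
      have "\<bar>\<phi> (fst p) - \<psi> (fst p)\<bar> \<le> ?S" "\<bar>\<phi> (snd p) - \<psi> (snd p)\<bar> \<le> ?S"
        using P(1) p by (auto intro!: member_le_sum)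
      then show "(case p of (x, y) \<Rightarrow> \<bar>(\<phi> x - \<psi> x) - (\<phi> y - \<psi> y)\<bar>) \<le> 2 * ?S"
        unfolding case_prod_unfold by linarith
    qed
    also have "\<dots> = real (card P) * 2 * ?S" by simp
    finally have "K * (\<Sum>(x, y)\<in>P. \<bar>(\<phi> x - \<psi> x) - (\<phi> y - \<psi> y)\<bar>) \<le> K * (real (card P) * 2 * ?S)"
      by (intro mult_left_mono P(2))
    with P(3)[of \<phi> \<psi>] show "\<bar>F \<phi> - F \<psi>\<bar> \<le> K * (real (card P) * 2) * ?S" by (simp add: mult.assoc)
  qed (use P in auto)
  with D show ?thesis unfolding lip_cyl_def by blast
qed

text \<open>By Cauchy-Schwarz over the translates, the spatial average has a Dirichlet Lipschitz
  constant of order 1 / sqrt (card X), with K independent of X. This gain in the volume is what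
  outweighs the boundary later.\<close>

lemma pair_lipschitz_average:
  fixes F :: "'d::finite config \<Rightarrow> real"
  assumes "pair_lipschitz F"
  obtains K where "0 \<le> K" "\<And>X. finite X \<Longrightarrow> X \<noteq> {} \<Longrightarrow> \<exists>E. bond_set E \<and> (\<forall>\<phi> \<psi>.
    (\<Sum>z\<in>X. F (shift z \<phi>)) / real (card X) - (\<Sum>z\<in>X. F (shift z \<psi>)) / real (card X)
      \<le> K / sqrt (card X) * edge_norm E (\<lambda>x. \<phi> x - \<psi> x))"
proof -
  obtain D K P where D: "\<And>\<phi>. \<bar>F \<phi>\<bar> \<le> D" and P: "finite P" "0 \<le> K"
    "\<And>\<phi> \<psi>. \<bar>F \<phi> - F \<psi>\<bar> \<le> K * (\<Sum>(x, y)\<in>P. \<bar>(\<phi> x - \<psi> x) - (\<phi> y - \<psi> y)\<bar>)"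
    by (rule pair_lipschitzE[OF assms]; rule that; assumption)
  obtain c where c: "\<And>w :: int ^ 'd. 0 \<le> c w" "\<And>w :: int ^ 'd. translation_bound w (c w)"
    using translation_bound_exists by metis
  define K' where "K' = K * (\<Sum>p\<in>P. c (fst p - snd p))"
  show ?thesis
  proof (rule that[of K'])
    show "0 \<le> K'" unfolding K'_def using P c by (intro mult_nonneg_nonneg sum_nonneg) auto
    fix X :: "(int ^ 'd) set" assume X: "finite X" "X \<noteq> {}"
    have n: "0 < real (card X)" using X by (simp add: card_gt_0_iff)
    define Q where "Q p E \<longleftrightarrow> bond_set E \<and> (\<forall>u. L2_set (\<lambda>y. u (y + (fst p - snd p)) - u y) ((\<lambda>z. snd p + z) ` X)
      \<le> c (fst p - snd p) * edge_norm E u)" for p :: "(int ^ 'd) \<times> (int ^ 'd)" and E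
    have "\<exists>E. Q p E" for p
      using c(2)[of "fst p - snd p", unfolded translation_bound_def, rule_format, of "(\<lambda>z. snd p + z) ` X"] X
      unfolding Q_def by simp
    then obtain E where QE: "\<And>p. Q p (E p)" by metis
    have E: "bond_set (E p)"
      "L2_set (\<lambda>y. u (y + (fst p - snd p)) - u y) ((\<lambda>z. snd p + z) ` X) \<le> c (fst p - snd p) * edge_norm (E p) u" for p u
      using QE[of p] unfolding Q_def by blast+
    define E' where "E' = (\<Union>p\<in>P. E p)"
    have E': "bond_set E'" using E(1) P(1) by (auto simp: bond_set_def E'_def)
    show "\<exists>E. bond_set E \<and> (\<forall>\<phi> \<psi>.
      (\<Sum>z\<in>X. F (shift z \<phi>)) / real (card X) - (\<Sum>z\<in>X. F (shift z \<psi>)) / real (card X)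
      \<le> K' / sqrt (card X) * edge_norm E (\<lambda>x. \<phi> x - \<psi> x))"
    proof (intro exI[of _ E'] conjI E' allI)
      fix \<phi> \<psi> :: "'d config"
      define u where "u x = \<phi> x - \<psi> x" for x
      have u: "(\<lambda>x. \<phi> x - \<psi> x) = u" by (simp add: u_def fun_eq_iff)
      have "(\<Sum>z\<in>X. F (shift z \<phi>) - F (shift z \<psi>)) \<le> (\<Sum>z\<in>X. K * (\<Sum>p\<in>P. \<bar>u (fst p + z) - u (snd p + z)\<bar>))"
      proof (intro sum_mono)
        fix z
        show "F (shift z \<phi>) - F (shift z \<psi>) \<le> K * (\<Sum>p\<in>P. \<bar>u (fst p + z) - u (snd p + z)\<bar>)"
          using P(3)[of "shift z \<phi>" "shift z \<psi>"] by (simp add: shift_def u_def case_prod_unfold)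
      qed
      also have "\<dots> = K * (\<Sum>p\<in>P. \<Sum>z\<in>X. \<bar>u (fst p + z) - u (snd p + z)\<bar>)"
        unfolding sum_distrib_left[symmetric] by (subst sum.swap) simp
      also have "\<dots> \<le> K * (\<Sum>p\<in>P. sqrt (card X) * (c (fst p - snd p) * edge_norm E' u))"
      proof (intro mult_left_mono sum_mono P(2))
        fix p assume p: "p \<in> P"
        have "(\<Sum>z\<in>X. \<bar>u (fst p + z) - u (snd p + z)\<bar>) \<le> sqrt (card X) * L2_set (\<lambda>z. \<bar>u (fst p + z) - u (snd p + z)\<bar>) X"
          using abs_sum_le_L2_set[of "\<lambda>z. \<bar>u (fst p + z) - u (snd p + z)\<bar>" X] by simp
        also have "L2_set (\<lambda>z. \<bar>u (fst p + z) - u (snd p + z)\<bar>) X = L2_set (\<lambda>y. u (y + (fst p - snd p)) - u y) ((\<lambda>z. snd p + z) ` X)"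
          by (subst L2_set_image) (auto simp: L2_set_def algebra_simps)
        also have "\<dots> \<le> c (fst p - snd p) * edge_norm (E p) u" by (rule E(2))
        also have "\<dots> \<le> c (fst p - snd p) * edge_norm E' u"
          using E' p c by (intro mult_left_mono edge_norm_mono) (auto simp: bond_set_def E'_def)
        finally show "(\<Sum>z\<in>X. \<bar>u (fst p + z) - u (snd p + z)\<bar>) \<le> sqrt (card X) * (c (fst p - snd p) * edge_norm E' u)"
          by (simp add: mult_left_mono)
      qed
      also have "\<dots> = K' * (sqrt (card X) * edge_norm E' u)"
        by (simp add: K'_def sum_distrib_left sum_distrib_right mult_ac)
      finally have "(\<Sum>z\<in>X. F (shift z \<phi>) - F (shift z \<psi>)) / real (card X) \<le> K' * (sqrt (card X) * edge_norm E' u) / real (card X)"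
        using n by (intro divide_right_mono) auto
      also have "\<dots> = K' / sqrt (card X) * edge_norm E' u"
        using n by (simp add: real_div_sqrt field_simps)
      finally show "(\<Sum>z\<in>X. F (shift z \<phi>)) / real (card X) - (\<Sum>z\<in>X. F (shift z \<psi>)) / real (card X)
        \<le> K' / sqrt (card X) * edge_norm E' (\<lambda>x. \<phi> x - \<psi> x)"
        unfolding u by (simp add: sum_subtractf diff_divide_distrib)
    qed
  qed
qed

lemma cube_add: "x \<in> cube k \<Longrightarrow> y \<in> cube l \<Longrightarrow> x + y \<in> cube (k + l)"
proof -
  assume a: "x \<in> cube k" "y \<in> cube l"
  show ?thesis unfolding cube_def
  proof (intro CollectI allI)
    fix i
    have "\<bar>x $ i\<bar> \<le> int k" "\<bar>y $ i\<bar> \<le> int l" using a by (auto simp: cube_def)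
    then show "\<bar>(x + y) $ i\<bar> \<le> int (k + l)" by simp
  qed
qed

lemma cube_mono: "k \<le> l \<Longrightarrow> cube k \<subseteq> cube l"
  by (auto simp: cube_def intro: order_trans)

lemma finite_subset_cube:
  fixes S :: "(int ^ 'd::finite) set"
  assumes "finite S" obtains r where "S \<subseteq> cube r"
proof -
  have one: "\<exists>r. x \<in> cube r" for x :: "int ^ 'd"
  proof (intro exI)
    show "x \<in> cube (nat (\<Sum>i\<in>UNIV. \<bar>x $ i\<bar>))"
      unfolding cube_def
    proof (intro CollectI allI)
      fix i
      have "\<bar>x $ i\<bar> \<le> (\<Sum>i\<in>UNIV. \<bar>x $ i\<bar>)" by (intro member_le_sum) auto
      then show "\<bar>x $ i\<bar> \<le> int (nat (\<Sum>i\<in>UNIV. \<bar>x $ i\<bar>))" by simp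
    qed
  qed
  then obtain f where f: "\<And>x :: int ^ 'd. x \<in> cube (f x)" by metis
  have "S \<subseteq> cube (\<Sum>x\<in>S. f x)"
  proof
    fix x assume "x \<in> S"
    then have "f x \<le> (\<Sum>x\<in>S. f x)" using assms by (intro member_le_sum) auto
    then show "x \<in> cube (\<Sum>x\<in>S. f x)" using f[of x] cube_mono by blast
  qed
  then show ?thesis by (rule that)
qed

context convex_potential
begin

text \<open>
  Only observables of the field inside \<open>\<Lambda>\<close> are tested. This is what \<open>phi_gibbs\<close> yields directly, and
  it suffices for the comparison of gradients.
\<close>

definition local_dlr :: "(int ^ 'd::finite) set \<Rightarrow> real \<Rightarrow> 'd config measure \<Rightarrow> bool" where
  "local_dlr \<Lambda> m \<mu> \<longleftrightarrow> (\<forall>G. lip_cyl G \<longrightarrow> (\<forall>\<phi> \<psi>. (\<forall>x\<in>\<Lambda>. \<phi> x = \<psi> x) \<longrightarrow> G \<phi> = G \<psi>) \<longrightarrow>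
     (\<integral>\<phi>. G \<phi> \<partial>\<mu>) = (\<integral>\<xi>. gibbs_avg \<Lambda> m \<xi> G \<partial>\<mu>))"

definition stationary_gibbs :: "real \<Rightarrow> real \<Rightarrow> 'd::finite config measure \<Rightarrow> bool" where
  "stationary_gibbs m K \<mu> \<longleftrightarrow> field_law \<mu> \<and> shift_invariant \<mu> \<and>
     (\<forall>\<Lambda>. finite \<Lambda> \<longrightarrow> local_dlr \<Lambda> m \<mu>) \<and> (\<forall>x. integrable \<mu> (\<lambda>\<phi>. (\<phi> x)\<^sup>2) \<and> (\<integral>\<phi>. (\<phi> x)\<^sup>2 \<partial>\<mu>) \<le> K)"

text \<open>By shift invariance \<open>F\<close> may be replaced by its average over
  \<open>cube L\<close>, with Lipschitz constant A / sqrt n for n sites. With s = e n the comparison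
  of boundary conditions costs a term of order e and the squared boundary distance divided by e n.
  Second moments bound the mean of the latter by boundary over volume, which vanishes as L grows at
  fixed e.\<close>

lemma gradient_mean_comparison:
  fixes F :: "'d::finite config \<Rightarrow> real"
  assumes F: "pair_lipschitz F" and \<mu>: "stationary_gibbs m K \<mu>" and \<nu>: "stationary_gibbs m K' \<nu>"
  shows "(\<integral>\<phi>. F \<phi> \<partial>\<mu>) \<le> (\<integral>\<phi>. F \<phi> \<partial>\<nu>)"
proof -
  have \<mu>p: "field_law \<mu>" and \<nu>p: "field_law \<nu>"
    using \<mu> \<nu> by (auto simp: stationary_gibbs_def)
  interpret \<mu>: prob_space \<mu> using \<mu>p by (rule prob_algebra_fieldsD)
  interpret \<nu>: prob_space \<nu> using \<nu>p by (rule prob_algebra_fieldsD)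
  obtain A where A: "0 \<le> A" "\<And>X. finite X \<Longrightarrow> X \<noteq> {} \<Longrightarrow> \<exists>E. bond_set E \<and> (\<forall>\<phi> \<psi>.
    (\<Sum>z\<in>X. F (shift z \<phi>)) / real (card X) - (\<Sum>z\<in>X. F (shift z \<psi>)) / real (card X)
      \<le> A / sqrt (card X) * edge_norm E (\<lambda>x. \<phi> x - \<psi> x))"
    using pair_lipschitz_average[OF F] by blast
  have lF: "lip_cyl F" by (rule pair_lipschitz_lip_cyl[OF F])
  obtain D KF S where D: "\<And>\<phi>. \<bar>F \<phi>\<bar> \<le> D" "0 \<le> D" and S: "lipschitz_in KF S F" using lip_cylE[OF lF] by blast
  obtain r where r: "S \<subseteq> cube r" using finite_subset_cube[of S] S by (auto simp: lipschitz_in_def)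
  have key: "(\<integral>\<phi>. F \<phi> \<partial>\<mu>) - (\<integral>\<phi>. F \<phi> \<partial>\<nu>) \<le> 4 * A\<^sup>2 / c * e
      + 2 * C\<^sup>2 / (c * e) * (K + K') * (real (card (boundary_bonds (cube (L + Suc r) :: (int ^ 'd) set))) / real (card (cube L :: (int ^ 'd) set)))"
    if e: "0 < e" for e :: real and L :: nat
  proof -
    \<comment> \<open>The width r contains the support of \<open>F\<close>; the additional layer
      brings the cube into the form of the boundary estimate.\<close>
    define \<Lambda> where "\<Lambda> = (cube (L + Suc r) :: (int ^ 'd) set)"
    define X where "X = (cube L :: (int ^ 'd) set)"
    let ?E = "lattice_edges \<Lambda>" and ?B = "boundary_bonds \<Lambda>"
    have \<Lambda>: "finite \<Lambda>" by (simp add: \<Lambda>_def)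
    have X: "finite X" "X \<noteq> {}"
    proof -
      show "finite X" by (simp add: X_def)
      have "card X \<noteq> 0" by (simp add: X_def card_cube)
      then show "X \<noteq> {}" by auto
    qed
    define n where "n = real (card X)"
    have n: "0 < n" using X by (simp add: n_def card_gt_0_iff)
    define G where "G \<phi> = (1 / n) * (\<Sum>z\<in>X. F (shift z \<phi>))" for \<phi>
    have lG: "lip_cyl G" unfolding G_def[abs_def] by (intro lip_cyl_cmult lip_cyl_sum X lip_cyl_shift lF)
    note Gm = lip_cyl_measurable[OF lG]
    have Gb: "\<bar>G \<phi>\<bar> \<le> D" for \<phi>
    proof -
      have "\<bar>\<Sum>z\<in>X. F (shift z \<phi>)\<bar> \<le> (\<Sum>z\<in>X. D)" using D by (intro order_trans[OF sum_abs] sum_mono) auto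
      then show ?thesis using n by (simp add: G_def abs_mult n_def[symmetric] field_simps)
    qed
    have G\<Lambda>: "G \<phi> = G \<psi>" if "\<forall>x\<in>\<Lambda>. \<phi> x = \<psi> x" for \<phi> \<psi>
    proof -
      have "F (shift z \<phi>) = F (shift z \<psi>)" if z: "z \<in> X" for z
      proof (rule lipschitz_in_cong[OF S])
        fix x assume "x \<in> S"
        then have "x + z \<in> cube (r + L)" using r z by (intro cube_add) (auto simp: X_def)
        then have "x + z \<in> \<Lambda>" using cube_mono[of "r + L" "L + Suc r"] by (auto simp: \<Lambda>_def)
        then show "shift z \<phi> x = shift z \<psi> x" using \<open>\<forall>x\<in>\<Lambda>. \<phi> x = \<psi> x\<close> by (simp add: shift_def)
      qed
      then show ?thesis by (simp add: G_def)
    qed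
    define f where "f x = G (override_on (\<lambda>_. 0) x \<Lambda>)" for x
    have fm: "f \<in> borel_measurable (flat \<Lambda>)"
      unfolding f_def by (rule measurable_compose[OF override_measurable_snd Gm])
    let ?g = "\<lambda>\<xi>. gibbs_avg \<Lambda> m \<xi> G"
    have gf: "?g \<xi> = (\<integral>x. f x \<partial>finite_gibbs V ?E \<Lambda> m \<xi>)" for \<xi>
      unfolding gibbs_avg_def f_def by (intro arg_cong[where f = "integral\<^sup>L _"] ext G\<Lambda>) auto
    obtain E where E: "bond_set E" "\<And>\<phi> \<psi>. (\<Sum>z\<in>X. F (shift z \<phi>)) / real (card X) - (\<Sum>z\<in>X. F (shift z \<psi>)) / real (card X)
      \<le> A / sqrt (card X) * edge_norm E (\<lambda>x. \<phi> x - \<psi> x)"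
      using A(2)[OF X] by blast
    define T where "T = 2 * C\<^sup>2 / (c * e * n)"
    have T: "0 \<le> T" using c_pos e n by (simp add: T_def)
    let ?q = "\<lambda>\<xi>. \<Sum>b\<in>?B. (\<xi> (snd b))\<^sup>2"
    \<comment> \<open>Bounding the squared distance by squares of \<xi> and of \<eta> separates the
      variables, so \<xi> can be integrated under \<mu> and \<eta> under \<nu> without any
      coupling.\<close>
    have comp: "?g \<xi> - T * ?q \<xi> \<le> ?g \<eta> + T * ?q \<eta> + 4 * A\<^sup>2 / c * e" for \<xi> \<eta>
    proof -
      let ?s = "e * n" and ?B' = "A / sqrt n * sqrt (2 / c)" and ?M = "C / 2 * sqrt (2 / c) * boundary_dist \<Lambda> \<xi> \<eta>"
      have s: "0 < ?s" using e n by simp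
      have "?g \<xi> - ?g \<eta> \<le> (?s * ?B' + ?M)\<^sup>2 / ?s"
        unfolding gf
      proof (rule boundary_comparison[OF \<Lambda> fm _ _ _ s])
        show "\<bar>f x\<bar> \<le> D" for x unfolding f_def by (rule Gb)
        show "0 \<le> A / sqrt n" using A n by simp
        fix x y :: "'d config"
        let ?u = "\<lambda>i. override_on (\<lambda>_. 0) x \<Lambda> i - override_on (\<lambda>_. 0) y \<Lambda> i"
        have "f x - f y \<le> A / sqrt n * edge_norm E ?u"
          using E(2)[of "override_on (\<lambda>_. 0) x \<Lambda>" "override_on (\<lambda>_. 0) y \<Lambda>"] by (simp add: f_def G_def n_def)
        also have "\<dots> \<le> A / sqrt n * edge_norm ?E ?u"
          using A n by (intro mult_left_mono edge_norm_supported E(1) \<Lambda>) auto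
        finally show "f x - f y \<le> A / sqrt n * edge_norm ?E ?u" .
      qed
      also have "\<dots> \<le> (2 * (?s * ?B')\<^sup>2 + 2 * ?M\<^sup>2) / ?s"
      proof (intro divide_right_mono)
        have "0 \<le> (?s * ?B' - ?M)\<^sup>2" by simp
        then show "(?s * ?B' + ?M)\<^sup>2 \<le> 2 * (?s * ?B')\<^sup>2 + 2 * ?M\<^sup>2" unfolding power2_diff power2_sum by linarith
      qed (use s in simp)
      also have "\<dots> = 4 * A\<^sup>2 / c * e + C\<^sup>2 / (c * e * n) * (boundary_dist \<Lambda> \<xi> \<eta>)\<^sup>2"
      proof -
        have "?B'\<^sup>2 = A\<^sup>2 / n * (2 / c)" using n c_pos by (simp add: power_mult_distrib power_divide)
        then have "2 * (?s * ?B')\<^sup>2 / ?s = 4 * A\<^sup>2 / c * e" using n e by (simp add: power_mult_distrib power2_eq_square field_simps)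
        moreover have "?M\<^sup>2 = C\<^sup>2 / 4 * (2 / c) * (boundary_dist \<Lambda> \<xi> \<eta>)\<^sup>2" using c_pos by (simp add: power_mult_distrib power_divide)
        then have "2 * ?M\<^sup>2 / ?s = C\<^sup>2 / (c * e * n) * (boundary_dist \<Lambda> \<xi> \<eta>)\<^sup>2" by simp
        ultimately show ?thesis unfolding add_divide_distrib by simp
      qed
      also have "\<dots> \<le> 4 * A\<^sup>2 / c * e + C\<^sup>2 / (c * e * n) * (2 * ?q \<xi> + 2 * ?q \<eta>)"
      proof (intro add_left_mono mult_left_mono)
        have "(boundary_dist \<Lambda> \<xi> \<eta>)\<^sup>2 = (\<Sum>b\<in>?B. (\<xi> (snd b) - \<eta> (snd b))\<^sup>2)"
          by (simp add: boundary_dist_def case_prod_unfold sum_nonneg)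
        also have "\<dots> \<le> (\<Sum>b\<in>?B. 2 * (\<xi> (snd b))\<^sup>2 + 2 * (\<eta> (snd b))\<^sup>2)"
        proof (intro sum_mono)
          fix b
          have "0 \<le> (\<xi> (snd b) + \<eta> (snd b))\<^sup>2" by simp
          then show "(\<xi> (snd b) - \<eta> (snd b))\<^sup>2 \<le> 2 * (\<xi> (snd b))\<^sup>2 + 2 * (\<eta> (snd b))\<^sup>2"
            unfolding power2_diff power2_sum by linarith
        qed
        also have "\<dots> = 2 * ?q \<xi> + 2 * ?q \<eta>" by (simp add: sum.distrib sum_distrib_left)
        finally show "(boundary_dist \<Lambda> \<xi> \<eta>)\<^sup>2 \<le> 2 * ?q \<xi> + 2 * ?q \<eta>" .
      qed (use c_pos e n in simp)
      finally have "?g \<xi> - ?g \<eta> \<le> 4 * A\<^sup>2 / c * e + T * ?q \<xi> + T * ?q \<eta>"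
        by (simp add: T_def algebra_simps add_divide_distrib)
      then show ?thesis by linarith
    qed
    have iq: "integrable \<rho> ?q" "(\<integral>\<xi>. ?q \<xi> \<partial>\<rho>) \<le> real (card ?B) * J" if "stationary_gibbs m J \<rho>" for \<rho> :: "'d config measure" and J
    proof -
      have i: "integrable \<rho> (\<lambda>\<phi>. (\<phi> x)\<^sup>2)" "(\<integral>\<phi>. (\<phi> x)\<^sup>2 \<partial>\<rho>) \<le> J" for x using that by (auto simp: stationary_gibbs_def)
      show "integrable \<rho> ?q" using i by (intro Bochner_Integration.integrable_sum)
      have "(\<integral>\<xi>. ?q \<xi> \<partial>\<rho>) = (\<Sum>b\<in>?B. \<integral>\<xi>. (\<xi> (snd b))\<^sup>2 \<partial>\<rho>)" using i by (intro Bochner_Integration.integral_sum)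
      also have "\<dots> \<le> (\<Sum>b\<in>?B. J)" using i by (intro sum_mono)
      finally show "(\<integral>\<xi>. ?q \<xi> \<partial>\<rho>) \<le> real (card ?B) * J" by simp
    qed
    have lg: "lip_cyl ?g" by (rule gibbs_avg_lipschitz[OF \<Lambda> lG])
    have ig: "integrable \<mu> ?g" "integrable \<nu> ?g" by (intro lip_cyl_integrable[OF lg] \<mu>p \<nu>p)+
    have eqF: "(\<integral>\<phi>. F \<phi> \<partial>\<rho>) = (\<integral>\<xi>. ?g \<xi> \<partial>\<rho>)" if \<rho>: "stationary_gibbs m J \<rho>" for \<rho> J
    proof -
      have \<rho>p: "field_law \<rho>" and sh: "shift_invariant \<rho>" and ld: "local_dlr \<Lambda> m \<rho>"
        using \<rho> \<Lambda> by (auto simp: stationary_gibbs_def)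
      have "(\<integral>\<phi>. G \<phi> \<partial>\<rho>) = 1 / n * (\<Sum>z\<in>X. \<integral>\<phi>. F (shift z \<phi>) \<partial>\<rho>)"
        unfolding G_def by (simp add: Bochner_Integration.integral_sum lip_cyl_integrable[OF lip_cyl_shift[OF lF] \<rho>p])
      also have "\<dots> = (\<integral>\<phi>. F \<phi> \<partial>\<rho>)"
        using shift_invariant_integral[OF \<rho>p sh lip_cyl_measurable[OF lF]] n by (simp add: n_def)
      finally show ?thesis using ld lG G\<Lambda> unfolding local_dlr_def by metis
    qed
    have step: "(\<integral>\<xi>. ?g \<xi> \<partial>\<mu>) - T * (real (card ?B) * K) \<le> ?g \<eta> + T * ?q \<eta> + 4 * A\<^sup>2 / c * e" for \<eta>
    proof -
      have "(\<integral>\<xi>. ?g \<xi> - T * ?q \<xi> \<partial>\<mu>) \<le> (\<integral>\<xi>. ?g \<eta> + T * ?q \<eta> + 4 * A\<^sup>2 / c * e \<partial>\<mu>)"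
        using ig iq[OF \<mu>] comp by (intro integral_mono) auto
      also have "\<dots> = ?g \<eta> + T * ?q \<eta> + 4 * A\<^sup>2 / c * e" using \<mu>.prob_space by simp
      also have "(\<integral>\<xi>. ?g \<xi> - T * ?q \<xi> \<partial>\<mu>) = (\<integral>\<xi>. ?g \<xi> \<partial>\<mu>) - T * (\<integral>\<xi>. ?q \<xi> \<partial>\<mu>)"
        using ig iq[OF \<mu>] by simp
      finally show ?thesis using mult_left_mono[OF iq(2)[OF \<mu>] T] by linarith
    qed
    have "(\<integral>\<eta>. (\<integral>\<xi>. ?g \<xi> \<partial>\<mu>) - T * (real (card ?B) * K) \<partial>\<nu>) \<le> (\<integral>\<eta>. ?g \<eta> + T * ?q \<eta> + 4 * A\<^sup>2 / c * e \<partial>\<nu>)"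
      using ig iq[OF \<nu>] step by (intro integral_mono) auto
    also have "(\<integral>\<eta>. (\<integral>\<xi>. ?g \<xi> \<partial>\<mu>) - T * (real (card ?B) * K) \<partial>\<nu>) = (\<integral>\<xi>. ?g \<xi> \<partial>\<mu>) - T * (real (card ?B) * K)"
      using \<nu>.prob_space by simp
    also have "(\<integral>\<eta>. ?g \<eta> + T * ?q \<eta> + 4 * A\<^sup>2 / c * e \<partial>\<nu>) = (\<integral>\<xi>. ?g \<xi> \<partial>\<nu>) + T * (\<integral>\<xi>. ?q \<xi> \<partial>\<nu>) + 4 * A\<^sup>2 / c * e"
      using ig iq[OF \<nu>] \<nu>.prob_space by simp
    finally have "(\<integral>\<xi>. ?g \<xi> \<partial>\<mu>) - (\<integral>\<xi>. ?g \<xi> \<partial>\<nu>) \<le> 4 * A\<^sup>2 / c * e + T * (real (card ?B) * K) + T * (real (card ?B) * K')"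
      using mult_left_mono[OF iq(2)[OF \<nu>] T] by linarith
    also have "\<dots> = 4 * A\<^sup>2 / c * e + 2 * C\<^sup>2 / (c * e) * (K + K') * (real (card ?B) / n)"
      by (simp add: T_def algebra_simps add_divide_distrib)
    finally show ?thesis unfolding eqF[OF \<mu>] eqF[OF \<nu>] n_def X_def \<Lambda>_def .
  qed
  have lim: "(\<integral>\<phi>. F \<phi> \<partial>\<mu>) - (\<integral>\<phi>. F \<phi> \<partial>\<nu>) \<le> 4 * A\<^sup>2 / c * e" if e: "0 < e" for e
  proof (rule LIMSEQ_le_const)
    show "(\<lambda>L. 4 * A\<^sup>2 / c * e + 2 * C\<^sup>2 / (c * e) * (K + K') * (real (card (boundary_bonds (cube (L + Suc r) :: (int ^ 'd) set))) / real (card (cube L :: (int ^ 'd) set))))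
      \<longlonglongrightarrow> 4 * A\<^sup>2 / c * e"
      using tendsto_add[OF tendsto_const[of "4 * A\<^sup>2 / c * e"] tendsto_mult[OF tendsto_const[of "2 * C\<^sup>2 / (c * e) * (K + K')"] cube_boundary_ratio[where 'd = 'd, of r]]] by simp
  qed (use key[OF e] in blast)
  have "(\<integral>\<phi>. F \<phi> \<partial>\<mu>) - (\<integral>\<phi>. F \<phi> \<partial>\<nu>) \<le> 0"
  proof (rule field_le_epsilon)
    fix e :: real assume e: "0 < e"
    define e' where "e' = e / (4 * A\<^sup>2 / c + 1)"
    have p: "0 < 4 * A\<^sup>2 / c + 1" using c_pos by (simp add: add_nonneg_pos)
    then have "0 < e'" using e by (simp add: e'_def)
    from lim[OF this] have "(\<integral>\<phi>. F \<phi> \<partial>\<mu>) - (\<integral>\<phi>. F \<phi> \<partial>\<nu>) \<le> 4 * A\<^sup>2 / c * e'" .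
    also have "\<dots> \<le> (4 * A\<^sup>2 / c + 1) * e'" using \<open>0 < e'\<close> by (intro mult_right_mono) auto
    also have "\<dots> = e" using p by (simp add: e'_def)
    finally show "(\<integral>\<phi>. F \<phi> \<partial>\<mu>) - (\<integral>\<phi>. F \<phi> \<partial>\<nu>) \<le> 0 + e" by simp
  qed
  then show ?thesis by simp
qed

lemma gradient_mean_unique:
  assumes "pair_lipschitz F" "stationary_gibbs m K \<mu>" "stationary_gibbs m K' \<nu>"
  shows "(\<integral>\<phi>. F \<phi> \<partial>\<mu>) = (\<integral>\<phi>. F \<phi> \<partial>\<nu>)"
  using gradient_mean_comparison[OF assms] gradient_mean_comparison[OF assms(1,3,2)] by (rule antisym)

end

text \<open>A difference of averages is an average of differences over all pairs of sites. The
  denominators are then dropped: only finiteness of the set of pairs matters, not the size of the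
  constant.\<close>

lemma block_avg_pair:
  fixes u :: "'d::finite config"
  assumes "block s \<noteq> {}" "block t \<noteq> {}"
  shows "\<bar>block_avg s u x - block_avg t u y\<bar>
    \<le> (\<Sum>(p, q)\<in>(\<lambda>w. x + w) ` block s \<times> (\<lambda>v. y + v) ` block t. \<bar>u p - u q\<bar>)"
proof -
  let ?S = "(\<lambda>w. x + w) ` block s" and ?T = "(\<lambda>v. y + v) ` block t"
  have cS: "card ?S = card (block s)" and cT: "card ?T = card (block t)" by (auto intro!: card_image)
  have n: "1 \<le> real (card ?S)" "1 \<le> real (card ?T)"
    unfolding cS cT using assms by (simp_all add: Suc_le_eq card_gt_0_iff)
  have aS: "block_avg s u x = (\<Sum>p\<in>?S. u p) / real (card ?S)" and aT: "block_avg t u y = (\<Sum>q\<in>?T. u q) / real (card ?T)"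
    unfolding cS cT block_avg_def by (subst sum.reindex; simp)+
  have "(\<Sum>(p, q)\<in>?S \<times> ?T. u p - u q) = (\<Sum>p\<in>?S. \<Sum>q\<in>?T. u p - u q)"
    by (rule sum.cartesian_product[symmetric])
  also have "\<dots> = real (card ?T) * (\<Sum>p\<in>?S. u p) - real (card ?S) * (\<Sum>q\<in>?T. u q)"
    by (simp add: sum_subtractf sum_distrib_left)
  finally have "(\<Sum>(p, q)\<in>?S \<times> ?T. u p - u q) = real (card ?T) * (\<Sum>p\<in>?S. u p) - real (card ?S) * (\<Sum>q\<in>?T. u q)" .
  moreover have quot: "a / k - b / l = (l * a - k * b) / (k * l)" if "1 \<le> k" "1 \<le> l" for a b k l :: real
    using that by (simp add: field_simps)
  ultimately have "block_avg s u x - block_avg t u y = (\<Sum>(p, q)\<in>?S \<times> ?T. u p - u q) / (real (card ?S) * real (card ?T))"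
    unfolding aS aT using quot[OF n] by metis
  then have "\<bar>block_avg s u x - block_avg t u y\<bar> = \<bar>\<Sum>(p, q)\<in>?S \<times> ?T. u p - u q\<bar> / (real (card ?S) * real (card ?T))"
    by (simp add: abs_divide)
  also have "\<dots> \<le> \<bar>\<Sum>(p, q)\<in>?S \<times> ?T. u p - u q\<bar> / 1"
    using mult_mono[OF n] by (intro divide_left_mono) auto
  also have "\<dots> \<le> (\<Sum>(p, q)\<in>?S \<times> ?T. \<bar>u p - u q\<bar>)"
    by (simp add: case_prod_unfold)
  finally show ?thesis .
qed

section \<open>Recentring by block averages\<close>

definition vanishing_mean :: "'d::finite config measure \<Rightarrow> bool" where
  "vanishing_mean \<mu> \<longleftrightarrow> (\<forall>k. integrable \<mu> (\<lambda>\<phi>. (dyadic_avg k \<phi> 0)\<^sup>2)) \<and>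
     (\<lambda>k. \<integral>\<phi>. (dyadic_avg k \<phi> 0)\<^sup>2 \<partial>\<mu>) \<longlonglongrightarrow> 0"

lemma vanishing_meanI:
  assumes "\<And>k. integrable \<mu> (\<lambda>\<phi>. (dyadic_avg k \<phi> 0)\<^sup>2)" and b: "\<And>k. (\<integral>\<phi>. (dyadic_avg k \<phi> 0)\<^sup>2 \<partial>\<mu>) \<le> W * (1/2) ^ k"
  shows "vanishing_mean \<mu>"
  unfolding vanishing_mean_def
proof (intro conjI allI assms(1))
  have "(\<lambda>k. W * (1/2) ^ k) \<longlonglongrightarrow> W * 0" by (intro tendsto_intros LIMSEQ_power_zero) auto
  then have u: "(\<lambda>k. W * (1/2) ^ k) \<longlonglongrightarrow> 0" by simp
  show "(\<lambda>k. \<integral>\<phi>. (dyadic_avg k \<phi> 0)\<^sup>2 \<partial>\<mu>) \<longlonglongrightarrow> 0"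
    by (rule tendsto_sandwich[OF _ _ tendsto_const u])
       (use b in \<open>auto intro!: always_eventually integral_nonneg_AE\<close>)
qed

lemma measurable_block_avg: "(\<lambda>\<phi>. block_avg s \<phi> x) \<in> borel_measurable (field_algebra :: 'd::finite config measure)"
  unfolding block_avg_def by measurable

text \<open>
  The recentred field depends on the field only through its gradients.
\<close>

definition recentre :: "nat \<Rightarrow> 'd::finite config \<Rightarrow> 'd config" where
  "recentre k \<phi> = (\<lambda>x. \<phi> x - dyadic_avg k \<phi> 0)"

lemma pair_lipschitz_recentre:
  fixes F :: "'d::finite config \<Rightarrow> real"
  assumes "lip_cyl F"
  shows "pair_lipschitz (\<lambda>\<phi>. F (recentre k \<phi>))"
proof -
  obtain D K X where D: "\<And>\<phi>. \<bar>F \<phi>\<bar> \<le> D" "0 \<le> D" and L: "lipschitz_in K X F" using lip_cylE[OF assms] by blast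
  have K: "0 \<le> K" "finite X" using L by (auto simp: lipschitz_in_def)
  let ?B = "block (\<lambda>_::'d. 2 ^ k)"
  define P where "P = X \<times> (\<lambda>v. 0 + v) ` ?B"
  have finP: "finite P" using K by (simp add: P_def)
  have "\<bar>F (recentre k \<phi>) - F (recentre k \<psi>)\<bar> \<le> (K * real (card X)) * (\<Sum>(x, y)\<in>P. \<bar>(\<phi> x - \<psi> x) - (\<phi> y - \<psi> y)\<bar>)" for \<phi> \<psi>
  proof -
    define u where "u x = \<phi> x - \<psi> x" for x
    have ub: "dyadic_avg k \<phi> 0 - dyadic_avg k \<psi> 0 = dyadic_avg k u 0" by (simp add: block_avg_def u_def diff_divide_distrib[symmetric] sum_subtractf)
    \<comment> \<open>A site is the block average at scale 0, so the estimate for two block averages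
      applies to a site and a block.\<close>
    have b1: "(\<lambda>w. x + w) ` block (\<lambda>_::'d. 2 ^ 0) = {x}" for x :: "int ^ 'd" by (simp add: block_one[simplified])
    have "\<bar>F (recentre k \<phi>) - F (recentre k \<psi>)\<bar> \<le> K * (\<Sum>x\<in>X. \<bar>u x - dyadic_avg k u 0\<bar>)"
      using lipschitz_inD[OF L, of "recentre k \<phi>" "recentre k \<psi>"]
      unfolding recentre_def ub[symmetric] u_def by (simp add: algebra_simps)
    also have "\<dots> \<le> K * (\<Sum>x\<in>X. (\<Sum>(p, q)\<in>P. \<bar>u p - u q\<bar>))"
    proof (intro mult_left_mono sum_mono K)
      fix x assume x: "x \<in> X"
      have "\<bar>dyadic_avg 0 u x - dyadic_avg k u 0\<bar>
        \<le> (\<Sum>(p, q)\<in>(\<lambda>w. x + w) ` block (\<lambda>_::'d. 2 ^ 0) \<times> (\<lambda>v. 0 + v) ` ?B. \<bar>u p - u q\<bar>)"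
        by (rule block_avg_pair[OF block_nonempty block_nonempty])
      also have "\<dots> \<le> (\<Sum>(p, q)\<in>P. \<bar>u p - u q\<bar>)"
        unfolding b1 P_def using K x by (intro sum_mono2) auto
      finally show "\<bar>u x - dyadic_avg k u 0\<bar> \<le> (\<Sum>(p, q)\<in>P. \<bar>u p - u q\<bar>)"
        unfolding dyadic_avg_0 .
    qed
    finally show ?thesis by (simp add: u_def mult.assoc)
  qed
  moreover have "0 \<le> K * real (card X)" using K by simp
  ultimately show ?thesis unfolding pair_lipschitz_def using D(1) finP by blast
qed

text \<open>A stand-in for Cauchy-Schwarz: second moments bound first moments, with e left free to
  be chosen small.\<close>

lemma abs_le_add_square: "0 < e \<Longrightarrow> \<bar>t\<bar> \<le> e + t\<^sup>2 / (e::real)"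
proof (cases "\<bar>t\<bar> \<le> e")
  case False
  assume e: "0 < e"
  then have "e * \<bar>t\<bar> \<le> \<bar>t\<bar> * \<bar>t\<bar>" using False by (intro mult_right_mono) auto
  then have "\<bar>t\<bar> \<le> t\<^sup>2 / e" using e by (simp add: field_simps power2_eq_square)
  then show ?thesis using e by linarith
qed (simp add: add_increasing2)

lemma (in prob_space) abs_expectation_le:
  fixes f :: "'a \<Rightarrow> real"
  assumes "f \<in> borel_measurable M" "integrable M (\<lambda>x. (f x)\<^sup>2)" "0 < e"
  shows "integrable M f" "(\<integral>x. \<bar>f x\<bar> \<partial>M) \<le> e + (\<integral>x. (f x)\<^sup>2 \<partial>M) / e"
proof -
  note le = abs_le_add_square[OF assms(3)]
  have i2: "integrable M (\<lambda>x. e + (f x)\<^sup>2 / e)" using assms(2) by simp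
  show i: "integrable M f"
    by (rule Bochner_Integration.integrable_bound[OF i2 assms(1)]) (use le in \<open>auto intro!: AE_I2 order_trans[OF _ abs_ge_self]\<close>)
  have "(\<integral>x. \<bar>f x\<bar> \<partial>M) \<le> (\<integral>x. e + (f x)\<^sup>2 / e \<partial>M)"
    using i i2 le by (intro integral_mono) auto
  then show "(\<integral>x. \<bar>f x\<bar> \<partial>M) \<le> e + (\<integral>x. (f x)\<^sup>2 \<partial>M) / e"
    using assms(2) by (simp add: prob_space)
qed

text \<open>Recentring shifts every site by the same block average, so a Lipschitz function changes
  by at most a fixed multiple of its modulus, and the first moment of that tends to 0.\<close>

lemma vanishing_mean_recentre:
  fixes \<mu> :: "'d::finite config measure"
  assumes \<mu>: "field_law \<mu>" and v: "vanishing_mean \<mu>" and F: "lip_cyl F"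
  shows "(\<lambda>k. \<integral>\<phi>. F (recentre k \<phi>) \<partial>\<mu>) \<longlonglongrightarrow> (\<integral>\<phi>. F \<phi> \<partial>\<mu>)"
proof -
  interpret prob_space \<mu> using \<mu> by (rule prob_algebra_fieldsD)
  obtain D K X where D: "\<And>\<phi>. \<bar>F \<phi>\<bar> \<le> D" "0 \<le> D" and L: "lipschitz_in K X F" using lip_cylE[OF F] by blast
  have K: "0 \<le> K" "finite X" using L by (auto simp: lipschitz_in_def)
  define T where "T = K * real (card X)"
  have T: "0 \<le> T" using K by (simp add: T_def)
  let ?a = "\<lambda>k. \<integral>\<phi>. (dyadic_avg k \<phi> 0)\<^sup>2 \<partial>\<mu>"
  have am: "(\<lambda>\<phi>. dyadic_avg k \<phi> 0) \<in> borel_measurable \<mu>" for k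
    by (rule measurable_field_law[OF \<mu> measurable_block_avg])
  have i2: "integrable \<mu> (\<lambda>\<phi>. (dyadic_avg k \<phi> 0)\<^sup>2)" for k using v by (simp add: vanishing_mean_def)
  have bound: "\<bar>(\<integral>\<phi>. F (recentre k \<phi>) \<partial>\<mu>) - (\<integral>\<phi>. F \<phi> \<partial>\<mu>)\<bar> \<le> T * (e + ?a k / e)" if e: "0 < e" for k e
  proof -
    have iF: "integrable \<mu> F" "integrable \<mu> (\<lambda>\<phi>. F (recentre k \<phi>))"
      by (intro lip_cyl_integrable[OF _ \<mu>] F pair_lipschitz_lip_cyl pair_lipschitz_recentre)+
    have ia: "integrable \<mu> (\<lambda>\<phi>. dyadic_avg k \<phi> 0)" by (rule abs_expectation_le(1)[OF am i2 e])
    have "(\<integral>\<phi>. F (recentre k \<phi>) \<partial>\<mu>) - (\<integral>\<phi>. F \<phi> \<partial>\<mu>) = (\<integral>\<phi>. F (recentre k \<phi>) - F \<phi> \<partial>\<mu>)" using iF by simp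
    also have "\<bar>\<dots>\<bar> \<le> (\<integral>\<phi>. T * \<bar>dyadic_avg k \<phi> 0\<bar> \<partial>\<mu>)"
    proof (intro order_trans[OF integral_abs_bound] integral_mono)
      show "integrable \<mu> (\<lambda>\<phi>. \<bar>F (recentre k \<phi>) - F \<phi>\<bar>)" using iF by simp
      show "integrable \<mu> (\<lambda>\<phi>. T * \<bar>dyadic_avg k \<phi> 0\<bar>)" using ia by simp
      fix \<phi>
      have "\<bar>F (recentre k \<phi>) - F \<phi>\<bar> \<le> K * (\<Sum>x\<in>X. \<bar>recentre k \<phi> x - \<phi> x\<bar>)" using lipschitz_inD[OF L] .
      then show "\<bar>F (recentre k \<phi>) - F \<phi>\<bar> \<le> T * \<bar>dyadic_avg k \<phi> 0\<bar>" by (simp add: recentre_def T_def mult.assoc)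
    qed
    also have "\<dots> = T * (\<integral>\<phi>. \<bar>dyadic_avg k \<phi> 0\<bar> \<partial>\<mu>)" by simp
    also have "\<dots> \<le> T * (e + ?a k / e)" by (intro mult_left_mono abs_expectation_le(2) am i2 e T)
    finally show ?thesis .
  qed
  show ?thesis
  proof (rule LIMSEQ_I)
    fix e :: real assume e: "0 < e"
    define d where "d = e / (2 * (T + 1))"
    have d: "0 < d" using e T by (simp add: d_def add_nonneg_pos)
    have "(\<lambda>k. T * (d + ?a k / d)) \<longlonglongrightarrow> T * (d + 0 / d)"
      using v d by (intro tendsto_intros) (auto simp: vanishing_mean_def)
    moreover have "T * (d + 0 / d) < e"
    proof -
      have "T * d \<le> (T + 1) * d" using d by (intro mult_right_mono) auto
      also have "\<dots> = e / 2" using T by (simp add: d_def field_simps)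
      finally show ?thesis using e by simp
    qed
    ultimately have "\<forall>\<^sub>F k in sequentially. T * (d + ?a k / d) < e" by (rule order_tendstoD)
    then have "\<forall>\<^sub>F k in sequentially. norm ((\<integral>\<phi>. F (recentre k \<phi>) \<partial>\<mu>) - (\<integral>\<phi>. F \<phi> \<partial>\<mu>)) < e"
    proof eventually_elim
      case (elim k)
      then show ?case using bound[OF d, of k] unfolding real_norm_def by (rule le_less_trans[rotated])
    qed
    then show "\<exists>no. \<forall>k\<ge>no. norm ((\<integral>\<phi>. F (recentre k \<phi>) \<partial>\<mu>) - (\<integral>\<phi>. F \<phi> \<partial>\<mu>)) < e"
      unfolding eventually_sequentially .
  qed
qed

context convex_potential
begin

text \<open>The mass is common to both measures but otherwise arbitrary, so the statement identifies
  limit points both in infinite volume at positive mass and in the massless limit. The second-moment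
  constants may differ.\<close>

lemma stationary_gibbs_unique:
  assumes \<mu>: "stationary_gibbs m K \<mu>" "vanishing_mean \<mu>" and \<nu>: "stationary_gibbs m K' \<nu>" "vanishing_mean \<nu>"
  shows "\<mu> = \<nu>"
proof (rule fields_eqI)
  show \<mu>p: "field_law \<mu>" and \<nu>p: "field_law \<nu>"
    using \<mu> \<nu> by (auto simp: stationary_gibbs_def)
  fix F :: "(int ^ 'a \<Rightarrow> real) \<Rightarrow> real" assume F: "lip_cyl F"
  have e: "(\<lambda>k. \<integral>\<phi>. F (recentre k \<phi>) \<partial>\<mu>) = (\<lambda>k. \<integral>\<phi>. F (recentre k \<phi>) \<partial>\<nu>)"
    by (intro ext gradient_mean_unique[OF pair_lipschitz_recentre[OF F] \<mu>(1) \<nu>(1)])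
  show "(\<integral>\<phi>. F \<phi> \<partial>\<mu>) = (\<integral>\<phi>. F \<phi> \<partial>\<nu>)"
    by (rule LIMSEQ_unique[OF vanishing_mean_recentre[OF \<mu>p \<mu>(2) F, unfolded e] vanishing_mean_recentre[OF \<nu>p \<nu>(2) F]])
qed

lemma good_stationary_gibbs:
  fixes \<mu> :: "'d::finite config measure"
  assumes g: "good m \<mu>" and d: "CARD('d) \<ge> 3"
  shows "stationary_gibbs m (8 * (green_const TYPE('d))\<^sup>2 / c) \<mu>" "vanishing_mean \<mu>"
proof -
  show "stationary_gibbs m (8 * (green_const TYPE('d))\<^sup>2 / c) \<mu>"
    unfolding stationary_gibbs_def
  proof (intro conjI allI impI good_site[OF g d])
    show "field_law \<mu>" "shift_invariant \<mu>" using g by (simp_all add: good_def)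
    show "local_dlr \<Lambda> m \<mu>" if "finite \<Lambda>" for \<Lambda>
      using g that by (simp add: good_def dlr_def local_dlr_def)
  qed
  show "vanishing_mean \<mu>" by (rule vanishing_meanI[OF good_dyadic_avg[OF g d]])
qed

lemma good_unique:
  fixes \<mu> \<nu> :: "'d::finite config measure"
  assumes "good m \<mu>" "good m \<nu>" "CARD('d) \<ge> 3"
  shows "\<mu> = \<nu>"
  by (rule stationary_gibbs_unique[OF good_stationary_gibbs[OF assms(1,3)] good_stationary_gibbs[OF assms(2,3)]])

end

section \<open>Ergodicity and conditional laws\<close>

lemma shift_shift: "shift z (shift w \<phi>) = shift (z + w) \<phi>"
  by (simp add: shift_def add.assoc)

lemma shift_0: "shift 0 \<phi> = \<phi>"
  by (simp add: shift_def)

lemma shift_eqD: "shift z \<phi> = shift z \<psi> \<Longrightarrow> \<phi> = \<psi>"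
  by (metis shift_0 shift_shift add.left_inverse)

lemma shift_image_invariant:
  fixes z :: "int ^ 'd"
  assumes "shift z ` A = A"
  shows "shift (int k *s z) \<phi> \<in> A \<longleftrightarrow> \<phi> \<in> A"
proof (induction k)
  case 0
  have "int 0 *s z = 0" by (simp add: vec_eq_iff)
  then show ?case by (simp add: shift_0)
next
  case (Suc k)
  have "int (Suc k) *s z = z + int k *s z" by (simp add: vec_eq_iff algebra_simps)
  then have "shift (int (Suc k) *s z) \<phi> = shift z (shift (int k *s z) \<phi>)" by (simp add: shift_shift)
  moreover have "shift z \<psi> \<in> A \<longleftrightarrow> \<psi> \<in> A" for \<psi>
    using assms shift_eqD by (metis imageE imageI)
  ultimately show ?case using Suc by simp
qed

definition shift_avg :: "int ^ 'd \<Rightarrow> ('d config \<Rightarrow> real) \<Rightarrow> nat \<Rightarrow> 'd config \<Rightarrow> real" where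
  "shift_avg z F N \<phi> = (1 / real N) * (\<Sum>k<N. F (shift (int k *s z) \<phi>))"

context convex_potential
begin

lemma good_ergodic_average_variance:
  fixes \<mu> :: "'d::finite config measure"
  assumes g: "good m \<mu>" and d: "CARD('d) \<ge> 3" and z: "z \<noteq> 0" and F: "lip_cyl F" and e: "0 < e"
  obtains N where "0 < N" "lip_cyl (shift_avg z F N)"
    "(\<integral>\<phi>. shift_avg z F N \<phi> * shift_avg z F N \<phi> \<partial>\<mu>) - (\<integral>\<phi>. shift_avg z F N \<phi> \<partial>\<mu>)\<^sup>2 \<le> e"
proof -
  obtain D K X where D: "\<And>\<phi>. \<bar>F \<phi>\<bar> \<le> D" "0 \<le> D" and L: "lipschitz_in K X F" using lip_cylE[OF F] by blast
  have K: "0 \<le> K" "finite X" using L by (auto simp: lipschitz_in_def)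
  \<comment> \<open>a is fixed by 8 a^2 / c = e, so that the variance bound is the desired
    one.\<close>
  define a where "a = sqrt (c * e / 8)"
  have a: "0 < a" "8 * a\<^sup>2 / c = e" using c_pos e by (auto simp: a_def)
  \<comment> \<open>The budget a is shared among the sites seen by \<open>F\<close>; the summand 1
    keeps the quotient defined when \<open>K\<close> or the set of sites is trivial.\<close>
  define b where "b = a / (K * real (card X) + 1)"
  have p: "0 < K * real (card X) + 1" using K by (simp add: add_nonneg_pos)
  have b: "0 < b" using a p by (simp add: b_def)
  have "\<exists>N0. \<forall>N\<ge>N0. dominated b (\<lambda>u. (\<Sum>k<N. \<bar>u (x + int k *s z)\<bar>) / real N)" for x
    using ergodic_avg_dominated[OF d z b, of x] by metis
  then obtain N0 where N0: "\<And>x N. N0 x \<le> N \<Longrightarrow> dominated b (\<lambda>u. (\<Sum>k<N. \<bar>u (x + int k *s z)\<bar>) / real N)" by metis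
  define N where "N = Suc (\<Sum>x\<in>X. N0 x)"
  have N: "N0 x \<le> N" if "x \<in> X" for x
    unfolding N_def using member_le_sum[of x X N0] K that by (simp add: le_SucI)
  have "dominated (K * (real (card X) * b)) (\<lambda>u. K * (\<Sum>x\<in>X. (\<Sum>k<N. \<bar>u (x + int k *s z)\<bar>) / real N))"
    using b K N by (intro dominated_cmult dominated_sum N0) auto
  then have dom: "dominated a (\<lambda>u. K * (\<Sum>x\<in>X. (\<Sum>k<N. \<bar>u (x + int k *s z)\<bar>) / real N))"
  proof (rule dominated_mono_const)
    have "K * (real (card X) * b) \<le> (K * real (card X) + 1) * b" using b by (simp add: algebra_simps)
    also have "\<dots> = a" using p by (simp add: b_def)
    finally show "K * (real (card X) * b) \<le> a" .
  qed
  have lA: "lip_cyl (shift_avg z F N)" unfolding shift_avg_def[abs_def] by (intro lip_cyl_cmult lip_cyl_sum lip_cyl_shift F) auto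
  have "grad_lipschitz a (shift_avg z F N)"
  proof (rule grad_lipschitzI[OF dom])
    fix \<phi> \<psi> :: "'d config"
    have "shift_avg z F N \<phi> - shift_avg z F N \<psi> = (1 / real N) * (\<Sum>k<N. F (shift (int k *s z) \<phi>) - F (shift (int k *s z) \<psi>))"
      by (simp add: shift_avg_def sum_subtractf right_diff_distrib)
    also have "\<dots> \<le> (1 / real N) * (\<Sum>k<N. K * (\<Sum>x\<in>X. \<bar>\<phi> (x + int k *s z) - \<psi> (x + int k *s z)\<bar>))"
    proof (intro mult_left_mono sum_mono)
      fix k
      show "F (shift (int k *s z) \<phi>) - F (shift (int k *s z) \<psi>) \<le> K * (\<Sum>x\<in>X. \<bar>\<phi> (x + int k *s z) - \<psi> (x + int k *s z)\<bar>)"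
        using lipschitz_inD[OF L, of "shift (int k *s z) \<phi>" "shift (int k *s z) \<psi>"] by (simp add: shift_def)
    qed auto
    also have "\<dots> = K * (\<Sum>x\<in>X. (\<Sum>k<N. \<bar>\<phi> (x + int k *s z) - \<psi> (x + int k *s z)\<bar>) / real N)"
      unfolding sum_distrib_left[symmetric] sum_divide_distrib[symmetric] by (subst sum.swap) simp
    finally show "shift_avg z F N \<phi> - shift_avg z F N \<psi> \<le> K * (\<Sum>x\<in>X. (\<Sum>k<N. \<bar>\<phi> (x + int k *s z) - \<psi> (x + int k *s z)\<bar>) / real N)" .
  qed
  then have "(\<integral>\<phi>. shift_avg z F N \<phi> * shift_avg z F N \<phi> \<partial>\<mu>) - (\<integral>\<phi>. shift_avg z F N \<phi> \<partial>\<mu>)\<^sup>2 \<le> e"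
  proof -
    assume gl: "grad_lipschitz a (shift_avg z F N)"
    have "grad_poincare \<mu>" using g by (simp add: good_def)
    from this[unfolded grad_poincare_def, rule_format, OF lA less_imp_le[OF a(1)] gl]
    show ?thesis unfolding a(2) .
  qed
  moreover have "0 < N" by (simp add: N_def)
  ultimately show ?thesis using that[OF _ lA] by blast
qed

text \<open>The mean of the indicator of an invariant event times \<open>F\<close> does not change
  when \<open>F\<close> is shifted, so \<open>F\<close> may be replaced by a shift average. That
  average is close in mean square to the constant mean of \<open>F\<close>.\<close>

lemma good_mixing:
  fixes \<mu> :: "'d::finite config measure"
  assumes g: "good m \<mu>" and d: "CARD('d) \<ge> 3" and z: "z \<noteq> 0" and F: "lip_cyl F"
    and A: "A \<in> sets field_algebra" and inv: "shift z ` A = A"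
  shows "(\<integral>\<phi>. indicator A \<phi> * F \<phi> \<partial>\<mu>) = measure \<mu> A * (\<integral>\<phi>. F \<phi> \<partial>\<mu>)"
proof -
  have \<mu>: "field_law \<mu>" and sh: "shift_invariant \<mu>" using g by (auto simp: good_def)
  interpret prob_space \<mu> using \<mu> by (rule prob_algebra_fieldsD)
  note s[measurable_cong] = prob_algebra_fieldsD(2)[OF \<mu>]
  note [measurable] = A
  let ?I = "\<integral>\<phi>. indicator A \<phi> * F \<phi> \<partial>\<mu>" and ?p = "measure \<mu> A" and ?f = "\<integral>\<phi>. F \<phi> \<partial>\<mu>"
  have bound: "\<bar>?I - ?p * ?f\<bar> \<le> e" if e: "0 < e" for e
  proof -
    have e2: "0 < (e / 2)\<^sup>2" using e by simp
    obtain N where N: "0 < N" and lA: "lip_cyl (shift_avg z F N)"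
      and var: "(\<integral>\<phi>. shift_avg z F N \<phi> * shift_avg z F N \<phi> \<partial>\<mu>) - (\<integral>\<phi>. shift_avg z F N \<phi> \<partial>\<mu>)\<^sup>2 \<le> (e / 2)\<^sup>2"
      by (rule good_ergodic_average_variance[OF g d z F e2])
    define G where "G = shift_avg z F N"
    have G_def': "G \<phi> = (1 / real N) * (\<Sum>k<N. F (shift (int k *s z) \<phi>))" for \<phi> by (simp add: G_def shift_avg_def)
    have lG: "lip_cyl G" using lA by (simp add: G_def)
    have Fm[measurable]: "F \<in> borel_measurable field_algebra" and Gm[measurable]: "G \<in> borel_measurable field_algebra"
      using lip_cyl_measurable F lG by auto
    have iFs: "integrable \<mu> (\<lambda>\<phi>. F (shift w \<phi>))" for w by (intro lip_cyl_integrable[OF _ \<mu>] lip_cyl_shift F)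
    have iG: "integrable \<mu> G" and iGG: "integrable \<mu> (\<lambda>\<phi>. G \<phi> * G \<phi>)"
      by (intro lip_cyl_integrable[OF _ \<mu>] lG lip_cyl_mult)+
    have iAF: "integrable \<mu> (\<lambda>\<phi>. indicator A \<phi> * F (shift w \<phi>))" for w
      using integrable_mult_indicator[of A \<mu> "\<lambda>\<phi>. F (shift w \<phi>)"] iFs by simp
    have iAG: "integrable \<mu> (\<lambda>\<phi>. indicator A \<phi> * G \<phi>)"
      using integrable_mult_indicator[of A \<mu> G] iG by simp
    have EG: "(\<integral>\<phi>. G \<phi> \<partial>\<mu>) = ?f"
    proof -
      have "(\<integral>\<phi>. G \<phi> \<partial>\<mu>) = 1 / real N * (\<Sum>k<N. \<integral>\<phi>. F (shift (int k *s z) \<phi>) \<partial>\<mu>)"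
        unfolding G_def' using iFs by (simp add: Bochner_Integration.integral_sum)
      then show ?thesis using shift_invariant_integral[OF \<mu> sh Fm] N by simp
    qed
    have EAG: "(\<integral>\<phi>. indicator A \<phi> * G \<phi> \<partial>\<mu>) = ?I"
    proof -
      have one: "(\<integral>\<phi>. indicator A \<phi> * F (shift (int k *s z) \<phi>) \<partial>\<mu>) = ?I" for k
      proof -
        have "(\<integral>\<phi>. indicator A \<phi> * F (shift (int k *s z) \<phi>) \<partial>\<mu>)
          = (\<integral>\<phi>. indicator A (shift (int k *s z) \<phi>) * F (shift (int k *s z) \<phi>) \<partial>\<mu>)"
          using shift_image_invariant[OF inv] by (simp add: indicator_def)
        also have "\<dots> = ?I"
          by (rule shift_invariant_integral[OF \<mu> sh, of "\<lambda>\<phi>. indicator A \<phi> * F \<phi>"]) measurable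
        finally show ?thesis .
      qed
      have "(\<integral>\<phi>. indicator A \<phi> * G \<phi> \<partial>\<mu>) = (\<integral>\<phi>. 1 / real N * (\<Sum>k<N. indicator A \<phi> * F (shift (int k *s z) \<phi>)) \<partial>\<mu>)"
        by (simp only: G_def' sum_distrib_left[symmetric] mult.left_commute[of "indicator A _"])
      also have "\<dots> = 1 / real N * (\<Sum>k<N. ?I)"
        unfolding integral_mult_right_zero one[symmetric]
        by (subst Bochner_Integration.integral_sum[of "{..<N}" \<mu> "\<lambda>k \<phi>. indicator A \<phi> * F (shift (int k *s z) \<phi>)", OF iAF]) (simp only: one)
      finally show ?thesis using N by simp
    qed
    have iGc: "integrable \<mu> (\<lambda>\<phi>. (G \<phi> - ?f)\<^sup>2)"
      using iG iGG by (simp add: power2_eq_square algebra_simps)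
    have vG: "(\<integral>\<phi>. (G \<phi> - ?f)\<^sup>2 \<partial>\<mu>) \<le> (e / 2)\<^sup>2"
    proof -
      have "(\<integral>\<phi>. (G \<phi> - ?f)\<^sup>2 \<partial>\<mu>) = (\<integral>\<phi>. G \<phi> * G \<phi> - 2 * ?f * G \<phi> + ?f\<^sup>2 \<partial>\<mu>)"
        by (simp add: power2_eq_square algebra_simps)
      also have "\<dots> = (\<integral>\<phi>. G \<phi> * G \<phi> \<partial>\<mu>) - 2 * ?f * (\<integral>\<phi>. G \<phi> \<partial>\<mu>) + ?f\<^sup>2"
        using iG iGG prob_space by simp
      also have "\<dots> = (\<integral>\<phi>. G \<phi> * G \<phi> \<partial>\<mu>) - (\<integral>\<phi>. G \<phi> \<partial>\<mu>)\<^sup>2"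
        unfolding EG by (simp add: power2_eq_square)
      finally show ?thesis using var by (simp add: G_def)
    qed
    have "?I - ?p * ?f = (\<integral>\<phi>. indicator A \<phi> * (G \<phi> - ?f) \<partial>\<mu>)"
    proof -
      have iA: "integrable \<mu> (\<lambda>\<phi>. indicat_real A \<phi> * ?f)" using A s by (simp add: less_top[symmetric])
      have "(\<integral>\<phi>. indicat_real A \<phi> * ?f \<partial>\<mu>) = ?p * ?f" using A s by simp
      then show ?thesis
        unfolding right_diff_distrib by (subst Bochner_Integration.integral_diff[OF iAG iA]) (simp add: EAG)
    qed
    also have "\<bar>\<dots>\<bar> \<le> (\<integral>\<phi>. \<bar>G \<phi> - ?f\<bar> \<partial>\<mu>)"
    proof (intro order_trans[OF integral_abs_bound] integral_mono)
      show "integrable \<mu> (\<lambda>\<phi>. \<bar>indicator A \<phi> * (G \<phi> - ?f)\<bar>)"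
        using integrable_mult_indicator[of A \<mu> "\<lambda>\<phi>. G \<phi> - ?f"] iG by (simp add: integrable_abs)
      show "integrable \<mu> (\<lambda>\<phi>. \<bar>G \<phi> - ?f\<bar>)" using iG by simp
    qed (auto simp: indicator_def)
    also have "\<dots> \<le> e / 2 + (\<integral>\<phi>. (G \<phi> - ?f)\<^sup>2 \<partial>\<mu>) / (e / 2)"
      by (rule abs_expectation_le(2)) (use iGc e in auto)
    also have "\<dots> \<le> e / 2 + (e / 2)\<^sup>2 / (e / 2)"
      using vG e by (intro add_left_mono divide_right_mono) auto
    also have "\<dots> = e" using e by (simp add: power2_eq_square)
    finally show ?thesis .
  qed
  have "\<bar>?I - ?p * ?f\<bar> \<le> 0" by (rule field_le_epsilon) (use bound in simp)
  then show ?thesis by simp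
qed

text \<open>An invariant event of positive probability is uncorrelated with every test function, so
  conditioning on it leaves the law unchanged. Under the conditioned law the event has probability
  1.\<close>

lemma good_shift_ergodic:
  fixes \<mu> :: "'d::finite config measure"
  assumes g: "good m \<mu>" and d: "CARD('d) \<ge> 3"
  shows "shift_ergodic \<mu>"
  unfolding shift_ergodic_def
proof (intro allI impI ballI)
  fix z :: "int ^ 'd" and A :: "'d config set"
  assume z: "z \<noteq> 0" and A[measurable]: "A \<in> sets field_algebra" and inv: "shift z ` A = A"
  have \<mu>: "field_law \<mu>" using g by (auto simp: good_def)
  interpret prob_space \<mu> using \<mu> by (rule prob_algebra_fieldsD)
  note s[measurable_cong] = prob_algebra_fieldsD(2)[OF \<mu>]
  show "measure \<mu> A \<in> {0, 1}"
  proof (cases "measure \<mu> A = 0")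
    case False
    define p where "p = measure \<mu> A"
    have p: "0 < p" using False measure_nonneg[of \<mu> A] by (simp add: p_def less_le)
    define \<nu> where "\<nu> = density \<mu> (\<lambda>\<phi>. ennreal (indicator A \<phi> / p))"
    have int: "(\<integral>\<phi>. F \<phi> \<partial>\<nu>) = (\<integral>\<phi>. indicator A \<phi> * F \<phi> \<partial>\<mu>) / p" if [measurable]: "F \<in> borel_measurable field_algebra" for F :: "'d config \<Rightarrow> real"
      unfolding \<nu>_def using p by (subst integral_density) (auto simp: indicator_def)
    have "emeasure \<nu> (space \<nu>) = (\<integral>\<^sup>+\<phi>. ennreal (indicator A \<phi> / p) \<partial>\<mu>)"
      unfolding \<nu>_def by (simp add: emeasure_density)
    also have "\<dots> = (\<integral>\<^sup>+\<phi>. ennreal (1 / p) * indicator A \<phi> \<partial>\<mu>)"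
      by (intro nn_integral_cong) (auto simp: indicator_def)
    also have "\<dots> = ennreal (1 / p) * ennreal p"
      using s A by (simp add: nn_integral_cmult p_def emeasure_eq_measure)
    also have "\<dots> = 1" using p by (simp flip: ennreal_mult)
    finally have "prob_space \<nu>" by (rule prob_spaceI)
    then have \<nu>: "field_law \<nu>" by (simp add: space_prob_algebra \<nu>_def s)
    have "\<nu> = \<mu>"
    proof (rule fields_eqI[OF \<nu> \<mu>])
      fix F :: "'d config \<Rightarrow> real" assume F: "lip_cyl F"
      show "(\<integral>\<phi>. F \<phi> \<partial>\<nu>) = (\<integral>\<phi>. F \<phi> \<partial>\<mu>)"
        using good_mixing[OF g d z F A inv] p by (simp add: int[OF lip_cyl_measurable[OF F]] p_def)
    qed
    moreover have "measure \<nu> A = 1"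
    proof -
      have "measure \<nu> A = (\<integral>\<phi>. indicat_real A \<phi> \<partial>\<nu>)" using A by (simp add: \<nu>_def s)
      also have "\<dots> = (\<integral>\<phi>. indicat_real A \<phi> * indicat_real A \<phi> \<partial>\<mu>) / p" by (rule int) simp
      also have "(\<integral>\<phi>. indicat_real A \<phi> * indicat_real A \<phi> \<partial>\<mu>) = (\<integral>\<phi>. indicat_real A \<phi> \<partial>\<mu>)"
        by (intro Bochner_Integration.integral_cong) (auto simp: indicator_def)
      also have "\<dots> = p" using A s by (simp add: p_def)
      finally show ?thesis using p by simp
    qed
    ultimately show ?thesis by simp
  qed simp
qed

section \<open>Conditional laws given the exterior\<close>

lemma restrict_measurable: "(\<lambda>\<phi>. restrict \<phi> S) \<in> measurable (field_algebra :: 'd::finite config measure) (PiM S (\<lambda>_. borel))"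
  by (rule measurable_restrict_subset) auto

lemma gibbs_avg_indicator:
  fixes \<Lambda> :: "(int ^ 'd::finite) set"
  assumes \<Lambda>: "finite \<Lambda>" and A: "A \<in> sets (PiM \<Lambda> (\<lambda>_. borel))"
  shows "gibbs_avg \<Lambda> m \<xi> (\<lambda>\<phi>. indicator B (restrict \<phi> (- \<Lambda>)) * indicator A (restrict \<phi> \<Lambda>))
    = indicator B (restrict \<xi> (- \<Lambda>)) * measure (lattice_gibbs \<Lambda> m \<xi>) A"
proof -
  let ?g = "lattice_gibbs \<Lambda> m \<xi>"
  have sA: "A \<in> sets ?g" using A by (simp add: sets_finite_gibbs cong: sets_PiM_cong)
  have "gibbs_avg \<Lambda> m \<xi> (\<lambda>\<phi>. indicator B (restrict \<phi> (- \<Lambda>)) * indicator A (restrict \<phi> \<Lambda>))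
    = (\<integral>\<phi>. indicator B (restrict \<xi> (- \<Lambda>)) * indicator A \<phi> \<partial>?g)"
    unfolding gibbs_avg_def
  proof (rule Bochner_Integration.integral_cong)
    fix \<phi> assume "\<phi> \<in> space ?g"
    then have "\<phi> \<in> extensional \<Lambda>" by (simp add: finite_gibbs_def space_PiM PiE_def)
    then have "restrict (override_on \<xi> \<phi> \<Lambda>) \<Lambda> = \<phi>" by (auto simp: fun_eq_iff extensional_def)
    moreover have "restrict (override_on \<xi> \<phi> \<Lambda>) (- \<Lambda>) = restrict \<xi> (- \<Lambda>)" by (auto simp: fun_eq_iff)
    ultimately show "indicator B (restrict (override_on \<xi> \<phi> \<Lambda>) (- \<Lambda>)) * indicator A (restrict (override_on \<xi> \<phi> \<Lambda>) \<Lambda>)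
      = indicator B (restrict \<xi> (- \<Lambda>)) * indicator A \<phi>" by simp
  qed simp
  then show ?thesis using sA by simp
qed

lemma override_on_idem: "override_on (override_on \<xi> \<eta> \<Lambda>) \<phi> \<Lambda> = override_on \<xi> \<phi> \<Lambda>"
  by (auto simp: override_on_def)

lemma finite_gibbs_exterior: "finite_gibbs V E \<Lambda> m (override_on \<xi> \<eta> \<Lambda>) = finite_gibbs V E \<Lambda> m \<xi>"
  by (simp add: finite_gibbs_eq override_on_idem)

lemma gibbs_kernel_measurable:
  fixes \<Lambda> :: "(int ^ 'd::finite) set" and \<mu> :: "'d config measure"
  assumes \<Lambda>: "finite \<Lambda>" and A: "A \<in> sets (PiM \<Lambda> (\<lambda>_. borel))" and \<mu>: "field_law \<mu>"
  shows "(\<lambda>\<xi>. measure (lattice_gibbs \<Lambda> m \<xi>) A) \<in> borel_measurable (exterior_algebra \<Lambda>)"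
    and "(\<lambda>\<xi>. measure (lattice_gibbs \<Lambda> m \<xi>) A) \<in> borel_measurable field_algebra"
proof -
  note [measurable] = A restrict_measurable
  have "(\<lambda>\<xi>. gibbs_avg \<Lambda> m \<xi> (\<lambda>\<phi>. indicator UNIV (restrict \<phi> (- \<Lambda>)) * indicator A (restrict \<phi> \<Lambda>))) \<in> borel_measurable field_algebra"
  proof (rule gibbs_avg_resample(1)[OF \<Lambda> \<mu>, where K = 1])
    have "(\<lambda>\<phi>. indicat_real A (restrict \<phi> \<Lambda>)) \<in> borel_measurable (field_algebra :: 'd config measure)"
      by (rule measurable_compose[OF restrict_measurable]) simp
    then show "(\<lambda>\<phi>. indicat_real UNIV (restrict \<phi> (- \<Lambda>)) * indicat_real A (restrict \<phi> \<Lambda>)) \<in> borel_measurable (field_algebra :: 'd config measure)"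
      by simp
  qed (auto simp: indicator_def)
  then show m: "(\<lambda>\<xi>. measure (lattice_gibbs \<Lambda> m \<xi>) A) \<in> borel_measurable field_algebra"
    unfolding gibbs_avg_indicator[OF \<Lambda> A] by simp
  \<comment> \<open>Overwriting the field in \<Lambda> by 0 does not change the kernel, and the
    overwritten configuration is a measurable function of the exterior; this transfers measurability
    from the full algebra to the exterior one.\<close>
  have T: "(\<lambda>\<xi>. override_on \<xi> (\<lambda>_. 0) \<Lambda>) \<in> measurable (exterior_algebra \<Lambda>) field_algebra"
  proof (rule measurable_PiM_single')
    fix x :: "int ^ 'd"
    show "(\<lambda>\<xi>. override_on \<xi> (\<lambda>_. 0) \<Lambda> x) \<in> borel_measurable (exterior_algebra \<Lambda>)"
    proof (cases "x \<in> \<Lambda>")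
      case False
      have r: "(\<lambda>\<phi>. restrict \<phi> (- \<Lambda>)) \<in> measurable (exterior_algebra \<Lambda>) (PiM (- \<Lambda>) (\<lambda>_. borel))"
        unfolding exterior_algebra_def by (rule measurable_vimage_algebra1) (auto simp: space_PiM)
      have "(\<lambda>\<phi>. (restrict \<phi> (- \<Lambda>)) x) \<in> borel_measurable (exterior_algebra \<Lambda>)"
        by (rule measurable_compose[OF r measurable_component_singleton]) (use False in simp)
      then show ?thesis using False by (simp add: override_on_def)
    qed (simp add: override_on_def)
  qed auto
  from measurable_compose[OF T m]
  show "(\<lambda>\<xi>. measure (lattice_gibbs \<Lambda> m \<xi>) A) \<in> borel_measurable (exterior_algebra \<Lambda>)"
    by (simp add: finite_gibbs_exterior)
qed

lemma exterior_subalgebra: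
  fixes \<Lambda> :: "(int ^ 'd::finite) set"
  assumes \<mu>: "field_law \<mu>"
  shows "finite_measure_subalgebra \<mu> (exterior_algebra \<Lambda>)"
proof -
  interpret prob_space \<mu> using \<mu> by (rule prob_algebra_fieldsD)
  have "subalgebra \<mu> (exterior_algebra \<Lambda>)"
    unfolding subalgebra_def
  proof
    show "space (exterior_algebra \<Lambda>) = space \<mu>" by (simp add: exterior_algebra_def prob_algebra_fieldsD(3)[OF \<mu>])
    have "(\<lambda>\<phi>. restrict \<phi> (- \<Lambda>)) -` B \<inter> UNIV \<in> sets \<mu>" if "B \<in> sets (PiM (- \<Lambda>) (\<lambda>_. borel))" for B :: "'d config set"
      using measurable_sets[OF restrict_measurable that] prob_algebra_fieldsD(2)[OF \<mu>] by (simp add: space_PiM)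
    then show "sets (exterior_algebra \<Lambda>) \<subseteq> sets \<mu>"
      unfolding exterior_algebra_def by (subst sets_vimage_algebra2) (auto simp: space_PiM)
  qed
  then show ?thesis by unfold_locales
qed

text \<open>Redrawing turns the equation for Lipschitz test functions into an identity of laws, and
  thereby extends it to indicators of arbitrary events.\<close>

lemma dlr_resample:
  fixes \<mu> :: "'d::finite config measure"
  assumes \<Lambda>: "finite \<Lambda>" and \<mu>: "field_law \<mu>" and d: "dlr \<Lambda> m \<mu>"
  shows "resample \<Lambda> m \<mu> = \<mu>"
proof (rule fields_eqI[OF resample_prob[OF \<Lambda> \<mu>] \<mu>])
  fix F :: "'d config \<Rightarrow> real" assume F: "lip_cyl F"
  obtain K where K: "\<And>\<phi>. \<bar>F \<phi>\<bar> \<le> K" using lip_cylE[OF F] by metis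
  show "(\<integral>\<phi>. F \<phi> \<partial>resample \<Lambda> m \<mu>) = (\<integral>\<phi>. F \<phi> \<partial>\<mu>)"
    using gibbs_avg_resample(2)[OF \<Lambda> \<mu> lip_cyl_measurable[OF F] K] d F by (simp add: dlr_def)
qed

text \<open>The characterisation of conditional expectations is tested on exterior events. For an
  exterior and an interior event, the product of the indicators has the same mean before and after
  redrawing, and redrawing acts only on the second factor.\<close>

lemma good_phi_gibbs:
  fixes \<mu> :: "'d::finite config measure"
  assumes g: "good 0 \<mu>"
  shows "phi_gibbs V \<mu>"
  unfolding phi_gibbs_def
proof (intro conjI allI impI ballI)
  show \<mu>: "field_law \<mu>" using g by (simp add: good_def)
  fix \<Lambda> :: "(int ^ 'd) set" and A assume \<Lambda>: "finite \<Lambda>" and A: "A \<in> sets (PiM \<Lambda> (\<lambda>_. borel :: real measure))"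
  interpret finite_measure_subalgebra \<mu> "exterior_algebra \<Lambda>" by (rule exterior_subalgebra[OF \<mu>])
  interpret prob_space \<mu> using \<mu> by (rule prob_algebra_fieldsD)
  note s[measurable_cong] = prob_algebra_fieldsD(2)[OF \<mu>]
  note [measurable] = A restrict_measurable
  let ?k = "\<lambda>\<xi>. measure (lattice_gibbs \<Lambda> 0 \<xi>) A"
  have res: "resample \<Lambda> 0 \<mu> = \<mu>" using g \<Lambda> by (intro dlr_resample \<mu>) (auto simp: good_def)
  have kb: "\<bar>?k \<xi>\<bar> \<le> 1" for \<xi>
  proof -
    interpret K: prob_space "lattice_gibbs \<Lambda> 0 \<xi>" by (rule prob_space_lattice_gibbs[OF \<Lambda>])
    show ?thesis using K.prob_le_1 by simp
  qed
  note km = gibbs_kernel_measurable[OF \<Lambda> A \<mu>, of 0]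
  have SA: "{\<phi>. restrict \<phi> \<Lambda> \<in> A} \<in> sets \<mu>"
    using measurable_sets[OF restrict_measurable A] s by (simp add: vimage_def space_PiM)
  show "AE \<xi> in \<mu>. real_cond_exp \<mu> (exterior_algebra \<Lambda>) (indicator {\<phi>. restrict \<phi> \<Lambda> \<in> A}) \<xi> = ?k \<xi>"
  proof (rule real_cond_exp_charact)
    show "integrable \<mu> (indicator {\<phi>. restrict \<phi> \<Lambda> \<in> A} :: _ \<Rightarrow> real)" using SA by (simp add: less_top[symmetric])
    show "?k \<in> borel_measurable (exterior_algebra \<Lambda>)" by (rule km)
    show "integrable \<mu> ?k" using km kb by (intro integrable_const_bound[of _ 1]) auto
    fix S assume "S \<in> sets (exterior_algebra \<Lambda>)"
    then obtain B where B[measurable]: "B \<in> sets (PiM (- \<Lambda>) (\<lambda>_. borel))" and S: "S = (\<lambda>\<phi>. restrict \<phi> (- \<Lambda>)) -` B"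
      unfolding exterior_algebra_def by (subst (asm) sets_vimage_algebra2) (auto simp: space_PiM)
    let ?G = "\<lambda>\<phi>. indicator B (restrict \<phi> (- \<Lambda>)) * indicator A (restrict \<phi> \<Lambda>) :: real"
    have "(\<integral>\<phi>. ?G \<phi> \<partial>\<mu>) = (\<integral>\<xi>. gibbs_avg \<Lambda> 0 \<xi> ?G \<partial>\<mu>)"
      using gibbs_avg_resample(2)[OF \<Lambda> \<mu>, of ?G 1 0] unfolding res by (simp add: indicator_def)
    then have "(\<integral>\<phi>. ?G \<phi> \<partial>\<mu>) = (\<integral>\<xi>. indicator B (restrict \<xi> (- \<Lambda>)) * ?k \<xi> \<partial>\<mu>)"
      unfolding gibbs_avg_indicator[OF \<Lambda> A] .
    moreover have "(\<integral>\<phi>\<in>S. indicator {\<phi>. restrict \<phi> \<Lambda> \<in> A} \<phi> \<partial>\<mu>) = (\<integral>\<phi>. ?G \<phi> \<partial>\<mu>)"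
      unfolding set_lebesgue_integral_def by (intro Bochner_Integration.integral_cong) (auto simp: S indicator_def)
    moreover have "(\<integral>\<phi>\<in>S. ?k \<phi> \<partial>\<mu>) = (\<integral>\<xi>. indicator B (restrict \<xi> (- \<Lambda>)) * ?k \<xi> \<partial>\<mu>)"
      unfolding set_lebesgue_integral_def by (intro Bochner_Integration.integral_cong) (auto simp: S indicator_def)
    ultimately show "(\<integral>\<phi>\<in>S. indicator {\<phi>. restrict \<phi> \<Lambda> \<in> A} \<phi> \<partial>\<mu>) = (\<integral>\<phi>\<in>S. ?k \<phi> \<partial>\<mu>)"
      by simp
  qed
qed

text \<open>Taking the mean of the conditional probabilities shows that the restriction of the field
  to \<Lambda> has the same distribution before and after redrawing. Functions of the field in
  \<Lambda> see nothing but this marginal.\<close>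

lemma phi_gibbs_local_dlr:
  fixes \<nu> :: "'d::finite config measure"
  assumes ph: "phi_gibbs V \<nu>" and \<Lambda>: "finite \<Lambda>"
  shows "local_dlr \<Lambda> 0 \<nu>"
  unfolding local_dlr_def
proof (intro allI impI)
  fix G :: "'d config \<Rightarrow> real" assume G: "lip_cyl G" and loc: "\<forall>\<phi> \<psi>. (\<forall>x\<in>\<Lambda>. \<phi> x = \<psi> x) \<longrightarrow> G \<phi> = G \<psi>"
  have \<nu>: "field_law \<nu>" using ph by (simp add: phi_gibbs_def)
  interpret finite_measure_subalgebra \<nu> "exterior_algebra \<Lambda>" by (rule exterior_subalgebra[OF \<nu>])
  interpret prob_space \<nu> using \<nu> by (rule prob_algebra_fieldsD)
  let ?R = "resample \<Lambda> 0 \<nu>" and ?Q = "PiM \<Lambda> (\<lambda>_. borel) :: 'd config measure"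
  interpret R: prob_space ?R using resample_prob[OF \<Lambda> \<nu>] by (rule prob_algebra_fieldsD)
  note s[measurable_cong] = prob_algebra_fieldsD(2)[OF \<nu>] prob_algebra_fieldsD(2)[OF resample_prob[OF \<Lambda> \<nu>], of 0]
  note [measurable] = restrict_measurable
  have rm: "(\<lambda>\<phi>. restrict \<phi> \<Lambda>) \<in> measurable \<nu> ?Q" "(\<lambda>\<phi>. restrict \<phi> \<Lambda>) \<in> measurable ?R ?Q" by measurable
  have "distr \<nu> ?Q (\<lambda>\<phi>. restrict \<phi> \<Lambda>) = distr ?R ?Q (\<lambda>\<phi>. restrict \<phi> \<Lambda>)"
  proof (rule measure_eqI)
    fix A assume "A \<in> sets (distr \<nu> ?Q (\<lambda>\<phi>. restrict \<phi> \<Lambda>))"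
    then have A[measurable]: "A \<in> sets ?Q" by simp
    let ?k = "\<lambda>\<xi>. measure (lattice_gibbs \<Lambda> 0 \<xi>) A"
    let ?G = "\<lambda>\<phi>. indicator UNIV (restrict \<phi> (- \<Lambda>)) * indicator A (restrict \<phi> \<Lambda>) :: real"
    have S: "{\<phi>. restrict \<phi> \<Lambda> \<in> A} \<in> sets field_algebra"
      using measurable_sets[OF restrict_measurable A] by (simp add: vimage_def space_PiM)
    then have iS: "integrable \<nu> (indicator {\<phi>. restrict \<phi> \<Lambda> \<in> A} :: _ \<Rightarrow> real)" using s by (simp add: less_top[symmetric])
    have "measure ?R {\<phi>. restrict \<phi> \<Lambda> \<in> A} = (\<integral>\<phi>. ?G \<phi> \<partial>?R)"
    proof -
      have "measure ?R {\<phi>. restrict \<phi> \<Lambda> \<in> A} = (\<integral>\<phi>. indicator {\<phi>. restrict \<phi> \<Lambda> \<in> A} \<phi> \<partial>?R)" using S s by simp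
      then show ?thesis by (simp add: indicator_def)
    qed
    also have "\<dots> = (\<integral>\<xi>. ?k \<xi> \<partial>\<nu>)"
      using gibbs_avg_resample(2)[OF \<Lambda> \<nu>, of ?G 1 0] unfolding gibbs_avg_indicator[OF \<Lambda> A] by (simp add: indicator_def)
    also have "\<dots> = (\<integral>\<xi>. real_cond_exp \<nu> (exterior_algebra \<Lambda>) (indicator {\<phi>. restrict \<phi> \<Lambda> \<in> A}) \<xi> \<partial>\<nu>)"
    proof (rule integral_cong_AE)
      show "?k \<in> borel_measurable \<nu>" using gibbs_kernel_measurable(2)[OF \<Lambda> A \<nu>] by measurable
      show "AE \<xi> in \<nu>. ?k \<xi> = real_cond_exp \<nu> (exterior_algebra \<Lambda>) (indicator {\<phi>. restrict \<phi> \<Lambda> \<in> A}) \<xi>"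
      proof -
        have "AE \<xi> in \<nu>. real_cond_exp \<nu> (exterior_algebra \<Lambda>) (indicator {\<phi>. restrict \<phi> \<Lambda> \<in> A}) \<xi> = ?k \<xi>"
          using ph \<Lambda> A unfolding phi_gibbs_def by blast
        then show ?thesis by eventually_elim simp
      qed
    qed simp
    also have "\<dots> = (\<integral>\<xi>. indicator {\<phi>. restrict \<phi> \<Lambda> \<in> A} \<xi> \<partial>\<nu>)" by (rule real_cond_exp_int(2)[OF iS])
    also have "\<dots> = measure \<nu> {\<phi>. restrict \<phi> \<Lambda> \<in> A}" using S s by simp
    finally have "measure \<nu> {\<phi>. restrict \<phi> \<Lambda> \<in> A} = measure ?R {\<phi>. restrict \<phi> \<Lambda> \<in> A}" ..
    then show "emeasure (distr \<nu> ?Q (\<lambda>\<phi>. restrict \<phi> \<Lambda>)) A = emeasure (distr ?R ?Q (\<lambda>\<phi>. restrict \<phi> \<Lambda>)) A"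
      using rm A prob_algebra_fieldsD(3)[OF \<nu>] prob_algebra_fieldsD(3)[OF resample_prob[OF \<Lambda> \<nu>]]
      by (simp add: emeasure_distr emeasure_eq_measure R.emeasure_eq_measure vimage_def)
  qed simp
  note eq = this
  define G' where "G' \<psi> = G (override_on (\<lambda>_. 0) \<psi> \<Lambda>)" for \<psi>
  have "(\<lambda>\<psi>. override_on (\<lambda>_. 0) \<psi> \<Lambda>) \<in> measurable ?Q field_algebra"
  proof (rule measurable_PiM_single')
    fix x :: "int ^ 'd"
    show "(\<lambda>\<psi>. override_on (\<lambda>_. 0) \<psi> \<Lambda> x) \<in> borel_measurable ?Q"
      by (cases "x \<in> \<Lambda>") (simp_all add: override_on_def)
  qed auto
  then have G'm: "G' \<in> borel_measurable ?Q" unfolding G'_def by (rule measurable_compose[OF _ lip_cyl_measurable[OF G]])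
  have GG': "G \<phi> = G' (restrict \<phi> \<Lambda>)" for \<phi> unfolding G'_def using loc by auto
  obtain K where K: "\<And>\<phi>. \<bar>G \<phi>\<bar> \<le> K" using lip_cylE[OF G] by metis
  have "(\<integral>\<phi>. G \<phi> \<partial>\<nu>) = (\<integral>\<psi>. G' \<psi> \<partial>distr \<nu> ?Q (\<lambda>\<phi>. restrict \<phi> \<Lambda>))"
    unfolding GG' by (rule integral_distr[OF rm(1) G'm, symmetric])
  also have "\<dots> = (\<integral>\<phi>. G \<phi> \<partial>?R)"
    unfolding eq GG' by (rule integral_distr[OF rm(2) G'm])
  also have "\<dots> = (\<integral>\<xi>. gibbs_avg \<Lambda> 0 \<xi> G \<partial>\<nu>)"
    by (rule gibbs_avg_resample(2)[OF \<Lambda> \<nu> lip_cyl_measurable[OF G] K])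
  finally show "(\<integral>\<phi>. G \<phi> \<partial>\<nu>) = (\<integral>\<xi>. gibbs_avg \<Lambda> 0 \<xi> G \<partial>\<nu>)" .
qed

end

section \<open>Uniqueness of the ergodic Gibbs measure\<close>

text \<open>The weight (3/4)^k lies between the decay (1/2)^k of the second moments and 1: dividing
  the squares by it leaves a summable series of means with ratio 2/3, and |t| \<le> (3/4)^k + t^2 /
  (3/4)^k transfers summability to the terms themselves.\<close>

lemma (in prob_space) AE_summable_of_second_moments:
  fixes t :: "nat \<Rightarrow> 'a \<Rightarrow> real"
  assumes [measurable]: "\<And>k. t k \<in> borel_measurable M"
    and i: "\<And>k. integrable M (\<lambda>x. (t k x)\<^sup>2)" and b: "\<And>k. (\<integral>x. (t k x)\<^sup>2 \<partial>M) \<le> W * (1/2) ^ k"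
  shows "AE x in M. summable (\<lambda>k. t k x)"
proof -
  let ?f = "\<lambda>k x. (t k x)\<^sup>2 / (3/4) ^ k"
  have "0 \<le> (\<integral>x. (t 0 x)\<^sup>2 \<partial>M)" by (rule integral_nonneg_AE) simp
  from order_trans[OF this b[of 0]] have W: "0 \<le> W" by simp
  have "(\<integral>\<^sup>+x. (\<Sum>k. ennreal (?f k x)) \<partial>M) = (\<Sum>k. \<integral>\<^sup>+x. ennreal (?f k x) \<partial>M)"
    by (intro nn_integral_suminf) measurable
  also have "\<dots> \<le> (\<Sum>k. ennreal (W * (2/3) ^ k))"
  proof (intro suminf_le allI)
    fix k
    have "(\<integral>\<^sup>+x. ennreal (?f k x) \<partial>M) = ennreal (\<integral>x. ?f k x \<partial>M)"
      using i[of k] by (intro nn_integral_eq_integral) auto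
    also have "(\<integral>x. ?f k x \<partial>M) = (\<integral>x. (t k x)\<^sup>2 \<partial>M) / (3/4) ^ k" by simp
    also have "\<dots> \<le> W * (1/2) ^ k / (3/4) ^ k" using b[of k] by (intro divide_right_mono) auto
    also have "\<dots> = W * (2/3) ^ k" by (simp add: power_divide field_simps flip: power_mult_distrib)
    finally show "(\<integral>\<^sup>+x. ennreal (?f k x) \<partial>M) \<le> ennreal (W * (2/3) ^ k)" by (simp add: ennreal_leI)
  qed auto
  also have "\<dots> < \<top>"
  proof -
    have "summable (\<lambda>k. W * (2/3) ^ k)" by (intro summable_mult summable_geometric) auto
    then have "(\<Sum>k. ennreal (W * (2/3) ^ k)) = ennreal (\<Sum>k. W * (2/3) ^ k)" using W by (intro suminf_ennreal2) auto
    then show ?thesis by simp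
  qed
  finally have "(\<integral>\<^sup>+x. (\<Sum>k. ennreal (?f k x)) \<partial>M) \<noteq> \<infinity>" by simp
  then have "AE x in M. (\<Sum>k. ennreal (?f k x)) \<noteq> \<infinity>"
    by (intro nn_integral_noteq_infinite) measurable
  then show ?thesis
  proof eventually_elim
    case (elim x)
    have "summable (\<lambda>k. ?f k x)" by (rule summable_suminf_not_top) (use elim in auto)
    moreover have "summable (\<lambda>k. (3/4::real) ^ k)" by (intro summable_geometric) auto
    ultimately have "summable (\<lambda>k. (3/4) ^ k + ?f k x)" by (intro summable_add)
    then show ?case
      by (rule summable_comparison_test'[where N = 0]) (use abs_le_add_square[of "(3/4) ^ _"] in simp)
  qed
qed

lemma block_avg_shift_field:
  "block_avg s (shift z \<phi>) x = block_avg s \<phi> (x + z)"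
  by (simp add: block_avg_def shift_def add.assoc add.commute add.left_commute)

context convex_potential
begin

lemma pair_lipschitz_clamp_square:
  fixes x y :: "int ^ 'd::finite"
  assumes R: "0 \<le> R"
  shows "pair_lipschitz (\<lambda>\<phi>. clamp_real R (dyadic_avg k \<phi> x - dyadic_avg l \<phi> y) * clamp_real R (dyadic_avg k \<phi> x - dyadic_avg l \<phi> y))"
proof -
  let ?l = "\<lambda>\<phi>. dyadic_avg k \<phi> x - dyadic_avg l \<phi> y"
  let ?P = "(\<lambda>w. x + w) ` block (\<lambda>_::'d. 2 ^ k) \<times> (\<lambda>v. y + v) ` block (\<lambda>_::'d. 2 ^ l)"
  have cb: "\<bar>clamp_real R t\<bar> \<le> R" for t by (rule clamp_real_bound[OF R])
  have bd: "\<bar>clamp_real R s * clamp_real R s\<bar> \<le> R * R" for s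
    unfolding abs_mult using R by (intro mult_mono cb) auto
  have "\<bar>clamp_real R (?l \<phi>) * clamp_real R (?l \<phi>) - clamp_real R (?l \<psi>) * clamp_real R (?l \<psi>)\<bar>
    \<le> (2 * R) * (\<Sum>(p, q)\<in>?P. \<bar>(\<phi> p - \<psi> p) - (\<phi> q - \<psi> q)\<bar>)" for \<phi> \<psi>
  proof -
    let ?s = "clamp_real R (?l \<phi>)" and ?t = "clamp_real R (?l \<psi>)"
    have "?s * ?s - ?t * ?t = (?s + ?t) * (?s - ?t)" by (simp add: algebra_simps)
    then have "\<bar>?s * ?s - ?t * ?t\<bar> = \<bar>?s + ?t\<bar> * \<bar>?s - ?t\<bar>" by (simp add: abs_mult)
    also have "\<dots> \<le> (2 * R) * \<bar>?l \<phi> - ?l \<psi>\<bar>"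
      using cb[of "?l \<phi>"] cb[of "?l \<psi>"] R by (intro mult_mono clamp_real_lipschitz) auto
    also have "?l \<phi> - ?l \<psi> = dyadic_avg k (\<lambda>y. \<phi> y - \<psi> y) x - dyadic_avg l (\<lambda>y. \<phi> y - \<psi> y) y"
      unfolding block_avg_diff[symmetric] by simp
    also have "2 * R * \<bar>\<dots>\<bar> \<le> (2 * R) * (\<Sum>(p, q)\<in>?P. \<bar>(\<phi> p - \<psi> p) - (\<phi> q - \<psi> q)\<bar>)"
      using R by (intro mult_left_mono block_avg_pair[OF block_nonempty block_nonempty]) auto
    finally show ?thesis .
  qed
  moreover have "finite ?P" by simp
  moreover have "0 \<le> 2 * R" using R by simp
  ultimately show ?thesis unfolding pair_lipschitz_def using bd by blast
qed

text \<open>A difference of block averages is a gradient observable, so its clamped second moment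
  under \<nu> equals the one under \<mu>, where each average is small by itself. The constant 32 is
  4 times the 8 in the bound for one average: two squares, each with a factor 2.\<close>

lemma gradient_second_moment:
  fixes \<mu> \<nu> :: "'d::finite config measure"
  assumes g: "good m \<mu>" and \<nu>: "stationary_gibbs m K \<nu>" and d: "CARD('d) \<ge> 3" and kl: "k \<le> l"
  defines "W \<equiv> 32 * (green_const TYPE('d))\<^sup>2 / c"
  shows "integrable \<nu> (\<lambda>\<phi>. (dyadic_avg k \<phi> x - dyadic_avg l \<phi> y)\<^sup>2)"
    "(\<integral>\<phi>. (dyadic_avg k \<phi> x - dyadic_avg l \<phi> y)\<^sup>2 \<partial>\<nu>) \<le> W * (1/2) ^ k"
proof -
  have \<mu>p: "field_law \<mu>" using g by (simp add: good_def)
  have \<nu>p: "field_law \<nu>" using \<nu> by (simp add: stationary_gibbs_def)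
  let ?l = "\<lambda>\<phi>. dyadic_avg k \<phi> x - dyadic_avg l \<phi> y"
  have lm: "?l \<in> borel_measurable field_algebra" using measurable_block_avg by measurable
  note lm\<nu> = measurable_field_law[OF \<nu>p lm]
  note i = good_dyadic_avg(1)[OF g d] and b = good_dyadic_avg(2)[OF g d]
  have sq: "(?l \<phi>)\<^sup>2 \<le> 2 * (dyadic_avg k \<phi> x)\<^sup>2 + 2 * (dyadic_avg l \<phi> y)\<^sup>2" for \<phi>
  proof -
    have "0 \<le> (dyadic_avg k \<phi> x + dyadic_avg l \<phi> y)\<^sup>2" by simp
    then show ?thesis unfolding power2_diff power2_sum by linarith
  qed
  have i2: "integrable \<mu> (\<lambda>\<phi>. 2 * (dyadic_avg k \<phi> x)\<^sup>2 + 2 * (dyadic_avg l \<phi> y)\<^sup>2)" using i by simp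
  have "(1/2::real) ^ l \<le> (1/2) ^ k" using kl by (intro power_decreasing) auto
  then have bl: "8 * (green_const TYPE('d))\<^sup>2 / c * (1/2) ^ l \<le> 8 * (green_const TYPE('d))\<^sup>2 / c * (1/2) ^ k"
    using c_pos by (intro mult_left_mono) auto
  have "(\<integral>\<phi>. 2 * (dyadic_avg k \<phi> x)\<^sup>2 + 2 * (dyadic_avg l \<phi> y)\<^sup>2 \<partial>\<mu>)
    = 2 * (\<integral>\<phi>. (dyadic_avg k \<phi> x)\<^sup>2 \<partial>\<mu>) + 2 * (\<integral>\<phi>. (dyadic_avg l \<phi> y)\<^sup>2 \<partial>\<mu>)" using i by simp
  also have "\<dots> \<le> 4 * (8 * (green_const TYPE('d))\<^sup>2 / c * (1/2) ^ k)" using b[of k x] b[of l y] bl by linarith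
  also have "\<dots> = W * (1/2) ^ k" by (simp add: W_def)
  finally have Wb: "(\<integral>\<phi>. 2 * (dyadic_avg k \<phi> x)\<^sup>2 + 2 * (dyadic_avg l \<phi> y)\<^sup>2 \<partial>\<mu>) \<le> W * (1/2) ^ k" .
  have cl: "(\<integral>\<phi>. clamp_real R (?l \<phi>) * clamp_real R (?l \<phi>) \<partial>\<nu>) \<le> W * (1/2) ^ k" if R: "0 \<le> R" for R
  proof -
    note pl = pair_lipschitz_clamp_square[OF R, of k x l y]
    have "(\<integral>\<phi>. clamp_real R (?l \<phi>) * clamp_real R (?l \<phi>) \<partial>\<nu>) = (\<integral>\<phi>. clamp_real R (?l \<phi>) * clamp_real R (?l \<phi>) \<partial>\<mu>)"
      by (rule gradient_mean_unique[OF pl \<nu> good_stationary_gibbs(1)[OF g d]])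
    also have "\<dots> \<le> (\<integral>\<phi>. 2 * (dyadic_avg k \<phi> x)\<^sup>2 + 2 * (dyadic_avg l \<phi> y)\<^sup>2 \<partial>\<mu>)"
    proof (rule integral_mono[OF lip_cyl_integrable[OF pair_lipschitz_lip_cyl[OF pl] \<mu>p] i2])
      fix \<phi>
      have "(clamp_real R (?l \<phi>))\<^sup>2 \<le> (?l \<phi>)\<^sup>2" using clamp_real_abs_le[OF R] by (rule abs_le_square_iff[THEN iffD1])
      then show "clamp_real R (?l \<phi>) * clamp_real R (?l \<phi>) \<le> 2 * (dyadic_avg k \<phi> x)\<^sup>2 + 2 * (dyadic_avg l \<phi> y)\<^sup>2"
        using sq[of \<phi>] by (simp add: power2_eq_square)
    qed
    also note Wb
    finally show ?thesis .
  qed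
  show "integrable \<nu> (\<lambda>\<phi>. (?l \<phi>)\<^sup>2)" "(\<integral>\<phi>. (?l \<phi>)\<^sup>2 \<partial>\<nu>) \<le> W * (1/2) ^ k"
    using second_moment_from_clamped[OF prob_algebra_fieldsD(1)[OF \<nu>p] lm\<nu> cl] by auto
qed

text \<open>Under \<nu> only differences of block averages are controlled, so a limit X exists but
  gradients say nothing about its value. Moreover X is shift invariant only almost surely, whereas
  ergodicity concerns events that are exactly invariant; this dictates the choice of the event
  \<open>S\<close>.\<close>

lemma ergodic_vanishing_mean:
  fixes \<mu> \<nu> :: "'d::finite config measure"
  assumes g: "good 0 \<mu>" and \<nu>: "stationary_gibbs 0 K \<nu>" and d: "CARD('d) \<ge> 3"
    and erg: "shift_ergodic \<nu>" and mean: "(\<integral>\<phi>. \<phi> 0 \<partial>\<nu>) = 0"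
  shows "vanishing_mean \<nu>"
proof -
  have \<nu>p: "field_law \<nu>" and sh: "shift_invariant \<nu>" using \<nu> by (auto simp: stationary_gibbs_def)
  interpret prob_space \<nu> using \<nu>p by (rule prob_algebra_fieldsD)
  note s[measurable_cong] = prob_algebra_fieldsD(2)[OF \<nu>p]
  define W where "W = 32 * (green_const TYPE('d))\<^sup>2 / c"
  define A where "A k x \<phi> = dyadic_avg k \<phi> x" for k and x :: "int ^ 'd" and \<phi>
  have Af[measurable]: "A k x \<in> borel_measurable field_algebra" for k x unfolding A_def by (rule measurable_block_avg)
  have i2: "integrable \<nu> (\<lambda>\<phi>. (A k x \<phi> - A l y \<phi>)\<^sup>2)" and b2: "(\<integral>\<phi>. (A k x \<phi> - A l y \<phi>)\<^sup>2 \<partial>\<nu>) \<le> W * (1/2) ^ k"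
    if "k \<le> l" for k l x y
    unfolding A_def W_def by (rule gradient_second_moment[OF g \<nu> d that])+
  obtain i :: 'd where True by simp
  define z :: "int ^ 'd" where "z = axis i 1"
  have z: "z \<noteq> 0" by (simp add: z_def axis_eq_0_iff)
  define X where "X \<phi> = lim (\<lambda>k. A k 0 \<phi>)" for \<phi>
  have Xm[measurable]: "X \<in> borel_measurable field_algebra" unfolding X_def by measurable
  have conv: "AE \<phi> in \<nu>. (\<lambda>k. A k 0 \<phi>) \<longlonglongrightarrow> X \<phi>"
  proof -
    have "AE \<phi> in \<nu>. summable (\<lambda>k. A k 0 \<phi> - A (Suc k) 0 \<phi>)"
    proof (rule AE_summable_of_second_moments[where W = W])
      show "(\<lambda>\<phi>. A k 0 \<phi> - A (Suc k) 0 \<phi>) \<in> borel_measurable \<nu>" for k by measurable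
    qed (rule i2 b2, simp)+
    then show ?thesis
    proof eventually_elim
      case (elim \<phi>)
      have "(\<lambda>n. \<Sum>k<n. A k 0 \<phi> - A (Suc k) 0 \<phi>) \<longlonglongrightarrow> (\<Sum>k. A k 0 \<phi> - A (Suc k) 0 \<phi>)" using elim by (rule summable_LIMSEQ)
      then have "(\<lambda>n. A 0 0 \<phi> - A n 0 \<phi>) \<longlonglongrightarrow> (\<Sum>k. A k 0 \<phi> - A (Suc k) 0 \<phi>)"
        by (simp only: sum_lessThan_telescope'[of "\<lambda>k. A k 0 \<phi>"])
      then have "(\<lambda>n. A 0 0 \<phi> - (A 0 0 \<phi> - A n 0 \<phi>)) \<longlonglongrightarrow> A 0 0 \<phi> - (\<Sum>k. A k 0 \<phi> - A (Suc k) 0 \<phi>)"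
        by (intro tendsto_intros)
      then have "convergent (\<lambda>n. A n 0 \<phi>)" by (auto simp: convergent_def)
      then show ?case unfolding X_def by (simp add: convergent_LIMSEQ_iff)
    qed
  qed
  have conv': "AE \<phi> in \<nu>. \<forall>j::int. (\<lambda>k. A k (j *s z) \<phi>) \<longlonglongrightarrow> X \<phi>"
    unfolding AE_all_countable
  proof
    fix j :: int
    have "AE \<phi> in \<nu>. summable (\<lambda>k. A k (j *s z) \<phi> - A k 0 \<phi>)"
    proof (rule AE_summable_of_second_moments[where W = W])
      show "(\<lambda>\<phi>. A k (j *s z) \<phi> - A k 0 \<phi>) \<in> borel_measurable \<nu>" for k by measurable
    qed (rule i2 b2, simp)+
    with conv show "AE \<phi> in \<nu>. (\<lambda>k. A k (j *s z) \<phi>) \<longlonglongrightarrow> X \<phi>"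
    proof eventually_elim
      case (elim \<phi>)
      have "(\<lambda>k. (A k (j *s z) \<phi> - A k 0 \<phi>) + A k 0 \<phi>) \<longlonglongrightarrow> 0 + X \<phi>"
        by (intro tendsto_intros summable_LIMSEQ_zero elim)
      then show ?case by simp
    qed
  qed
  \<comment> \<open>Letting the larger scale tend to infinity in the bound on differences gives the
    same rate for the distance to the limit.\<close>
  have fatou: "integrable \<nu> (\<lambda>\<phi>. (A k 0 \<phi> - X \<phi>)\<^sup>2)" "(\<integral>\<phi>. (A k 0 \<phi> - X \<phi>)\<^sup>2 \<partial>\<nu>) \<le> W * (1/2) ^ k" for k
  proof -
    have W: "0 \<le> W * (1/2) ^ k" using c_pos by (simp add: W_def)
    have "(\<integral>\<^sup>+\<phi>. ennreal ((A k 0 \<phi> - X \<phi>)\<^sup>2) \<partial>\<nu>) = (\<integral>\<^sup>+\<phi>. liminf (\<lambda>l. ennreal ((A k 0 \<phi> - A l 0 \<phi>)\<^sup>2)) \<partial>\<nu>)"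
    proof (rule nn_integral_cong_AE)
      show "AE \<phi> in \<nu>. ennreal ((A k 0 \<phi> - X \<phi>)\<^sup>2) = liminf (\<lambda>l. ennreal ((A k 0 \<phi> - A l 0 \<phi>)\<^sup>2))"
        using conv
      proof eventually_elim
        case (elim \<phi>)
        have "(\<lambda>l. ennreal ((A k 0 \<phi> - A l 0 \<phi>)\<^sup>2)) \<longlonglongrightarrow> ennreal ((A k 0 \<phi> - X \<phi>)\<^sup>2)"
          by (intro tendsto_ennrealI tendsto_intros elim)
        from lim_imp_Liminf[OF sequentially_bot this] show ?case by simp
      qed
    qed
    also have "\<dots> \<le> liminf (\<lambda>l. \<integral>\<^sup>+\<phi>. ennreal ((A k 0 \<phi> - A l 0 \<phi>)\<^sup>2) \<partial>\<nu>)" by (intro nn_integral_liminf) measurable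
    also have "\<dots> \<le> ennreal (W * (1/2) ^ k)"
    proof (rule Liminf_le)
      show "\<forall>\<^sub>F l in sequentially. (\<integral>\<^sup>+\<phi>. ennreal ((A k 0 \<phi> - A l 0 \<phi>)\<^sup>2) \<partial>\<nu>) \<le> ennreal (W * (1/2) ^ k)"
      proof (rule eventually_sequentiallyI)
        fix l assume l: "k \<le> l"
        have "(\<integral>\<^sup>+\<phi>. ennreal ((A k 0 \<phi> - A l 0 \<phi>)\<^sup>2) \<partial>\<nu>) = ennreal (\<integral>\<phi>. (A k 0 \<phi> - A l 0 \<phi>)\<^sup>2 \<partial>\<nu>)"
          using i2[OF l] by (intro nn_integral_eq_integral) auto
        then show "(\<integral>\<^sup>+\<phi>. ennreal ((A k 0 \<phi> - A l 0 \<phi>)\<^sup>2) \<partial>\<nu>) \<le> ennreal (W * (1/2) ^ k)"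
          using b2[OF l] by (simp add: ennreal_leI)
      qed
    qed simp
    finally have *: "(\<integral>\<^sup>+\<phi>. ennreal ((A k 0 \<phi> - X \<phi>)\<^sup>2) \<partial>\<nu>) \<le> ennreal (W * (1/2) ^ k)" .
    show i: "integrable \<nu> (\<lambda>\<phi>. (A k 0 \<phi> - X \<phi>)\<^sup>2)"
      using * by (intro integrableI_nonneg) (auto intro: le_less_trans)
    show "(\<integral>\<phi>. (A k 0 \<phi> - X \<phi>)\<^sup>2 \<partial>\<nu>) \<le> W * (1/2) ^ k"
      using * W by (subst (asm) nn_integral_eq_integral[OF i]) (auto simp: ennreal_le_iff)
  qed
  have site: "integrable \<nu> (\<lambda>\<phi>. \<phi> x)" "(\<integral>\<phi>. \<phi> x \<partial>\<nu>) = 0" for x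
  proof -
    have "integrable \<nu> (\<lambda>\<phi>. (\<phi> x)\<^sup>2)" using \<nu> by (auto simp: stationary_gibbs_def)
    then show "integrable \<nu> (\<lambda>\<phi>. \<phi> x)" by (rule abs_expectation_le(1)[rotated, of _ 1]) auto
    have "(\<integral>\<phi>. (shift x \<phi>) 0 \<partial>\<nu>) = (\<integral>\<phi>. \<phi> 0 \<partial>\<nu>)"
      by (rule shift_invariant_integral[OF \<nu>p sh]) simp
    then show "(\<integral>\<phi>. \<phi> x \<partial>\<nu>) = 0" by (simp add: shift_def mean)
  qed
  have iA: "integrable \<nu> (A k 0)" and EA: "(\<integral>\<phi>. A k 0 \<phi> \<partial>\<nu>) = 0" for k
    unfolding A_def[abs_def] block_avg_def using site by (auto simp: Bochner_Integration.integral_sum)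
  have iAX: "integrable \<nu> (\<lambda>\<phi>. A k 0 \<phi> - X \<phi>)" for k
    by (rule abs_expectation_le(1)[of "\<lambda>\<phi>. A k 0 \<phi> - X \<phi>" 1]) (use fatou(1) in simp_all)
  have iX: "integrable \<nu> X"
    using Bochner_Integration.integrable_diff[OF iA[of 0] iAX[of 0]] by simp
  have EX: "(\<integral>\<phi>. X \<phi> \<partial>\<nu>) = 0"
  proof -
    have "\<bar>\<integral>\<phi>. X \<phi> \<partial>\<nu>\<bar> \<le> 0 + e" if e: "0 < e" for e
    proof -
      have bound: "\<bar>\<integral>\<phi>. X \<phi> \<partial>\<nu>\<bar> \<le> e + W * (1/2) ^ k / e" for k
      proof -
        have "(\<integral>\<phi>. X \<phi> \<partial>\<nu>) = - (\<integral>\<phi>. A k 0 \<phi> - X \<phi> \<partial>\<nu>)" using iA[of k] iX EA[of k] by simp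
        then have "\<bar>\<integral>\<phi>. X \<phi> \<partial>\<nu>\<bar> \<le> (\<integral>\<phi>. \<bar>A k 0 \<phi> - X \<phi>\<bar> \<partial>\<nu>)" by (simp add: integral_abs_bound)
        also have "\<dots> \<le> e + (\<integral>\<phi>. (A k 0 \<phi> - X \<phi>)\<^sup>2 \<partial>\<nu>) / e" by (rule abs_expectation_le(2)) (use fatou(1) e in simp_all)
        also have "\<dots> \<le> e + W * (1/2) ^ k / e" using fatou(2)[of k] e by (intro add_left_mono divide_right_mono) auto
        finally show ?thesis .
      qed
      have "(\<lambda>k. e + W * (1/2) ^ k / e) \<longlonglongrightarrow> e + W * 0 / e" using e by (intro tendsto_intros LIMSEQ_power_zero) auto
      from LIMSEQ_le_const[OF this] bound show ?thesis by auto
    qed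
    then have "\<bar>\<integral>\<phi>. X \<phi> \<partial>\<nu>\<bar> \<le> 0" by (rule field_le_epsilon)
    then show ?thesis by simp
  qed
  have small: "AE \<phi> in \<nu>. X \<phi> \<le> a" if a: "0 < a" for a
  proof -
    \<comment> \<open>Quantifying over all integer multiples of z makes the event exactly invariant,
      and the upper limit in the extended reals exists for every configuration. Up to a null set the
      event is a < X.\<close>
    define S where "S = {\<phi>. \<forall>j::int. ereal a < limsup (\<lambda>k. ereal (A k (j *s z) \<phi>))}"
    have "{\<phi> \<in> space field_algebra. \<forall>j::int. ereal a < limsup (\<lambda>k. ereal (A k (j *s z) \<phi>))} \<in> sets field_algebra"
      by measurable
    then have Sm: "S \<in> sets field_algebra" by (simp add: S_def space_PiM)
    have inv1: "shift z \<phi> \<in> S \<longleftrightarrow> \<phi> \<in> S" for \<phi>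
    proof -
      have e: "A k (j *s z) (shift z \<phi>) = A k ((j + 1) *s z) \<phi>" for k j
      proof -
        have "(j + 1) *s z = j *s z + z" by (simp add: vec_eq_iff algebra_simps)
        then show ?thesis by (simp add: A_def block_avg_shift_field)
      qed
      have "(\<forall>j::int. ereal a < limsup (\<lambda>k. ereal (A k ((j + 1) *s z) \<phi>))) \<longleftrightarrow> (\<forall>j::int. ereal a < limsup (\<lambda>k. ereal (A k (j *s z) \<phi>)))"
        by (metis diff_add_cancel)
      then show ?thesis by (simp add: S_def e)
    qed
    have "shift z ` S = S"
    proof (intro equalityI subsetI)
      fix \<phi> assume "\<phi> \<in> S"
      moreover have e: "shift z (shift (- z) \<phi>) = \<phi>" by (simp add: shift_shift shift_0)
      ultimately have "shift (- z) \<phi> \<in> S" using inv1[of "shift (- z) \<phi>"] by simp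
      then show "\<phi> \<in> shift z ` S" using e by (metis imageI)
    qed (use inv1 in auto)
    then have "measure \<nu> S \<in> {0, 1}" using erg z Sm unfolding shift_ergodic_def by blast
    have SX: "AE \<phi> in \<nu>. \<phi> \<in> S \<longleftrightarrow> a < X \<phi>"
      using conv'
    proof eventually_elim
      case (elim \<phi>)
      have "limsup (\<lambda>k. ereal (A k (j *s z) \<phi>)) = ereal (X \<phi>)" for j :: int
        using elim by (intro lim_imp_Limsup tendsto_ereal) auto
      then show ?case by (simp add: S_def)
    qed
    have "measure \<nu> S \<noteq> 1"
    proof
      assume "measure \<nu> S = 1"
      then have "AE \<phi> in \<nu>. \<phi> \<in> S" using Sm s by (intro AE_prob_1) auto
      with SX have "AE \<phi> in \<nu>. a \<le> X \<phi>" by eventually_elim auto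
      then have "(\<integral>\<phi>. a \<partial>\<nu>) \<le> (\<integral>\<phi>. X \<phi> \<partial>\<nu>)" using iX by (intro integral_mono_AE) auto
      then show False using a EX by (simp add: prob_space)
    qed
    then have "measure \<nu> S = 0" using \<open>measure \<nu> S \<in> {0, 1}\<close> by simp
    then have "AE \<phi> in \<nu>. \<phi> \<notin> S" using Sm s by (intro AE_not_in) (auto simp: null_sets_def emeasure_eq_measure)
    with SX show ?thesis by eventually_elim auto
  qed
  have "AE \<phi> in \<nu>. \<forall>n::nat. X \<phi> \<le> 1 / real (Suc n)"
    unfolding AE_all_countable using small by auto
  then have "AE \<phi> in \<nu>. 0 \<le> - X \<phi>"
  proof eventually_elim
    case (elim \<phi>)
    have "X \<phi> \<le> 0"
      by (rule LIMSEQ_le_const[OF LIMSEQ_Suc[OF lim_1_over_n]]) (use elim in auto)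
    then show ?case by simp
  qed
  \<comment> \<open>X is almost surely nonpositive with mean 0, hence 0; the bound from above alone
    settles both signs.\<close>
  then have X0: "AE \<phi> in \<nu>. X \<phi> = 0"
    using integral_nonneg_eq_0_iff_AE[of \<nu> "\<lambda>\<phi>. - X \<phi>"] iX EX by auto
  have "integrable \<nu> (\<lambda>\<phi>. (A k 0 \<phi>)\<^sup>2) \<and> (\<integral>\<phi>. (A k 0 \<phi>)\<^sup>2 \<partial>\<nu>) \<le> W * (1/2) ^ k" for k
  proof -
    have ae: "AE \<phi> in \<nu>. (A k 0 \<phi>)\<^sup>2 = (A k 0 \<phi> - X \<phi>)\<^sup>2" using X0 by eventually_elim simp
    have "integrable \<nu> (\<lambda>\<phi>. (A k 0 \<phi>)\<^sup>2) \<longleftrightarrow> integrable \<nu> (\<lambda>\<phi>. (A k 0 \<phi> - X \<phi>)\<^sup>2)"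
      using ae by (intro integrable_cong_AE) auto
    moreover have "(\<integral>\<phi>. (A k 0 \<phi>)\<^sup>2 \<partial>\<nu>) = (\<integral>\<phi>. (A k 0 \<phi> - X \<phi>)\<^sup>2 \<partial>\<nu>)"
      using ae by (intro integral_cong_AE) auto
    ultimately show ?thesis using fatou[of k] by simp
  qed
  then show ?thesis by (intro vanishing_meanI[where W = W]) (simp_all add: A_def)
qed

theorem ergodic_centred_gibbs_unique:
  fixes \<mu> \<nu> :: "'d::finite config measure"
  assumes g: "good 0 \<mu>" and e: "ergodic_centred_gibbs V \<nu>" and d: "CARD('d) \<ge> 3"
  shows "\<nu> = \<mu>"
proof -
  have ph: "phi_gibbs V \<nu>" and sh: "shift_invariant \<nu>" and er: "shift_ergodic \<nu>"
    and i0: "integrable \<nu> (\<lambda>\<phi>. (\<phi> 0)\<^sup>2)" and m0: "(\<integral>\<phi>. \<phi> 0 \<partial>\<nu>) = 0"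
    using e by (auto simp: ergodic_centred_gibbs_def)
  have \<nu>p: "field_law \<nu>" using ph by (simp add: phi_gibbs_def)
  have "stationary_gibbs 0 (\<integral>\<phi>. (\<phi> 0)\<^sup>2 \<partial>\<nu>) \<nu>"
    unfolding stationary_gibbs_def
  proof (intro conjI allI impI \<nu>p sh phi_gibbs_local_dlr[OF ph])
    fix x :: "int ^ 'd"
    note T = measurable_field_law[OF \<nu>p measurable_shift]
    have "integrable (distr \<nu> field_algebra (shift x)) (\<lambda>\<phi>. (\<phi> 0)\<^sup>2)" using sh i0 by (simp add: shift_invariant_def)
    then have "integrable \<nu> (\<lambda>\<phi>. ((shift x \<phi>) 0)\<^sup>2)" by (subst (asm) integrable_distr_eq[OF T]) auto
    then show "integrable \<nu> (\<lambda>\<phi>. (\<phi> x)\<^sup>2)" by (simp add: shift_def)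
    have "(\<integral>\<phi>. ((shift x \<phi>) 0)\<^sup>2 \<partial>\<nu>) = (\<integral>\<phi>. (\<phi> 0)\<^sup>2 \<partial>\<nu>)"
      by (rule shift_invariant_integral[OF \<nu>p sh]) measurable
    then show "(\<integral>\<phi>. (\<phi> x)\<^sup>2 \<partial>\<nu>) \<le> (\<integral>\<phi>. (\<phi> 0)\<^sup>2 \<partial>\<nu>)" by (simp add: shift_def)
  qed
  note sg = this
  show ?thesis
    by (rule stationary_gibbs_unique[OF sg ergodic_vanishing_mean[OF g sg d er m0] good_stationary_gibbs[OF g d]])
qed

theorem good_ergodic_centred_gibbs:
  fixes \<mu> :: "'d::finite config measure"
  assumes g: "good 0 \<mu>" and d: "CARD('d) \<ge> 3"
  shows "ergodic_centred_gibbs V \<mu>"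
  unfolding ergodic_centred_gibbs_def
  using g good_phi_gibbs[OF g] good_shift_ergodic[OF g d] good_site[OF g d] by (simp add: good_def)

end

section \<open>The torus measures and their limits\<close>

lemma finite_torus_sites[simp]: "finite (torus_sites n :: (int ^ 'd::finite) set)"
proof (rule finite_subset[OF _ finite_cube[of n]], rule subsetI)
  fix x :: "int ^ 'd" assume "x \<in> torus_sites n"
  then have "- int n < 2 * x $ i \<and> 2 * x $ i \<le> int n" for i by (simp add: torus_sites_def)
  then have "\<bar>x $ i\<bar> \<le> int n" for i by (smt (verit))
  then show "x \<in> cube n" by (simp add: cube_def)
qed

lemma finite_torus_edges[simp]: "finite (torus_edges n :: ((int ^ 'd::finite) \<times> (int ^ 'd)) set)"
  by (rule finite_subset[of _ "torus_sites n \<times> torus_sites n"]) (auto simp: torus_edges_def)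

lemma torus_sites_exhaust:
  fixes X :: "(int ^ 'd::finite) set"
  assumes "finite X"
  shows "\<forall>\<^sub>F n in sequentially. X \<subseteq> torus_sites n"
proof -
  obtain r where r: "X \<subseteq> cube r" by (rule finite_subset_cube[OF assms])
  have "X \<subseteq> torus_sites n" if n: "2 * r + 1 \<le> n" for n
  proof
    fix x assume "x \<in> X"
    then have x: "\<bar>x $ i\<bar> \<le> int r" for i using r by (auto simp: cube_def)
    have "2 * int r + 1 \<le> int n" using n by linarith
    then have "- int n < 2 * x $ i \<and> 2 * x $ i \<le> int n" for i using x[of i] by linarith
    then show "x \<in> torus_sites n" by (simp add: torus_sites_def)
  qed
  then show ?thesis by (auto simp: eventually_sequentially)
qed

lemma torus_sites_cong_eq:
  assumes "x \<in> torus_sites n" "y \<in> torus_sites n" "\<And>i. [x $ i = y $ i] (mod int n)"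
  shows "x = y"
proof -
  have "x $ i = y $ i" for i
  proof -
    have "int n dvd (x $ i - y $ i)" using assms(3)[of i] by (simp add: cong_iff_dvd_diff)
    moreover have "\<bar>x $ i - y $ i\<bar> < int n"
      using assms(1)[unfolded torus_sites_def, simplified, THEN spec, of i] assms(2)[unfolded torus_sites_def, simplified, THEN spec, of i]
      by linarith
    ultimately show ?thesis using zdvd_imp_le[of "int n" "\<bar>x $ i - y $ i\<bar>"] by fastforce
  qed
  then show ?thesis by (simp add: vec_eq_iff)
qed

lemma torus_edges_sym: "(x, y) \<in> torus_edges n \<Longrightarrow> (y, x) \<in> torus_edges n"
proof -
  assume "(x, y) \<in> torus_edges n"
  then obtain z where z: "x \<in> torus_sites n" "y \<in> torus_sites n" "nearest_neighbour x z" "\<And>i. [z $ i = y $ i] (mod int n)"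
    by (auto simp: torus_edges_def)
  have "nearest_neighbour y (x + (y - z))"
    using z(3) nearest_neighbour_add[of x "y - z" z] nearest_neighbour_sym by (metis diff_add_cancel add.commute)
  moreover have "[(x + (y - z)) $ i = x $ i] (mod int n)" for i
    using z(4)[of i] by (simp add: cong_iff_dvd_diff dvd_diff_commute)
  ultimately show ?thesis using z by (auto simp: torus_edges_def)
qed

text \<open>Distinct sites of the box are distinct modulo n. When the closure of \<Lambda> fits into
  the box, every lattice neighbour of \<Lambda> represents itself, so an edge touching \<Lambda>
  does not wrap around.\<close>

lemma torus_edges_touching:
  assumes "lattice_closure \<Lambda> \<subseteq> torus_sites n" "(x, y) \<in> torus_edges n" "x \<in> \<Lambda> \<or> y \<in> \<Lambda>"
  shows "nearest_neighbour x y"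
proof -
  have *: "nearest_neighbour x y" if xy: "(x, y) \<in> torus_edges n" "x \<in> \<Lambda>" for x y
  proof -
    obtain z where z: "y \<in> torus_sites n" "nearest_neighbour x z" "\<And>i. [z $ i = y $ i] (mod int n)"
      using xy by (auto simp: torus_edges_def)
    have "z \<in> torus_sites n" using assms(1) xy z(2) nearest_neighbour_sym[of x z] by (auto simp: lattice_closure_def)
    then show ?thesis using torus_sites_cong_eq[OF _ z(1,3)] z(2) by simp
  qed
  show ?thesis using assms(3) *[of x y] *[of y x] assms(2) torus_edges_sym[OF assms(2)] nearest_neighbour_sym[of x y] by blast
qed

lemma nearest_neighbour_torus_edge:
  "nearest_neighbour x y \<Longrightarrow> x \<in> torus_sites n \<Longrightarrow> y \<in> torus_sites n \<Longrightarrow> (x, y) \<in> torus_edges n"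
  by (auto simp: torus_edges_def intro!: exI[of _ y])

text \<open>For n > 0 the offset (n - 1) div 2 is minus the least coordinate in the box, for both
  parities of n.\<close>

definition torus_wrap :: "nat \<Rightarrow> int ^ 'd \<Rightarrow> int ^ 'd" where
  "torus_wrap n x = (\<chi> i. (x $ i + (int n - 1) div 2) mod int n - (int n - 1) div 2)"

lemma torus_wrap:
  assumes "0 < n"
  shows "torus_wrap n x \<in> torus_sites n" "[torus_wrap n x $ i = x $ i] (mod int n)"
proof -
  let ?h = "(int n - 1) div 2"
  have "- int n < 2 * ((x $ i + ?h) mod int n - ?h) \<and> 2 * ((x $ i + ?h) mod int n - ?h) \<le> int n" for i
  proof -
    have "0 \<le> (x $ i + ?h) mod int n" "(x $ i + ?h) mod int n < int n" using assms by auto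
    moreover have "2 * ?h = int n - 1 \<or> 2 * ?h = int n - 2" by linarith
    moreover have "0 \<le> a \<Longrightarrow> a < N \<Longrightarrow> 2 * h = N - 1 \<or> 2 * h = N - 2 \<Longrightarrow> - N < 2 * (a - h) \<and> 2 * (a - h) \<le> N"
      for a h N :: int by arith
    ultimately show ?thesis by blast
  qed
  then show "torus_wrap n x \<in> torus_sites n" by (simp add: torus_sites_def torus_wrap_def)
  have "[(x $ i + ?h) mod int n - ?h = x $ i + ?h - ?h] (mod int n)"
    by (intro cong_diff) (auto simp: cong_def)
  then show "[torus_wrap n x $ i = x $ i] (mod int n)" by (simp add: torus_wrap_def)
qed

lemma torus_wrap_id: "0 < n \<Longrightarrow> x \<in> torus_sites n \<Longrightarrow> torus_wrap n x = x"
  using torus_wrap by (intro torus_sites_cong_eq)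

lemma torus_translation:
  fixes z :: "int ^ 'd::finite"
  assumes n: "0 < n"
  defines "\<sigma> \<equiv> \<lambda>x :: int ^ 'd. torus_wrap n (x + z)"
  shows "bij_betw \<sigma> (torus_sites n) (torus_sites n)" "bij_betw (\<lambda>(x, y). (\<sigma> x, \<sigma> y)) (torus_edges n) (torus_edges n)"
proof -
  have m: "[\<sigma> x $ i = x $ i + z $ i] (mod int n)" for x i
    using torus_wrap(2)[OF n, of "x + z" i] by (simp add: \<sigma>_def)
  have T: "\<sigma> x \<in> torus_sites n" for x unfolding \<sigma>_def by (rule torus_wrap(1)[OF n])
  have inj: "inj_on \<sigma> (torus_sites n)"
  proof (rule inj_onI)
    fix x y assume *: "x \<in> torus_sites n" "y \<in> torus_sites n" "\<sigma> x = \<sigma> y"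
    show "x = y"
    proof (rule torus_sites_cong_eq[OF *(1,2)])
      fix i
      have "[x $ i + z $ i = y $ i + z $ i] (mod int n)"
        using m[of x i] m[of y i] *(3) by (metis cong_sym cong_trans)
      then show "[x $ i = y $ i] (mod int n)" by (simp add: cong_add_rcancel)
    qed
  qed
  show "bij_betw \<sigma> (torus_sites n) (torus_sites n)"
    unfolding bij_betw_def using endo_inj_surj[OF finite_torus_sites image_subsetI inj] inj T by simp
  have E: "(\<lambda>(x, y). (\<sigma> x, \<sigma> y)) ` torus_edges n \<subseteq> torus_edges n"
  proof safe
    fix x y :: "int ^ 'd" assume "(x, y) \<in> torus_edges n"
    then obtain w where w: "nearest_neighbour x w" "\<And>i. [w $ i = y $ i] (mod int n)" by (auto simp: torus_edges_def)
    have "nearest_neighbour (\<sigma> x) (w + (\<sigma> x - x))"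
      using w(1) nearest_neighbour_add[of x "\<sigma> x - x" w] by simp
    moreover have "[(w + (\<sigma> x - x)) $ i = \<sigma> y $ i] (mod int n)" for i
    proof -
      have "[w $ i + (\<sigma> x $ i - x $ i) = y $ i + ((x $ i + z $ i) - x $ i)] (mod int n)"
        by (intro cong_add cong_diff w m cong_refl)
      also have "y $ i + ((x $ i + z $ i) - x $ i) = y $ i + z $ i" by simp
      finally show ?thesis using cong_trans[OF _ cong_sym[OF m[of y i]]] by simp
    qed
    ultimately show "(\<sigma> x, \<sigma> y) \<in> torus_edges n" using T by (auto simp: torus_edges_def)
  qed
  have "inj_on (\<lambda>(x, y). (\<sigma> x, \<sigma> y)) (torus_edges n)"
    using inj by (auto simp: inj_on_def torus_edges_def)
  then show "bij_betw (\<lambda>(x, y). (\<sigma> x, \<sigma> y)) (torus_edges n) (torus_edges n)"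
    unfolding bij_betw_def using endo_inj_surj[OF finite_torus_edges E] by blast
qed

text \<open>One change of variables serves both symmetries of the torus: translations permute the
  coordinates, the reflection changes their signs.\<close>

lemma distr_PiM_lborel_reindex:
  fixes h :: "real \<Rightarrow> real"
  assumes I: "finite I" and \<sigma>: "bij_betw \<sigma> I I" and h[measurable]: "h \<in> borel_measurable borel" and hd: "distr lborel borel h = lborel"
  shows "distr (flat I) (flat I) (\<lambda>\<phi>. \<lambda>x\<in>I. h (\<phi> (\<sigma> x))) = flat I"
proof -
  interpret product_sigma_finite "\<lambda>_::'a. lborel :: real measure" by standard
  let ?P = "flat I"
  let ?S = "\<lambda>\<phi>. \<lambda>x\<in>I. h (\<phi> (\<sigma> x))"
  have \<sigma>I: "\<sigma> x \<in> I" if "x \<in> I" for x using \<sigma> that by (auto simp: bij_betw_def)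
  have S: "?S \<in> measurable ?P ?P"
  proof (rule measurable_restrict)
    fix x assume "x \<in> I"
    then have "(\<lambda>\<phi>. \<phi> (\<sigma> x)) \<in> borel_measurable ?P" using \<sigma>I[of x] by measurable
    from measurable_compose[OF this h] show "(\<lambda>\<phi>. h (\<phi> (\<sigma> x))) \<in> measurable ?P lborel" by simp
  qed
  show ?thesis
  proof (rule PiM_eqI[OF I])
    fix A :: "'a \<Rightarrow> real set" assume A: "\<And>i. i \<in> I \<Longrightarrow> A i \<in> sets lborel"
    define \<tau> where "\<tau> = inv_into I \<sigma>"
    have \<tau>: "\<tau> y \<in> I" "\<sigma> (\<tau> y) = y" if "y \<in> I" for y
      using \<sigma> that by (auto simp: \<tau>_def bij_betw_def inv_into_into f_inv_into_f)
    have \<tau>\<sigma>: "\<tau> (\<sigma> x) = x" if "x \<in> I" for x using \<sigma> that by (simp add: \<tau>_def bij_betw_def)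
    have hA: "h -` A i \<in> sets lborel" if "i \<in> I" for i
      using measurable_sets[OF h, of "A i"] A[OF that] by simp
    have eA: "emeasure lborel (h -` A i) = emeasure lborel (A i)" if "i \<in> I" for i
      using emeasure_distr[of h lborel borel "A i"] hd A[OF that] by simp
    have "?S -` PiE I A \<inter> space ?P = PiE I (\<lambda>y. h -` A (\<tau> y))"
    proof (intro equalityI subsetI)
      fix \<phi> assume *: "\<phi> \<in> ?S -` PiE I A \<inter> space ?P"
      then have e: "\<phi> \<in> extensional I" by (simp add: space_PiM PiE_def)
      have "h (\<phi> y) \<in> A (\<tau> y)" if "y \<in> I" for y
      proof -
        have "?S \<phi> \<in> PiE I A" using * by simp
        from PiE_mem[OF this \<tau>(1)[OF that]] show ?thesis using \<tau>[OF that] by simp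
      qed
      then show "\<phi> \<in> PiE I (\<lambda>y. h -` A (\<tau> y))" using e by (auto simp: PiE_def)
    next
      fix \<phi> assume *: "\<phi> \<in> PiE I (\<lambda>y. h -` A (\<tau> y))"
      have "h (\<phi> (\<sigma> x)) \<in> A x" if "x \<in> I" for x
        using PiE_mem[OF * \<sigma>I[OF that]] \<tau>\<sigma>[OF that] by simp
      then show "\<phi> \<in> ?S -` PiE I A \<inter> space ?P" using * by (auto simp: space_PiM PiE_def)
    qed
    then have "emeasure (distr ?P ?P ?S) (PiE I A) = emeasure ?P (PiE I (\<lambda>y. h -` A (\<tau> y)))"
      using A I by (subst emeasure_distr[OF S]) (auto intro!: sets_PiM_I_finite)
    also have "\<dots> = (\<Prod>y\<in>I. emeasure lborel (h -` A (\<tau> y)))" using hA \<tau>(1) by (intro emeasure_PiM I) auto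
    also have "\<dots> = (\<Prod>y\<in>I. emeasure lborel (A (\<tau> y)))" using eA \<tau>(1) by (intro prod.cong) auto
    also have "\<dots> = (\<Prod>x\<in>I. emeasure lborel (A x))"
      by (rule prod.reindex_bij_witness[of _ \<sigma> \<tau>]) (use \<tau> \<tau>\<sigma> \<sigma>I in auto)
    finally show "emeasure (distr ?P ?P ?S) (PiE I A) = (\<Prod>i\<in>I. emeasure lborel (A i))" .
  qed simp
qed

context convex_potential
begin

section \<open>Symmetries of the torus measures\<close>

lemma torus_gibbs_prob:
  assumes m: "0 < m"
  shows "field_law (torus_gibbs V n m :: 'd::finite config measure)"
proof -
  interpret prob_space "finite_gibbs V (torus_edges n) (torus_sites n :: (int ^ 'd) set) m (\<lambda>_. 0)"
    by (rule prob_space_massive_gibbs) (auto simp: m)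
  have "(\<lambda>\<phi>. override_on (\<lambda>_. 0) \<phi> (torus_sites n)) \<in> measurable (finite_gibbs V (torus_edges n) (torus_sites n :: (int ^ 'd) set) m (\<lambda>_. 0)) field_algebra"
    using override_measurable_snd by measurable
  then show ?thesis by (simp add: torus_gibbs_def space_prob_algebra prob_space_distr)
qed

lemma integral_torus_gibbs:
  fixes G :: "'d::finite config \<Rightarrow> real"
  assumes G: "G \<in> borel_measurable field_algebra"
  shows "(\<integral>\<phi>. G \<phi> \<partial>torus_gibbs V n m) =
    (\<integral>\<phi>. G (override_on (\<lambda>_. 0) \<phi> (torus_sites n)) \<partial>finite_gibbs V (torus_edges n) (torus_sites n) m (\<lambda>_. 0))"
  unfolding torus_gibbs_def
  by (rule integral_distr[OF _ G]) (use override_measurable_snd in measurable)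

text \<open>The relation between \<open>G'\<close> and \<open>G\<close> is imposed only on
  configurations that vanish outside the box. This leaves room for lattice shifts, which agree with
  torus translations only on the sites that a local function sees.\<close>

lemma torus_gibbs_invariance:
  fixes G :: "'d::finite config \<Rightarrow> real" and n :: nat
  defines "T \<equiv> (torus_sites n :: (int ^ 'd) set)" and "E \<equiv> torus_edges n"
  assumes m: "0 < m" and G: "G \<in> borel_measurable field_algebra"
    and \<sigma>: "bij_betw \<sigma> T T" "bij_betw (\<lambda>(x, y). (\<sigma> x, \<sigma> y)) E E"
    and h: "h = id \<or> h = uminus"
    and G': "\<And>\<phi>. G' (override_on (\<lambda>_. 0) \<phi> T) = G (override_on (\<lambda>_. 0) (\<lambda>x\<in>T. h (\<phi> (\<sigma> x))) T)"
    and G'm: "G' \<in> borel_measurable field_algebra"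
  shows "(\<integral>\<phi>. G' \<phi> \<partial>torus_gibbs V n m) = (\<integral>\<phi>. G \<phi> \<partial>torus_gibbs V n m)"
proof -
  let ?P = "flat T"
  let ?o = "\<lambda>\<phi>. override_on (\<lambda>_. 0) \<phi> T :: 'd config"
  let ?S = "\<lambda>\<phi>. \<lambda>x\<in>T. h (\<phi> (\<sigma> x))"
  define H where "H \<phi> = hamiltonian V E T m (?o \<phi>)" for \<phi>
  have fin: "finite T" "finite E" by (simp_all add: T_def E_def)
  have [measurable]: "h \<in> borel_measurable borel" using h by auto
  have hd: "distr lborel borel h = lborel"
  proof -
    have "distr lborel borel (id :: real \<Rightarrow> real) = lborel" unfolding id_def by (rule distr_id2) simp
    then show ?thesis using h lborel_distr_uminus by auto
  qed
  have \<sigma>T: "\<sigma> x \<in> T" if "x \<in> T" for x using \<sigma>(1) that by (auto simp: bij_betw_def)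
  have S: "?S \<in> measurable ?P ?P"
  proof (rule measurable_restrict)
    fix x assume "x \<in> T"
    then have "(\<lambda>\<phi>. \<phi> (\<sigma> x)) \<in> borel_measurable ?P" using \<sigma>T[of x] by measurable
    then show "(\<lambda>\<phi>. h (\<phi> (\<sigma> x))) \<in> measurable ?P lborel" by measurable
  qed
  have Hm: "H \<in> borel_measurable ?P" unfolding H_def by (rule hamiltonian_measurable[OF fin(2)])
  have om: "(\<lambda>\<phi>. F (?o \<phi>)) \<in> borel_measurable ?P" if "F \<in> borel_measurable field_algebra" for F :: "_ \<Rightarrow> real"
    by (rule measurable_compose[OF override_measurable_snd that])
  note Hm[measurable] om[OF G, measurable]
  have HS: "H (?S \<phi>) = H \<phi>" for \<phi>
  proof -
    have hV: "V (h s - h t) = V (s - t)" for s t using h V_even[of "s - t"] by auto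
    have h2: "(h s)\<^sup>2 = s\<^sup>2" for s using h by auto
    have "(\<Sum>(x, y)\<in>E. V (?o (?S \<phi>) x - ?o (?S \<phi>) y)) = (\<Sum>(x, y)\<in>E. V (?o \<phi> (\<sigma> x) - ?o \<phi> (\<sigma> y)))"
      by (intro sum.cong) (auto simp: E_def T_def[symmetric] torus_edges_def \<sigma>T hV)
    also have "\<dots> = (\<Sum>e\<in>E. (\<lambda>(x, y). V (?o \<phi> x - ?o \<phi> y)) ((\<lambda>(x, y). (\<sigma> x, \<sigma> y)) e))"
      by (simp add: case_prod_unfold)
    also have "\<dots> = (\<Sum>(x, y)\<in>E. V (?o \<phi> x - ?o \<phi> y))" by (rule sum.reindex_bij_betw[OF \<sigma>(2)])
    finally have 1: "(\<Sum>(x, y)\<in>E. V (?o (?S \<phi>) x - ?o (?S \<phi>) y)) = (\<Sum>(x, y)\<in>E. V (?o \<phi> x - ?o \<phi> y))" .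
    have "(\<Sum>x\<in>T. (?o (?S \<phi>) x)\<^sup>2) = (\<Sum>x\<in>T. (?o \<phi> (\<sigma> x))\<^sup>2)" by (intro sum.cong) (auto simp: \<sigma>T h2)
    also have "\<dots> = (\<Sum>x\<in>T. (?o \<phi> x)\<^sup>2)" by (rule sum.reindex_bij_betw[OF \<sigma>(1)])
    finally show ?thesis unfolding H_def hamiltonian_def 1 by simp
  qed
  have n: "normalisable ?P H" using massive_normalisable[OF fin m] by (simp add: H_def[abs_def])
  have rep: "(\<integral>\<phi>. F \<phi> \<partial>torus_gibbs V n m) = (\<integral>x. F (?o x) * exp (- H x) \<partial>?P) / (\<integral>x. exp (- H x) \<partial>?P)"
    if F: "F \<in> borel_measurable field_algebra" for F
    unfolding integral_torus_gibbs[OF F] finite_gibbs_eq T_def[symmetric] E_def[symmetric] H_def[symmetric]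
    by (rule integral_gibbs_density(1)[OF n om[OF F]])
  have "(\<integral>x. G (?o x) * exp (- H x) \<partial>?P) = (\<integral>x. G (?o x) * exp (- H x) \<partial>distr ?P ?P ?S)"
    by (subst distr_PiM_lborel_reindex[OF fin(1) \<sigma>(1) _ hd]) simp_all
  also have "\<dots> = (\<integral>x. G (?o (?S x)) * exp (- H (?S x)) \<partial>?P)"
    by (rule integral_distr[OF S]) measurable
  also have "\<dots> = (\<integral>x. G' (?o x) * exp (- H x) \<partial>?P)" by (simp add: HS G')
  finally show ?thesis unfolding rep[OF G] rep[OF G'm] by simp
qed

lemma torus_gibbs_reflection:
  fixes G :: "'d::finite config \<Rightarrow> real"
  assumes m: "0 < m" and G: "G \<in> borel_measurable field_algebra"
  shows "(\<integral>\<phi>. G (\<lambda>x. - \<phi> x) \<partial>torus_gibbs V n m) = (\<integral>\<phi>. G \<phi> \<partial>torus_gibbs V n m)"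
proof (rule torus_gibbs_invariance[OF m G, where \<sigma> = id and h = uminus])
  show "(\<lambda>\<phi>. G (\<lambda>x. - \<phi> x)) \<in> borel_measurable field_algebra"
    by (rule measurable_compose[OF measurable_reflect G])
  fix \<phi> :: "'d config"
  have "(\<lambda>x. - override_on (\<lambda>_. 0) \<phi> (torus_sites n) x) = override_on (\<lambda>_. 0) (\<lambda>x\<in>torus_sites n. - \<phi> x) (torus_sites n)"
    by (auto simp: override_on_def)
  then show "G (\<lambda>x. - override_on (\<lambda>_. 0) \<phi> (torus_sites n) x) = G (override_on (\<lambda>_. 0) (\<lambda>x\<in>torus_sites n. - \<phi> (id x)) (torus_sites n))"
    by simp
qed (auto simp: bij_betw_def inj_on_def)

text \<open>Wrapping is the identity on the box. As soon as the box contains the sites seen by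
  \<open>G\<close> and their shifts, the lattice shift and the torus translation have the same
  effect on \<open>G\<close>, and the identity is exact.\<close>

lemma torus_gibbs_shift:
  fixes G :: "'d::finite config \<Rightarrow> real"
  assumes m: "0 < m" and G: "lip_cyl G"
  shows "\<forall>\<^sub>F n in sequentially. (\<integral>\<phi>. G (shift z \<phi>) \<partial>torus_gibbs V n m) = (\<integral>\<phi>. G \<phi> \<partial>torus_gibbs V n m)"
proof -
  obtain D K X where X: "\<And>\<phi>. \<bar>G \<phi>\<bar> \<le> D" "0 \<le> D" "lipschitz_in K X G" using lip_cylE[OF G] by blast
  have fX: "finite X" using X(3) by (simp add: lipschitz_in_def)
  have local: "G \<phi> = G \<psi>" if "\<And>x. x \<in> X \<Longrightarrow> \<phi> x = \<psi> x" for \<phi> \<psi>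
    using lipschitz_inD[OF X(3), of \<phi> \<psi>] that by simp
  have "\<forall>\<^sub>F n in sequentially. X \<subseteq> torus_sites n" "\<forall>\<^sub>F n in sequentially. (\<lambda>x. x + z) ` X \<subseteq> torus_sites n"
    using fX by (auto intro!: torus_sites_exhaust)
  then show ?thesis using eventually_gt_at_top[of 0]
  proof eventually_elim
    case (elim n)
    let ?T = "torus_sites n :: (int ^ 'd) set"
    show ?case
    proof (rule torus_gibbs_invariance[OF m lip_cyl_measurable[OF G] torus_translation[OF elim(3), of z], where h = id])
      fix \<phi> :: "'d config"
      show "G (shift z (override_on (\<lambda>_. 0) \<phi> ?T)) = G (override_on (\<lambda>_. 0) (\<lambda>x\<in>?T. id (\<phi> (torus_wrap n (x + z)))) ?T)"
      proof (rule local)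
        fix x assume "x \<in> X"
        then have "x \<in> ?T" "x + z \<in> ?T" using elim by auto
        then show "shift z (override_on (\<lambda>_. 0) \<phi> ?T) x = override_on (\<lambda>_. 0) (\<lambda>x\<in>?T. id (\<phi> (torus_wrap n (x + z)))) ?T x"
          using torus_wrap_id[OF elim(3), of "x + z"] by (simp add: shift_def)
      qed
    qed (simp_all add: lip_cyl_measurable lip_cyl_shift G)
  qed
qed

section \<open>Variance bounds and local equations on the torus\<close>

lemma torus_gibbs_variance_bound:
  fixes G :: "'d::finite config \<Rightarrow> real"
  assumes m: "0 < m" and G: "lip_cyl G" and ab: "0 \<le> a" "0 < b"
    and E: "E \<subseteq> torus_edges n" and X: "X \<subseteq> torus_sites n"
    and lip: "\<And>\<phi> \<psi>. G \<phi> - G \<psi> \<le> a * edge_norm E (\<lambda>x. \<phi> x - \<psi> x) + b * L2_set (\<lambda>x. \<phi> x - \<psi> x) X"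
  shows "(\<integral>\<phi>. G \<phi> * G \<phi> \<partial>torus_gibbs V n m) - (\<integral>\<phi>. G \<phi> \<partial>torus_gibbs V n m)\<^sup>2 \<le> 4 * (a * sqrt (2 / c) + b / m)\<^sup>2"
proof -
  let ?T = "torus_sites n :: (int ^ 'd) set"
  let ?o = "\<lambda>\<phi>. override_on (\<lambda>_. 0) \<phi> ?T :: 'd config"
  obtain K where K: "\<And>\<phi>. \<bar>G \<phi>\<bar> \<le> K" using lip_cylE[OF G] by metis
  show ?thesis
    unfolding integral_torus_gibbs[OF lip_cyl_measurable[OF G]] integral_torus_gibbs[OF lip_cyl_measurable[OF lip_cyl_mult[OF G G]]]
    unfolding power2_eq_square[of "G _", symmetric]
  proof (rule massive_variance_bound[OF finite_torus_sites finite_torus_edges m _ K _ ab])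
    show "(\<lambda>\<phi>. G (?o \<phi>)) \<in> borel_measurable (flat ?T)"
      by (rule measurable_compose[OF override_measurable_snd lip_cyl_measurable[OF G]])
    fix x y :: "'d config"
    let ?u = "\<lambda>i. ?o x i - ?o y i"
    have "a * edge_norm E ?u \<le> a * edge_norm (torus_edges n) ?u" "b * L2_set ?u X \<le> b * L2_set ?u ?T"
      using ab by (auto intro!: mult_left_mono edge_norm_mono L2_set_subset E X)
    then show "G (?o x) - G (?o y) \<le> a * edge_norm (torus_edges n) ?u + b * L2_set ?u ?T"
      using lip[of "?o x" "?o y"] by linarith
  qed
qed

text \<open>The l2 constant b is chosen small for the given mass; only then is n taken so large that
  the torus contains the edges and sites belonging to b. With the opposite order the term b / m
  could not be removed.\<close>

lemma torus_gibbs_grad_poincare: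
  fixes G :: "'d::finite config \<Rightarrow> real"
  assumes m: "0 < m" and G: "lip_cyl G" and a: "0 \<le> a" and gl: "grad_lipschitz a G" and e: "0 < e"
  shows "\<forall>\<^sub>F n in sequentially. (\<integral>\<phi>. G \<phi> * G \<phi> \<partial>torus_gibbs V n m) - (\<integral>\<phi>. G \<phi> \<partial>torus_gibbs V n m)\<^sup>2 \<le> 8 * a\<^sup>2 / c + e"
proof -
  have "((\<lambda>b. 4 * (a * sqrt (2 / c) + b / m)\<^sup>2) \<longlongrightarrow> 4 * (a * sqrt (2 / c) + 0 / m)\<^sup>2) (at_right 0)"
    using m by (intro tendsto_intros) auto
  moreover have "4 * (a * sqrt (2 / c) + 0 / m)\<^sup>2 < 8 * a\<^sup>2 / c + e"
    using c_pos e by (simp add: power_mult_distrib)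
  ultimately have "\<forall>\<^sub>F b in at_right 0. 4 * (a * sqrt (2 / c) + b / m)\<^sup>2 < 8 * a\<^sup>2 / c + e"
    by (rule order_tendstoD)
  then obtain b :: real where b: "0 < b" "4 * (a * sqrt (2 / c) + b / m)\<^sup>2 < 8 * a\<^sup>2 / c + e"
    unfolding eventually_at_right_field by (metis dense)
  obtain E X where EX: "bond_set E" "finite X"
    "\<And>\<phi> \<psi>. G \<phi> - G \<psi> \<le> a * edge_norm E (\<lambda>x. \<phi> x - \<psi> x) + b * L2_set (\<lambda>x. \<phi> x - \<psi> x) X"
    using gl b(1) unfolding grad_lipschitz_def by blast
  have fE: "finite (fst ` E \<union> snd ` E)" using EX(1) by (simp add: bond_set_def)
  from torus_sites_exhaust[OF fE] torus_sites_exhaust[OF EX(2)] show ?thesis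
  proof eventually_elim
    case (elim n)
    have "E \<subseteq> torus_edges n"
    proof
      fix p assume "p \<in> E"
      then have "nearest_neighbour (fst p) (snd p)" "fst p \<in> torus_sites n" "snd p \<in> torus_sites n"
        using EX(1) elim(1) by (auto simp: bond_set_def)
      from nearest_neighbour_torus_edge[OF this] show "p \<in> torus_edges n" by simp
    qed
    from torus_gibbs_variance_bound[OF m G a b(1) this elim(2) EX(3)] b(2) show ?case by linarith
  qed
qed

text \<open>The mass alone gives this bound, through the variance estimate with a = 0 and no edges.
  It is uniform in n but degenerates as m tends to 0, where the bound from block averages takes
  over.\<close>

lemma torus_gibbs_tail:
  fixes x :: "int ^ 'd::finite"
  assumes m: "0 < m" and R: "0 < R"
  shows "measure (torus_gibbs V n m) {\<phi>. R < \<bar>\<phi> x\<bar>} \<le> (4 / m\<^sup>2) / R\<^sup>2"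
proof -
  let ?\<mu> = "torus_gibbs V n m :: 'd config measure"
  let ?G = "\<lambda>\<phi>. clamp_real R (\<phi> x)"
  note \<mu> = torus_gibbs_prob[OF m, of n, where 'd = 'd]
  have sp: "space ?\<mu> = UNIV" by (simp add: torus_gibbs_def space_PiM)
  have lm: "(\<lambda>\<phi>. \<phi> x) \<in> borel_measurable ?\<mu>" by (simp add: torus_gibbs_def)
  have lc: "lip_cyl ?G" using R by (intro lip_cyl_clamp[OF lipschitz_in_site]) auto
  have "(\<integral>\<phi>. ?G \<phi> * ?G \<phi> \<partial>?\<mu>) \<le> 4 / m\<^sup>2"
  proof (cases "x \<in> torus_sites n")
    case True
    have "(\<integral>\<phi>. ?G \<phi> * ?G \<phi> \<partial>?\<mu>) - (\<integral>\<phi>. ?G \<phi> \<partial>?\<mu>)\<^sup>2 \<le> 4 * (0 * sqrt (2 / c) + 1 / m)\<^sup>2"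
    proof (rule torus_gibbs_variance_bound[OF m lc, where E = "{}" and X = "{x}"])
      fix \<phi> \<psi> :: "'d config"
      show "?G \<phi> - ?G \<psi> \<le> 0 * edge_norm {} (\<lambda>x. \<phi> x - \<psi> x) + 1 * L2_set (\<lambda>x. \<phi> x - \<psi> x) {x}"
        using clamp_real_lipschitz[of R "\<phi> x" "\<psi> x"] by (simp add: L2_set_def)
    qed (use True in auto)
    moreover have "(\<integral>\<phi>. ?G \<phi> \<partial>?\<mu>) = 0"
      using torus_gibbs_reflection[OF m lip_cyl_measurable[OF lc], of n] R by (simp add: clamp_real_minus)
    ultimately show ?thesis by (simp add: power_divide)
  next
    case False
    then have "(\<integral>\<phi>. ?G \<phi> * ?G \<phi> \<partial>?\<mu>) = 0"
      using R by (subst integral_torus_gibbs[OF lip_cyl_measurable[OF lip_cyl_mult[OF lc lc]]]) (simp add: clamp_real_def)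
    then show ?thesis using m by simp
  qed
  from tail_bound[OF prob_algebra_fieldsD(1)[OF \<mu>] lm R this] show ?thesis by (simp add: sp)
qed

text \<open>\<open>R\<close> collects the terms that do not see the field in \<Lambda>; with the
  outside frozen, its exponential is a constant factor of the weight.\<close>

lemma torus_hamiltonian_split:
  fixes \<Lambda> :: "(int ^ 'd::finite) set" and m :: real
  assumes cl: "lattice_closure \<Lambda> \<subseteq> torus_sites n"
  defines "R \<equiv> \<lambda>\<psi>. 1 / 2 * (\<Sum>(x, y)\<in>torus_edges n - lattice_edges \<Lambda>. V (\<psi> x - \<psi> y)) + m\<^sup>2 / 2 * (\<Sum>x\<in>torus_sites n - \<Lambda>. (\<psi> x)\<^sup>2)"
  shows "hamiltonian V (torus_edges n) (torus_sites n) m \<psi> = hamiltonian V (lattice_edges \<Lambda>) \<Lambda> m \<psi> + R \<psi>"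
    and "R (override_on \<psi> \<phi> \<Lambda>) = R \<psi>"
proof -
  have \<Lambda>T: "\<Lambda> \<subseteq> torus_sites n" using cl by (auto simp: lattice_closure_def)
  have ET: "lattice_edges \<Lambda> \<subseteq> torus_edges n"
    using cl by (auto simp: lattice_edges_def intro!: nearest_neighbour_torus_edge)
  have "(\<Sum>e\<in>torus_edges n. g e) = (\<Sum>e\<in>torus_edges n - lattice_edges \<Lambda>. g e) + (\<Sum>e\<in>lattice_edges \<Lambda>. g e)" for g :: "_ \<Rightarrow> real"
    by (rule sum.subset_diff[OF ET]) simp
  moreover have "(\<Sum>x\<in>torus_sites n. g x) = (\<Sum>x\<in>torus_sites n - \<Lambda>. g x) + (\<Sum>x\<in>\<Lambda>. g x)" for g :: "_ \<Rightarrow> real"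
    by (rule sum.subset_diff[OF \<Lambda>T]) simp
  ultimately show "hamiltonian V (torus_edges n) (torus_sites n) m \<psi> = hamiltonian V (lattice_edges \<Lambda>) \<Lambda> m \<psi> + R \<psi>"
    by (simp add: hamiltonian_def R_def distrib_left)
  have off: "x \<notin> \<Lambda> \<and> y \<notin> \<Lambda>" if "(x, y) \<in> torus_edges n - lattice_edges \<Lambda>" for x y
    using torus_edges_touching[OF cl] lattice_edges_touching[of x y \<Lambda>] that by blast
  have "(\<Sum>(x, y)\<in>torus_edges n - lattice_edges \<Lambda>. V (override_on \<psi> \<phi> \<Lambda> x - override_on \<psi> \<phi> \<Lambda> y))
    = (\<Sum>(x, y)\<in>torus_edges n - lattice_edges \<Lambda>. V (\<psi> x - \<psi> y))"
    by (intro sum.cong refl) (use off in \<open>auto simp: override_on_def\<close>)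
  moreover have "(\<Sum>x\<in>torus_sites n - \<Lambda>. (override_on \<psi> \<phi> \<Lambda> x)\<^sup>2) = (\<Sum>x\<in>torus_sites n - \<Lambda>. (\<psi> x)\<^sup>2)"
    by (intro sum.cong) auto
  ultimately show "R (override_on \<psi> \<phi> \<Lambda>) = R \<psi>" by (simp add: R_def)
qed

text \<open>With the field outside \<Lambda> frozen, the torus density is the weight of the kernel
  times a factor r that depends on the outside only. Integrating the weight over \<Lambda> gives the
  partition function of the kernel, which cancels its normalisation.\<close>

lemma torus_gibbs_resample:
  fixes \<Lambda> :: "(int ^ 'd::finite) set"
  assumes m: "0 < m" and \<Lambda>: "finite \<Lambda>" and cl: "lattice_closure \<Lambda> \<subseteq> torus_sites n"
  shows "resample \<Lambda> m (torus_gibbs V n m) = torus_gibbs V n m"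
proof (rule measure_eqI)
  let ?\<mu> = "torus_gibbs V n m :: 'd config measure"
  let ?T = "torus_sites n :: (int ^ 'd) set" and ?E = "torus_edges n :: ((int ^ 'd) \<times> _) set" and ?F = "lattice_edges \<Lambda>"
  define J where "J = ?T - \<Lambda>"
  let ?P = "\<lambda>I :: (int ^ 'd) set. flat I"
  interpret product_sigma_finite "\<lambda>_::int ^ 'd. lborel :: real measure" by standard
  note \<mu> = torus_gibbs_prob[OF m, of n, where 'd = 'd]
  have \<Lambda>T: "\<Lambda> \<subseteq> ?T" using cl by (auto simp: lattice_closure_def)
  have T: "?T = J \<union> \<Lambda>" "J \<inter> \<Lambda> = {}" "finite J" using \<Lambda>T by (auto simp: J_def)
  show "sets (resample \<Lambda> m ?\<mu>) = sets ?\<mu>" by (simp add: resample_def torus_gibbs_def)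
  fix A assume "A \<in> sets (resample \<Lambda> m ?\<mu>)"
  then have A: "A \<in> sets field_algebra" by (simp add: resample_def)
  define g :: "'d config \<Rightarrow> ennreal" where "g = indicator A"
  have g[measurable]: "g \<in> borel_measurable field_algebra" using A by (simp add: g_def)
  define k where "k \<xi> = (\<integral>\<^sup>+\<phi>. g (override_on \<xi> \<phi> \<Lambda>) \<partial>finite_gibbs V ?F \<Lambda> m \<xi>)" for \<xi>
  have k[measurable]: "k \<in> borel_measurable field_algebra"
    unfolding k_def[abs_def] by (rule nn_integral_resample(2)[OF \<Lambda> \<mu> g])
  define w where "w \<psi> = ennreal (exp (- hamiltonian V ?E ?T m \<psi>))" for \<psi>
  have w[measurable]: "w \<in> borel_measurable field_algebra" unfolding w_def[abs_def] by measurable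
  define Z where "Z = partition_function V ?E ?T m (\<lambda>_. 0)"
  let ?o = "\<lambda>\<phi>. override_on (\<lambda>_. 0) \<phi> ?T :: 'd config"
  let ?q = "\<lambda>\<eta>. override_on (\<lambda>_. 0) \<eta> J :: 'd config"
  have merge: "?o (merge J \<Lambda> (\<eta>, \<zeta>)) = override_on (?q \<eta>) \<zeta> \<Lambda>" for \<eta> \<zeta>
    using T(2) by (auto simp: T(1) override_on_def merge_def fun_eq_iff)
  have rep: "(\<integral>\<^sup>+\<psi>. f \<psi> \<partial>?\<mu>) = (\<integral>\<^sup>+\<eta>. \<integral>\<^sup>+\<zeta>. w (override_on (?q \<eta>) \<zeta> \<Lambda>) / Z * f (override_on (?q \<eta>) \<zeta> \<Lambda>) \<partial>?P \<Lambda> \<partial>?P J)"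
    if f: "f \<in> borel_measurable field_algebra" for f
  proof -
    note f[measurable]
    have om[measurable]: "(\<lambda>\<phi>. f' (?o \<phi>)) \<in> borel_measurable (?P ?T)" if "f' \<in> borel_measurable field_algebra" for f' :: "_ \<Rightarrow> ennreal"
      by (rule measurable_compose[OF override_measurable_snd that])
    have "(\<integral>\<^sup>+\<psi>. f \<psi> \<partial>?\<mu>) = (\<integral>\<^sup>+\<phi>. f (?o \<phi>) \<partial>finite_gibbs V ?E ?T m (\<lambda>_. 0))"
      unfolding torus_gibbs_def by (rule nn_integral_distr) (use override_measurable_snd f in measurable)
    also have "\<dots> = (\<integral>\<^sup>+\<phi>. w (?o \<phi>) / Z * f (?o \<phi>) \<partial>?P ?T)"
      unfolding finite_gibbs_def boltzmann_weight_def w_def[symmetric] Z_def[symmetric]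
      by (rule nn_integral_density) (intro borel_measurable_divide_ennreal om f w borel_measurable_const)+
    also have "\<dots> = (\<integral>\<^sup>+\<eta>. \<integral>\<^sup>+\<zeta>. w (?o (merge J \<Lambda> (\<eta>, \<zeta>))) / Z * f (?o (merge J \<Lambda> (\<eta>, \<zeta>))) \<partial>?P \<Lambda> \<partial>?P J)"
      unfolding T(1)
      by (rule product_nn_integral_fold[OF T(2,3) \<Lambda>])
         (fold T(1), intro borel_measurable_times_ennreal borel_measurable_divide_ennreal om f w borel_measurable_const)
    finally show ?thesis unfolding merge .
  qed
  have inner: "(\<integral>\<^sup>+\<zeta>. w (override_on \<xi> \<zeta> \<Lambda>) / Z * k (override_on \<xi> \<zeta> \<Lambda>) \<partial>?P \<Lambda>)
    = (\<integral>\<^sup>+\<zeta>. w (override_on \<xi> \<zeta> \<Lambda>) / Z * g (override_on \<xi> \<zeta> \<Lambda>) \<partial>?P \<Lambda>)" for \<xi>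
  proof -
    obtain r where r: "\<And>\<zeta>. w (override_on \<xi> \<zeta> \<Lambda>) = boltzmann_weight V ?F \<Lambda> m \<xi> \<zeta> * r"
    proof
      let ?R = "1 / 2 * (\<Sum>(x, y)\<in>?E - ?F. V (\<xi> x - \<xi> y)) + m\<^sup>2 / 2 * (\<Sum>x\<in>?T - \<Lambda>. (\<xi> x)\<^sup>2)"
      fix \<zeta>
      show "w (override_on \<xi> \<zeta> \<Lambda>) = boltzmann_weight V ?F \<Lambda> m \<xi> \<zeta> * ennreal (exp (- ?R))"
        unfolding w_def boltzmann_weight_def torus_hamiltonian_split(1)[OF cl] torus_hamiltonian_split(2)[OF cl]
        by (simp add: exp_add[symmetric] flip: ennreal_mult)
    qed
    let ?b = "boltzmann_weight V ?F \<Lambda> m \<xi>"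
    define Y where "Y = partition_function V ?F \<Lambda> m \<xi>"
    have Y: "Y \<noteq> 0" "Y \<noteq> \<top>"
      using lattice_normalisable[OF \<Lambda>, THEN normalisableD(2), of m \<xi>] lattice_normalisable[OF \<Lambda>, THEN normalisableD(3), of m \<xi>]
      by (auto simp: Y_def partition_function_def boltzmann_weight_def)
    have b[measurable]: "?b \<in> borel_measurable (?P \<Lambda>)"
      using lattice_normalisable[OF \<Lambda>, THEN normalisableD(1), of m \<xi>] unfolding boltzmann_weight_def by measurable
    have go[measurable]: "(\<lambda>\<zeta>. g (override_on \<xi> \<zeta> \<Lambda>)) \<in> borel_measurable (?P \<Lambda>)"
      by (rule measurable_compose[OF override_measurable_snd g])
    \<comment> \<open>The kernel average does not depend on the field in \<Lambda>, so it can be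
      taken out of the inner integral.\<close>
    have kc: "k (override_on \<xi> \<zeta> \<Lambda>) = k \<xi>" for \<zeta>
      by (simp add: k_def finite_gibbs_exterior override_on_idem)
    have k\<xi>: "k \<xi> = (\<integral>\<^sup>+\<zeta>. ?b \<zeta> / Y * g (override_on \<xi> \<zeta> \<Lambda>) \<partial>?P \<Lambda>)"
      unfolding k_def finite_gibbs_def Y_def by (rule nn_integral_density) measurable
    have "(\<integral>\<^sup>+\<zeta>. w (override_on \<xi> \<zeta> \<Lambda>) / Z * k (override_on \<xi> \<zeta> \<Lambda>) \<partial>?P \<Lambda>) = (\<integral>\<^sup>+\<zeta>. ?b \<zeta> * (r / Z * k \<xi>) \<partial>?P \<Lambda>)"
      by (simp add: r kc ennreal_times_divide mult.assoc divide_ennreal_def mult_ac)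
    also have "\<dots> = Y * (r / Z * k \<xi>)" by (subst nn_integral_multc) (simp_all add: Y_def partition_function_def)
    also have "\<dots> = (Y * r / Z) * (\<integral>\<^sup>+\<zeta>. ?b \<zeta> / Y * g (override_on \<xi> \<zeta> \<Lambda>) \<partial>?P \<Lambda>)"
      unfolding k\<xi> by (simp add: divide_ennreal_def mult_ac)
    also have "\<dots> = (\<integral>\<^sup>+\<zeta>. (Y * r / Z) * (?b \<zeta> / Y * g (override_on \<xi> \<zeta> \<Lambda>)) \<partial>?P \<Lambda>)"
      by (rule nn_integral_cmult[symmetric]) measurable
    also have "\<dots> = (\<integral>\<^sup>+\<zeta>. w (override_on \<xi> \<zeta> \<Lambda>) / Z * g (override_on \<xi> \<zeta> \<Lambda>) \<partial>?P \<Lambda>)"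
    proof (rule nn_integral_cong)
      fix \<zeta>
      have "(Y * r / Z) * (?b \<zeta> / Y * g (override_on \<xi> \<zeta> \<Lambda>)) = (Y / Y) * (?b \<zeta> * r / Z * g (override_on \<xi> \<zeta> \<Lambda>))"
        by (simp add: divide_ennreal_def mult_ac)
      also have "Y / Y = 1" using Y by (simp add: ennreal_divide_self less_top)
      finally show "(Y * r / Z) * (?b \<zeta> / Y * g (override_on \<xi> \<zeta> \<Lambda>)) = w (override_on \<xi> \<zeta> \<Lambda>) / Z * g (override_on \<xi> \<zeta> \<Lambda>)"
        by (simp add: r)
    qed
    finally show ?thesis .
  qed
  have "emeasure (resample \<Lambda> m ?\<mu>) A = (\<integral>\<^sup>+\<psi>. g \<psi> \<partial>resample \<Lambda> m ?\<mu>)" using A by (simp add: g_def resample_def)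
  also have "\<dots> = (\<integral>\<^sup>+\<xi>. k \<xi> \<partial>?\<mu>)" unfolding k_def by (rule nn_integral_resample(1)[OF \<Lambda> \<mu> g])
  also have "\<dots> = (\<integral>\<^sup>+\<psi>. g \<psi> \<partial>?\<mu>)" unfolding rep[OF k] rep[OF g] inner ..
  also have "\<dots> = emeasure ?\<mu> A" using A by (simp add: g_def torus_gibbs_def)
  finally show "emeasure (resample \<Lambda> m ?\<mu>) A = emeasure ?\<mu> A" .
qed

lemma torus_limit_good:
  fixes L :: "'d::finite config measure"
  assumes m: "0 < m" and r: "strict_mono r" and w: "weakly_converges (\<lambda>i. torus_gibbs V (r i) m) L sequentially"
  shows "good m L"
proof -
  have ev: "\<forall>\<^sub>F i in sequentially. P (r i)" if "\<forall>\<^sub>F n in sequentially. P n" for P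
    using eventually_subseq[OF r that] .
  show ?thesis
    unfolding good_def
  proof (intro conjI allI impI)
    show "field_law L" using w by (simp add: weakly_converges_def)
    show "shift_invariant L" by (rule shift_invariant_limit[OF w ev[OF torus_gibbs_shift[OF m]]])
    show "reflection_invariant L"
      by (rule reflection_invariant_limit[OF w]) (intro always_eventually allI torus_gibbs_reflection[OF m] lip_cyl_measurable)
    show "grad_poincare L" by (rule grad_poincare_limit[OF w ev[OF torus_gibbs_grad_poincare[OF m]]])
    fix \<Lambda> :: "(int ^ 'd) set" assume \<Lambda>: "finite \<Lambda>"
    show "dlr \<Lambda> m L"
    proof (rule dlr_limit[OF w \<Lambda> ev])
      fix G :: "'d config \<Rightarrow> real" assume G: "lip_cyl G"
      obtain K where K: "\<And>\<phi>. \<bar>G \<phi>\<bar> \<le> K" using lip_cylE[OF G] by metis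
      show "\<forall>\<^sub>F n in sequentially. (\<integral>\<phi>. G \<phi> \<partial>torus_gibbs V n m) = (\<integral>\<xi>. gibbs_avg \<Lambda> m \<xi> G \<partial>torus_gibbs V n m)"
        using torus_sites_exhaust[OF finite_lattice_closure[OF \<Lambda>]]
      proof eventually_elim
        case (elim n)
        show ?case
          using gibbs_avg_resample(2)[OF \<Lambda> torus_gibbs_prob[OF m] lip_cyl_measurable[OF G] K, of m n]
          unfolding torus_gibbs_resample[OF m \<Lambda> elim] .
      qed
    qed
  qed
qed

section \<open>Convergence in infinite volume and at vanishing mass\<close>

lemma tail_radius:
  fixes K e :: real
  assumes "0 \<le> K" "0 < e"
  obtains R where "0 < R" "K / R\<^sup>2 \<le> e"
proof
  have p: "0 < K / e + 1" using assms by (intro add_nonneg_pos) auto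
  then show "0 < sqrt (K / e + 1)" by simp
  have "K \<le> e * (K / e + 1)" using assms by (simp add: distrib_left)
  then show "K / (sqrt (K / e + 1))\<^sup>2 \<le> e" using p by (simp add: divide_le_eq)
qed

lemma torus_gibbs_tight:
  fixes x :: "int ^ 'd::finite"
  assumes m: "0 < m" and e: "0 < e"
  shows "\<exists>R\<ge>0. \<forall>\<^sub>F n in sequentially. measure (torus_gibbs V (n :: nat) m) {\<phi>. R < \<bar>\<phi> x\<bar>} \<le> e"
proof -
  obtain R where R: "0 < R" "(4 / m\<^sup>2) / R\<^sup>2 \<le> e" using tail_radius[of "4 / m\<^sup>2" e] e by auto
  then show ?thesis
    by (intro exI[of _ R] conjI always_eventually allI order_trans[OF torus_gibbs_tail[OF m R(1)]]) auto
qed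

theorem torus_gibbs_converges:
  assumes m: "0 < m" and d: "CARD('d::finite) \<ge> 3"
  obtains L :: "'d::finite config measure" where "good m L" "weakly_converges (\<lambda>n. torus_gibbs V n m) L sequentially"
proof -
  obtain r and L :: "'d config measure" where r: "strict_mono r" "weakly_converges (\<lambda>n. torus_gibbs V (r n) m) L sequentially"
    using weak_limit_exists[OF torus_gibbs_prob[OF m] torus_gibbs_tight[OF m]] .
  have L: "good m L" by (rule torus_limit_good[OF m r])
  have "weakly_converges (\<lambda>n. torus_gibbs V n m) L sequentially"
  proof (rule weakly_converges_by_subsequences[OF torus_gibbs_prob[OF m] torus_gibbs_tight[OF m]])
    show "field_law L" using L by (simp add: good_def)
    fix r' and L' :: "'d config measure" assume "strict_mono r'" "weakly_converges (\<lambda>n. torus_gibbs V (r' n) m) L' sequentially"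
    then have "good m L'" by (rule torus_limit_good[OF m])
    then show "L' = L" using L d by (rule good_unique)
  qed
  with L show ?thesis by (rule that)
qed

lemma good_tight:
  fixes x :: "int ^ 'd::finite"
  assumes g: "\<And>i. good (ms i) (M i)" and d: "CARD('d) \<ge> 3" and e: "0 < e"
  shows "\<exists>R\<ge>0. \<forall>\<^sub>F i in sequentially. measure (M i) {\<phi>. R < \<bar>\<phi> x\<bar>} \<le> e"
proof -
  define K where "K = 8 * (green_const TYPE('d))\<^sup>2 / c"
  obtain R where R: "0 < R" "K / R\<^sup>2 \<le> e" using tail_radius[of K e] e c_pos by (auto simp: K_def)
  have "measure (M i) {\<phi>. R < \<bar>\<phi> x\<bar>} \<le> K / R\<^sup>2" for i
  proof -
    have \<mu>: "field_law (M i)" using g by (simp add: good_def)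
    note s = prob_algebra_fieldsD[OF \<mu>]
    interpret prob_space "M i" by (rule s)
    have sp: "space (M i) = UNIV" using sets_eq_imp_space_eq[OF s(2)] by (simp add: space_PiM)
    have lm: "(\<lambda>\<phi>. \<phi> x) \<in> borel_measurable (M i)" by (rule measurable_field_law[OF \<mu>]) simp
    have lc: "lip_cyl (\<lambda>\<phi> :: int ^ 'd \<Rightarrow> real. clamp_real R (\<phi> x))" using R by (intro lip_cyl_clamp[OF lipschitz_in_site]) auto
    have "(\<integral>\<phi>. clamp_real R (\<phi> x) * clamp_real R (\<phi> x) \<partial>M i) \<le> (\<integral>\<phi>. (\<phi> x)\<^sup>2 \<partial>M i)"
    proof (rule integral_mono[OF lip_cyl_integrable[OF lip_cyl_mult[OF lc lc] \<mu>] good_site(1)[OF g d]])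
      fix \<phi> :: "'d config"
      have "(clamp_real R (\<phi> x))\<^sup>2 \<le> (\<phi> x)\<^sup>2" using R by (intro abs_le_square_iff[THEN iffD1] clamp_real_abs_le) auto
      then show "clamp_real R (\<phi> x) * clamp_real R (\<phi> x) \<le> (\<phi> x)\<^sup>2" by (simp add: power2_eq_square)
    qed
    also have "\<dots> \<le> K" unfolding K_def by (rule good_site(2)[OF g d])
    finally show ?thesis using tail_bound[OF s(1) lm R(1)] by (simp add: sp)
  qed
  then show ?thesis
    using R by (intro exI[of _ R] conjI always_eventually allI) (auto intro: order_trans)
qed

text \<open>The masses 1 / (n + 1) produce one limit point. Any other sequence of masses tending to
  0 is tight with the same bound, and its limit points satisfy the massless equations as well, so
  uniqueness identifies them with the first.\<close>

theorem massless_limit: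
  fixes \<mu> :: "real \<Rightarrow> 'd::finite config measure"
  assumes g: "\<And>m. 0 < m \<Longrightarrow> good m (\<mu> m)" and d: "CARD('d) \<ge> 3"
  obtains \<mu>0 where "good 0 \<mu>0" "weakly_converges \<mu> \<mu>0 (at_right 0)"
proof -
  have p: "field_law (\<mu> m)" if "0 < m" for m using g[OF that] by (simp add: good_def)
  let ?m = "\<lambda>n. 1 / real (Suc n)"
  have sub: "good 0 L" if X: "\<And>i. 0 < X i" "X \<longlonglongrightarrow> 0" and r: "strict_mono r"
    and w: "weakly_converges (\<lambda>i. \<mu> (X (r i))) L sequentially" for X :: "nat \<Rightarrow> real" and r L
    by (rule good_massless_limit[OF w g[OF X(1)] X(1)]) (use LIMSEQ_subseq_LIMSEQ[OF X(2) r] in \<open>simp add: comp_def\<close>)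
  have m0: "0 < ?m n" for n by simp
  obtain r L where r: "strict_mono r" "weakly_converges (\<lambda>n. \<mu> (?m (r n))) L sequentially"
    using weak_limit_exists[OF p[OF m0] good_tight[OF g[OF m0] d]] .
  have L: "good 0 L" by (rule sub[OF m0 LIMSEQ_Suc[OF lim_1_over_n] r])
  have "weakly_converges \<mu> L (at_right 0)"
  proof (rule weakly_converges_at_right[OF p])
    show Lp: "field_law L" using L by (simp add: good_def)
    fix X :: "nat \<Rightarrow> real" assume X: "\<And>i. 0 < X i" "X \<longlonglongrightarrow> 0"
    show "weakly_converges (\<lambda>i. \<mu> (X i)) L sequentially"
    proof (rule weakly_converges_by_subsequences[OF p[OF X(1)] good_tight[OF g[OF X(1)] d] Lp])
      fix r' L' assume "strict_mono r'" "weakly_converges (\<lambda>n. \<mu> (X (r' n))) L' sequentially"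
      then have "good 0 L'" by (rule sub[OF X])
      then show "L' = L" using L d by (rule good_unique)
    qed
  qed
  with L show ?thesis by (rule that)
qed

end

text \<open>The midpoint inequality is convexity of V - c t^2 / 2. The mixed difference is an
  increment of t \<mapsto> V (t + h) - V t, whose derivative is at most C |h| in modulus because V'
  is Lipschitz.\<close>

lemma convex_potential_of_C2:
  fixes V V' V'' :: "real \<Rightarrow> real"
  assumes V: "\<And>t. (V has_real_derivative V' t) (at t)" and V': "\<And>t. (V' has_real_derivative V'' t) (at t)"
    and even: "\<And>t. V (- t) = V t" and c: "0 < c" and b: "\<And>t. c \<le> V'' t \<and> V'' t \<le> C"
  shows "convex_potential V c C"
proof
  show "0 < c" "V (- t) = V t" for t by fact+
  show C: "0 \<le> C" using c b[of 0] by linarith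
  show "continuous_on UNIV V" using V by (intro continuous_at_imp_continuous_on ballI DERIV_isCont)
  fix x y h :: real
  define f where "f t = V t - c / 2 * t\<^sup>2" for t
  have "convex_on UNIV f"
  proof (rule f''_ge0_imp_convex[where f' = "\<lambda>t. V' t - c * t" and f'' = "\<lambda>t. V'' t - c"])
    show "(f has_real_derivative V' t - c * t) (at t)" for t
      unfolding f_def[abs_def] by (auto intro!: derivative_eq_intros V)
    show "((\<lambda>t. V' t - c * t) has_real_derivative V'' t - c) (at t)" for t
      by (auto intro!: derivative_eq_intros V')
  qed (use b in auto)
  from convex_onD[OF this, of "1/2" x y] have "f ((x + y) / 2) \<le> f x / 2 + f y / 2" by (simp add: add_divide_distrib)
  moreover have mid_arith: "v - c / 2 * m \<le> (p - c / 2 * s) / 2 + (q - c / 2 * t) / 2 \<Longrightarrow> 2 * v \<le> p + q - (c / 2 * s + c / 2 * t - c * m)"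
    for v m p q s t :: real by (simp add: field_simps)
  ultimately have "2 * V ((x + y) / 2) \<le> V x + V y - (c / 2 * x\<^sup>2 + c / 2 * y\<^sup>2 - c * ((x + y) / 2)\<^sup>2)"
    unfolding f_def by blast
  also have "c / 2 * x\<^sup>2 + c / 2 * y\<^sup>2 - c * ((x + y) / 2)\<^sup>2 = c / 4 * (x - y)\<^sup>2"
    by (simp add: power2_eq_square field_simps)
  finally show "2 * V ((x + y) / 2) + c / 4 * (x - y)\<^sup>2 \<le> V x + V y" by simp
  have "\<bar>V'' t\<bar> \<le> C" for t using b[of t] c by linarith
  then have lip: "\<bar>V' s - V' t\<bar> \<le> C * \<bar>s - t\<bar>" for s t
    using field_differentiable_bound[of UNIV V' V'' C s t] V' by simp
  show "\<bar>(V (x + h) - V x) - (V (y + h) - V y)\<bar> \<le> C * (\<bar>h\<bar> * \<bar>x - y\<bar>)"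
  proof -
    have "((\<lambda>t. V (t + h) - V t) has_real_derivative V' (t + h) - V' t) (at t)" for t
      by (auto intro!: derivative_eq_intros V DERIV_shift[THEN iffD1, of V])
    moreover have "\<bar>V' (t + h) - V' t\<bar> \<le> C * \<bar>h\<bar>" for t using lip[of "t + h" t] by simp
    ultimately have "\<bar>(V (x + h) - V x) - (V (y + h) - V y)\<bar> \<le> C * \<bar>h\<bar> * \<bar>x - y\<bar>"
      using field_differentiable_bound[of UNIV "\<lambda>t. V (t + h) - V t" "\<lambda>t. V' (t + h) - V' t" "C * \<bar>h\<bar>" x y] by simp
    then show ?thesis by (simp add: mult.assoc)
  qed
qed

theorem lemma4p5:
  fixes V V' V'' :: "real \<Rightarrow> real" and C\<^sub>m C\<^sub>p :: real
  assumes "CARD('d::finite) \<ge> 3"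
    and "\<And>t. (V has_real_derivative V' t) (at t)"
    and "\<And>t. (V' has_real_derivative V'' t) (at t)"
    and "continuous_on UNIV V''"
    and "\<And>t. V (- t) = V t"
    and "0 < C\<^sub>m" and "C\<^sub>m \<le> C\<^sub>p"
    and "\<And>t. C\<^sub>m \<le> V'' t \<and> V'' t \<le> C\<^sub>p"
  shows "\<exists>(\<mu> :: real \<Rightarrow> (int ^ 'd \<Rightarrow> real) measure) \<mu>\<^sub>0.
      (\<forall>m>0. weakly_converges (\<lambda>n. torus_gibbs V n m) (\<mu> m) sequentially) \<and>
      weakly_converges \<mu> \<mu>\<^sub>0 (at_right 0) \<and>
      ergodic_centred_gibbs V \<mu>\<^sub>0 \<and>
      (\<forall>\<nu>. ergodic_centred_gibbs V \<nu> \<longrightarrow> \<nu> = \<mu>\<^sub>0)"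
proof -
  interpret convex_potential V C\<^sub>m C\<^sub>p
    by (rule convex_potential_of_C2[OF assms(2,3,5,6,8)])
  have "\<forall>m. 0 < m \<longrightarrow> (\<exists>L :: 'd config measure. good m L \<and> weakly_converges (\<lambda>n. torus_gibbs V n m) L sequentially)"
    using torus_gibbs_converges[OF _ assms(1)] by blast
  then obtain \<mu> :: "real \<Rightarrow> 'd config measure"
    where \<mu>: "\<And>m. 0 < m \<Longrightarrow> good m (\<mu> m)" "\<And>m. 0 < m \<Longrightarrow> weakly_converges (\<lambda>n. torus_gibbs V n m) (\<mu> m) sequentially"
    by metis
  obtain \<mu>0 where \<mu>0: "good 0 \<mu>0" "weakly_converges \<mu> \<mu>0 (at_right 0)"
    using massless_limit[OF \<mu>(1) assms(1)] .
  show ?thesis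
    using \<mu>(2) \<mu>0(2) good_ergodic_centred_gibbs[OF \<mu>0(1) assms(1)] ergodic_centred_gibbs_unique[OF \<mu>0(1) _ assms(1)]
    by blast
qed

end
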